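(* Let $K$ be a hyperbolic knot in a closed orientable 3-manifold $M$, let $N=M\setminus K$ be equipped with its complete hyperbolic metric $h$ (constant curvature $-1$), and let $T\subset N$ be a horo-torus. Then for any geodesic cord $c\in\mathrm{Cord}(T)$, both the Morse index and the nullity of $c$ vanish. In particular, any non-constant Hamiltonian chord of $H_h$ associated to $\nu^*T$ is rigid and nondegenerate.
   Context: Horo-torus: the end of $N$ is a cusp; identify the universal cover with the upper half space $\mathbb H^3=\{(x,y,z): z>0\}$, $h=(dx^2+dy^2+dz^2)/z^2$, so that the cusp corresponds to $\infty$; a horo-torus is the embedded torus in $N$ which is the image of a horosphere $\{z=z_0\}$ with $z_0$ large (a level set of the Busemann function $-\log z$ of a geodesic ray going into the cusp, chosen so that distinct lifts are disjoint). Geodesic cords: $\mathrm{Cord}(T)=\{c:[0,1]\to N \mid \nabla_t\dot c=0,\ c(i)\in T,\ \dot c(i)\perp T \text{ for } i=0,1\}$. These are the critical points of the energy $E(c)=\frac12\int_0^1|\dot c|_h^2\,dt$ on the path space $\mathcal P(N,T)=\{c:[0,1]\to N\mid c(0),c(1)\in T\}$ (free boundary on $T$). The Morse index of $c$ is the maximal dimension of a subspace of $T_c\mathcal P(N,T)$ (vector fields along $c$ tangent to $T$ at both endpoints) on which the second variation $d^2E(c)$ is negative definite; the nullity is the dimension of the null space of $d^2E(c)$. Hamiltonian chords: on $T^*N$ with $\omega_0=\sum dq^i\wedge dp_i$, let $H_h(q,p)=\frac12|p|_h^2$ and $\omega_0(X_{H_h},\cdot)=dH_h$. A Hamiltonian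 chord of $\nu^*T$ (the conormal bundle of $T$) is $\gamma:[0,1]\to T^*N$ with $\dot\gamma=X_{H_h}(\gamma)$ and $\gamma(0),\gamma(1)\in\nu^*T$. Chords and geodesic cords are related by $\gamma\mapsto\pi\circ\gamma$ (with $\pi:T^*N\to N$ the projection) and $c\mapsto(c,\dot c^\flat)$. "Rigid" means index $0$ and "nondegenerate" means that the time-one image of $\nu^*T$ under the Hamiltonian flow meets $\nu^*T$ transversally at $\gamma(1)$.
   Formalization: The claim that the Morse index and nullity vanish is stated only for non-constant geodesic cords, since a constant path at a point of T is a geodesic cord whose nullity is 2. *)

theory Defs
  imports "HOL-Analysis.Analysis" "HOL-Library.Function_Algebras" "HOL-Library.Extended_Nat"
begin

section \<open>Smooth maps between Euclidean spaces\<close>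

primrec Ck_on :: "nat \<Rightarrow> ('e::real_normed_vector \<Rightarrow> 'f::real_normed_vector) \<Rightarrow> 'e set \<Rightarrow> bool" where
  "Ck_on 0 f S \<longleftrightarrow> continuous_on S f"
| "Ck_on (Suc n) f S \<longleftrightarrow> (\<forall>x\<in>S. f differentiable (at x)) \<and>
     (\<forall>v. Ck_on n (\<lambda>x. frechet_derivative f (at x) v) S)"

text \<open>Used for open sets (of finite-dimensional spaces) only.\<close>
definition smooth_on :: "'e::real_normed_vector set \<Rightarrow> ('e \<Rightarrow> 'f::real_normed_vector) \<Rightarrow> bool" where
  "smooth_on S f \<longleftrightarrow> (\<forall>n. Ck_on n f S)"

text \<open>Smoothness at a point of a map on an arbitrary (not necessarily open) set \<open>S\<close>, such as
  \<open>[0,1]\<close>: existence of a smooth extension to a neighbourhood of the point.\<close>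
definition smooth_at :: "'e::real_normed_vector set \<Rightarrow> 'e \<Rightarrow> ('e \<Rightarrow> 'f::real_normed_vector) \<Rightarrow> bool" where
  "smooth_at S x f \<longleftrightarrow> (\<exists>W g. open W \<and> x \<in> W \<and> smooth_on W g \<and> (\<forall>y\<in>S \<inter> W. g y = f y))"

section \<open>Smooth 3-manifolds, described by atlases\<close>

text \<open>A chart is a pair of its domain and its coordinate map.\<close>
type_synonym 'a chart = "'a set \<times> ('a \<Rightarrow> real^3)"

abbreviation dom_chart :: "'a chart \<Rightarrow> 'a set" where "dom_chart \<kappa> \<equiv> fst \<kappa>"
abbreviation coord :: "'a chart \<Rightarrow> 'a \<Rightarrow> real^3" where "coord \<kappa> \<equiv> snd \<kappa>"
abbreviation cod_chart :: "'a chart \<Rightarrow> (real^3) set" where "cod_chart \<kappa> \<equiv> snd \<kappa> ` fst \<kappa>"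
definition inv_coord :: "'a chart \<Rightarrow> real^3 \<Rightarrow> 'a" where
  "inv_coord \<kappa> = inv_into (fst \<kappa>) (snd \<kappa>)"

definition transition :: "'a chart \<Rightarrow> 'a chart \<Rightarrow> real^3 \<Rightarrow> real^3" where
  "transition \<kappa> \<kappa>' = coord \<kappa>' \<circ> inv_coord \<kappa>"

definition charts_at :: "'a chart set \<Rightarrow> 'a \<Rightarrow> 'a chart set" where
  "charts_at A q = {\<kappa>\<in>A. q \<in> dom_chart \<kappa>}"

definition smooth_atlas :: "'a::topological_space set \<Rightarrow> 'a chart set \<Rightarrow> bool" where
  "smooth_atlas X A \<longleftrightarrow>
     (\<Union>\<kappa>\<in>A. dom_chart \<kappa>) = X \<and>
     (\<forall>\<kappa>\<in>A. openin (top_of_set X) (dom_chart \<kappa>) \<and> open (cod_chart \<kappa>) \<and>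
        homeomorphism (dom_chart \<kappa>) (cod_chart \<kappa>) (coord \<kappa>) (inv_coord \<kappa>)) \<and>
     (\<forall>\<kappa>\<in>A. \<forall>\<kappa>'\<in>A. smooth_on (coord \<kappa> ` (dom_chart \<kappa> \<inter> dom_chart \<kappa>')) (transition \<kappa> \<kappa>'))"

definition orientable_manifold :: "'a::topological_space set \<Rightarrow> 'a chart set \<Rightarrow> bool" where
  "orientable_manifold X A \<longleftrightarrow>
     (\<exists>B. smooth_atlas X B \<and> smooth_atlas X (A \<union> B) \<and>
        (\<forall>\<kappa>\<in>B. \<forall>\<kappa>'\<in>B. \<forall>x\<in>coord \<kappa> ` (dom_chart \<kappa> \<inter> dom_chart \<kappa>').
           det (matrix (frechet_derivative (transition \<kappa> \<kappa>') (at x))) > 0))"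

text \<open>Second countability and the Hausdorff property come from the type class in the theorem.\<close>
definition closed_manifold :: "'a::topological_space set \<Rightarrow> 'a chart set \<Rightarrow> bool" where
  "closed_manifold M A \<longleftrightarrow> smooth_atlas M A \<and> compact M \<and> connected M"

definition smooth_map :: "'a::topological_space set \<Rightarrow> 'a chart set \<Rightarrow>
    'e::real_normed_vector set \<Rightarrow> ('e \<Rightarrow> 'a) \<Rightarrow> bool" where
  "smooth_map X A S f \<longleftrightarrow> f ` S \<subseteq> X \<and> continuous_on S f \<and>
     (\<forall>x\<in>S. \<forall>\<kappa>\<in>charts_at A (f x). smooth_at S x (coord \<kappa> \<circ> f))"

subsection \<open>Tangent vectors\<close>

text \<open>A tangent vector at \<open>q\<close> is the family of its coordinate vectors in all charts of the atlas
  around \<open>q\<close>, related by the Jacobians of the transition maps.  The components in all other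
  charts are set to zero, so that \<open>T\<^sub>qX\<close> is a three-dimensional subspace of a function space.\<close>
type_synonym 'a tangent = "'a chart \<Rightarrow> real^3"

definition tangent_space :: "'a chart set \<Rightarrow> 'a \<Rightarrow> 'a tangent set" where
  "tangent_space A q = {v. (\<forall>\<kappa>. \<kappa> \<notin> charts_at A q \<longrightarrow> v \<kappa> = 0) \<and>
     (\<forall>\<kappa>\<in>charts_at A q. \<forall>\<kappa>'\<in>charts_at A q.
        v \<kappa>' = frechet_derivative (transition \<kappa> \<kappa>') (at (coord \<kappa> q)) (v \<kappa>))}"

text \<open>The tangent vector at \<open>q\<close> whose coordinate vector in the chart \<open>\<kappa>\<close> is \<open>u\<close>.\<close>
definition tangent_of :: "'a chart set \<Rightarrow> 'a chart \<Rightarrow> 'a \<Rightarrow> real^3 \<Rightarrow> 'a tangent" where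
  "tangent_of A \<kappa> q u = (\<lambda>\<kappa>'. if \<kappa>' \<in> charts_at A q
     then frechet_derivative (transition \<kappa> \<kappa>') (at (coord \<kappa> q)) u else 0)"

definition velocity :: "'a chart set \<Rightarrow> (real \<Rightarrow> 'a) \<Rightarrow> real set \<Rightarrow> real \<Rightarrow> 'a tangent" where
  "velocity A c S t = (\<lambda>\<kappa>. if \<kappa> \<in> charts_at A (c t)
     then vector_derivative (coord \<kappa> \<circ> c) (at t within S) else 0)"

definition differential :: "'a chart set \<Rightarrow> ('e::real_normed_vector \<Rightarrow> 'a) \<Rightarrow> 'e \<Rightarrow> 'e \<Rightarrow> 'a tangent" where
  "differential A f x u = (\<lambda>\<kappa>. if \<kappa> \<in> charts_at A (f x)
     then frechet_derivative (coord \<kappa> \<circ> f) (at x) u else 0)"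

text \<open>\<open>T\<^sub>qT\<close> for a submanifold \<open>T\<close> of \<open>X\<close>.\<close>
definition tangent_to :: "'a::topological_space set \<Rightarrow> 'a chart set \<Rightarrow> 'a set \<Rightarrow> 'a \<Rightarrow> 'a tangent set" where
  "tangent_to X A T q = {v. \<exists>\<sigma> \<delta>. \<delta> > 0 \<and> smooth_map X A {-\<delta><..<\<delta>} \<sigma> \<and> \<sigma> ` {-\<delta><..<\<delta>} \<subseteq> T \<and>
     \<sigma> 0 = q \<and> velocity A \<sigma> UNIV 0 = v}"

subsection \<open>Knots and their complements\<close>

definition smooth_knot :: "'a::topological_space set \<Rightarrow> 'a chart set \<Rightarrow> 'a set \<Rightarrow> bool" where
  "smooth_knot M A K \<longleftrightarrow> (\<exists>k::real \<Rightarrow> 'a. smooth_map M A UNIV k \<and>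
     (\<forall>\<theta>. k (\<theta> + 2 * pi) = k \<theta>) \<and> inj_on k {0..<2 * pi} \<and>
     (\<forall>\<theta>. velocity A k UNIV \<theta> \<noteq> (\<lambda>_. 0)) \<and> K = range k)"

definition complement_atlas :: "'a chart set \<Rightarrow> 'a set \<Rightarrow> 'a chart set" where
  "complement_atlas A K = (\<lambda>\<kappa>. (dom_chart \<kappa> - K, coord \<kappa>)) ` A"

section \<open>Riemannian metrics\<close>

type_synonym 'a metric = "'a \<Rightarrow> 'a tangent \<Rightarrow> 'a tangent \<Rightarrow> real"

definition metric_in :: "'a chart set \<Rightarrow> 'a metric \<Rightarrow> 'a chart \<Rightarrow> real^3 \<Rightarrow> real^3 \<Rightarrow> real^3 \<Rightarrow> real" where
  "metric_in A h \<kappa> x u v =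
     h (inv_coord \<kappa> x) (tangent_of A \<kappa> (inv_coord \<kappa> x) u) (tangent_of A \<kappa> (inv_coord \<kappa> x) v)"

definition riemannian_metric :: "'a chart set \<Rightarrow> 'a metric \<Rightarrow> bool" where
  "riemannian_metric A h \<longleftrightarrow> (\<forall>\<kappa>\<in>A.
     (\<forall>x\<in>cod_chart \<kappa>. bilinear (metric_in A h \<kappa> x) \<and>
        (\<forall>u v. metric_in A h \<kappa> x u v = metric_in A h \<kappa> x v u) \<and>
        (\<forall>u. u \<noteq> 0 \<longrightarrow> metric_in A h \<kappa> x u u > 0)) \<and>
     (\<forall>u v. smooth_on (cod_chart \<kappa>) (\<lambda>x. metric_in A h \<kappa> x u v)))"

definition gram :: "'a chart set \<Rightarrow> 'a metric \<Rightarrow> 'a chart \<Rightarrow> real^3 \<Rightarrow> real^3^3" where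
  "gram A h \<kappa> x = (\<chi> i j. metric_in A h \<kappa> x (axis i 1) (axis j 1))"

definition partial :: "3 \<Rightarrow> (real^3 \<Rightarrow> real) \<Rightarrow> real^3 \<Rightarrow> real" where
  "partial i f x = frechet_derivative f (at x) (axis i 1)"

text \<open>\<open>christoffel A h \<kappa> k i j\<close> is \<open>\<Gamma>\<^sup>k\<^sub>i\<^sub>j\<close>.\<close>
definition christoffel :: "'a chart set \<Rightarrow> 'a metric \<Rightarrow> 'a chart \<Rightarrow> 3 \<Rightarrow> 3 \<Rightarrow> 3 \<Rightarrow> real^3 \<Rightarrow> real" where
  "christoffel A h \<kappa> k i j x = 1/2 * (\<Sum>l\<in>UNIV. matrix_inv (gram A h \<kappa> x) $ k $ l *
     (partial i (\<lambda>y. gram A h \<kappa> y $ j $ l) x + partial j (\<lambda>y. gram A h \<kappa> y $ i $ l) x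
        - partial l (\<lambda>y. gram A h \<kappa> y $ i $ j) x))"

text \<open>\<open>riemann A h \<kappa> l i j k\<close> is the \<open>l\<close>-th component of \<open>R(\<partial>\<^sub>i,\<partial>\<^sub>j)\<partial>\<^sub>k\<close>, with
  \<open>R(X,Y) = \<nabla>\<^sub>X\<nabla>\<^sub>Y - \<nabla>\<^sub>Y\<nabla>\<^sub>X - \<nabla>\<^bsub>[X,Y]\<^esub>\<close>.\<close>
definition riemann :: "'a chart set \<Rightarrow> 'a metric \<Rightarrow> 'a chart \<Rightarrow> 3 \<Rightarrow> 3 \<Rightarrow> 3 \<Rightarrow> 3 \<Rightarrow> real^3 \<Rightarrow> real" where
  "riemann A h \<kappa> l i j k x =
     partial i (christoffel A h \<kappa> l j k) x - partial j (christoffel A h \<kappa> l i k) x +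
     (\<Sum>m\<in>UNIV. christoffel A h \<kappa> l i m x * christoffel A h \<kappa> m j k x
              - christoffel A h \<kappa> l j m x * christoffel A h \<kappa> m i k x)"

definition curvature :: "'a chart set \<Rightarrow> 'a metric \<Rightarrow> 'a chart \<Rightarrow> real^3 \<Rightarrow> real^3 \<Rightarrow> real^3 \<Rightarrow> real^3 \<Rightarrow> real^3" where
  "curvature A h \<kappa> x u v w =
     (\<chi> l. \<Sum>i\<in>UNIV. \<Sum>j\<in>UNIV. \<Sum>k\<in>UNIV. riemann A h \<kappa> l i j k x * u $ i * v $ j * w $ k)"

text \<open>All sectional curvatures
  \<open>\<langle>R(u,v)v,u\<rangle> / (|u|\<^sup>2|v|\<^sup>2 - \<langle>u,v\<rangle>\<^sup>2)\<close> are equal to \<open>b\<close>.\<close>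
definition constant_curvature :: "'a chart set \<Rightarrow> 'a metric \<Rightarrow> real \<Rightarrow> bool" where
  "constant_curvature A h b \<longleftrightarrow> (\<forall>\<kappa>\<in>A. \<forall>x\<in>cod_chart \<kappa>. \<forall>u v.
     metric_in A h \<kappa> x (curvature A h \<kappa> x u v v) u =
       b * (metric_in A h \<kappa> x u u * metric_in A h \<kappa> x v v - (metric_in A h \<kappa> x u v)\<^sup>2))"

definition path_length :: "'a chart set \<Rightarrow> 'a metric \<Rightarrow> (real \<Rightarrow> 'a) \<Rightarrow> real" where
  "path_length A h c = integral {0..1}
     (\<lambda>t. sqrt (h (c t) (velocity A c {0..1} t) (velocity A c {0..1} t)))"

definition riemannian_distance :: "'a::topological_space set \<Rightarrow> 'a chart set \<Rightarrow> 'a metric \<Rightarrow> 'a \<Rightarrow> 'a \<Rightarrow> real" where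
  "riemannian_distance X A h x y =
     Inf {path_length A h c | c. smooth_map X A {0..1} c \<and> c 0 = x \<and> c 1 = y}"

definition complete_hyperbolic_metric :: "'a::topological_space set \<Rightarrow> 'a chart set \<Rightarrow> 'a metric \<Rightarrow> bool" where
  "complete_hyperbolic_metric X A h \<longleftrightarrow> riemannian_metric A h \<and> constant_curvature A h (-1) \<and>
     Metric_space.mcomplete X (riemannian_distance X A h)"

section \<open>Horo-tori\<close>

definition upper_half_space :: "(real^3) set" where
  "upper_half_space = {x. x $ 3 > 0}"

text \<open>The Riemannian covering identifies the universal cover of \<open>(X,h)\<close> with
  \<open>\<bbbH>\<^sup>3 = ({z > 0}, (dx\<^sup>2 + dy\<^sup>2 + dz\<^sup>2) / z\<^sup>2)\<close>.\<close>
definition hyperbolic_universal_cover ::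
    "'a::topological_space set \<Rightarrow> 'a chart set \<Rightarrow> 'a metric \<Rightarrow> (real^3 \<Rightarrow> 'a) \<Rightarrow> bool" where
  "hyperbolic_universal_cover X A h p \<longleftrightarrow>
     covering_space upper_half_space p X \<and> smooth_map X A upper_half_space p \<and>
     (\<forall>x\<in>upper_half_space. \<forall>u v.
        h (p x) (differential A p x u) (differential A p x v) = (u \<bullet> v) / (x $ 3)\<^sup>2)"

definition deck_transformation :: "(real^3 \<Rightarrow> 'a) \<Rightarrow> (real^3 \<Rightarrow> real^3) \<Rightarrow> bool" where
  "deck_transformation p g \<longleftrightarrow>
     (\<exists>g'. homeomorphism upper_half_space upper_half_space g g') \<and>
     (\<forall>x\<in>upper_half_space. p (g x) = p x)"

definition horosphere :: "real \<Rightarrow> (real^3) set" where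
  "horosphere z0 = {x. x $ 3 = z0}"

text \<open>The condition on compact sets says that the cusp (the end of \<open>X\<close>) corresponds to \<open>\<infinity>\<close>.
  The lifts of \<open>T\<close> are the images of the horosphere under the deck group.\<close>
definition horo_torus :: "'a::topological_space set \<Rightarrow> 'a chart set \<Rightarrow> 'a metric \<Rightarrow> 'a set \<Rightarrow> bool" where
  "horo_torus X A h T \<longleftrightarrow> (\<exists>p z0.
     hyperbolic_universal_cover X A h p \<and> z0 > 0 \<and>
     (\<forall>C. compact C \<and> C \<subseteq> X \<longrightarrow> (\<exists>a>0. p ` {x. x $ 3 > a} \<inter> C = {})) \<and>
     pairwise disjnt {g ` horosphere z0 | g. deck_transformation p g} \<and>
     T = p ` horosphere z0 \<and>
     T homeomorphic (sphere (0::complex) 1 \<times> sphere (0::complex) 1))"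

section \<open>Geodesic cords, Morse index and nullity\<close>

text \<open>Throughout, a path is a function on \<open>real\<close> of which only the restriction to \<open>[0,1]\<close> matters.\<close>

definition nonconstant_path :: "(real \<Rightarrow> 'b) \<Rightarrow> bool" where
  "nonconstant_path c \<longleftrightarrow> (\<exists>t\<in>{0..1}. c t \<noteq> c 0)"

text \<open>\<open>\<nabla>\<^sub>t c' = 0\<close> in local coordinates.\<close>
definition geodesic :: "'a::topological_space set \<Rightarrow> 'a chart set \<Rightarrow> 'a metric \<Rightarrow> (real \<Rightarrow> 'a) \<Rightarrow> bool" where
  "geodesic X A h c \<longleftrightarrow> smooth_map X A {0..1} c \<and>
     (\<forall>t\<in>{0..1}. \<forall>\<kappa>\<in>charts_at A (c t).
        let x' = (\<lambda>\<tau>. vector_derivative (coord \<kappa> \<circ> c) (at \<tau> within {0..1}));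
            x'' = vector_derivative x' (at t within {0..1})
        in \<forall>k. x'' $ k + (\<Sum>i\<in>UNIV. \<Sum>j\<in>UNIV.
             christoffel A h \<kappa> k i j (coord \<kappa> (c t)) * x' t $ i * x' t $ j) = 0)"

definition Cord :: "'a::topological_space set \<Rightarrow> 'a chart set \<Rightarrow> 'a metric \<Rightarrow> 'a set \<Rightarrow> (real \<Rightarrow> 'a) set" where
  "Cord X A h T = {c. geodesic X A h c \<and> (\<forall>i\<in>{0,1}. c i \<in> T \<and>
     (\<forall>v\<in>tangent_to X A T (c i). h (c i) (velocity A c {0..1} i) v = 0))}"

definition energy :: "'a chart set \<Rightarrow> 'a metric \<Rightarrow> (real \<Rightarrow> 'a) \<Rightarrow> real" where
  "energy A h c = 1/2 * integral {0..1}
     (\<lambda>t. h (c t) (velocity A c {0..1} t) (velocity A c {0..1} t))"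

text \<open>A smooth two-parameter family of paths in \<open>\<P>(X,T)\<close> through \<open>c\<close>.\<close>
definition variation :: "'a::topological_space set \<Rightarrow> 'a chart set \<Rightarrow> 'a set \<Rightarrow> (real \<Rightarrow> 'a) \<Rightarrow>
    (real \<Rightarrow> real \<Rightarrow> real \<Rightarrow> 'a) \<Rightarrow> bool" where
  "variation X A T c F \<longleftrightarrow> (\<exists>\<delta>>0.
     smooth_map X A ({-\<delta><..<\<delta>} \<times> {-\<delta><..<\<delta>} \<times> {0..1}) (\<lambda>(s, r, t). F s r t) \<and>
     (\<forall>s\<in>{-\<delta><..<\<delta>}. \<forall>r\<in>{-\<delta><..<\<delta>}. F s r 0 \<in> T \<and> F s r 1 \<in> T) \<and>
     (\<forall>t\<in>{0..1}. F 0 0 t = c t))"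

text \<open>Vector fields along a path, extended by zero outside \<open>[0,1]\<close>.\<close>
type_synonym 'a path_field = "real \<Rightarrow> 'a tangent"

text \<open>The tangent space \<open>T\<^sub>c\<P>(X,T)\<close>.\<close>
definition path_tangent :: "'a::topological_space set \<Rightarrow> 'a chart set \<Rightarrow> 'a set \<Rightarrow> (real \<Rightarrow> 'a) \<Rightarrow>
    'a path_field set" where
  "path_tangent X A T c = {V.
     (\<forall>t. t \<notin> {0..1} \<longrightarrow> V t = 0) \<and>
     (\<forall>t\<in>{0..1}. V t \<in> tangent_space A (c t)) \<and>
     (\<forall>t\<in>{0..1}. \<forall>\<kappa>\<in>charts_at A (c t). smooth_at {0..1} t (\<lambda>\<tau>. V \<tau> \<kappa>)) \<and>
     V 0 \<in> tangent_to X A T (c 0) \<and> V 1 \<in> tangent_to X A T (c 1)}"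

text \<open>\<open>d\<^sup>2E(c)(V,W) = \<partial>\<^sub>s\<partial>\<^sub>r E(F s r)\<close> at \<open>s = r = 0\<close>, for a variation \<open>F\<close> of \<open>c\<close> with
  \<open>\<partial>\<^sub>sF = V\<close> and \<open>\<partial>\<^sub>rF = W\<close>.  At a critical point \<open>c\<close> of the energy this does not depend on
  the choice of \<open>F\<close>.\<close>
definition second_variation :: "'a::topological_space set \<Rightarrow> 'a chart set \<Rightarrow> 'a metric \<Rightarrow> 'a set \<Rightarrow>
    (real \<Rightarrow> 'a) \<Rightarrow> 'a path_field \<Rightarrow> 'a path_field \<Rightarrow> real" where
  "second_variation X A h T c V W = (THE a. \<exists>F. variation X A T c F \<and>
     (\<forall>t\<in>{0..1}. velocity A (\<lambda>s. F s 0 t) UNIV 0 = V t \<and> velocity A (\<lambda>r. F 0 r t) UNIV 0 = W t) \<and>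
     ((\<lambda>s. deriv (\<lambda>r. energy A h (F s r)) 0) has_real_derivative a) (at 0))"

definition field_scale :: "real \<Rightarrow> 'a path_field \<Rightarrow> 'a path_field" where
  "field_scale r V = (\<lambda>t \<kappa>. r *\<^sub>R V t \<kappa>)"

global_interpretation path_fields: vector_space field_scale
  by unfold_locales (simp_all add: field_scale_def fun_eq_iff algebra_simps)

text \<open>The dimension of a subspace, with value \<open>\<infinity>\<close> in the infinite-dimensional case
  (where the library's \<open>dim\<close> is 0).\<close>
definition field_dim :: "'a path_field set \<Rightarrow> enat" where
  "field_dim W = (SUP B\<in>{B. B \<subseteq> W \<and> finite B \<and> path_fields.independent B}. enat (card B))"

definition morse_index :: "'a::topological_space set \<Rightarrow> 'a chart set \<Rightarrow> 'a metric \<Rightarrow> 'a set \<Rightarrow>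
    (real \<Rightarrow> 'a) \<Rightarrow> enat" where
  "morse_index X A h T c = (SUP W\<in>{W. path_fields.subspace W \<and> W \<subseteq> path_tangent X A T c \<and>
     (\<forall>V\<in>W - {0}. second_variation X A h T c V V < 0)}. field_dim W)"

definition nullity :: "'a::topological_space set \<Rightarrow> 'a chart set \<Rightarrow> 'a metric \<Rightarrow> 'a set \<Rightarrow>
    (real \<Rightarrow> 'a) \<Rightarrow> enat" where
  "nullity X A h T c = field_dim {V \<in> path_tangent X A T c.
     \<forall>W\<in>path_tangent X A T c. second_variation X A h T c V W = 0}"

section \<open>Hamiltonian chords\<close>

text \<open>Points of \<open>T\<^sup>*X\<close>: covectors are linear functionals on the tangent space, extended by zero.\<close>
type_synonym 'a cotangent = "'a \<times> ('a tangent \<Rightarrow> real)"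

definition cotangent_bundle :: "'a set \<Rightarrow> 'a chart set \<Rightarrow> 'a cotangent set" where
  "cotangent_bundle X A = {(q, \<alpha>). q \<in> X \<and> (\<forall>v. v \<notin> tangent_space A q \<longrightarrow> \<alpha> v = 0) \<and>
     (\<forall>\<kappa>\<in>charts_at A q. linear (\<lambda>u. \<alpha> (tangent_of A \<kappa> q u)))}"

text \<open>The canonical coordinates \<open>(q\<^sup>1,q\<^sup>2,q\<^sup>3,p\<^sub>1,p\<^sub>2,p\<^sub>3)\<close> on \<open>T\<^sup>*X\<close> induced by a chart, and the
  inverse of this coordinate map.\<close>
definition canonical :: "'a chart set \<Rightarrow> 'a chart \<Rightarrow> 'a cotangent \<Rightarrow> (real^3) \<times> (real^3)" where
  "canonical A \<kappa> \<xi> = (coord \<kappa> (fst \<xi>), \<chi> i. snd \<xi> (tangent_of A \<kappa> (fst \<xi>) (axis i 1)))"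

definition inv_canonical :: "'a chart set \<Rightarrow> 'a chart \<Rightarrow> (real^3) \<times> (real^3) \<Rightarrow> 'a cotangent" where
  "inv_canonical A \<kappa> y = (inv_coord \<kappa> (fst y),
     \<lambda>v. if v \<in> tangent_space A (inv_coord \<kappa> (fst y)) then snd y \<bullet> v \<kappa> else 0)"

definition smooth_cotangent_map :: "'a::topological_space set \<Rightarrow> 'a chart set \<Rightarrow>
    'e::real_normed_vector set \<Rightarrow> ('e \<Rightarrow> 'a cotangent) \<Rightarrow> bool" where
  "smooth_cotangent_map X A S f \<longleftrightarrow> f ` S \<subseteq> cotangent_bundle X A \<and> continuous_on S (fst \<circ> f) \<and>
     (\<forall>x\<in>S. \<forall>\<kappa>\<in>charts_at A (fst (f x)). smooth_at S x (canonical A \<kappa> \<circ> f))"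

definition sharp :: "'a chart set \<Rightarrow> 'a metric \<Rightarrow> 'a cotangent \<Rightarrow> 'a tangent" where
  "sharp A h \<xi> = (THE v. v \<in> tangent_space A (fst \<xi>) \<and>
     (\<forall>w\<in>tangent_space A (fst \<xi>). h (fst \<xi>) v w = snd \<xi> w))"

definition hamiltonian :: "'a chart set \<Rightarrow> 'a metric \<Rightarrow> 'a cotangent \<Rightarrow> real" where
  "hamiltonian A h \<xi> = 1/2 * h (fst \<xi>) (sharp A h \<xi>) (sharp A h \<xi>)"

text \<open>\<open>\<Sum>\<^sub>i dq\<^sup>i \<and> dp\<^sub>i\<close> in canonical coordinates.\<close>
definition symplectic_form :: "(real^3) \<times> (real^3) \<Rightarrow> (real^3) \<times> (real^3) \<Rightarrow> real" where
  "symplectic_form Y Z = fst Y \<bullet> snd Z - fst Z \<bullet> snd Y"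

text \<open>\<open>\<gamma>' = X\<^sub>H(\<gamma>)\<close>, that is, \<open>\<omega>\<^sub>0(\<gamma>',\<cdot>) = dH\<close>, on \<open>[0,1]\<close>.\<close>
definition hamiltonian_trajectory :: "'a::topological_space set \<Rightarrow> 'a chart set \<Rightarrow> 'a metric \<Rightarrow>
    (real \<Rightarrow> 'a cotangent) \<Rightarrow> bool" where
  "hamiltonian_trajectory X A h \<gamma> \<longleftrightarrow> smooth_cotangent_map X A {0..1} \<gamma> \<and>
     (\<forall>t\<in>{0..1}. \<forall>\<kappa>\<in>charts_at A (fst (\<gamma> t)). \<forall>Y.
        symplectic_form (vector_derivative (canonical A \<kappa> \<circ> \<gamma>) (at t within {0..1})) Y =
        frechet_derivative (hamiltonian A h \<circ> inv_canonical A \<kappa>) (at (canonical A \<kappa> (\<gamma> t))) Y)"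

definition conormal :: "'a::topological_space set \<Rightarrow> 'a chart set \<Rightarrow> 'a set \<Rightarrow> 'a cotangent set" where
  "conormal X A T = {\<xi> \<in> cotangent_bundle X A. fst \<xi> \<in> T \<and>
     (\<forall>v\<in>tangent_to X A T (fst \<xi>). snd \<xi> v = 0)}"

definition hamiltonian_chord :: "'a::topological_space set \<Rightarrow> 'a chart set \<Rightarrow> 'a metric \<Rightarrow> 'a set \<Rightarrow>
    (real \<Rightarrow> 'a cotangent) \<Rightarrow> bool" where
  "hamiltonian_chord X A h T \<gamma> \<longleftrightarrow> hamiltonian_trajectory X A h \<gamma> \<and>
     \<gamma> 0 \<in> conormal X A T \<and> \<gamma> 1 \<in> conormal X A T"

text \<open>The index of a chord is the Morse index of the geodesic cord \<open>\<pi> \<circ> \<gamma>\<close>.\<close>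
definition rigid :: "'a::topological_space set \<Rightarrow> 'a chart set \<Rightarrow> 'a metric \<Rightarrow> 'a set \<Rightarrow>
    (real \<Rightarrow> 'a cotangent) \<Rightarrow> bool" where
  "rigid X A h T \<gamma> \<longleftrightarrow> morse_index X A h T (fst \<circ> \<gamma>) = 0"

definition time_one_image :: "'a::topological_space set \<Rightarrow> 'a chart set \<Rightarrow> 'a metric \<Rightarrow>
    'a cotangent set \<Rightarrow> 'a cotangent set" where
  "time_one_image X A h L = {\<gamma> 1 | \<gamma>. hamiltonian_trajectory X A h \<gamma> \<and> \<gamma> 0 \<in> L}"

text \<open>\<open>T\<^sub>\<xi>L\<close> for a submanifold \<open>L\<close> of \<open>T\<^sup>*X\<close>, in the canonical coordinates of \<open>\<kappa>\<close>.\<close>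
definition cotangent_tangent_to :: "'a::topological_space set \<Rightarrow> 'a chart set \<Rightarrow> 'a chart \<Rightarrow>
    'a cotangent set \<Rightarrow> 'a cotangent \<Rightarrow> ((real^3) \<times> (real^3)) set" where
  "cotangent_tangent_to X A \<kappa> L \<xi> = {v. \<exists>\<sigma> \<delta>. \<delta> > 0 \<and> smooth_cotangent_map X A {-\<delta><..<\<delta>} \<sigma> \<and>
     \<sigma> ` {-\<delta><..<\<delta>} \<subseteq> L \<and> \<sigma> 0 = \<xi> \<and> vector_derivative (canonical A \<kappa> \<circ> \<sigma>) (at 0) = v}"

definition transversal_at :: "'a::topological_space set \<Rightarrow> 'a chart set \<Rightarrow>
    'a cotangent set \<Rightarrow> 'a cotangent set \<Rightarrow> 'a cotangent \<Rightarrow> bool" where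
  "transversal_at X A L L' \<xi> \<longleftrightarrow> (\<forall>\<kappa>\<in>charts_at A (fst \<xi>).
     {v + w | v w. v \<in> cotangent_tangent_to X A \<kappa> L \<xi> \<and> w \<in> cotangent_tangent_to X A \<kappa> L' \<xi>} = UNIV)"

definition nondegenerate :: "'a::topological_space set \<Rightarrow> 'a chart set \<Rightarrow> 'a metric \<Rightarrow> 'a set \<Rightarrow>
    (real \<Rightarrow> 'a cotangent) \<Rightarrow> bool" where
  "nondegenerate X A h T \<gamma> \<longleftrightarrow>
     transversal_at X A (time_one_image X A h (conormal X A T)) (conormal X A T) (\<gamma> 1)"

end

theory Submission
  imports Defs
begin

text \<open>The proof takes place in the upper half space \<open>z > 0\<close>, which covers the knot complement by a
  local isometry \<open>p\<close>.  There the torus \<open>T\<close> becomes a family of horospheres, one of which is the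
  plane \<open>H = {z = z0}\<close>, and every non-constant cord or chord can be written down explicitly.

  A geodesic that starts perpendicularly to \<open>H\<close> is vertical, \<open>z(t) = z0 exp(-L t)\<close> with constant
  horizontal coordinates.  It ends on another lift \<open>g H\<close> of \<open>T\<close>, where \<open>g\<close> is a deck transformation.
  Isometries of hyperbolic space change heights by a factor of the form
  \<open>a + b \<bullet> x + c |x|\<^sup>2\<close> with \<open>|b|\<^sup>2 = 4 a c\<close> (\<open>half_space_isometry_height\<close>), so that \<open>g H\<close> is either
  a horizontal plane or a Euclidean sphere tangent to \<open>z = 0\<close>.  A plane other than \<open>H\<close> would come from
  a rescaling of heights, and iterates of it or of its inverse would move points of \<open>H\<close> arbitrarily
  high, although heights over the compact set \<open>T\<close> are bounded (\<open>no_scaling_deck\<close>).  Hence the geodesic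
  ends at the top \<open>Q + d e\<^sub>3\<close> of a sphere \<open>|x - Q|\<^sup>2 = d z\<close>, and this sphere lies below \<open>H\<close> because
  the lifts of \<open>T\<close> are disjoint: \<open>d < z0\<close> and \<open>L > 0\<close> (\<open>end_sphere\<close>).

  The second variation of the energy is computed from variations of the lifted geodesic whose ends
  stay on \<open>H\<close> and on the sphere.  After an integration by parts, and with the endpoint terms
  evaluated by means of the equations of the two surfaces, it becomes
  \<open>\<integral> (V\<^sub>1'\<^sup>2 + V\<^sub>2'\<^sup>2 + (V\<^sub>3' + L V\<^sub>3)\<^sup>2)/z\<^sup>2 dt + 2 L |V(1)|\<^sup>2/d\<^sup>2\<close> (\<open>second_variation_lifted\<close>).  The last
  term comes from the Euclidean curvature of the sphere, and \<open>L > 0\<close> gives it the favourable sign.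
  The form is positive definite: if it vanishes on a field \<open>V\<close>, then \<open>V(1) = 0\<close>, \<open>V\<^sub>1' = V\<^sub>2' = 0\<close> and
  \<open>V\<^sub>3' = - L V\<^sub>3\<close>, with \<open>V\<^sub>3(0) = 0\<close> by tangency to \<open>H\<close>.  So the Morse index and the nullity vanish
  (\<open>second_variation_pos\<close>).

  On the cotangent bundle, \<open>p\<close> induces a covering which in canonical coordinates is symplectic and
  pulls the Hamiltonian back to \<open>z\<^sup>2 |\<xi>|\<^sup>2/2\<close>.  Chords are therefore images of solutions of an explicit
  system, whose first integrals \<open>\<xi>\<^sub>1\<close>, \<open>\<xi>\<^sub>2\<close> and \<open>z \<xi>\<^sub>3\<close> show that they lie over the vertical geodesics
  above; this gives rigidity.  For nondegeneracy, curves in the time-one image and in the conormal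
  bundle of the sphere are written down whose velocities span the tangent space (\<open>transversal\<close>).
  The horizontal momenta are reached because the conormal direction of the sphere turns when the base
  point moves away from the top, while the time-one image only contributes vertical momenta.\<close>

section \<open>Calculus of smooth maps\<close>

abbreviation fd :: "('e::real_normed_vector \<Rightarrow> 'f::real_normed_vector) \<Rightarrow> 'e \<Rightarrow> 'e \<Rightarrow> 'f" where
  "fd f x \<equiv> frechet_derivative f (at x)"

lemma fd_eqI: "(f has_derivative f') (at x) \<Longrightarrow> fd f x = f'"
  by (metis frechet_derivative_at)

lemma has_derivative_fd: "f differentiable (at x) \<Longrightarrow> (f has_derivative fd f x) (at x)"
  by (simp add: frechet_derivative_works)

lemma Ck_on_cong:
  assumes "open S" "\<And>x. x \<in> S \<Longrightarrow> f x = g x" "Ck_on n f S"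
  shows "Ck_on n g S"
  using assms(2,3)
proof (induction n arbitrary: f g)
  case 0
  then show ?case by (simp cong: continuous_on_cong)
next
  case (Suc n)
  have d: "f differentiable (at x)" if "x \<in> S" for x
    using Suc.prems(2) that by simp
  have g: "(g has_derivative fd f x) (at x)" if "x \<in> S" for x
    using has_derivative_transform_within_open[OF has_derivative_fd[OF d[OF that]] \<open>open S\<close> that]
      Suc.prems(1) by blast
  then have eq: "fd f x = fd g x" if "x \<in> S" for x
    using that fd_eqI by metis
  have "Ck_on n (\<lambda>x. fd g x v) S" for v
    by (rule Suc.IH[of "\<lambda>x. fd f x v"]) (use Suc.prems(2) eq in auto)
  then show ?case
    using g by (auto simp only: Ck_on.simps differentiable_def)
qed

lemma Ck_on_subset: "Ck_on n f S \<Longrightarrow> T \<subseteq> S \<Longrightarrow> Ck_on n f T"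
  by (induction n arbitrary: f) (auto intro: continuous_on_subset)

lemma Ck_on_SucD: "Ck_on (Suc n) f S \<Longrightarrow> Ck_on n f S"
proof (induction n arbitrary: f)
  case 0
  then show ?case
    by (auto intro!: continuous_at_imp_continuous_on differentiable_imp_continuous_within)
next
  case (Suc n)
  then show ?case by (metis Ck_on.simps(2))
qed

lemma Ck_on_locally:
  "(\<And>x. x \<in> S \<Longrightarrow> \<exists>T. open T \<and> x \<in> T \<and> Ck_on n f T) \<Longrightarrow> Ck_on n f S"
proof (induction n arbitrary: f)
  case 0
  then show ?case
    by (auto intro!: continuous_at_imp_continuous_on simp: continuous_on_eq_continuous_at)
       (metis continuous_on_eq_continuous_at)
next
  case (Suc n)
  then have "Ck_on n (\<lambda>x. fd f x v) S" for v
    by (intro Suc.IH) (metis Ck_on.simps(2))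
  moreover have "f differentiable (at x)" if "x \<in> S" for x
    using Suc.prems[OF that] by auto
  ultimately show ?case by simp
qed

lemma smooth_on_iff:
  "smooth_on S f \<longleftrightarrow> (\<forall>x\<in>S. f differentiable (at x)) \<and> (\<forall>v. smooth_on S (\<lambda>x. fd f x v))"
proof
  assume *: "smooth_on S f"
  then have "Ck_on (Suc n) f S" for n unfolding smooth_on_def by blast
  then show "(\<forall>x\<in>S. f differentiable (at x)) \<and> (\<forall>v. smooth_on S (\<lambda>x. fd f x v))"
    unfolding smooth_on_def by auto
next
  assume "(\<forall>x\<in>S. f differentiable (at x)) \<and> (\<forall>v. smooth_on S (\<lambda>x. fd f x v))"
  then have "Ck_on (Suc n) f S" for n by (simp add: smooth_on_def)
  then show "smooth_on S f"
    unfolding smooth_on_def using Ck_on_SucD by blast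
qed

lemma smooth_on_fd: "smooth_on S f \<Longrightarrow> smooth_on S (\<lambda>x. fd f x v)"
  using smooth_on_iff by blast

lemma smooth_on_has_derivative: "smooth_on S f \<Longrightarrow> x \<in> S \<Longrightarrow> (f has_derivative fd f x) (at x)"
  using smooth_on_iff has_derivative_fd by blast

lemma smooth_on_continuous: "smooth_on S f \<Longrightarrow> continuous_on S f"
  unfolding smooth_on_def by (metis Ck_on.simps(1))

lemma smooth_on_subset: "smooth_on S f \<Longrightarrow> T \<subseteq> S \<Longrightarrow> smooth_on T f"
  unfolding smooth_on_def using Ck_on_subset by blast

lemma smooth_on_cong: "open S \<Longrightarrow> (\<And>x. x \<in> S \<Longrightarrow> f x = g x) \<Longrightarrow> smooth_on S f \<Longrightarrow> smooth_on S g"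
  unfolding smooth_on_def using Ck_on_cong by blast

lemma smooth_on_locally:
  "(\<And>x. x \<in> S \<Longrightarrow> \<exists>T. open T \<and> x \<in> T \<and> smooth_on T f) \<Longrightarrow> smooth_on S f"
  unfolding smooth_on_def
proof
  fix n
  assume "\<And>x. x \<in> S \<Longrightarrow> \<exists>T. open T \<and> x \<in> T \<and> (\<forall>n. Ck_on n f T)"
  then show "Ck_on n f S" by (intro Ck_on_locally) meson
qed

lemma fd_linear: "f differentiable (at x) \<Longrightarrow> linear (fd f x)"
  by (simp add: linear_frechet_derivative)

lemma Ck_on_const: "Ck_on n (\<lambda>_. c) S"
  by (induction n arbitrary: c) auto

lemma smooth_on_const [simp]: "smooth_on S (\<lambda>_. c)"
  by (simp add: smooth_on_def Ck_on_const)

lemma Ck_on_bounded_linear: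
  assumes "bounded_linear l" "open S"
  shows "Ck_on n f S \<Longrightarrow> Ck_on n (\<lambda>x. l (f x)) S"
proof (induction n arbitrary: f)
  case 0
  then show ?case
    using bounded_linear.continuous_on[OF assms(1)] by simp
next
  case (Suc n)
  have *: "((\<lambda>x. l (f x)) has_derivative (\<lambda>v. l (fd f x v))) (at x)" if "x \<in> S" for x
    using bounded_linear.has_derivative[OF assms(1) has_derivative_fd] Suc.prems that by auto
  have "Ck_on n (\<lambda>x. l (fd f x v)) S" for v
    using Suc.prems by (intro Suc.IH) simp
  then have "Ck_on n (\<lambda>x. fd (\<lambda>x. l (f x)) x v) S" for v
    by (rule Ck_on_cong[OF \<open>open S\<close>, rotated]) (simp add: fd_eqI[OF *])
  then show ?case using * by (auto simp: differentiable_def)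
qed

lemma Ck_on_add:
  assumes "open S"
  shows "Ck_on n f S \<Longrightarrow> Ck_on n g S \<Longrightarrow> Ck_on n (\<lambda>x. f x + g x) S"
proof (induction n arbitrary: f g)
  case 0
  then show ?case by (simp add: continuous_on_add)
next
  case (Suc n)
  have *: "((\<lambda>x. f x + g x) has_derivative (\<lambda>v. fd f x v + fd g x v)) (at x)" if "x \<in> S" for x
    by (rule has_derivative_add[OF has_derivative_fd has_derivative_fd]) (use Suc.prems that in auto)
  have "Ck_on n (\<lambda>x. fd f x v + fd g x v) S" for v
    using Suc.prems by (intro Suc.IH) simp_all
  then have "Ck_on n (\<lambda>x. fd (\<lambda>x. f x + g x) x v) S" for v
    by (rule Ck_on_cong[OF \<open>open S\<close>, rotated]) (simp add: fd_eqI[OF *])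
  then show ?case using * by (auto simp: differentiable_def)
qed

lemma Ck_on_bilinear:
  assumes "bounded_bilinear b" "open S"
  shows "Ck_on n f S \<Longrightarrow> Ck_on n g S \<Longrightarrow> Ck_on n (\<lambda>x. b (f x) (g x)) S"
proof (induction n arbitrary: f g)
  case 0
  then show ?case using bounded_bilinear.continuous_on[OF assms(1)] by simp
next
  case (Suc n)
  have *: "((\<lambda>x. b (f x) (g x)) has_derivative (\<lambda>v. b (f x) (fd g x v) + b (fd f x v) (g x))) (at x)"
    if "x \<in> S" for x
    by (rule bounded_bilinear.FDERIV[OF assms(1) has_derivative_fd has_derivative_fd])
       (use Suc.prems that in auto)
  have "Ck_on n (\<lambda>x. b (f x) (fd g x v) + b (fd f x v) (g x)) S" for v
    using Suc.prems Suc.prems[THEN Ck_on_SucD] by (intro Ck_on_add \<open>open S\<close> Suc.IH) auto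
  then have "Ck_on n (\<lambda>x. fd (\<lambda>x. b (f x) (g x)) x v) S" for v
    by (rule Ck_on_cong[OF \<open>open S\<close>, rotated]) (simp add: fd_eqI[OF *])
  then show ?case using * by (auto simp: differentiable_def)
qed

lemma smooth_on_bounded_linear:
  "bounded_linear l \<Longrightarrow> open S \<Longrightarrow> smooth_on S f \<Longrightarrow> smooth_on S (\<lambda>x. l (f x))"
  unfolding smooth_on_def using Ck_on_bounded_linear by blast

lemma smooth_on_add:
  "open S \<Longrightarrow> smooth_on S f \<Longrightarrow> smooth_on S g \<Longrightarrow> smooth_on S (\<lambda>x. f x + g x)"
  unfolding smooth_on_def using Ck_on_add by blast

lemma smooth_on_bilinear:
  "bounded_bilinear b \<Longrightarrow> open S \<Longrightarrow> smooth_on S f \<Longrightarrow> smooth_on S g \<Longrightarrow>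
    smooth_on S (\<lambda>x. b (f x) (g x))"
  unfolding smooth_on_def using Ck_on_bilinear by blast

lemma Ck_on_ident: "Ck_on n (\<lambda>x. x) S"
  by (cases n) (auto simp: Ck_on_const)

lemma smooth_on_ident [simp]: "smooth_on S (\<lambda>x. x)"
  by (simp add: smooth_on_def Ck_on_ident)

lemma smooth_on_sum:
  "open S \<Longrightarrow> (\<And>i. i \<in> I \<Longrightarrow> smooth_on S (f i)) \<Longrightarrow> smooth_on S (\<lambda>x. \<Sum>i\<in>I. f i x)"
  by (induction I rule: infinite_finite_induct) (auto intro: smooth_on_add)

lemmas smooth_on_mult = smooth_on_bilinear[OF bounded_bilinear_mult]
lemmas smooth_on_scaleR = smooth_on_bilinear[OF bounded_bilinear_scaleR]
lemmas smooth_on_inner = smooth_on_bilinear[OF bounded_bilinear_inner]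
lemmas smooth_on_minus = smooth_on_bounded_linear[OF bounded_linear_minus[OF bounded_linear_ident]]

lemma smooth_on_diff:
  "open S \<Longrightarrow> smooth_on S f \<Longrightarrow> smooth_on S g \<Longrightarrow> smooth_on S (\<lambda>x. f x - g x)"
  using smooth_on_add[of S f "\<lambda>x. - g x"] smooth_on_minus by force

lemma smooth_on_power:
  fixes f :: "'e::real_normed_vector \<Rightarrow> real"
  shows "open S \<Longrightarrow> smooth_on S f \<Longrightarrow> smooth_on S (\<lambda>x. f x ^ n)"
  by (induction n) (auto intro: smooth_on_mult)

lemma smooth_on_vec_nth:
  "open S \<Longrightarrow> smooth_on S f \<Longrightarrow> smooth_on S (\<lambda>x. f x $ i)"
  by (rule smooth_on_bounded_linear[OF bounded_linear_vec_nth])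

lemma smooth_on_vec:
  fixes f :: "'e::real_normed_vector \<Rightarrow> real^'n"
  assumes "open S" "\<And>i. smooth_on S (\<lambda>x. f x $ i)"
  shows "smooth_on S f"
proof -
  have "smooth_on S (\<lambda>x. \<Sum>i\<in>UNIV. (f x $ i) *\<^sub>R (axis i 1 :: real^'n))"
    using assms by (intro smooth_on_sum smooth_on_scaleR) auto
  moreover have "(\<Sum>i\<in>UNIV. (f x $ i) *\<^sub>R (axis i 1 :: real^'n)) = f x" for x
    by (simp add: vec_eq_iff axis_def if_distrib cong: if_cong)
  ultimately show ?thesis by simp
qed

lemma smooth_on_Pair:
  assumes "open S" "smooth_on S f" "smooth_on S g"
  shows "smooth_on S (\<lambda>x. (f x, g x))"
proof -
  have "smooth_on S (\<lambda>x. (f x, 0) + (0, g x))"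
    using assms
    by (intro smooth_on_add smooth_on_bounded_linear[where f=f and l="\<lambda>y. (y, 0)"]
        smooth_on_bounded_linear[where f=g and l="\<lambda>y. (0, y)"] bounded_linear_Pair
        bounded_linear_ident bounded_linear_zero)
  then show ?thesis by simp
qed

lemma smooth_on_fst: "open S \<Longrightarrow> smooth_on S f \<Longrightarrow> smooth_on S (\<lambda>x. fst (f x))"
  by (rule smooth_on_bounded_linear[OF bounded_linear_fst])

lemma smooth_on_snd: "open S \<Longrightarrow> smooth_on S f \<Longrightarrow> smooth_on S (\<lambda>x. snd (f x))"
  by (rule smooth_on_bounded_linear[OF bounded_linear_snd])

text \<open>The chain rule \<open>d(f \<circ> g)(x) v = \<Sum>\<^sub>b (dg(x) v \<bullet> b) df(g x) b\<close> exhibits the derivative as a sum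
  of products of maps that are covered by the induction hypothesis.\<close>
lemma Ck_on_compose:
  fixes g :: "'d::real_normed_vector \<Rightarrow> 'e::euclidean_space"
  assumes "open S" "open V" "g ` S \<subseteq> V"
  shows "Ck_on n f V \<Longrightarrow> Ck_on n g S \<Longrightarrow> Ck_on n (\<lambda>x. f (g x)) S"
proof (induction n arbitrary: f)
  case 0
  then show ?case using assms continuous_on_compose2 by fastforce
next
  case (Suc n)
  have df: "(f has_derivative fd f (g x)) (at (g x))" and dg: "(g has_derivative fd g x) (at x)"
    if "x \<in> S" for x
    using Suc.prems that assms(3) by (auto simp: frechet_derivative_works image_subset_iff)
  have *: "((\<lambda>x. f (g x)) has_derivative (\<lambda>v. fd f (g x) (fd g x v))) (at x)" if "x \<in> S" for x
    using has_derivative_compose[OF dg df] that by auto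
  have "fd f (g x) (fd g x v) = (\<Sum>b\<in>Basis. (fd g x v \<bullet> b) *\<^sub>R fd f (g x) b)" if "x \<in> S" for x v
  proof -
    interpret linear "fd f (g x)" using df[OF that] has_derivative_linear by blast
    have "fd f (g x) (fd g x v) = fd f (g x) (\<Sum>b\<in>Basis. (fd g x v \<bullet> b) *\<^sub>R b)"
      by (simp add: euclidean_representation)
    then show ?thesis by (simp only: sum scale)
  qed
  then have eq: "fd (\<lambda>x. f (g x)) x v = (\<Sum>b\<in>Basis. (fd g x v \<bullet> b) *\<^sub>R fd f (g x) b)"
    if "x \<in> S" for x v
    using *[OF that] fd_eqI that by metis
  have 1: "Ck_on n (\<lambda>x. fd f (g x) b) S" for b
    using Suc.IH[of "\<lambda>y. fd f y b"] Suc.prems Ck_on_SucD by auto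
  have 2: "Ck_on n (\<lambda>x. fd g x v \<bullet> b) S" for v b
    by (intro Ck_on_bounded_linear[OF bounded_linear_inner_left] \<open>open S\<close>) (use Suc.prems in auto)
  have "Ck_on n (\<lambda>x. \<Sum>b\<in>B. (fd g x v \<bullet> b) *\<^sub>R fd f (g x) b) S" for v and B :: "'e set"
    by (induction B rule: infinite_finite_induct)
       (auto intro!: Ck_on_add Ck_on_bilinear[OF bounded_bilinear_scaleR] \<open>open S\<close> 1 2 Ck_on_const)
  then have "Ck_on n (\<lambda>x. fd (\<lambda>x. f (g x)) x v) S" for v
    by (rule Ck_on_cong[OF \<open>open S\<close>, rotated]) (simp add: eq)
  then show ?case using * by (auto simp: differentiable_def)
qed

lemma smooth_on_compose:
  fixes g :: "'d::real_normed_vector \<Rightarrow> 'e::euclidean_space"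
  shows "smooth_on V f \<Longrightarrow> smooth_on S g \<Longrightarrow> open S \<Longrightarrow> open V \<Longrightarrow> g ` S \<subseteq> V \<Longrightarrow>
    smooth_on S (\<lambda>x. f (g x))"
  unfolding smooth_on_def using Ck_on_compose by blast

lemma Ck_on_inverse: "Ck_on n (inverse :: real \<Rightarrow> real) (- {0})"
proof (induction n)
  case 0
  then show ?case by (auto intro!: continuous_intros)
next
  case (Suc n)
  have *: "(inverse has_derivative (\<lambda>v. - (inverse x * v * inverse x))) (at x)"
    if "x \<in> - {0}" for x :: real
    using that by (auto intro!: has_derivative_inverse')
  have "Ck_on n (\<lambda>x. (- v) * (inverse x * inverse x)) (- {0})" for v :: real
    by (intro Ck_on_bilinear[OF bounded_bilinear_mult] Ck_on_const Suc.IH) auto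
  then have "Ck_on n (\<lambda>x. fd inverse x v) (- {0})" for v :: real
    by (rule Ck_on_cong[rotated 2]) (auto simp: fd_eqI[OF *])
  then show ?case using * by (auto simp: differentiable_def)
qed

lemma smooth_on_inverse:
  fixes f :: "'e::real_normed_vector \<Rightarrow> real"
  assumes "open S" "smooth_on S f" "\<And>x. x \<in> S \<Longrightarrow> f x \<noteq> 0"
  shows "smooth_on S (\<lambda>x. inverse (f x))"
  by (rule smooth_on_compose[of "- {0}"]) (use assms Ck_on_inverse in \<open>auto simp: smooth_on_def\<close>)

lemma Ck_on_exp: "Ck_on n (exp :: real \<Rightarrow> real) UNIV"
proof (induction n)
  case 0
  then show ?case by (auto intro!: continuous_intros)
next
  case (Suc n)
  have *: "(exp has_derivative (\<lambda>v. v * exp x)) (at x)" for x :: real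
    by (auto intro!: derivative_eq_intros)
  have "Ck_on n (\<lambda>x. v * exp x) UNIV" for v :: real
    by (intro Ck_on_bilinear[OF bounded_bilinear_mult] Ck_on_const Suc.IH) auto
  then show ?case using * by (auto simp: differentiable_def fd_eqI[OF *])
qed

lemma smooth_on_exp:
  fixes f :: "'e::real_normed_vector \<Rightarrow> real"
  assumes "open S" "smooth_on S f"
  shows "smooth_on S (\<lambda>x. exp (f x))"
  by (rule smooth_on_compose[of UNIV]) (use assms Ck_on_exp in \<open>auto simp: smooth_on_def\<close>)

subsection \<open>Symmetry of second derivatives\<close>

lemma fd_line:
  assumes "smooth_on S f" "x + t *\<^sub>R v \<in> S"
  shows "((\<lambda>t. f (x + t *\<^sub>R v)) has_vector_derivative fd f (x + t *\<^sub>R v) v) (at t within A)"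
proof -
  have 1: "((\<lambda>t. x + t *\<^sub>R v) has_derivative (\<lambda>h. h *\<^sub>R v)) (at t within A)"
    by (auto intro!: derivative_eq_intros)
  have 2: "(f has_derivative fd f (x + t *\<^sub>R v)) (at (x + t *\<^sub>R v))"
    by (rule smooth_on_has_derivative[OF assms])
  interpret linear "fd f (x + t *\<^sub>R v)" using 2 has_derivative_linear by blast
  show ?thesis
    using has_derivative_compose[OF 1 2] by (simp add: has_vector_derivative_def scale)
qed

text \<open>Differentiating \<open>f (x + a v + b w) - f (x + b w) = \<integral>\<^sub>0\<^sup>a df(x + \<tau> v + b w) v d\<tau>\<close> in \<open>b\<close>
  under the integral sign, and then in \<open>a\<close>, gives both iterated derivatives.\<close>
lemma fd_commute:
  fixes f :: "'e::real_normed_vector \<Rightarrow> 'f::euclidean_space"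
  assumes S: "open S" "smooth_on S f" "x \<in> S"
  shows "fd (\<lambda>y. fd f y v) x w = fd (\<lambda>y. fd f y w) x v"
proof -
  define k where "k p = x + fst p *\<^sub>R v + snd p *\<^sub>R w" for p :: "real \<times> real"
  have ck: "continuous_on UNIV k" unfolding k_def by (intro continuous_intros)
  have "open (k -` S)" using ck S(1) by (simp add: open_vimage)
  moreover have "(0,0) \<in> k -` S" using S(3) by (simp add: k_def)
  ultimately obtain e where e: "e > 0" "ball (0,0) e \<subseteq> k -` S"
    using openE by blast
  define d where "d = e / 2"
  have d: "d > 0" using e by (simp add: d_def)
  have in_S: "x + a *\<^sub>R v + b *\<^sub>R w \<in> S" if "\<bar>a\<bar> \<le> d" "\<bar>b\<bar> < d" for a b
  proof -
    have "norm (a, b) \<le> \<bar>a\<bar> + \<bar>b\<bar>" by (metis norm_Pair_le real_norm_def)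
    then have "(a,b) \<in> ball (0,0) e" using that by (simp add: dist_norm norm_Pair d_def)
    then show ?thesis using e by (auto simp: k_def)
  qed
  have in_S0: "x + a *\<^sub>R v \<in> S" if "\<bar>a\<bar> \<le> d" for a using in_S[of a 0] that d by simp
  let ?I = "{-d<..<d}"
  have sv: "smooth_on S (\<lambda>y. fd f y v)" "smooth_on S (\<lambda>y. fd f y w)"
    "smooth_on S (\<lambda>y. fd (\<lambda>z. fd f z v) y w)"
    using S(2) smooth_on_fd by blast+
  have ftc: "((\<lambda>\<tau>. fd f (x + \<tau> *\<^sub>R v + b *\<^sub>R w) v) has_integral
      (f (x + a *\<^sub>R v + b *\<^sub>R w) - f (x + b *\<^sub>R w))) {0..a}"
    if "b \<in> ?I" "0 \<le> a" "a \<le> d" for a b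
  proof -
    have "((\<lambda>\<tau>. f ((x + b *\<^sub>R w) + \<tau> *\<^sub>R v)) has_vector_derivative fd f ((x + b *\<^sub>R w) + \<tau> *\<^sub>R v) v)
        (at \<tau> within {0..a})" if "\<tau> \<in> {0..a}" for \<tau>
      using fd_line[OF S(2), of "x + b *\<^sub>R w" \<tau> v] in_S[of \<tau> b] that \<open>b \<in> ?I\<close> \<open>a \<le> d\<close>
      by (auto simp: algebra_simps)
    from fundamental_theorem_of_calculus[OF \<open>0 \<le> a\<close> this] show ?thesis
      by (simp add: algebra_simps)
  qed
  have cont: "continuous_on ({- d<..<d} \<times> {0..a})
      (\<lambda>(b,\<tau>). fd (\<lambda>z. fd f z v) (x + \<tau> *\<^sub>R v + b *\<^sub>R w) w)" if "a \<le> d" for a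
    unfolding case_prod_unfold
    by (rule continuous_on_compose2[OF smooth_on_continuous[OF sv(3)]])
       (use in_S that in \<open>auto intro!: continuous_intros\<close>)
  have h: "fd f (x + a *\<^sub>R v) w - fd f x w = integral {0..a} (\<lambda>\<tau>. fd (\<lambda>z. fd f z v) (x + \<tau> *\<^sub>R v) w)"
    if a: "a \<in> {0..d}" for a
  proof -
    have "((\<lambda>b. integral (cbox 0 a) (\<lambda>\<tau>. fd f (x + \<tau> *\<^sub>R v + b *\<^sub>R w) v)) has_vector_derivative
        integral (cbox 0 a) (\<lambda>\<tau>. fd (\<lambda>z. fd f z v) (x + \<tau> *\<^sub>R v + 0 *\<^sub>R w) w)) (at 0 within ?I)"
    proof (rule leibniz_rule_vector_derivative)
      fix b t assume "b \<in> ?I" "t \<in> cbox 0 a"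
      then show "((\<lambda>b. fd f (x + t *\<^sub>R v + b *\<^sub>R w) v) has_vector_derivative
          fd (\<lambda>z. fd f z v) (x + t *\<^sub>R v + b *\<^sub>R w) w) (at b within ?I)"
        using fd_line[OF sv(1), of "x + t *\<^sub>R v" b w] in_S[of t b] a by auto
    qed (use ftc cont a d in \<open>auto intro: has_integral_integrable\<close>)
    moreover have "integral (cbox 0 a) (\<lambda>\<tau>. fd f (x + \<tau> *\<^sub>R v + b *\<^sub>R w) v) =
        f (x + a *\<^sub>R v + b *\<^sub>R w) - f (x + b *\<^sub>R w)" if "b \<in> ?I" for b
      using ftc[OF that] a by (auto intro: integral_unique)
    ultimately have 1: "((\<lambda>b. f (x + a *\<^sub>R v + b *\<^sub>R w) - f (x + b *\<^sub>R w)) has_vector_derivative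
        integral (cbox 0 a) (\<lambda>\<tau>. fd (\<lambda>z. fd f z v) (x + \<tau> *\<^sub>R v) w)) (at 0 within ?I)"
      by (rule_tac has_vector_derivative_transform) (use d in auto)
    have 2: "((\<lambda>b. f (x + a *\<^sub>R v + b *\<^sub>R w) - f (x + b *\<^sub>R w)) has_vector_derivative
        fd f (x + a *\<^sub>R v) w - fd f x w) (at 0 within ?I)"
      using fd_line[OF S(2), of "x + a *\<^sub>R v" 0 w] fd_line[OF S(2), of x 0 w] in_S0[of a] a S(3)
      by (intro has_vector_derivative_diff) auto
    have "at (0::real) within ?I = at 0" using d by (intro at_within_open) auto
    then show ?thesis using 1 2 vector_derivative_unique_at by fastforce
  qed
  have "continuous_on {0..d} (\<lambda>\<tau>. fd (\<lambda>z. fd f z v) (x + \<tau> *\<^sub>R v) w)"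
    by (rule continuous_on_compose2[OF smooth_on_continuous[OF sv(3)]])
       (use in_S0 in \<open>auto intro!: continuous_intros\<close>)
  then have "((\<lambda>a. integral {0..a} (\<lambda>\<tau>. fd (\<lambda>z. fd f z v) (x + \<tau> *\<^sub>R v) w)) has_vector_derivative
      fd (\<lambda>z. fd f z v) (x + 0 *\<^sub>R v) w) (at 0 within {0..d})"
    using d by (intro integral_has_vector_derivative) auto
  then have "((\<lambda>a. fd f (x + a *\<^sub>R v) w - fd f x w) has_vector_derivative
      fd (\<lambda>z. fd f z v) x w) (at 0 within {0..d})"
    by (rule_tac has_vector_derivative_transform) (use d h in auto)
  moreover have "((\<lambda>a. fd f (x + a *\<^sub>R v) w - fd f x w) has_vector_derivative
      fd (\<lambda>z. fd f z w) x v - 0) (at 0 within {0..d})"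
    using fd_line[OF sv(2), of x 0 v] S(3)
    by (intro has_vector_derivative_diff has_vector_derivative_const) auto
  ultimately show ?thesis
    using vector_derivative_unique_within_closed_interval[of 0 d 0] d by fastforce
qed

subsection \<open>Smoothness on sets that are not open\<close>

definition smooth_in :: "'e::real_normed_vector set \<Rightarrow> ('e \<Rightarrow> 'f::real_normed_vector) \<Rightarrow> bool" where
  "smooth_in S f \<longleftrightarrow> (\<forall>x\<in>S. smooth_at S x f)"

lemma smooth_at_cong:
  assumes "smooth_at S x f" "open W" "x \<in> W" "\<And>y. y \<in> S \<inter> W \<Longrightarrow> f y = g y"
  shows "smooth_at S x g"
proof -
  obtain V k where "open V" "x \<in> V" "smooth_on V k" "\<forall>y\<in>S \<inter> V. k y = f y"
    using assms(1) unfolding smooth_at_def by blast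
  then show ?thesis unfolding smooth_at_def
    by (intro exI[of _ "V \<inter> W"] exI[of _ k]) (use assms in \<open>auto intro: smooth_on_subset\<close>)
qed

lemma smooth_at_subset: "smooth_at S x f \<Longrightarrow> T \<subseteq> S \<Longrightarrow> smooth_at T x f"
  unfolding smooth_at_def by (meson IntD1 IntD2 IntI subsetD)

lemma smooth_on_imp_smooth_at: "smooth_on W f \<Longrightarrow> open W \<Longrightarrow> x \<in> W \<Longrightarrow> smooth_at S x f"
  unfolding smooth_at_def by blast

lemma smooth_at_compose:
  fixes f :: "'d::real_normed_vector \<Rightarrow> 'e::euclidean_space"
  assumes "smooth_at T (f x) \<phi>" "smooth_at S x f" "x \<in> S" "f ` S \<subseteq> T"
  shows "smooth_at S x (\<lambda>y. \<phi> (f y))"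
proof -
  obtain W g where g: "open W" "x \<in> W" "smooth_on W g" "\<forall>y\<in>S \<inter> W. g y = f y"
    using assms(2) unfolding smooth_at_def by blast
  obtain W' g' where g': "open W'" "f x \<in> W'" "smooth_on W' g'" "\<forall>y\<in>T \<inter> W'. g' y = \<phi> y"
    using assms(1) unfolding smooth_at_def by blast
  have o: "open (W \<inter> g -` W')"
    using continuous_open_preimage[OF smooth_on_continuous[OF g(3)] g(1) g'(1)] .
  have "smooth_on (W \<inter> g -` W') (\<lambda>y. g' (g y))"
    by (rule smooth_on_compose[OF g'(3) smooth_on_subset[OF g(3)] o g'(1)]) auto
  then show ?thesis unfolding smooth_at_def
    by (intro exI[of _ "W \<inter> g -` W'"] exI[of _ "\<lambda>y. g' (g y)"])
       (use o g g' assms(3,4) in \<open>auto simp: image_subset_iff\<close>)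
qed

lemma smooth_at_compose_on:
  fixes f :: "'d::real_normed_vector \<Rightarrow> 'e::euclidean_space"
  assumes "smooth_on V \<phi>" "open V" "smooth_at S x f" "x \<in> S" "f x \<in> V"
  shows "smooth_at S x (\<lambda>y. \<phi> (f y))"
  by (rule smooth_at_compose[OF smooth_on_imp_smooth_at[OF assms(1,2)], where T=UNIV])
     (use assms in auto)

lemma smooth_at_Pair:
  assumes "smooth_at S x f" "smooth_at S x g"
  shows "smooth_at S x (\<lambda>y. (f y, g y))"
proof -
  obtain W f' where f: "open W" "x \<in> W" "smooth_on W f'" "\<forall>y\<in>S \<inter> W. f' y = f y"
    using assms(1) unfolding smooth_at_def by blast
  obtain V g' where g: "open V" "x \<in> V" "smooth_on V g'" "\<forall>y\<in>S \<inter> V. g' y = g y"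
    using assms(2) unfolding smooth_at_def by blast
  have "smooth_on (W \<inter> V) (\<lambda>y. (f' y, g' y))"
    using f g by (intro smooth_on_Pair) (auto intro: smooth_on_subset)
  then show ?thesis unfolding smooth_at_def
    by (intro exI[of _ "W \<inter> V"] exI[of _ "\<lambda>y. (f' y, g' y)"]) (use f g in auto)
qed

lemma smooth_at_binary:
  fixes f :: "'d::real_normed_vector \<Rightarrow> 'e::euclidean_space" and g :: "'d \<Rightarrow> 'g::euclidean_space"
  assumes "smooth_at S x f" "smooth_at S x g" "x \<in> S"
    and "open V" "(f x, g x) \<in> V" "smooth_on V (\<lambda>p. \<phi> (fst p) (snd p))"
  shows "smooth_at S x (\<lambda>y. \<phi> (f y) (g y))"
  using smooth_at_compose_on[OF assms(6,4) smooth_at_Pair[OF assms(1,2)] assms(3)] assms(5) by simp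

lemma smooth_at_bilinear:
  fixes f :: "'d::real_normed_vector \<Rightarrow> 'e::euclidean_space" and g :: "'d \<Rightarrow> 'g::euclidean_space"
  assumes "bounded_bilinear b" "smooth_at S x f" "smooth_at S x g" "x \<in> S"
  shows "smooth_at S x (\<lambda>y. b (f y) (g y))"
  by (rule smooth_at_binary[OF assms(2,3,4), where V=UNIV])
     (auto intro!: smooth_on_bilinear[OF assms(1)] smooth_on_fst smooth_on_snd)

lemma smooth_at_add:
  fixes f g :: "'d::real_normed_vector \<Rightarrow> 'e::euclidean_space"
  assumes "smooth_at S x f" "smooth_at S x g" "x \<in> S"
  shows "smooth_at S x (\<lambda>y. f y + g y)"
  by (rule smooth_at_binary[OF assms, where V=UNIV])
     (auto intro!: smooth_on_add smooth_on_fst smooth_on_snd)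

lemma smooth_at_const: "smooth_at S x (\<lambda>_. c)"
  by (rule smooth_on_imp_smooth_at[of UNIV]) auto

lemma smooth_at_bounded_linear:
  fixes f :: "'d::real_normed_vector \<Rightarrow> 'e::euclidean_space"
  assumes "bounded_linear l" "smooth_at S x f" "x \<in> S"
  shows "smooth_at S x (\<lambda>y. l (f y))"
  by (rule smooth_at_compose_on[OF smooth_on_bounded_linear[OF assms(1) _ smooth_on_ident], where V=UNIV])
     (use assms in auto)

lemmas smooth_at_vec_nth = smooth_at_bounded_linear[OF bounded_linear_vec_nth]
lemmas smooth_at_fst = smooth_at_bounded_linear[OF bounded_linear_fst]
lemmas smooth_at_scaleR = smooth_at_bilinear[OF bounded_bilinear_scaleR]
lemmas smooth_at_mult = smooth_at_bilinear[OF bounded_bilinear_mult]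
lemmas smooth_at_inner = smooth_at_bilinear[OF bounded_bilinear_inner]

lemma smooth_at_inverse:
  fixes f :: "'d::real_normed_vector \<Rightarrow> real"
  assumes "smooth_at S x f" "x \<in> S" "f x \<noteq> 0"
  shows "smooth_at S x (\<lambda>y. inverse (f y))"
  by (rule smooth_at_compose_on[of "- {0}" inverse])
     (use assms Ck_on_inverse in \<open>auto simp: smooth_on_def\<close>)

lemma smooth_in_open:
  assumes "open S"
  shows "smooth_in S f \<longleftrightarrow> smooth_on S f"
proof
  assume *: "smooth_in S f"
  show "smooth_on S f"
  proof (rule smooth_on_locally)
    fix x assume "x \<in> S"
    then obtain W g where g: "open W" "x \<in> W" "smooth_on W g" "\<forall>y\<in>S \<inter> W. g y = f y"
      using * unfolding smooth_in_def smooth_at_def by blast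
    then have "smooth_on (S \<inter> W) f"
      using assms by (intro smooth_on_cong[of "S \<inter> W" g f]) (auto intro: smooth_on_subset)
    then show "\<exists>T. open T \<and> x \<in> T \<and> smooth_on T f"
      using g assms \<open>x \<in> S\<close> by blast
  qed
qed (use assms in \<open>auto simp: smooth_in_def intro: smooth_on_imp_smooth_at\<close>)

lemma smooth_in_continuous:
  assumes "smooth_in S f"
  shows "continuous_on S f"
  unfolding continuous_on_eq_continuous_within
proof
  fix x assume "x \<in> S"
  then obtain W g where g: "open W" "x \<in> W" "smooth_on W g" "\<forall>y\<in>S \<inter> W. g y = f y"
    using assms unfolding smooth_in_def smooth_at_def by blast
  have "continuous (at x) g"
    using smooth_on_continuous[OF g(3)] g(1,2) continuous_on_eq_continuous_at by blast
  then have "continuous (at x within S) g"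
    by (rule continuous_at_imp_continuous_at_within)
  then show "continuous (at x within S) f"
    using continuous_transform_within_openin[of x S g W f] g \<open>x \<in> S\<close>
    by (smt (verit) IntD1 IntD2 IntI Int_commute continuous_transform_within_openin openin_open)
qed

text \<open>Every point can be approached from within the set along all coordinate directions.  This makes
  derivatives within the set unique, so that derivatives of a function which is smooth on it do not
  depend on the choice of the local smooth extensions.\<close>
definition thick :: "'e::euclidean_space set \<Rightarrow> bool" where
  "thick S \<longleftrightarrow> (\<forall>x\<in>S. \<forall>i\<in>Basis. \<forall>e>0. \<exists>d. 0 < \<bar>d\<bar> \<and> \<bar>d\<bar> < e \<and> x + d *\<^sub>R i \<in> S)"

lemma thick_unique:
  assumes "thick S" "x \<in> S" "(f has_derivative f') (at x within S)"
    "(f has_derivative f'') (at x within S)"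
  shows "f' = f''"
  by (rule frechet_derivative_unique_within[OF assms(3,4)]) (use assms(1,2) in \<open>auto simp: thick_def\<close>)

lemma thick_open: "open S \<Longrightarrow> thick S"
  unfolding thick_def
proof (intro ballI allI impI)
  fix x i :: 'a and e :: real assume "open S" "x \<in> S" "i \<in> Basis" "0 < e"
  then obtain r where r: "r > 0" "ball x r \<subseteq> S" using openE by blast
  then have "x + (min r e / 2) *\<^sub>R i \<in> ball x r"
    using \<open>0 < e\<close> \<open>i \<in> Basis\<close> by (simp add: dist_norm)
  then show "\<exists>d. 0 < \<bar>d\<bar> \<and> \<bar>d\<bar> < e \<and> x + d *\<^sub>R i \<in> S"
    using r \<open>0 < e\<close> by (intro exI[of _ "min r e / 2"]) auto
qed

lemma thick_Icc: "(a::real) < b \<Longrightarrow> thick {a..b}"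
  unfolding thick_def
proof (intro ballI allI impI)
  fix x i e :: real assume a: "a < b" "x \<in> {a..b}" "i \<in> Basis" "0 < e"
  show "\<exists>d. 0 < \<bar>d\<bar> \<and> \<bar>d\<bar> < e \<and> x + d *\<^sub>R i \<in> {a..b}"
  proof (cases "x < b")
    case True
    then show ?thesis using a by (intro exI[of _ "min (e/2) (b - x)"]) auto
  next
    case False
    then show ?thesis using a by (intro exI[of _ "- min (e/2) (b - a)"]) auto
  qed
qed

lemma thick_Times:
  assumes "thick S" "thick T"
  shows "thick (S \<times> T)"
  unfolding thick_def
proof (intro ballI allI impI)
  fix x i and e :: real assume x: "x \<in> S \<times> T" and i: "i \<in> (Basis :: ('a \<times> 'b) set)" and e: "0 < e"
  from i consider u where "u \<in> Basis" "i = (u, 0)" | v where "v \<in> Basis" "i = (0, v)"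
    unfolding Basis_prod_def by blast
  then show "\<exists>d. 0 < \<bar>d\<bar> \<and> \<bar>d\<bar> < e \<and> x + d *\<^sub>R i \<in> S \<times> T"
  proof cases
    case 1
    obtain d where "0 < \<bar>d\<bar>" "\<bar>d\<bar> < e" "fst x + d *\<^sub>R u \<in> S"
      using assms(1) x 1 e unfolding thick_def by (metis mem_Times_iff)
    then show ?thesis using x 1 by (intro exI[of _ d]) (auto simp: mem_Times_iff)
  next
    case 2
    obtain d where "0 < \<bar>d\<bar>" "\<bar>d\<bar> < e" "snd x + d *\<^sub>R v \<in> T"
      using assms(2) x 2 e unfolding thick_def by (metis mem_Times_iff)
    then show ?thesis using x 2 by (intro exI[of _ d]) (auto simp: mem_Times_iff)
  qed
qed

abbreviation dw :: "'e::euclidean_space set \<Rightarrow> ('e \<Rightarrow> 'f::real_normed_vector) \<Rightarrow> 'e \<Rightarrow> 'e \<Rightarrow> 'f" where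
  "dw S f x \<equiv> frechet_derivative f (at x within S)"

lemma dw_extension:
  assumes S: "thick S" and g: "open W" "smooth_on W g" "\<And>y. y \<in> S \<inter> W \<Longrightarrow> g y = f y"
    and x: "x \<in> S" "x \<in> W"
  shows "(f has_derivative fd g x) (at x within S)" "dw S f x = fd g x"
proof -
  have "(g has_derivative fd g x) (at x within S)"
    using smooth_on_has_derivative[OF g(2) x(2)] has_derivative_at_withinI by blast
  then show *: "(f has_derivative fd g x) (at x within S)"
    using g(1,3) x unfolding open_dist
    by (metis IntI has_derivative_transform_within)
  then have "(f has_derivative dw S f x) (at x within S)"
    using differentiableI frechet_derivative_works by blast
  then show "dw S f x = fd g x"
    using * thick_unique[OF S x(1)] by blast
qed

lemma smooth_in_dw:
  assumes "thick S" "smooth_in S f"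
  shows "smooth_in S (\<lambda>x. dw S f x v)"
  unfolding smooth_in_def
proof
  fix x assume "x \<in> S"
  then obtain W g where g: "open W" "x \<in> W" "smooth_on W g" "\<forall>y\<in>S \<inter> W. g y = f y"
    using assms(2) unfolding smooth_in_def smooth_at_def by blast
  then show "smooth_at S x (\<lambda>x. dw S f x v)"
    unfolding smooth_at_def using dw_extension(2)[OF assms(1) g(1,3)] smooth_on_fd[OF g(3)]
    by (intro exI[of _ W] exI[of _ "\<lambda>x. fd g x v"]) auto
qed

lemma smooth_in_has_derivative:
  assumes "thick S" "smooth_in S f" "x \<in> S"
  shows "(f has_derivative dw S f x) (at x within S)"
proof -
  obtain W g where g: "open W" "x \<in> W" "smooth_on W g" "\<forall>y\<in>S \<inter> W. g y = f y"
    using assms unfolding smooth_in_def smooth_at_def by blast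
  then show ?thesis
    using dw_extension[OF assms(1) g(1,3), of f x] assms(3) by auto
qed

lemma dw_commute:
  fixes f :: "'e::euclidean_space \<Rightarrow> 'f::euclidean_space"
  assumes "thick S" "smooth_in S f" "x \<in> S"
  shows "dw S (\<lambda>y. dw S f y v) x w = dw S (\<lambda>y. dw S f y w) x v"
proof -
  obtain W g where g: "open W" "x \<in> W" "smooth_on W g" "\<forall>y\<in>S \<inter> W. g y = f y"
    using assms unfolding smooth_in_def smooth_at_def by blast
  have "dw S (\<lambda>y. dw S f y v) x = fd (\<lambda>y. fd g y v) x" for v
    by (rule dw_extension(2)[OF assms(1) g(1) smooth_on_fd[OF g(3)]])
       (use dw_extension(2)[OF assms(1) g(1,3)] g assms(3) in auto)
  then show ?thesis using fd_commute[OF g(1,3,2), of v w] by simp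
qed

section \<open>Lifting through covering maps\<close>

definition is_lift :: "('c::real_normed_vector \<Rightarrow> 'b::topological_space) \<Rightarrow> 'c set \<Rightarrow>
    ('d::real_normed_vector \<Rightarrow> 'b) \<Rightarrow> 'd \<Rightarrow> 'c \<Rightarrow> 'd set \<Rightarrow> ('d \<Rightarrow> 'c) \<Rightarrow> bool" where
  "is_lift p C f s0 a W g \<longleftrightarrow>
     continuous_on W g \<and> g ` W \<subseteq> C \<and> g s0 = a \<and> (\<forall>y\<in>W. p (g y) = f y)"

lemma is_lift_unique:
  assumes "covering_space C p X" "is_lift p C f s0 a V g" "is_lift p C f s0 a V' g'"
    and "connected W" "s0 \<in> W" "W \<subseteq> V" "W \<subseteq> V'" "continuous_on W f" "f ` W \<subseteq> X" "y \<in> W"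
  shows "g y = g' y"
proof (rule covering_space_lift_unique[OF assms(1), where a=s0 and f=f and T=W])
  show "continuous_on W g" "continuous_on W g'"
    using assms(2,3) by (auto simp: is_lift_def intro: continuous_on_subset[OF _ assms(6)]
        continuous_on_subset[OF _ assms(7)])
  show "g \<in> W \<rightarrow> C" "g' \<in> W \<rightarrow> C" "f \<in> W \<rightarrow> X"
    using assms(2,3,6,7,9) by (auto simp: is_lift_def subset_eq)
  show "g s0 = g' s0" using assms(2,3) by (simp add: is_lift_def)
  show "f x = p (g x)" "f x = p (g' x)" if "x \<in> W" for x
    using assms(2,3,6,7) that unfolding is_lift_def by (metis subsetD)+
qed (use assms in simp_all)

text \<open>A lift defined near a part of a segment is continued by the sheet over an evenly covered
  neighbourhood of the end of that part.  The \<open>e\<close>-neighbourhoods of segments are used as domains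
  because they are convex, so that lifts which agree at one point agree on overlaps.\<close>
lemma lift_near_segment:
  fixes p :: "'c::real_normed_vector \<Rightarrow> 'b::topological_space"
    and f :: "'d::real_normed_vector \<Rightarrow> 'b"
  assumes cov: "covering_space C p X" and S: "convex S" "s0 \<in> S" "s \<in> S"
    and a: "a \<in> C" "p a = f s0" and f: "continuous_on S f" "f ` S \<subseteq> X"
  shows "\<exists>e>0. \<exists>g. is_lift p C f s0 a (S \<inter> (\<Union>x\<in>closed_segment s0 s. ball x e)) g"
proof -
  define \<sigma> where "\<sigma> t = s0 + t *\<^sub>R (s - s0)" for t
  define N where "N e t = S \<inter> (\<Union>x\<in>closed_segment s0 (\<sigma> t). ball x e)" for e t
  define P where "P t \<longleftrightarrow> (\<exists>e>0. \<exists>g. is_lift p C f s0 a (N e t) g)" for t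
  define Q where "Q t t' \<longleftrightarrow> (0 \<le> t \<longrightarrow> t' \<le> 1 \<longrightarrow> P t \<longrightarrow> P t')" for t t'
  have \<sigma>S: "\<sigma> t \<in> S" if "t \<in> {0..1}" for t
    using that convexD_alt[OF S(1,2,3), of t] by (simp add: \<sigma>_def algebra_simps)
  have opf: "\<exists>r>0. S \<inter> ball y r \<subseteq> f -` U" if "y \<in> S" "openin (top_of_set X) U" "f y \<in> U" for y U
  proof -
    have "openin (top_of_set S) (S \<inter> f -` U)"
      using continuous_openin_preimage[OF f(1) _ that(2)] f(2) by auto
    then show ?thesis
      unfolding openin_contains_ball using that(1,3) by (fastforce simp: Int_commute)
  qed
  have cvx: "convex (N e t)" for e t
  proof -
    have "ball x e = (\<Union>y\<in>ball 0 e. {x + y})" for x :: 'd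
    proof (intro set_eqI iffI)
      fix y assume "y \<in> ball x e"
      then have "y - x \<in> ball 0 e" by (simp add: dist_norm norm_minus_commute)
      then show "y \<in> (\<Union>y\<in>ball 0 e. {x + y})" by (intro UN_I[of "y - x"]) auto
    qed (auto simp: dist_norm)
    from SUP_cong[OF refl this] have "(\<Union>x\<in>closed_segment s0 (\<sigma> t). ball x e) =
        (\<Union>x\<in>closed_segment s0 (\<sigma> t). \<Union>y\<in>ball 0 e. {x + y})" .
    then show ?thesis unfolding N_def
      using convex_Int[OF S(1) convex_sums[OF convex_closed_segment convex_ball]] by simp
  qed
  have open_N: "\<exists>V. open V \<and> N e t = S \<inter> V" for e t
    unfolding N_def by (rule exI[of _ "\<Union>x\<in>closed_segment s0 (\<sigma> t). ball x e"]) auto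
  have "P 0"
  proof -
    obtain T U q where q: "a \<in> T" "openin (top_of_set C) T" "p a \<in> U" "openin (top_of_set X) U"
        "homeomorphism T U p q"
      using covering_space_local_homeomorphism[OF cov a(1)] by metis
    obtain r where r: "r > 0" "S \<inter> ball s0 r \<subseteq> f -` U"
      using opf[OF S(2) q(4)] q(3) a(2) by auto
    have "is_lift p C f s0 a (S \<inter> ball s0 r) (\<lambda>y. q (f y))"
      unfolding is_lift_def
    proof (intro conjI ballI)
      show "continuous_on (S \<inter> ball s0 r) (\<lambda>y. q (f y))"
        by (rule continuous_on_compose2[OF homeomorphism_cont2[OF q(5)]])
           (use r f in \<open>auto intro: continuous_on_subset\<close>)
      show "q (f s0) = a" using q(1,5) a(2) homeomorphism_apply1 by metis
      show "(\<lambda>y. q (f y)) ` (S \<inter> ball s0 r) \<subseteq> C"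
        using r homeomorphism_image2[OF q(5)] openin_imp_subset[OF q(2)] by fastforce
      show "p (q (f y)) = f y" if "y \<in> S \<inter> ball s0 r" for y
        using homeomorphism_apply2[OF q(5)] r that by auto
    qed
    then show ?thesis unfolding P_def N_def \<sigma>_def using r(1) by (intro exI[of _ r]) auto
  qed
  moreover have "Q 0 1"
  proof (rule Bolzano[of 0 1 Q])
    show "Q x z" if "Q x y" "Q y z" "x \<le> y" "y \<le> z" for x y z
      using that unfolding Q_def by auto
    fix x :: real assume x: "0 \<le> x" "x \<le> 1"
    have "f (\<sigma> x) \<in> X" using \<sigma>S x f by auto
    then obtain T v where T: "f (\<sigma> x) \<in> T" "openin (top_of_set X) T"
      and v: "\<Union>v = C \<inter> p -` T" "\<And>u. u \<in> v \<Longrightarrow> \<exists>q. homeomorphism u T p q"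
      using cov unfolding covering_space_def by metis
    obtain r where r: "r > 0" "S \<inter> ball (\<sigma> x) r \<subseteq> f -` T"
      using opf[OF _ T(2,1)] \<sigma>S x by auto
    define n where "n = norm (s - s0) + 1"
    have n: "n > 0" unfolding n_def by (simp add: add_nonneg_pos)
    define d where "d = r / 2 / n"
    have d: "d > 0" using r n by (simp add: d_def)
    have near: "dist (\<sigma> t) (\<sigma> t') < r / 2" if "\<bar>t - t'\<bar> < d" for t t'
    proof -
      have "dist (\<sigma> t) (\<sigma> t') = \<bar>t - t'\<bar> * norm (s - s0)"
        by (simp add: \<sigma>_def dist_norm flip: scaleR_left_diff_distrib)
      also have "\<dots> \<le> \<bar>t - t'\<bar> * n" by (intro mult_left_mono) (auto simp: n_def)
      also have "\<dots> < d * n" using that n by simp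
      finally show ?thesis using n by (simp add: d_def)
    qed
    have "Q t t'" if t: "t \<le> x" "x \<le> t'" "t' - t < d" for t t'
      unfolding Q_def
    proof (intro impI)
      assume t0: "0 \<le> t" "t' \<le> 1" and "P t"
      then obtain e g where e: "e > 0" and g: "is_lift p C f s0 a (N e t) g"
        unfolding P_def by blast
      define B where "B = S \<inter> ball (\<sigma> x) r"
      have tB: "\<sigma> t \<in> B" using near[of x t] t t0 x r \<sigma>S[of t] by (auto simp: B_def)
      have tN: "\<sigma> t \<in> N e t" using \<sigma>S[of t] t t0 x e by (force simp: N_def)
      have sN: "s0 \<in> N e t" using S e by (force simp: N_def)
      have "g (\<sigma> t) \<in> C \<inter> p -` T"
        using g tN tB r(2) unfolding is_lift_def B_def by auto
      then obtain u where u: "u \<in> v" "g (\<sigma> t) \<in> u" using v(1) by blast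
      then obtain q where q: "homeomorphism u T p q" using v(2) by blast
      have uC: "u \<subseteq> C" using v(1) u(1) by blast
      have ck: "continuous_on B (\<lambda>y. q (f y))"
        by (rule continuous_on_compose2[OF homeomorphism_cont2[OF q]])
           (use r f in \<open>auto simp: B_def intro: continuous_on_subset\<close>)
      have qC: "q (f y) \<in> C" "p (q (f y)) = f y" if "y \<in> B" for y
      proof -
        have "f y \<in> T" using that r(2) by (auto simp: B_def)
        then show "q (f y) \<in> C" "p (q (f y)) = f y"
          using homeomorphism_image2[OF q] uC homeomorphism_apply2[OF q] by auto
      qed
      have gN: "g y \<in> C" "f y = p (g y)" "f y \<in> X" if "y \<in> N e t" for y
      proof -
        have "y \<in> S" using that by (simp add: N_def)
        then show "g y \<in> C" "f y = p (g y)" "f y \<in> X"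
          using g that f(2) unfolding is_lift_def by auto
      qed
      have agree: "g y = q (f y)" if "y \<in> N e t \<inter> B" for y
      proof (rule covering_space_lift_unique[OF cov, where a="\<sigma> t" and f=f and T="N e t \<inter> B"])
        show "g (\<sigma> t) = q (f (\<sigma> t))"
          using g tN homeomorphism_apply1[OF q u(2)] by (simp add: is_lift_def)
        show "continuous_on (N e t \<inter> B) f"
          using f(1) by (rule continuous_on_subset) (auto simp: N_def)
        show "connected (N e t \<inter> B)"
          unfolding B_def by (intro convex_connected convex_Int cvx S convex_ball)
        show "continuous_on (N e t \<inter> B) g" "continuous_on (N e t \<inter> B) (\<lambda>y. q (f y))"
          using g ck unfolding is_lift_def by (auto intro: continuous_on_subset)
        show "f y = p (q (f y))" if "y \<in> N e t \<inter> B" for y using qC that by simp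
      qed (use that tB tN gN qC(1) in auto)
      define k where "k y = (if y \<in> N e t then g y else q (f y))" for y
      have lift: "is_lift p C f s0 a (N e t \<union> B) k"
        unfolding is_lift_def
      proof (intro conjI ballI)
        obtain V where "open V" "N e t = S \<inter> V" using open_N by blast
        moreover have "B \<subseteq> S" "B = S \<inter> ball (\<sigma> x) r" by (auto simp: B_def)
        ultimately have "N e t = (N e t \<union> B) \<inter> V" "B = (N e t \<union> B) \<inter> ball (\<sigma> x) r" by blast+
        then have "openin (top_of_set (N e t \<union> B)) (N e t)" "openin (top_of_set (N e t \<union> B)) B"
          using \<open>open V\<close> openin_open_Int by (metis, metis open_ball)
        then show "continuous_on (N e t \<union> B) k" unfolding k_def
          using agree g ck
          by (intro continuous_on_cases_local_open) (auto simp: is_lift_def)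
      qed (use g qC sN in \<open>auto simp: is_lift_def k_def\<close>)
      define e' where "e' = min e (r / 2)"
      have "N e' t' \<subseteq> N e t \<union> B"
      proof
        fix y assume y: "y \<in> N e' t'"
        then obtain z where z: "z \<in> closed_segment s0 (\<sigma> t')" "dist z y < e'" "y \<in> S"
          unfolding N_def by auto
        then obtain c where c: "0 \<le> c" "c \<le> 1" "z = (1 - c) *\<^sub>R s0 + c *\<^sub>R \<sigma> t'"
          unfolding closed_segment_def by auto
        define \<tau> where "\<tau> = c * t'"
        have z\<tau>: "z = \<sigma> \<tau>" using c by (simp add: \<sigma>_def \<tau>_def algebra_simps)
        have \<tau>: "0 \<le> \<tau>" "\<tau> \<le> t'" using c t x by (auto simp: \<tau>_def mult_left_le_one_le)
        show "y \<in> N e t \<union> B"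
        proof (cases "\<tau> \<le> t")
          case True
          have "z \<in> closed_segment s0 (\<sigma> t)"
          proof (cases "t = 0")
            case True then show ?thesis using \<open>\<tau> \<le> t\<close> \<tau> z\<tau> by (simp add: \<sigma>_def)
          next
            case False
            then show ?thesis unfolding closed_segment_def z\<tau> using True \<tau> t0
              by (auto intro!: exI[of _ "\<tau> / t"] simp: \<sigma>_def algebra_simps)
          qed
          then show ?thesis using z unfolding N_def e'_def by auto
        next
          case False
          then have "dist (\<sigma> x) z < r / 2" using near[of x \<tau>] \<tau> t z\<tau> by auto
          moreover have "dist z y < r / 2" using z by (auto simp: e'_def)
          ultimately have "dist (\<sigma> x) y < r" using dist_triangle_half_r[of z] by (metis dist_commute)
          then show ?thesis using z by (simp add: B_def)
        qed
      qed
      moreover have "e' > 0" using e r by (simp add: e'_def)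
      ultimately show "P t'"
        using lift unfolding P_def is_lift_def
        by (intro exI[of _ e'] conjI exI[of _ k]) (auto intro: continuous_on_subset)
    qed
    then show "\<exists>d>0. \<forall>t t'. t \<le> x \<and> x \<le> t' \<and> t' - t < d \<longrightarrow> Q t t'" using d by blast
  qed auto
  ultimately have "P 1" by (simp add: Q_def)
  then show ?thesis by (simp add: P_def N_def \<sigma>_def)
qed

text \<open>The lift at \<open>s\<close> is the end of the lift along the segment from \<open>s0\<close> to \<open>s\<close>.\<close>
proposition covering_space_lift_convex:
  fixes p :: "'c::real_normed_vector \<Rightarrow> 'b::topological_space"
    and f :: "'d::real_normed_vector \<Rightarrow> 'b"
  assumes cov: "covering_space C p X" and S: "convex S" "s0 \<in> S"
    and a: "a \<in> C" "p a = f s0" and f: "continuous_on S f" "f ` S \<subseteq> X"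
  obtains g where "is_lift p C f s0 a S g"
proof -
  define N where "N e s = S \<inter> (\<Union>x\<in>closed_segment s0 s. ball x e)" for e s
  have "\<forall>s. \<exists>e g. s \<in> S \<longrightarrow> e > 0 \<and> is_lift p C f s0 a (N e s) g"
    using lift_near_segment[OF cov S _ a f] unfolding N_def by meson
  then obtain E G where EG: "\<And>s. s \<in> S \<Longrightarrow> E s > 0 \<and> is_lift p C f s0 a (N (E s) s) (G s)"
    by metis
  define g where "g s = G s s" for s
  have seg: "closed_segment s0 s \<subseteq> S" if "s \<in> S" for s
    using S that closed_segment_subset by metis
  have segN: "closed_segment s0 s \<subseteq> N (E s) s" if "s \<in> S" for s
    using EG[OF that] seg[OF that] by (force simp: N_def)
  have eq: "g s' = G s s'" if s: "s \<in> S" "s' \<in> S" "dist s s' < E s" for s s'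
  proof -
    have fs: "continuous_on (closed_segment s0 s') f" "f ` closed_segment s0 s' \<subseteq> X"
      using f seg[OF s(2)] by (blast intro: continuous_on_subset)+
    have "closed_segment s0 s' \<subseteq> N (E s) s"
    proof
      fix y assume y: "y \<in> closed_segment s0 s'"
      then obtain c where c: "0 \<le> c" "c \<le> 1" "y = (1 - c) *\<^sub>R s0 + c *\<^sub>R s'"
        unfolding closed_segment_def by auto
      define z where "z = (1 - c) *\<^sub>R s0 + c *\<^sub>R s"
      have "z \<in> closed_segment s0 s" using c unfolding closed_segment_def z_def by auto
      moreover have "dist z y \<le> dist s s'"
      proof -
        have "z - y = c *\<^sub>R (s - s')" by (simp add: z_def c algebra_simps)
        then show ?thesis using c by (simp add: dist_norm mult_left_le_one_le)
      qed
      ultimately show "y \<in> N (E s) s"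
        using s(3) seg[OF s(2)] y by (auto simp: N_def intro!: bexI[of _ z])
    qed
    then show ?thesis unfolding g_def
      using is_lift_unique[OF cov, of f s0 a "N (E s') s'" "G s'" "N (E s) s" "G s" "closed_segment s0 s'" s']
        EG[OF s(1)] EG[OF s(2)] segN[OF s(2)] fs
      by auto
  qed
  have "is_lift p C f s0 a S g"
    unfolding is_lift_def
  proof (intro conjI ballI)
    show "continuous_on S g"
      unfolding continuous_on_eq_continuous_within
    proof
      fix s assume s: "s \<in> S"
      have "s \<in> N (E s) s" using segN[OF s] by auto
      moreover have "continuous_on (N (E s) s) (G s)" using EG[OF s] by (simp add: is_lift_def)
      ultimately have "continuous (at s within N (E s) s) (G s)"
        using continuous_on_eq_continuous_within by blast
      moreover have "at s within N (E s) s = at s within S"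
      proof (rule at_within_nhd[of _ "ball s (E s)"])
        show "N (E s) s \<inter> ball s (E s) - {s} = S \<inter> ball s (E s) - {s}"
          unfolding N_def by force
      qed (use EG[OF s] in auto)
      ultimately have "continuous (at s within S) (G s)" by simp
      then show "continuous (at s within S) g"
        by (rule continuous_transform_within[where \<delta>="E s"]) (use EG[OF s] eq[OF s] s in \<open>auto simp: dist_commute\<close>)
    qed
    show "g s0 = a" using EG[OF S(2)] by (simp add: g_def is_lift_def)
    have "g y \<in> C \<and> p (g y) = f y" if "y \<in> S" for y
      using EG[OF that] segN[OF that] unfolding g_def is_lift_def by (auto simp: subset_eq)
    then show "g ` S \<subseteq> C" "\<And>y. y \<in> S \<Longrightarrow> p (g y) = f y" by auto
  qed
  then show thesis using that by blast
qed

section \<open>Isometries of the upper half space\<close>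

lemma linear_real3:
  fixes f :: "real^3 \<Rightarrow> 'b::real_vector"
  assumes "linear f"
  shows "f u = u$1 *\<^sub>R f (axis 1 1) + u$2 *\<^sub>R f (axis 2 1) + u$3 *\<^sub>R f (axis 3 1)"
proof -
  interpret linear f by fact
  have "u = u$1 *\<^sub>R axis 1 1 + u$2 *\<^sub>R axis 2 1 + u$3 *\<^sub>R axis 3 1"
    by (simp add: vec_eq_iff axis_def forall_3)
  then have "f u = f (u$1 *\<^sub>R axis 1 1 + u$2 *\<^sub>R axis 2 1 + u$3 *\<^sub>R axis 3 1)" by simp
  then show ?thesis by (simp only: add scale)
qed

lemma inner_real3: "u \<bullet> v = u$1 * v$1 + u$2 * v$2 + u$3 * v$3" for u v :: "real^3"
  by (simp add: inner_vec_def sum_3)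

lemma linear_functional_real3:
  fixes f :: "real^3 \<Rightarrow> real"
  assumes "linear f"
  shows "f u = (\<chi> i. f (axis i 1)) \<bullet> u"
  using linear_real3[OF assms, of u] by (simp add: inner_real3 mult.commute)

lemma open_upper_half_space: "open upper_half_space"
  unfolding upper_half_space_def by (rule open_halfspace_component_gt_cart)

lemma convex_upper_half_space: "convex upper_half_space"
proof -
  have "upper_half_space = {x. (axis 3 1 :: real^3) \<bullet> x > 0}"
    by (simp add: upper_half_space_def inner_axis')
  then show ?thesis by (metis convex_halfspace_gt)
qed

lemma upper_half_space_pos: "x \<in> upper_half_space \<Longrightarrow> x $ 3 > 0"
  by (simp add: upper_half_space_def)

text \<open>The two terms of the derivative of \<open>dg(u) \<bullet> dg(v) = l\<^sup>2 (u \<bullet> v)\<close> are separated by permuting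
  the three vectors cyclically, as in the derivation of the Levi-Civita connection.\<close>
lemma conformal_second_derivative:
  fixes J :: "real^3 \<Rightarrow> real^3" and K :: "real^3 \<Rightarrow> real^3 \<Rightarrow> real^3"
  assumes sym: "\<And>u v. K u v = K v u"
    and eq: "\<And>u v w. J u \<bullet> K v w + K u w \<bullet> J v = 2 * m w * (u \<bullet> v)"
  shows "K u v \<bullet> J w = m u * (v \<bullet> w) + m v * (u \<bullet> w) - m w * (u \<bullet> v)"
  using eq[of u w v] eq[of v w u] eq[of u v w] sym[of w v] sym[of w u] sym[of u v]
  by (simp add: inner_commute algebra_simps)

text \<open>A local isometry \<open>g\<close> pulls solutions of \<open>Hess f = f h\<close> back to solutions.  The function
  \<open>1/z\<close> is a solution, and the solutions are \<open>(a + b \<bullet> x + c |x|\<^sup>2)/z\<close> with \<open>b\<close> horizontal.  The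
  constraint on \<open>a,b,c\<close> is the pull-back of \<open>|grad (1/z)| = 1/z\<close>.  In Euclidean terms, the
  function \<open>F = z/g\<^sub>3\<close> has Hessian \<open>k I\<close> with a constant \<open>k\<close>.\<close>
proposition half_space_isometry_height:
  fixes g :: "real^3 \<Rightarrow> real^3"
  defines "U \<equiv> upper_half_space"
  assumes g: "smooth_on U g" and gU: "g ` U \<subseteq> U"
    and iso: "\<And>x u. x \<in> U \<Longrightarrow> (fd g x u \<bullet> fd g x u) / (g x $ 3)\<^sup>2 = (u \<bullet> u) / (x $ 3)\<^sup>2"
  obtains a b c where "b $ 3 = 0" "b \<bullet> b = 4 * a * c"
    "\<And>x. x \<in> U \<Longrightarrow> x $ 3 = g x $ 3 * (a + b \<bullet> x + c * (x \<bullet> x))"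
proof -
  note U = open_upper_half_space[folded U_def] convex_upper_half_space[folded U_def]
  let ?e = "axis 3 1 :: real^3"
  define q where "q x = g x $ 3" for x
  define J where "J x u = fd g x u" for x u
  define K where "K x u v = fd (\<lambda>y. fd g y u) x v" for x u v
  define Dq where "Dq x u = J x u $ 3" for x u
  define L where "L x = (q x / x$3)\<^sup>2" for x
  have zpos: "x $ 3 > 0" and qpos: "q x > 0" and Lpos: "L x > 0" if "x \<in> U" for x
    using that gU by (auto simp: U_def upper_half_space_def q_def L_def)
  have dg: "(g has_derivative J x) (at x)" if "x \<in> U" for x
    unfolding J_def using smooth_on_has_derivative[OF g that] by simp
  have dJ: "((\<lambda>y. J y u) has_derivative K x u) (at x)" if "x \<in> U" for x u
    unfolding J_def K_def using smooth_on_has_derivative[OF smooth_on_fd[OF g] that] by simp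
  have dq: "(q has_derivative Dq x) (at x)" if "x \<in> U" for x
    unfolding q_def Dq_def by (rule bounded_linear.has_derivative[OF bounded_linear_vec_nth dg[OF that]])
  have dDq: "((\<lambda>y. Dq y u) has_derivative (\<lambda>w. K x u w $ 3)) (at x)" if "x \<in> U" for x u
    unfolding Dq_def by (rule bounded_linear.has_derivative[OF bounded_linear_vec_nth dJ[OF that]])
  have dz: "((\<lambda>y. y $ 3) has_derivative (\<lambda>w. w $ 3)) (at x)" for x :: "real^3"
    by (rule bounded_linear.has_derivative[OF bounded_linear_vec_nth has_derivative_ident])
  have J_lin: "linear (J x)" if "x \<in> U" for x using dg[OF that] has_derivative_linear by blast
  have polar: "J x u \<bullet> J x v = L x * (u \<bullet> v)" if "x \<in> U" for x u v
  proof -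
    have *: "J x w \<bullet> J x w = L x * (w \<bullet> w)" for w
      using iso[OF that, of w] zpos[OF that] qpos[OF that]
      by (simp add: J_def L_def q_def power_divide divide_simps mult.commute)
    show ?thesis
      using *[of "u + v"] *[of u] *[of v] linear_add[OF J_lin[OF that], of u v]
      by (simp add: inner_add_left inner_add_right algebra_simps inner_commute)
  qed
  \<comment> \<open>\<open>L\<close> is the conformal factor of \<open>g\<close>, and \<open>m\<close> is half of its differential.\<close>
  define m where "m x w = (q x / x$3) * ((Dq x w * x$3 - q x * w$3) / (x$3)\<^sup>2)" for x w
  have conn: "K x u v \<bullet> J x w = m x u * (v \<bullet> w) + m x v * (u \<bullet> w) - m x w * (u \<bullet> v)"
    if x: "x \<in> U" for x u v w
  proof (rule conformal_second_derivative)
    show "K x u v = K x v u" for u v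
      unfolding K_def by (rule fd_commute[OF U(1) g x])
    fix u v w
    have "((\<lambda>y. J y u \<bullet> J y v) has_derivative (\<lambda>w. J x u \<bullet> K x v w + K x u w \<bullet> J x v)) (at x)"
      by (rule has_derivative_inner[OF dJ[OF x] dJ[OF x]])
    then have 1: "((\<lambda>y. L y * (u \<bullet> v)) has_derivative (\<lambda>w. J x u \<bullet> K x v w + K x u w \<bullet> J x v)) (at x)"
      by (rule has_derivative_transform_within_open[OF _ U(1) x]) (simp add: polar)
    have 2: "((\<lambda>y. L y * (u \<bullet> v)) has_derivative (\<lambda>w. 2 * m x w * (u \<bullet> v))) (at x)"
      unfolding L_def using zpos[OF x]
      by (auto intro!: derivative_eq_intros dq[OF x] dz simp: m_def power2_eq_square field_simps)
    show "J x u \<bullet> K x v w + K x u w \<bullet> J x v = 2 * m x w * (u \<bullet> v)"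
      using has_derivative_unique[OF 1 2] by metis
  qed
  \<comment> \<open>Vertical components of \<open>dg\<close> and its derivative are inner products with \<open>dg(n) = e\<^sub>3\<close>.\<close>
  have surj: "\<exists>n. J x n = ?e" if "x \<in> U" for x
  proof -
    have "inj (J x)"
      unfolding linear_injective_0[OF J_lin[OF that]]
      using polar[OF that] Lpos[OF that] by (metis inner_eq_zero_iff inner_zero_left mult_eq_0_iff less_irrefl)
    then have "surj (J x)" using linear_injective_imp_surjective[OF J_lin[OF that]] by simp
    then show ?thesis by (metis surjD)
  qed
  then obtain n where n: "\<And>x. x \<in> U \<Longrightarrow> J x (n x) = ?e" by metis
  have Dq_n: "Dq x u = L x * (u \<bullet> n x)" if "x \<in> U" for x u
    using polar[OF that, of u "n x"] n[OF that] by (simp add: Dq_def inner_axis)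
  have nn: "L x * (n x \<bullet> n x) = 1" if "x \<in> U" for x
    using polar[OF that, of "n x" "n x"] n[OF that] by (simp add: inner_axis')
  have Dqn1: "Dq x (n x) = 1" if "x \<in> U" for x using n[OF that] by (simp add: Dq_def)
  have n3: "n x $ 3 = Dq x ?e / L x" if "x \<in> U" for x
    using Dq_n[OF that, of ?e] Lpos[OF that] by (simp add: inner_axis')
  define F where "F x = x$3 / q x" for x
  define DF where "DF x u = u$3 / q x - x$3 * Dq x u / (q x)\<^sup>2" for x u
  define \<psi> where "\<psi> x = DF x ?e / x$3" for x
  have dF: "(F has_derivative DF x) (at x)" if "x \<in> U" for x
    unfolding F_def DF_def using qpos[OF that]
    by (auto intro!: derivative_eq_intros dq[OF that] dz simp: power2_eq_square field_simps)
  have dDF: "((\<lambda>y. DF y u) has_derivative (\<lambda>w. \<psi> x * (u \<bullet> w))) (at x)" if x: "x \<in> U" for x u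
  proof -
    let ?z = "x$3" and ?q = "q x"
    have pos: "?z > 0" "?q > 0" using zpos[OF x] qpos[OF x] by auto
    have "((\<lambda>y. DF y u) has_derivative (\<lambda>w. - u$3 * Dq x w / ?q\<^sup>2 -
        (w$3 * Dq x u + ?z * K x u w $ 3) / ?q\<^sup>2 + 2 * ?z * Dq x u * Dq x w / ?q^3)) (at x)"
      unfolding DF_def using pos
      by (auto intro!: derivative_eq_intros dq[OF x] dDq[OF x] dz
          simp: power2_eq_square power3_eq_cube field_simps)
    moreover have "- u$3 * Dq x w / ?q\<^sup>2 - (w$3 * Dq x u + ?z * K x u w $ 3) / ?q\<^sup>2 +
        2 * ?z * Dq x u * Dq x w / ?q^3 = \<psi> x * (u \<bullet> w)" for w
    proof -
      define i where "i = u \<bullet> w"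
      have "K x u w $ 3 = K x u w \<bullet> J x (n x)" by (simp add: n[OF x] inner_axis)
      also have "\<dots> = m x u * (w \<bullet> n x) + m x w * (u \<bullet> n x) - m x (n x) * i"
        unfolding i_def by (rule conn[OF x])
      also have "\<dots> = m x u * (Dq x w / L x) + m x w * (Dq x u / L x) - m x (n x) * i"
        using Dq_n[OF x] Lpos[OF x] by auto
      finally have Kq: "K x u w $ 3 = m x u * (Dq x w / L x) + m x w * (Dq x u / L x) - m x (n x) * i" .
      show ?thesis
        unfolding Kq m_def Dqn1[OF x] n3[OF x] \<psi>_def DF_def i_def[symmetric] L_def
        using pos by (simp add: divide_simps) (simp add: algebra_simps eval_nat_numeral)
    qed
    ultimately show ?thesis by simp
  qed
  \<comment> \<open>As \<open>F\<close> has the Hessian \<open>\<psi> I\<close>, the differential of \<open>\<partial>\<^sub>3F\<close> is \<open>\<psi> dz\<close>, so \<open>\<psi> = \<partial>\<^sub>3F/z\<close> is constant.\<close>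
  obtain k where k: "\<And>x. x \<in> U \<Longrightarrow> \<psi> x = k"
  proof -
    have "(\<psi> has_derivative (\<lambda>_. 0)) (at x within U)" if x: "x \<in> U" for x
      unfolding \<psi>_def using zpos[OF x]
      by (auto intro!: derivative_eq_intros dDF[OF x, THEN has_derivative_at_withinI]
          dz[THEN has_derivative_at_withinI] simp: \<psi>_def inner_axis' field_simps)
    from has_derivative_zero_constant[OF U(2) this] show thesis using that by blast
  qed
  have "\<exists>\<beta>. \<forall>x\<in>U. DF x u - k * (u \<bullet> x) = \<beta>" for u
  proof (rule has_derivative_zero_constant[OF U(2)])
    fix x assume x: "x \<in> U"
    show "((\<lambda>x. DF x u - k * (u \<bullet> x)) has_derivative (\<lambda>_. 0)) (at x within U)"
      by (auto intro!: derivative_eq_intros dDF[OF x, THEN has_derivative_at_withinI] simp: k[OF x])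
  qed
  then obtain \<beta> where "\<And>u x. x \<in> U \<Longrightarrow> DF x u - k * (u \<bullet> x) = \<beta> u" by metis
  then have \<beta>: "DF x u = k * (u \<bullet> x) + \<beta> u" if "x \<in> U" for x u
    using that by (metis add_diff_cancel_left' add_diff_eq)
  define b where "b = (\<chi> i. \<beta> (axis i 1))"
  have eU: "?e \<in> U" by (simp add: U_def upper_half_space_def)
  have \<beta>b: "\<beta> u = b \<bullet> u" for u
  proof -
    have "linear (\<lambda>u. DF ?e u - k * (u \<bullet> ?e))"
      using has_derivative_linear[OF dF[OF eU]]
      by (auto simp: linear_iff inner_add_left algebra_simps)
    then have "linear \<beta>" using \<beta>[OF eU] by simp
    then show ?thesis unfolding b_def by (rule linear_functional_real3)
  qed
  have b3: "b $ 3 = 0"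
    using \<beta>[OF eU, of ?e] k[OF eU] \<beta>b[of ?e] by (simp add: \<psi>_def inner_axis)
  define c where "c = k / 2"
  have "\<exists>a. \<forall>x\<in>U. F x - b \<bullet> x - c * (x \<bullet> x) = a"
  proof (rule has_derivative_zero_constant[OF U(2)])
    fix x assume x: "x \<in> U"
    show "((\<lambda>x. F x - b \<bullet> x - c * (x \<bullet> x)) has_derivative (\<lambda>_. 0)) (at x within U)"
      by (auto intro!: derivative_eq_intros dF[OF x, THEN has_derivative_at_withinI]
          simp: \<beta>[OF x] \<beta>b c_def inner_commute algebra_simps)
  qed
  then obtain a where a0: "\<And>x. x \<in> U \<Longrightarrow> F x - b \<bullet> x - c * (x \<bullet> x) = a" by blast
  have a: "F x = a + b \<bullet> x + c * (x \<bullet> x)" if "x \<in> U" for x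
    using a0[OF that] by linarith
  have "b \<bullet> b = 4 * a * c"
  proof -
    let ?n = "n ?e" and ?q = "q ?e" and ?v = "k *\<^sub>R ?e + b"
    have q: "?q > 0" using qpos[OF eU] .
    have L: "L ?e = ?q\<^sup>2" by (simp add: L_def)
    have *: "u \<bullet> ?v = u \<bullet> ((1 / ?q) *\<^sub>R ?e - ?n)" for u
      using \<beta>[OF eU, of u] Dq_n[OF eU, of u] q
      by (simp add: \<beta>b DF_def L inner_add_right inner_diff_right inner_axis inner_commute field_simps)
    then have v: "?v = (1 / ?q) *\<^sub>R ?e - ?n" by (metis vector_eq_ldot)
    have nn': "?n \<bullet> ?n = 1 / ?q\<^sup>2" using nn[OF eU] q by (simp add: L field_simps)
    have "?v $ 3 = 1 / ?q - ?n $ 3" using arg_cong[OF v, of "\<lambda>v. v $ 3"] by simp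
    then have n3': "?n $ 3 = 1 / ?q - k" using b3 by simp
    have "?v \<bullet> ?v = 1 / ?q\<^sup>2 - 2 * (1 / ?q) * ?n $ 3 + ?n \<bullet> ?n"
      unfolding v by (simp add: inner_diff_left inner_diff_right inner_axis inner_axis' power2_eq_square
          inner_commute algebra_simps)
    also have "\<dots> = 2 * k / ?q" using q by (simp add: nn' n3' field_simps power2_eq_square)
    also have "\<dots> = 2 * k * (1 / ?q)" by simp
    also have "1 / ?q = a + c" using a[OF eU] b3 by (simp add: F_def inner_axis)
    finally show ?thesis
      using b3 by (simp add: inner_add_left inner_add_right inner_axis inner_axis' c_def algebra_simps power2_eq_square)
  qed
  moreover have "x $ 3 = g x $ 3 * (a + b \<bullet> x + c * (x \<bullet> x))" if "x \<in> U" for x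
    using a[OF that] qpos[OF that] by (simp add: F_def q_def field_simps)
  ultimately show thesis using b3 that by blast
qed

section \<open>The universal covering in charts\<close>

text \<open>If the derivative of \<open>\<psi>\<close> is a smooth function of \<open>y\<close> and \<open>\<psi> y\<close>, each order of differentiability
  of \<open>\<psi>\<close> yields the next one.\<close>
lemma smooth_on_bootstrap:
  fixes \<psi> :: "'d::euclidean_space \<Rightarrow> 'e::euclidean_space"
  assumes V: "open V" and \<psi>: "\<And>y. y \<in> V \<Longrightarrow> (\<psi> has_derivative (\<lambda>w. \<Phi> w (y, \<psi> y))) (at y)"
    and \<Omega>: "open \<Omega>" "\<And>y. y \<in> V \<Longrightarrow> (y, \<psi> y) \<in> \<Omega>" and \<Phi>: "\<And>w. smooth_on \<Omega> (\<Phi> w)"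
  shows "smooth_on V \<psi>"
proof -
  have "Ck_on n \<psi> V" for n
  proof (induction n)
    case 0
    show ?case
      using \<psi> by (auto intro!: continuous_at_imp_continuous_on has_derivative_continuous)
  next
    case (Suc n)
    have "Ck_on n (\<lambda>y. (y, 0) + (0, \<psi> y)) V"
      by (rule Ck_on_add[OF V Ck_on_bounded_linear[OF _ V Ck_on_ident]
            Ck_on_bounded_linear[OF _ V Suc]])
         (intro bounded_linear_Pair bounded_linear_ident bounded_linear_zero)+
    then have "Ck_on n (\<lambda>y. (y, \<psi> y)) V" by simp
    then have "Ck_on n (\<lambda>y. \<Phi> w (y, \<psi> y)) V" for w
      using \<Phi>[of w] \<Omega>
      by (intro Ck_on_compose[OF V, where V=\<Omega> and f="\<Phi> w"]) (auto simp: smooth_on_def)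
    then have "Ck_on n (\<lambda>y. fd \<psi> y w) V" for w
      by (rule Ck_on_cong[OF V, rotated]) (simp add: fd_eqI[OF \<psi>])
    then show ?case using \<psi> by (auto simp: differentiable_def)
  qed
  then show ?thesis by (simp add: smooth_on_def)
qed

lemma smooth_map_cong:
  assumes "smooth_map X A S F" "\<And>s. s \<in> S \<Longrightarrow> F s = G s"
  shows "smooth_map X A S G"
proof -
  have "smooth_at S x (coord \<kappa> \<circ> G)" if "x \<in> S" "\<kappa> \<in> charts_at A (G x)" for x \<kappa>
  proof (rule smooth_at_cong[of S x "coord \<kappa> \<circ> F" UNIV])
    show "smooth_at S x (coord \<kappa> \<circ> F)"
      using assms(1) assms(2)[OF that(1)] that unfolding smooth_map_def by simp
  qed (use assms(2) in auto)
  moreover have "continuous_on S G"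
    using assms continuous_on_cong[of S S F G] unfolding smooth_map_def by simp
  ultimately show ?thesis using assms unfolding smooth_map_def by auto
qed

locale hyperbolic_covering =
  fixes X :: "'a::t2_space set" and A :: "'a chart set" and h :: "'a metric"
    and p :: "real^3 \<Rightarrow> 'a"
  assumes atlas: "smooth_atlas X A" and metric: "riemannian_metric A h"
    and cover: "hyperbolic_universal_cover X A h p"
begin

abbreviation U :: "(real^3) set" where "U \<equiv> upper_half_space"

definition P :: "'a chart \<Rightarrow> real^3 \<Rightarrow> real^3" where "P \<kappa> = coord \<kappa> \<circ> p"

definition Dom :: "'a chart \<Rightarrow> (real^3) set" where "Dom \<kappa> = {x\<in>U. p x \<in> dom_chart \<kappa>}"

abbreviation G :: "'a chart \<Rightarrow> real^3 \<Rightarrow> real^3 \<Rightarrow> real^3 \<Rightarrow> real" where "G \<equiv> metric_in A h"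

lemma covering: "covering_space U p X"
  using cover unfolding hyperbolic_universal_cover_def by blast

lemma p_smooth: "smooth_map X A U p"
  using cover unfolding hyperbolic_universal_cover_def by blast

lemma p_isometry: "x \<in> U \<Longrightarrow> h (p x) (differential A p x u) (differential A p x v) = (u \<bullet> v) / (x$3)\<^sup>2"
  using cover unfolding hyperbolic_universal_cover_def by blast

lemma p_in: "x \<in> U \<Longrightarrow> p x \<in> X"
  using covering_space_imp_surjective[OF covering] by blast

lemma p_continuous: "continuous_on U p"
  using covering_space_imp_continuous[OF covering] .

lemma charts_at_iff: "\<kappa> \<in> charts_at A q \<longleftrightarrow> \<kappa> \<in> A \<and> q \<in> dom_chart \<kappa>"
  by (auto simp: charts_at_def)

lemma chart_exists: "q \<in> X \<Longrightarrow> \<exists>\<kappa>. \<kappa> \<in> charts_at A q"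
  using atlas unfolding smooth_atlas_def charts_at_def by blast

lemma chart_props:
  assumes "\<kappa> \<in> A"
  shows "openin (top_of_set X) (dom_chart \<kappa>)" "open (cod_chart \<kappa>)"
    "homeomorphism (dom_chart \<kappa>) (cod_chart \<kappa>) (coord \<kappa>) (inv_coord \<kappa>)"
  using atlas assms unfolding smooth_atlas_def by auto

lemma inv_coord_coord: "\<kappa> \<in> A \<Longrightarrow> q \<in> dom_chart \<kappa> \<Longrightarrow> inv_coord \<kappa> (coord \<kappa> q) = q"
  using chart_props(3) homeomorphism_apply1 by metis

lemma charts_at_Dom: "x \<in> U \<Longrightarrow> \<kappa> \<in> charts_at A (p x) \<longleftrightarrow> \<kappa> \<in> A \<and> x \<in> Dom \<kappa>"
  by (auto simp: charts_at_iff Dom_def)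

lemma Dom_subset: "Dom \<kappa> \<subseteq> U" by (auto simp: Dom_def)

lemma DomD: "x \<in> Dom \<kappa> \<Longrightarrow> x \<in> U" by (simp add: Dom_def)

lemma charts_at_DomI: "\<kappa> \<in> A \<Longrightarrow> x \<in> Dom \<kappa> \<Longrightarrow> \<kappa> \<in> charts_at A (p x)"
  by (simp add: charts_at_iff Dom_def)

lemma charts_at_DomD: "\<kappa> \<in> charts_at A (p x) \<Longrightarrow> x \<in> U \<Longrightarrow> \<kappa> \<in> A \<and> x \<in> Dom \<kappa>"
  by (simp add: charts_at_iff Dom_def)

lemma Dom_exists: "x \<in> U \<Longrightarrow> \<exists>\<kappa>\<in>A. x \<in> Dom \<kappa>"
  using chart_exists[OF p_in] charts_at_Dom by blast

lemma open_Dom: "\<kappa> \<in> A \<Longrightarrow> open (Dom \<kappa>)"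
proof -
  assume "\<kappa> \<in> A"
  then have "openin (top_of_set U) (U \<inter> p -` dom_chart \<kappa>)"
    using continuous_openin_preimage[OF p_continuous _ chart_props(1)] p_in by auto
  then have "open (U \<inter> p -` dom_chart \<kappa>)" using open_upper_half_space openin_open_trans by blast
  moreover have "U \<inter> p -` dom_chart \<kappa> = Dom \<kappa>" by (auto simp: Dom_def)
  ultimately show ?thesis by simp
qed

lemma P_in_cod: "x \<in> Dom \<kappa> \<Longrightarrow> P \<kappa> x \<in> cod_chart \<kappa>" by (auto simp: Dom_def P_def)

lemma inv_coord_P: "\<kappa> \<in> A \<Longrightarrow> x \<in> Dom \<kappa> \<Longrightarrow> inv_coord \<kappa> (P \<kappa> x) = p x"
  by (simp add: P_def Dom_def inv_coord_coord)

lemma smooth_P: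
  assumes "\<kappa> \<in> A"
  shows "smooth_on (Dom \<kappa>) (P \<kappa>)"
proof -
  have "smooth_in (Dom \<kappa>) (P \<kappa>)"
    using p_smooth assms Dom_subset[of \<kappa>] charts_at_Dom unfolding smooth_in_def smooth_map_def P_def
    by (meson smooth_at_subset subsetD)
  then show ?thesis using smooth_in_open[OF open_Dom[OF assms]] by blast
qed

lemmas P_has_derivative = smooth_on_has_derivative[OF smooth_P]

lemma P_linear: "\<kappa> \<in> A \<Longrightarrow> x \<in> Dom \<kappa> \<Longrightarrow> linear (fd (P \<kappa>) x)"
  using P_has_derivative has_derivative_linear by blast

lemma P_transition:
  assumes "\<kappa> \<in> A" "\<kappa>' \<in> A" "x \<in> Dom \<kappa>" "x \<in> Dom \<kappa>'"
  shows "fd (P \<kappa>') x u = fd (transition \<kappa> \<kappa>') (P \<kappa> x) (fd (P \<kappa>) x u)"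
proof -
  let ?D = "coord \<kappa> ` (dom_chart \<kappa> \<inter> dom_chart \<kappa>')"
  have "smooth_on ?D (transition \<kappa> \<kappa>')" using atlas assms unfolding smooth_atlas_def by blast
  moreover have "P \<kappa> x \<in> ?D" using assms by (auto simp: P_def Dom_def)
  ultimately have 1: "(transition \<kappa> \<kappa>' has_derivative fd (transition \<kappa> \<kappa>') (P \<kappa> x)) (at (P \<kappa> x))"
    by (rule smooth_on_has_derivative)
  have 2: "((\<lambda>y. transition \<kappa> \<kappa>' (P \<kappa> y)) has_derivative
      (\<lambda>u. fd (transition \<kappa> \<kappa>') (P \<kappa> x) (fd (P \<kappa>) x u))) (at x)"
    by (rule has_derivative_compose[OF P_has_derivative[OF assms(1,3)] 1])
  have "(P \<kappa>' has_derivative (\<lambda>u. fd (transition \<kappa> \<kappa>') (P \<kappa> x) (fd (P \<kappa>) x u))) (at x)"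
    by (rule has_derivative_transform_within_open[OF 2 open_Dom[OF assms(1)] assms(3)])
       (use inv_coord_P[OF assms(1)] in \<open>auto simp: transition_def P_def\<close>)
  then show ?thesis by (simp add: fd_eqI)
qed

lemma differential_apply: "\<kappa> \<in> charts_at A (p x) \<Longrightarrow> differential A p x u \<kappa> = fd (P \<kappa>) x u"
  by (simp add: differential_def P_def)

lemma differential_tangent_of:
  assumes "x \<in> U" "\<kappa> \<in> charts_at A (p x)"
  shows "differential A p x u = tangent_of A \<kappa> (p x) (fd (P \<kappa>) x u)"
proof (rule ext)
  fix \<kappa>'
  show "differential A p x u \<kappa>' = tangent_of A \<kappa> (p x) (fd (P \<kappa>) x u) \<kappa>'"
  proof (cases "\<kappa>' \<in> charts_at A (p x)")
    case True
    then show ?thesis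
      using assms(2) P_transition[of \<kappa> \<kappa>' x u] charts_at_Dom[OF assms(1)]
      by (simp add: differential_apply tangent_of_def P_def)
  next
    case False
    then show ?thesis by (simp only: differential_def tangent_of_def if_False)
  qed
qed

lemma differential_in_tangent_space: "x \<in> U \<Longrightarrow> differential A p x u \<in> tangent_space A (p x)"
  unfolding tangent_space_def mem_Collect_eq
proof (intro conjI allI ballI impI)
  fix \<kappa> assume "\<kappa> \<notin> charts_at A (p x)"
  then show "differential A p x u \<kappa> = 0" by (simp only: differential_def if_False)
next
  fix \<kappa> \<kappa>' assume "x \<in> U" "\<kappa> \<in> charts_at A (p x)" "\<kappa>' \<in> charts_at A (p x)"
  then show "differential A p x u \<kappa>' =
      fd (transition \<kappa> \<kappa>') (coord \<kappa> (p x)) (differential A p x u \<kappa>)"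
    using P_transition[of \<kappa> \<kappa>' x u] charts_at_Dom
    by (simp add: differential_apply P_def)
qed

lemma tangent_of_of_tangent:
  assumes "v \<in> tangent_space A q" "\<kappa> \<in> charts_at A q"
  shows "tangent_of A \<kappa> q (v \<kappa>) = v"
proof (rule ext)
  fix \<kappa>' show "tangent_of A \<kappa> q (v \<kappa>) \<kappa>' = v \<kappa>'"
  proof (cases "\<kappa>' \<in> charts_at A q")
    case True
    then have "v \<kappa>' = fd (transition \<kappa> \<kappa>') (coord \<kappa> q) (v \<kappa>)"
      using assms unfolding tangent_space_def by blast
    then show ?thesis using True by (simp only: tangent_of_def if_True)
  next
    case False
    then have "v \<kappa>' = 0" using assms(1) unfolding tangent_space_def by blast
    then show ?thesis using False by (simp only: tangent_of_def if_False)
  qed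
qed

lemma h_tangent_of:
  assumes "\<kappa> \<in> charts_at A q"
  shows "h q (tangent_of A \<kappa> q u) (tangent_of A \<kappa> q v) = G \<kappa> (coord \<kappa> q) u v"
  using assms inv_coord_coord by (simp add: metric_in_def charts_at_iff)

lemma G_P:
  assumes "\<kappa> \<in> A" "x \<in> Dom \<kappa>"
  shows "G \<kappa> (P \<kappa> x) (fd (P \<kappa>) x u) (fd (P \<kappa>) x v) = (u \<bullet> v) / (x$3)\<^sup>2"
proof -
  have x: "x \<in> U" "\<kappa> \<in> charts_at A (p x)" using assms DomD charts_at_DomI by blast+
  show ?thesis
    using h_tangent_of[OF x(2)] p_isometry[OF x(1)] differential_tangent_of[OF x] by (simp add: P_def)
qed

lemma G_bilinear: "\<kappa> \<in> A \<Longrightarrow> y \<in> cod_chart \<kappa> \<Longrightarrow> bilinear (G \<kappa> y)"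
  using metric unfolding riemannian_metric_def by blast

lemma G_sym: "\<kappa> \<in> A \<Longrightarrow> y \<in> cod_chart \<kappa> \<Longrightarrow> G \<kappa> y u v = G \<kappa> y v u"
  using metric unfolding riemannian_metric_def by blast

lemma G_smooth: "\<kappa> \<in> A \<Longrightarrow> smooth_on (cod_chart \<kappa>) (\<lambda>y. G \<kappa> y u v)"
  using metric unfolding riemannian_metric_def by blast

lemma G_expand_right:
  assumes "\<kappa> \<in> A" "y \<in> cod_chart \<kappa>"
  shows "G \<kappa> y u v = v$1 * G \<kappa> y u (axis 1 1) + v$2 * G \<kappa> y u (axis 2 1) + v$3 * G \<kappa> y u (axis 3 1)"
  using linear_real3[of "G \<kappa> y u" v] G_bilinear[OF assms] by (simp add: bilinear_def)

lemma G_expand_left: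
  assumes "\<kappa> \<in> A" "y \<in> cod_chart \<kappa>"
  shows "G \<kappa> y u v = u$1 * G \<kappa> y (axis 1 1) v + u$2 * G \<kappa> y (axis 2 1) v + u$3 * G \<kappa> y (axis 3 1) v"
  using G_expand_right[OF assms, of v u] by (simp add: G_sym[OF assms, of _ v])

lemma P_inj:
  assumes "\<kappa> \<in> A" "x \<in> Dom \<kappa>" "fd (P \<kappa>) x u = fd (P \<kappa>) x v"
  shows "u = v"
proof -
  have l: "linear (fd (P \<kappa>) x)" by (rule P_linear[OF assms(1,2)])
  have "fd (P \<kappa>) x (u - v) = 0" using assms(3) by (simp add: linear_diff[OF l])
  then have "((u - v) \<bullet> (u - v)) / (x$3)\<^sup>2 = G \<kappa> (P \<kappa> x) 0 0"
    using G_P[OF assms(1,2), of "u - v" "u - v"] by simp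
  also have "\<dots> = 0" using bilinear_lzero[OF G_bilinear[OF assms(1) P_in_cod[OF assms(2)]]] .
  finally show ?thesis using assms(2) by (auto simp: Dom_def upper_half_space_def)
qed

lemma P_surj:
  assumes "\<kappa> \<in> A" "x \<in> Dom \<kappa>"
  shows "\<exists>u. fd (P \<kappa>) x u = w"
proof -
  have "inj (fd (P \<kappa>) x)" using P_inj[OF assms] by (auto simp: inj_def)
  then have "surj (fd (P \<kappa>) x)" using linear_injective_imp_surjective[OF P_linear[OF assms]] by simp
  then show ?thesis by (metis surjD)
qed

lemma differential_surj:
  assumes "x \<in> U" "v \<in> tangent_space A (p x)"
  shows "\<exists>u. v = differential A p x u"
proof -
  obtain \<kappa> where \<kappa>: "\<kappa> \<in> A" "x \<in> Dom \<kappa>" using Dom_exists[OF assms(1)] by blast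
  then have c: "\<kappa> \<in> charts_at A (p x)" using charts_at_Dom assms(1) by blast
  obtain u where "fd (P \<kappa>) x u = v \<kappa>" using P_surj[OF \<kappa>] by metis
  then have "differential A p x u = v"
    using differential_tangent_of[OF assms(1) c] tangent_of_of_tangent[OF assms(2) c] by simp
  then show ?thesis by metis
qed

lemma differential_inj:
  assumes "x \<in> U" "differential A p x u = differential A p x v"
  shows "u = v"
proof -
  obtain \<kappa> where \<kappa>: "\<kappa> \<in> A" "x \<in> Dom \<kappa>" using Dom_exists[OF assms(1)] by blast
  then have "\<kappa> \<in> charts_at A (p x)" using charts_at_Dom assms(1) by blast
  then show ?thesis using P_inj[OF \<kappa>] assms(2) differential_apply by metis
qed

lemma differential_linear: "x \<in> U \<Longrightarrow> linear (\<lambda>u. differential A p x u \<kappa>)"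
proof (cases "\<kappa> \<in> charts_at A (p x)")
  case True
  assume "x \<in> U"
  then show ?thesis using True P_linear charts_at_Dom by (simp add: differential_apply)
next
  case False
  then show ?thesis by (simp add: differential_def linear_iff)
qed

text \<open>The derivative of a local inverse \<open>\<psi>\<close> of \<open>p\<close> in a chart is the adjoint of \<open>dp\<close> with respect
  to the two metrics: \<open>d\<psi>(y) w \<bullet> e\<^sub>i = (\<psi>\<^sub>3 y)\<^sup>2 h(w, dp(\<psi> y) e\<^sub>i)\<close>.  As the right-hand side is a smooth
  function of \<open>y\<close> and \<open>\<psi> y\<close>, continuity of \<open>\<psi>\<close> is enough to conclude that it is smooth.\<close>
lemma local_inverse:
  assumes "\<kappa> \<in> A" "x \<in> Dom \<kappa>"
  obtains W V \<psi> where "open W" "open V" "x \<in> W" "W \<subseteq> Dom \<kappa>" "V \<subseteq> cod_chart \<kappa>"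
    "homeomorphism W V (P \<kappa>) \<psi>" "smooth_on V \<psi>"
proof -
  have "x \<in> U" using assms(2) by (rule DomD)
  obtain T u q where T: "x \<in> T" "openin (top_of_set U) T" "openin (top_of_set X) u"
      "homeomorphism T u p q"
    using covering_space_local_homeomorphism[OF covering \<open>x \<in> U\<close>] by metis
  define W where "W = T \<inter> Dom \<kappa>"
  define V where "V = coord \<kappa> ` (u \<inter> dom_chart \<kappa>)"
  define \<psi> where "\<psi> = q \<circ> inv_coord \<kappa>"
  have "open T" using T(2) open_upper_half_space openin_open_trans by blast
  then have W: "open W" "x \<in> W" "W \<subseteq> Dom \<kappa>" using T(1) assms open_Dom[OF assms(1)] by (auto simp: W_def)
  have dX: "dom_chart \<kappa> \<subseteq> X" using chart_props(1)[OF assms(1)] openin_imp_subset by blast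
  have "openin (top_of_set (dom_chart \<kappa>)) (u \<inter> dom_chart \<kappa>)"
  proof -
    obtain N where "open N" "u = X \<inter> N" using T(3) unfolding openin_open by blast
    moreover from this have "u \<inter> dom_chart \<kappa> = dom_chart \<kappa> \<inter> N" using dX by blast
    ultimately show ?thesis unfolding openin_open by blast
  qed
  then have "openin (top_of_set (cod_chart \<kappa>)) V"
    unfolding V_def using homeomorphism_imp_open_map[OF chart_props(3)[OF assms(1)]] by blast
  then have V: "open V" "V \<subseteq> cod_chart \<kappa>"
    using chart_props(2)[OF assms(1)] openin_open_trans openin_imp_subset by blast+
  have TU: "T \<subseteq> U" using T(2) openin_imp_subset by blast
  have pW: "p w \<in> u \<inter> dom_chart \<kappa>" if "w \<in> W" for w
    using that homeomorphism_image1[OF T(4)] by (auto simp: W_def Dom_def)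
  have qW: "q y \<in> W" "p (q y) = y" if "y \<in> u \<inter> dom_chart \<kappa>" for y
    using that homeomorphism_image2[OF T(4)] homeomorphism_apply2[OF T(4)] TU
    by (auto simp: W_def Dom_def)
  have hom: "homeomorphism W V (P \<kappa>) \<psi>"
  proof (rule homeomorphismI)
    show "continuous_on W (P \<kappa>)"
      using smooth_on_continuous[OF smooth_P[OF assms(1)]] W(3) continuous_on_subset by blast
    have "continuous_on V (inv_coord \<kappa>)"
      using homeomorphism_cont2[OF chart_props(3)[OF assms(1)]] V(2) continuous_on_subset by blast
    moreover have "inv_coord \<kappa> ` V \<subseteq> u"
      using inv_coord_coord[OF assms(1)] by (auto simp: V_def)
    ultimately show "continuous_on V \<psi>" unfolding \<psi>_def
      using homeomorphism_cont2[OF T(4)] continuous_on_compose continuous_on_subset by blast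
    show "P \<kappa> ` W \<subseteq> V" using pW by (auto simp: V_def P_def)
    show "\<psi> ` V \<subseteq> W" using qW inv_coord_coord[OF assms(1)] by (auto simp: V_def \<psi>_def)
    show "\<psi> (P \<kappa> w) = w" if "w \<in> W" for w
      using that inv_coord_P[OF assms(1)] W(3) homeomorphism_apply1[OF T(4)] by (auto simp: \<psi>_def W_def)
    show "P \<kappa> (\<psi> y) = y" if "y \<in> V" for y
      using that qW inv_coord_coord[OF assms(1)] by (auto simp: V_def \<psi>_def P_def)
  qed
  define \<Phi> where "\<Phi> w yx = (\<chi> i. (snd yx $ 3)\<^sup>2 * G \<kappa> (fst yx) w (fd (P \<kappa>) (snd yx) (axis i 1)))"
    for w and yx :: "(real^3) \<times> (real^3)"
  have \<Phi>: "smooth_on (cod_chart \<kappa> \<times> Dom \<kappa>) (\<Phi> w)" for w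
  proof (rule smooth_on_vec)
    show op: "open (cod_chart \<kappa> \<times> Dom \<kappa>)" using chart_props(2) open_Dom assms(1) open_Times by blast
    have sf: "smooth_on (cod_chart \<kappa> \<times> Dom \<kappa>) fst" "smooth_on (cod_chart \<kappa> \<times> Dom \<kappa>) snd"
      using smooth_on_fst[OF op smooth_on_ident] smooth_on_snd[OF op smooth_on_ident] by simp_all
    have 1: "smooth_on (cod_chart \<kappa> \<times> Dom \<kappa>) (\<lambda>yx. fd (P \<kappa>) (snd yx) e $ j)" for e j
      by (rule smooth_on_vec_nth[OF op smooth_on_compose[OF smooth_on_fd[OF smooth_P[OF assms(1)]]
              sf(2) op open_Dom[OF assms(1)]]]) auto
    have 2: "smooth_on (cod_chart \<kappa> \<times> Dom \<kappa>) (\<lambda>yx. G \<kappa> (fst yx) w e)" for e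
      by (rule smooth_on_compose[OF G_smooth[OF assms(1)] sf(1) op chart_props(2)[OF assms(1)]]) auto
    have 3: "smooth_on (cod_chart \<kappa> \<times> Dom \<kappa>) (\<lambda>yx. (snd yx $ 3)\<^sup>2)"
      by (rule smooth_on_power[OF op smooth_on_vec_nth[OF op sf(2)]])
    fix i
    have "smooth_on (cod_chart \<kappa> \<times> Dom \<kappa>) (\<lambda>yx. (snd yx $ 3)\<^sup>2 *
        (fd (P \<kappa>) (snd yx) (axis i 1) $ 1 * G \<kappa> (fst yx) w (axis 1 1) +
         fd (P \<kappa>) (snd yx) (axis i 1) $ 2 * G \<kappa> (fst yx) w (axis 2 1) +
         fd (P \<kappa>) (snd yx) (axis i 1) $ 3 * G \<kappa> (fst yx) w (axis 3 1)))"
      by (intro smooth_on_mult smooth_on_add op 1 2 3)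
    then show "smooth_on (cod_chart \<kappa> \<times> Dom \<kappa>) (\<lambda>yx. \<Phi> w yx $ i)"
      by (rule smooth_on_cong[OF op, rotated])
         (simp add: \<Phi>_def G_expand_right[OF assms(1), of _ w "fd (P \<kappa>) _ _"] mem_Times_iff)
  qed
  have "smooth_on V \<psi>"
  proof (rule smooth_on_bootstrap[OF V(1) _ _ _ \<Phi>])
    fix y assume y: "y \<in> V"
    then have w: "\<psi> y \<in> W" "P \<kappa> (\<psi> y) = y"
      using homeomorphism_image2[OF hom] homeomorphism_apply2[OF hom] by auto
    then have wO: "\<psi> y \<in> Dom \<kappa>" using W by auto
    have wpos: "\<psi> y $ 3 > 0" using wO by (auto simp: Dom_def upper_half_space_def)
    have yc: "y \<in> cod_chart \<kappa>" using y V by auto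
    have lin: "linear (\<lambda>w. \<Phi> w (y, \<psi> y))"
      using G_bilinear[OF assms(1) yc] unfolding bilinear_def \<Phi>_def
      by (auto simp: linear_iff vec_eq_iff algebra_simps)
    have inv: "\<Phi> (fd (P \<kappa>) (\<psi> y) u) (y, \<psi> y) = u" for u
      using G_P[OF assms(1) wO, of u] wpos by (simp add: \<Phi>_def vec_eq_iff w(2) inner_axis)
    have "(\<psi> has_derivative (\<lambda>w. \<Phi> w (y, \<psi> y))) (at (P \<kappa> (\<psi> y)))"
    proof (rule has_derivative_inverse_basic_x[OF P_has_derivative[OF assms(1) wO]])
      show "bounded_linear (\<lambda>w. \<Phi> w (y, \<psi> y))" using lin linear_conv_bounded_linear by blast
      show "(\<lambda>w. \<Phi> w (y, \<psi> y)) \<circ> fd (P \<kappa>) (\<psi> y) = id" using inv by auto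
      show "continuous (at (P \<kappa> (\<psi> y))) \<psi>"
        using homeomorphism_cont2[OF hom] V(1) y w(2) by (simp add: continuous_on_eq_continuous_at)
      show "\<psi> (P \<kappa> (\<psi> y)) = \<psi> y" by (simp add: w(2))
      show "open V" "P \<kappa> (\<psi> y) \<in> V" using V y w(2) by auto
      show "\<And>y. y \<in> V \<Longrightarrow> P \<kappa> (\<psi> y) = y" using homeomorphism_apply2[OF hom] .
    qed
    then show "(\<psi> has_derivative (\<lambda>w. \<Phi> w (y, \<psi> y))) (at y)" by (simp add: w(2))
    show "(y, \<psi> y) \<in> cod_chart \<kappa> \<times> Dom \<kappa>" using yc wO by simp
  qed (use chart_props(2) open_Dom assms(1) open_Times in blast)
  then show thesis using that W V hom by blast
qed

subsection \<open>Lifts\<close>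

text \<open>Locally, a continuous lift is the composition of the given map with a smooth inverse of \<open>p\<close>.\<close>
lemma lift_smooth:
  fixes f :: "'d::euclidean_space \<Rightarrow> real^3"
  assumes f: "continuous_on S f" "f ` S \<subseteq> U" and F: "smooth_map X A S F"
    and pf: "\<And>s. s \<in> S \<Longrightarrow> p (f s) = F s"
  shows "smooth_in S f"
  unfolding smooth_in_def
proof
  fix s assume s: "s \<in> S"
  then have "f s \<in> U" using f by auto
  then obtain \<kappa> where \<kappa>: "\<kappa> \<in> A" "f s \<in> Dom \<kappa>" using Dom_exists by blast
  obtain W V \<psi> where W: "open W" "open V" "f s \<in> W" "W \<subseteq> Dom \<kappa>"
      "homeomorphism W V (P \<kappa>) \<psi>" "smooth_on V \<psi>"
    using local_inverse[OF \<kappa>] by metis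
  obtain N where N: "open N" "S \<inter> f -` W = S \<inter> N"
    using continuous_on_open_invariant f(1) W(1) unfolding continuous_on_open_invariant
    by (metis inf_commute)
  have "\<kappa> \<in> charts_at A (F s)" using \<kappa> charts_at_Dom[OF \<open>f s \<in> U\<close>] pf[OF s] by simp
  then have "smooth_at S s (coord \<kappa> \<circ> F)" using F s unfolding smooth_map_def by blast
  moreover have "(coord \<kappa> \<circ> F) s \<in> V"
  proof -
    have "P \<kappa> (f s) \<in> V" using W(3) homeomorphism_image1[OF W(5)] by blast
    then show ?thesis using pf[OF s] by (simp add: P_def)
  qed
  ultimately have "smooth_at S s (\<lambda>s. \<psi> ((coord \<kappa> \<circ> F) s))"
    using smooth_at_compose_on[OF W(6,2)] s by blast
  then show "smooth_at S s f"
  proof (rule smooth_at_cong[OF _ N(1)])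
    show "s \<in> N" using N s W(3) by blast
    fix y assume "y \<in> S \<inter> N"
    then have "f y \<in> W" "p (f y) = F y" using N pf by auto
    then show "\<psi> ((coord \<kappa> \<circ> F) y) = f y"
      using homeomorphism_apply1[OF W(5), of "f y"] by (simp add: P_def)
  qed
qed

lemma projection_smooth:
  fixes f :: "'d::euclidean_space \<Rightarrow> real^3"
  assumes "smooth_in S f" "f ` S \<subseteq> U"
  shows "smooth_map X A S (\<lambda>s. p (f s))"
  unfolding smooth_map_def
proof (intro conjI ballI)
  show "(\<lambda>s. p (f s)) ` S \<subseteq> X" using assms p_in by auto
  show "continuous_on S (\<lambda>s. p (f s))"
    using continuous_on_compose2[OF p_continuous smooth_in_continuous[OF assms(1)]] assms(2) by auto
  fix s \<kappa> assume s: "s \<in> S" "\<kappa> \<in> charts_at A (p (f s))"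
  then have \<kappa>: "\<kappa> \<in> A" "f s \<in> Dom \<kappa>" using charts_at_DomD assms(2) by blast+
  have "smooth_at S s f" using assms(1) s(1) by (simp add: smooth_in_def)
  then have "smooth_at S s (\<lambda>s. P \<kappa> (f s))"
    by (rule smooth_at_compose_on[where f=f, OF smooth_P[OF \<kappa>(1)] open_Dom[OF \<kappa>(1)] _ s(1) \<kappa>(2)])
  then show "smooth_at S s (coord \<kappa> \<circ> (\<lambda>s. p (f s)))" by (simp add: P_def o_def)
qed

lemma lift_exists:
  fixes F :: "'d::euclidean_space \<Rightarrow> 'a"
  assumes "smooth_map X A S F" "convex S" "s0 \<in> S" "a \<in> U" "p a = F s0"
  obtains f where "smooth_in S f" "f ` S \<subseteq> U" "f s0 = a" "\<And>s. s \<in> S \<Longrightarrow> p (f s) = F s"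
proof -
  have "continuous_on S F" "F ` S \<subseteq> X" using assms(1) by (auto simp: smooth_map_def)
  then obtain f where f: "is_lift p U F s0 a S f"
    using covering_space_lift_convex[where f=F, OF covering assms(2-5)] by blast
  then show thesis
    using lift_smooth[OF _ _ assms(1)] that unfolding is_lift_def by blast
qed

lemma velocity_projection:
  assumes f: "(f has_vector_derivative f') (at t within S)" "f ` S \<subseteq> U" "t \<in> S"
    and F: "\<And>s. s \<in> S \<Longrightarrow> F s = p (f s)" and t: "at t within S \<noteq> bot"
  shows "velocity A F S t = differential A p (f t) f'"
proof (rule ext)
  fix \<kappa>
  show "velocity A F S t \<kappa> = differential A p (f t) f' \<kappa>"
  proof (cases "\<kappa> \<in> charts_at A (p (f t))")
    case True
    have "\<kappa> \<in> A" "f t \<in> Dom \<kappa>" using True charts_at_DomD f(2,3) by blast+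
    then have "((\<lambda>s. P \<kappa> (f s)) has_vector_derivative fd (P \<kappa>) (f t) f') (at t within S)"
      using has_derivative_compose[OF f(1)[unfolded has_vector_derivative_def] P_has_derivative]
        linear_scale[OF P_linear] by (simp add: has_vector_derivative_def)
    then have "((coord \<kappa> \<circ> F) has_vector_derivative fd (P \<kappa>) (f t) f') (at t within S)"
      by (rule has_vector_derivative_transform[OF f(3), rotated]) (simp add: F P_def)
    then show ?thesis
      using vector_derivative_within[OF t] True F[OF f(3)]
      by (simp add: velocity_def differential_def P_def)
  next
    case False
    then show ?thesis using F[OF f(3)] by (simp add: velocity_def differential_def)
  qed
qed

subsection \<open>Deck transformations\<close>

definition deck :: "(real^3 \<Rightarrow> real^3) \<Rightarrow> (real^3 \<Rightarrow> real^3) \<Rightarrow> bool" where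
  "deck g g' \<longleftrightarrow> homeomorphism U U g g' \<and> (\<forall>x\<in>U. p (g x) = p x)"

lemma deck_transformation: "deck g g' \<Longrightarrow> deck_transformation p g"
  by (auto simp: deck_def deck_transformation_def)

lemma deck_inverse: "deck g g' \<Longrightarrow> deck g' g"
  unfolding deck_def by (metis homeomorphism_apply2 homeomorphism_image2 homeomorphism_symD imageI)

lemma deck_in: "deck g g' \<Longrightarrow> x \<in> U \<Longrightarrow> g x \<in> U"
  unfolding deck_def using homeomorphism_image1 by blast

lemma deck_p: "deck g g' \<Longrightarrow> x \<in> U \<Longrightarrow> p (g x) = p x"
  unfolding deck_def by blast

lemma deck_inv_apply: "deck g g' \<Longrightarrow> x \<in> U \<Longrightarrow> g' (g x) = x"
  unfolding deck_def using homeomorphism_apply1 by blast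

text \<open>Since the half space is simply connected, \<open>p\<close> lifts through itself; the lifts that send \<open>x\<close> to \<open>y\<close>
  and \<open>y\<close> to \<open>x\<close> are inverse to each other by the uniqueness of lifts.\<close>
lemma deck_exists:
  assumes "x \<in> U" "y \<in> U" "p x = p y"
  obtains g g' where "deck g g'" "g x = y"
proof -
  note c = convex_upper_half_space
  have pU: "p ` U \<subseteq> X" using p_in by auto
  obtain g where g: "is_lift p U p x y U g"
    using covering_space_lift_convex[OF covering c assms(1,2) assms(3)[symmetric] p_continuous pU] .
  obtain g' where g': "is_lift p U p y x U g'"
    using covering_space_lift_convex[OF covering c assms(2,1) assms(3) p_continuous pU] .
  have id: "is_lift p U p z z U (\<lambda>x. x)" for z by (auto simp: is_lift_def)
  have comp: "is_lift p U p x x U (\<lambda>z. g' (g z))" "is_lift p U p y y U (\<lambda>z. g (g' z))"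
    using g g' unfolding is_lift_def by (auto intro: continuous_on_compose2 simp: image_subset_iff)
  have con: "connected U" using c convex_connected by blast
  have inv: "g' (g z) = z" "g (g' z) = z" if "z \<in> U" for z
    using is_lift_unique[OF covering comp(1) id con assms(1) _ _ p_continuous pU that]
      is_lift_unique[OF covering comp(2) id con assms(2) _ _ p_continuous pU that] by auto
  have "deck g g'" unfolding deck_def
    using g g' inv by (auto intro!: homeomorphismI simp: is_lift_def)
  then show thesis using that g unfolding is_lift_def by blast
qed

lemma deck_smooth:
  assumes "deck g g'"
  shows "smooth_on U g"
proof -
  have "continuous_on U g" "g ` U \<subseteq> U"
    using assms unfolding deck_def homeomorphism_def by auto
  then have "smooth_in U g"
    by (rule lift_smooth[OF _ _ p_smooth]) (use assms in \<open>auto simp: deck_def\<close>)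
  then show ?thesis using smooth_in_open[OF open_upper_half_space] by blast
qed

lemma deck_differential:
  assumes "deck g g'" "x \<in> U"
  shows "differential A p (g x) (fd g x u) = differential A p x u"
proof (rule ext)
  fix \<kappa>
  show "differential A p (g x) (fd g x u) \<kappa> = differential A p x u \<kappa>"
  proof (cases "\<kappa> \<in> charts_at A (p x)")
    case True
    then have \<kappa>: "\<kappa> \<in> A" "g x \<in> Dom \<kappa>" "x \<in> Dom \<kappa>"
      using charts_at_Dom assms deck_in[OF assms] deck_p[OF assms] by (metis)+
    have "((\<lambda>x. P \<kappa> (g x)) has_derivative (\<lambda>u. fd (P \<kappa>) (g x) (fd g x u))) (at x)"
      using has_derivative_compose[OF smooth_on_has_derivative[OF deck_smooth[OF assms(1)] assms(2)]
          P_has_derivative[OF \<kappa>(1,2)]] .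
    then have "(P \<kappa> has_derivative (\<lambda>u. fd (P \<kappa>) (g x) (fd g x u))) (at x)"
      by (rule has_derivative_transform_within_open[OF _ open_upper_half_space assms(2)])
         (use deck_p[OF assms(1)] in \<open>auto simp: P_def\<close>)
    then have "fd (P \<kappa>) x u = fd (P \<kappa>) (g x) (fd g x u)" by (simp add: fd_eqI)
    then show ?thesis using True deck_p[OF assms] by (simp add: differential_def P_def)
  next
    case False
    then show ?thesis using deck_p[OF assms] by (simp add: differential_def)
  qed
qed

lemma deck_height:
  assumes "deck g g'"
  obtains a b c where "b $ 3 = 0" "b \<bullet> b = 4 * a * c"
    "\<And>x. x \<in> U \<Longrightarrow> x $ 3 = g x $ 3 * (a + b \<bullet> x + c * (x \<bullet> x))"
proof (rule half_space_isometry_height[OF deck_smooth[OF assms]])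
  show "g ` U \<subseteq> U" using deck_in[OF assms] by auto
  show "(fd g x u \<bullet> fd g x u) / (g x $ 3)\<^sup>2 = (u \<bullet> u) / (x $ 3)\<^sup>2" if "x \<in> U" for x u
    using p_isometry[OF deck_in[OF assms that], of "fd g x u" "fd g x u"] p_isometry[OF that, of u u]
      deck_differential[OF assms that] deck_p[OF assms that] by simp
qed (use that in blast)

end

section \<open>The horo-torus and its lifts\<close>

text \<open>On the right half of the unit circle the imaginary part is a coordinate.\<close>
lemma unit_circle_half_inj:
  fixes w w' :: complex
  assumes "norm w = 1" "norm w' = 1" "Re w > 0" "Re w' > 0" "Im w = Im w'"
  shows "w = w'"
proof -
  have "(Re w)\<^sup>2 = (Re w')\<^sup>2"
    using assms(1,2,5) cmod_power2[of w] cmod_power2[of w'] by simp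
  then have "Re w = Re w'" using assms(3,4) by (simp add: power2_eq_iff)
  then show ?thesis using assms(5) by (simp add: complex_eq_iff)
qed

definition above :: "real \<Rightarrow> complex \<Rightarrow> real^3" where
  "above z w = Re w *\<^sub>R axis 1 1 + Im w *\<^sub>R axis 2 1 + z *\<^sub>R axis 3 1"

lemma above_nth [simp]: "above z w $ 1 = Re w" "above z w $ 2 = Im w" "above z w $ 3 = z"
  by (simp_all add: above_def axis_def)

context hyperbolic_covering
begin

lemma velocity_open_interval:
  assumes "open I" "t \<in> I"
  shows "velocity A F UNIV t = velocity A F I t"
  by (simp only: velocity_def at_within_open[OF assms(2,1)])

lemma tangent_to_lift:
  assumes "v \<in> tangent_to X A T (p x)" "x \<in> U"
  obtains \<sigma> \<delta> \<sigma>' where "\<delta> > 0" "smooth_in {-\<delta><..<\<delta>} \<sigma>" "\<sigma> ` {-\<delta><..<\<delta>} \<subseteq> U" "\<sigma> 0 = x"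
    "\<And>s. s \<in> {-\<delta><..<\<delta>} \<Longrightarrow> p (\<sigma> s) \<in> T" "(\<sigma> has_vector_derivative \<sigma>') (at 0)"
    "v = differential A p x \<sigma>'"
proof -
  obtain \<tau> \<delta> where \<tau>: "\<delta> > 0" "smooth_map X A {-\<delta><..<\<delta>} \<tau>" "\<tau> ` {-\<delta><..<\<delta>} \<subseteq> T"
      "\<tau> 0 = p x" "velocity A \<tau> UNIV 0 = v"
    using assms(1) unfolding tangent_to_def by blast
  have I: "0 \<in> {-\<delta><..<\<delta>}" "open {-\<delta><..<\<delta>}" using \<tau>(1) by auto
  obtain \<sigma> where \<sigma>: "smooth_in {-\<delta><..<\<delta>} \<sigma>" "\<sigma> ` {-\<delta><..<\<delta>} \<subseteq> U" "\<sigma> 0 = x"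
      "\<And>s. s \<in> {-\<delta><..<\<delta>} \<Longrightarrow> p (\<sigma> s) = \<tau> s"
    using lift_exists[OF \<tau>(2) convex_real_interval(8) I(1) assms(2) \<tau>(4)[symmetric]] by metis
  have "smooth_on {-\<delta><..<\<delta>} \<sigma>" using \<sigma>(1) smooth_in_open[OF I(2)] by blast
  then have d0: "(\<sigma> has_derivative fd \<sigma> 0) (at 0)" using smooth_on_has_derivative I(1) by blast
  have "fd \<sigma> 0 = (\<lambda>r. r *\<^sub>R fd \<sigma> 0 1)"
  proof
    show "fd \<sigma> 0 r = r *\<^sub>R fd \<sigma> 0 1" for r
      using linear_scale[OF has_derivative_linear[OF d0], of r 1] by simp
  qed
  then have d: "(\<sigma> has_vector_derivative fd \<sigma> 0 1) (at 0)"
    unfolding has_vector_derivative_def by (rule has_derivative_eq_rhs[OF d0])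
  have "velocity A \<tau> UNIV 0 = velocity A \<tau> {-\<delta><..<\<delta>} 0"
    using velocity_open_interval[OF I(2,1)] .
  also have "\<dots> = differential A p (\<sigma> 0) (fd \<sigma> 0 1)"
    by (rule velocity_projection[OF has_vector_derivative_at_within[OF d] \<sigma>(2) I(1)])
       (use \<sigma>(4) at_within_open[OF I] in auto)
  finally have v: "v = differential A p x (fd \<sigma> 0 1)" using \<sigma>(3) \<tau>(5) by simp
  have "p (\<sigma> s) \<in> T" if "s \<in> {-\<delta><..<\<delta>}" for s using \<sigma>(4)[OF that] \<tau>(3) that by blast
  then show thesis using that[OF \<tau>(1) \<sigma>(1,2,3) _ d v] by blast
qed

lemma tangent_toI:
  assumes "\<delta> > 0" "smooth_in {-\<delta><..<\<delta>} \<sigma>" "\<sigma> ` {-\<delta><..<\<delta>} \<subseteq> U" "\<sigma> 0 = x"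
    "\<And>s. s \<in> {-\<delta><..<\<delta>} \<Longrightarrow> p (\<sigma> s) \<in> T" "(\<sigma> has_vector_derivative u) (at 0)"
  shows "differential A p x u \<in> tangent_to X A T (p x)"
proof -
  have I: "0 \<in> {-\<delta><..<\<delta>}" "open {-\<delta><..<\<delta>}" using assms(1) by auto
  have "velocity A (\<lambda>s. p (\<sigma> s)) UNIV 0 = velocity A (\<lambda>s. p (\<sigma> s)) {-\<delta><..<\<delta>} 0"
    using velocity_open_interval[OF I(2,1)] .
  also have "\<dots> = differential A p (\<sigma> 0) u"
    by (rule velocity_projection[OF has_vector_derivative_at_within[OF assms(6)] assms(3) I(1)])
       (use at_within_open[OF I] in auto)
  finally show ?thesis
    unfolding tangent_to_def using projection_smooth[OF assms(2,3)] assms by blast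
qed

end

locale horotorus = hyperbolic_covering X A h p
  for X :: "'a::t2_space set" and A h p +
  fixes T :: "'a set" and z0 :: real
  assumes z0: "z0 > 0"
    and cusp: "\<And>C. compact C \<Longrightarrow> C \<subseteq> X \<Longrightarrow> \<exists>a>0. p ` {x. x $ 3 > a} \<inter> C = {}"
    and disjoint_lifts: "pairwise disjnt {g ` horosphere z0 | g. deck_transformation p g}"
    and T: "T = p ` horosphere z0"
    and torus: "T homeomorphic (sphere (0::complex) 1 \<times> sphere (0::complex) 1)"
begin

abbreviation H where "H \<equiv> horosphere z0"

lemma H_iff: "x \<in> H \<longleftrightarrow> x $ 3 = z0" by (simp add: horosphere_def)

lemma H_subset: "H \<subseteq> U" using z0 by (auto simp: horosphere_def upper_half_space_def)

lemma T_subset: "T \<subseteq> X" using T H_subset p_in by auto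

lemma T_compact: "compact T"
  using torus homeomorphic_compactness compact_Times compact_sphere by metis

text \<open>A deck transformation that rescales heights would, when iterated, move the lifts of the
  compact set \<open>T\<close> arbitrarily far into the cusp.\<close>
lemma no_growing_deck:
  assumes "deck g g'" "a < 1" "\<And>x. x \<in> U \<Longrightarrow> x $ 3 = a * g x $ 3"
  shows False
proof -
  let ?x = "axis 3 z0 :: real^3"
  have x: "?x \<in> H" "?x \<in> U" using z0 by (auto simp: H_iff upper_half_space_def)
  have a: "a > 0"
    using assms(3)[OF x(2)] upper_half_space_pos[OF deck_in[OF assms(1) x(2)]] z0
    by (metis axis_nth zero_less_mult_pos2)
  have it: "(g ^^ n) ?x \<in> U \<and> p ((g ^^ n) ?x) = p ?x \<and> (g ^^ n) ?x $ 3 = z0 / a ^ n" for n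
  proof (induction n)
    case (Suc n)
    then show ?case
      using deck_in[OF assms(1)] deck_p[OF assms(1)] assms(3)[of "(g ^^ n) ?x"] a
      by (auto simp: field_simps)
  qed (use x in auto)
  obtain b where b: "b > 0" "p ` {x. x $ 3 > b} \<inter> T = {}" using cusp[OF T_compact T_subset] by blast
  have "\<exists>n. a ^ n < z0 / b" using real_arch_pow_inv[of "z0 / b" a] assms(2) b(1) z0 by simp
  then obtain n where "a ^ n < z0 / b" by blast
  then have "b * a ^ n < z0" using b(1) by (simp add: field_simps)
  then have "b < z0 / a ^ n" using a by (simp add: pos_less_divide_eq)
  then have "(g ^^ n) ?x $ 3 > b" using it[of n] by simp
  moreover have "p ((g ^^ n) ?x) \<in> T" using it[of n] x T by auto
  ultimately show False using b(2) by blast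
qed

lemma no_scaling_deck:
  assumes "deck g g'" "\<And>x. x \<in> U \<Longrightarrow> x $ 3 = a * g x $ 3"
  shows "a = 1"
proof (rule ccontr)
  assume "a \<noteq> 1"
  moreover have "\<not> a < 1" using no_growing_deck assms by blast
  ultimately have a: "a > 1" by simp
  have "x $ 3 = 1 / a * g' x $ 3" if "x \<in> U" for x
    using assms(2)[OF deck_in[OF deck_inverse[OF assms(1)] that]] a
      deck_inv_apply[OF deck_inverse[OF assms(1)] that] by simp
  then show False using no_growing_deck[OF deck_inverse[OF assms(1)], of "1 / a"] a by simp
qed

text \<open>Both \<open>H\<close> and the torus \<open>T\<close> are two-dimensional manifolds, so by invariance of domain \<open>p\<close> maps
  a piece of \<open>H\<close> to an open subset of \<open>T\<close>.  No other part of the preimage of \<open>T\<close> can then come close.\<close>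
lemma preimage_T_near_H:
  assumes x: "x \<in> H"
  obtains N where "open N" "x \<in> N" "\<And>y. y \<in> N \<Longrightarrow> p y \<in> T \<Longrightarrow> y \<in> H"
proof -
  have xU: "x \<in> U" using x H_subset by auto
  obtain N0 u q where N0: "x \<in> N0" "openin (top_of_set U) N0" "homeomorphism N0 u p q"
    using covering_space_local_homeomorphism[OF covering xU] by metis
  have oN0: "open N0" using N0(2) open_upper_half_space openin_open_trans by blast
  have N0U: "N0 \<subseteq> U" using N0(2) openin_imp_subset by blast
  have p_inj: "y = y'" if "y \<in> N0" "y' \<in> N0" "p y = p y'" for y y'
    using that homeomorphism_apply1[OF N0(3)] by metis
  obtain \<tau> \<tau>' where \<tau>: "homeomorphism T (sphere (0::complex) 1 \<times> sphere (0::complex) 1) \<tau> \<tau>'"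
    using torus unfolding homeomorphic_def by blast
  have c\<tau>: "continuous_on T \<tau>" using \<tau> homeomorphism_cont1 by blast
  have \<tau>S: "norm (fst (\<tau> t)) = 1" "norm (snd (\<tau> t)) = 1" if "t \<in> T" for t
  proof -
    have "\<tau> t \<in> sphere 0 1 \<times> sphere 0 1" using homeomorphism_image1[OF \<tau>] that by blast
    then show "norm (fst (\<tau> t)) = 1" "norm (snd (\<tau> t)) = 1" by (simp_all add: mem_Times_iff)
  qed
  have px: "p x \<in> T" using x T by blast
  define a1 where "a1 = fst (\<tau> (p x))"
  define a2 where "a2 = snd (\<tau> (p x))"
  have a: "norm a1 = 1" "norm a2 = 1" using \<tau>S[OF px] by (auto simp: a1_def a2_def)
  then have a0: "a1 \<noteq> 0" "a2 \<noteq> 0" by auto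
  \<comment> \<open>Rotations of the two circle factors move \<open>p x\<close> to \<open>(1, 1)\<close>, and then the imaginary parts of both
    factors form a chart \<open>\<eta>\<close> of the neighbourhood \<open>\<Omega>\<close> of \<open>p x\<close> in the torus.\<close>
  define m1 where "m1 t = fst (\<tau> t) / a1" for t
  define m2 where "m2 t = snd (\<tau> t) / a2" for t
  have cm: "continuous_on T m1" "continuous_on T m2"
    unfolding m1_def m2_def using c\<tau> a0 by (auto intro!: continuous_intros)
  have nm: "norm (m1 t) = 1" "norm (m2 t) = 1" if "t \<in> T" for t
    using \<tau>S[OF that] a by (auto simp: m1_def m2_def norm_divide)
  define \<eta> where "\<eta> t = Complex (Im (m1 t)) (Im (m2 t))" for t
  have c\<eta>: "continuous_on T \<eta>"
    unfolding \<eta>_def Complex_eq using cm by (auto intro!: continuous_intros)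
  define \<Omega> where "\<Omega> = T \<inter> (\<lambda>t. (Re (m1 t), Re (m2 t))) -` ({0<..} \<times> {0<..})"
  have \<Omega>: "openin (top_of_set T) \<Omega>"
    unfolding \<Omega>_def
    by (rule continuous_openin_preimage_gen)
       (use cm in \<open>auto intro!: continuous_intros open_Times\<close>)
  have \<eta>_inj: "t = t'" if "t \<in> \<Omega>" "t' \<in> \<Omega>" "\<eta> t = \<eta> t'" for t t'
  proof -
    have tT: "t \<in> T" "t' \<in> T" using that by (auto simp: \<Omega>_def)
    have "m1 t = m1 t'" "m2 t = m2 t'"
      using that nm[OF tT(1)] nm[OF tT(2)] unit_circle_half_inj by (auto simp: \<Omega>_def \<eta>_def)
    then have "\<tau> t = \<tau> t'" using a0 by (simp add: m1_def m2_def prod_eq_iff)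
    then show ?thesis using homeomorphism_apply1[OF \<tau>] tT by metis
  qed
  have aH: "above z0 w \<in> H" for w by (simp add: H_iff)
  have c_above: "continuous_on S (above z0)" for S
    unfolding above_def by (intro continuous_intros)
  have pT: "p (above z0 w) \<in> T" for w using aH T by blast
  have c_pa: "continuous_on S (\<lambda>w. p (above z0 w))" for S
    by (rule continuous_on_compose2[OF p_continuous c_above]) (use aH H_subset in auto)
  \<comment> \<open>The part of \<open>H\<close> that lies in the sheet \<open>N0\<close> and over \<open>\<Omega>\<close>, parametrised by the plane.\<close>
  define D where "D = above z0 -` N0 \<inter> (\<lambda>w. p (above z0 w)) -` \<Omega>"
  have "open D"
  proof -
    obtain N1 where "open N1" "\<Omega> = T \<inter> N1" using \<Omega> unfolding openin_open by blast
    then have "(\<lambda>w. p (above z0 w)) -` \<Omega> = (\<lambda>w. p (above z0 w)) -` N1" using pT by auto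
    then show ?thesis unfolding D_def
      using open_vimage[OF oN0 c_above] open_vimage[OF \<open>open N1\<close> c_pa] by (simp add: open_Int)
  qed
  moreover have "continuous_on D (\<lambda>w. \<eta> (p (above z0 w)))"
    by (rule continuous_on_compose2[OF c\<eta> c_pa]) (use pT in auto)
  moreover have "inj_on (\<lambda>w. \<eta> (p (above z0 w))) D"
  proof (rule inj_onI)
    fix w w' assume w: "w \<in> D" "w' \<in> D" "\<eta> (p (above z0 w)) = \<eta> (p (above z0 w'))"
    then have "p (above z0 w) = p (above z0 w')" using \<eta>_inj by (auto simp: D_def)
    then have "above z0 w = above z0 w'" using p_inj w by (auto simp: D_def)
    then show "w = w'" by (metis above_nth(1,2) complex_eqI)
  qed
  ultimately have "open ((\<lambda>w. \<eta> (p (above z0 w))) ` D)" by (intro invariance_of_domain)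
  then have "openin (top_of_set \<Omega>) (\<Omega> \<inter> \<eta> -` ((\<lambda>w. \<eta> (p (above z0 w))) ` D))"
    using c\<eta> by (intro continuous_openin_preimage_gen) (auto simp: \<Omega>_def intro: continuous_on_subset)
  then have "openin (top_of_set T) (\<Omega> \<inter> \<eta> -` ((\<lambda>w. \<eta> (p (above z0 w))) ` D))"
    using \<Omega> openin_trans by blast
  then obtain N1 where N1: "open N1" "\<Omega> \<inter> \<eta> -` ((\<lambda>w. \<eta> (p (above z0 w))) ` D) = T \<inter> N1"
    unfolding openin_open by blast
  show thesis
  proof (rule that)
    show "open (N0 \<inter> p -` N1)"
      using continuous_open_preimage[OF continuous_on_subset[OF p_continuous N0U] oN0 N1(1)] .
    have w: "above z0 (Complex (x$1) (x$2)) = x"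
      using x by (simp add: vec_eq_iff forall_3 H_iff)
    have "p x \<in> \<Omega>" using px a0 by (simp add: \<Omega>_def m1_def m2_def a1_def[symmetric] a2_def[symmetric])
    then have "Complex (x$1) (x$2) \<in> D" using w N0(1) by (simp add: D_def)
    then have "\<eta> (p x) \<in> (\<lambda>w. \<eta> (p (above z0 w))) ` D" by (metis (mono_tags, lifting) imageI w)
    then have "p x \<in> T \<inter> N1" using N1(2) \<open>p x \<in> \<Omega>\<close> by blast
    then show "x \<in> N0 \<inter> p -` N1" using N0(1) by blast
    fix y assume y: "y \<in> N0 \<inter> p -` N1" "p y \<in> T"
    then have "p y \<in> \<Omega>" "\<eta> (p y) \<in> (\<lambda>w. \<eta> (p (above z0 w))) ` D" using N1(2) by blast+
    then obtain w where w: "w \<in> D" "\<eta> (p y) = \<eta> (p (above z0 w))" by blast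
    then have "p y = p (above z0 w)" using \<eta>_inj \<open>p y \<in> \<Omega>\<close> by (auto simp: D_def)
    then have "y = above z0 w" using p_inj y w by (auto simp: D_def)
    then show "y \<in> H" using aH by simp
  qed
qed

text \<open>The points of \<open>S\<close> that are mapped to \<open>H\<close> form a closed set, and an open one because no other part
  of the preimage of \<open>T\<close> is near \<open>H\<close>.\<close>
lemma lift_stays_in_H:
  assumes "connected S" "continuous_on S f" "f ` S \<subseteq> U" "\<And>s. s \<in> S \<Longrightarrow> p (f s) \<in> T"
    and "s0 \<in> S" "f s0 \<in> H" "s \<in> S"
  shows "f s \<in> H"
proof -
  have "closed H" unfolding horosphere_def by (intro closed_Collect_eq continuous_intros)
  then have "closedin (top_of_set S) (S \<inter> f -` H)"
    using continuous_closedin_preimage[OF assms(2)] by blast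
  moreover have "openin (top_of_set S) (S \<inter> f -` H)"
  proof (subst openin_subopen, intro ballI)
    fix t assume t: "t \<in> S \<inter> f -` H"
    then obtain N where N: "open N" "f t \<in> N" "\<And>y. y \<in> N \<Longrightarrow> p y \<in> T \<Longrightarrow> y \<in> H"
      using preimage_T_near_H by (metis IntD2 vimageD)
    have "openin (top_of_set S) (S \<inter> f -` N)"
      using continuous_openin_preimage_gen[OF assms(2) N(1)] .
    then show "\<exists>V. openin (top_of_set S) V \<and> t \<in> V \<and> V \<subseteq> S \<inter> f -` H"
      using t N assms(4) by (intro exI[of _ "S \<inter> f -` N"]) auto
  qed
  ultimately have "S \<inter> f -` H = S"
    using assms(1,5,6) unfolding connected_clopen by blast
  then show ?thesis using assms(7) by blast
qed

lemma tangent_H: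
  assumes "y \<in> H"
  shows "differential A p y u \<in> tangent_to X A T (p y) \<longleftrightarrow> u $ 3 = 0"
proof
  assume "u $ 3 = 0"
  define \<sigma> where "\<sigma> s = y + s *\<^sub>R u" for s
  have \<sigma>: "\<sigma> s \<in> H" for s using assms \<open>u $ 3 = 0\<close> by (simp add: H_iff \<sigma>_def)
  have "smooth_on UNIV \<sigma>"
    unfolding \<sigma>_def by (intro smooth_on_add smooth_on_scaleR) auto
  then have "smooth_in {-1<..<1} \<sigma>" using smooth_on_subset smooth_in_open open_greaterThanLessThan by blast
  moreover have "(\<sigma> has_vector_derivative u) (at 0)"
  proof -
    have "\<sigma> = (\<lambda>s. y + s *\<^sub>R u)" by (simp add: fun_eq_iff \<sigma>_def)
    then show ?thesis by (auto intro!: derivative_eq_intros)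
  qed
  ultimately show "differential A p y u \<in> tangent_to X A T (p y)"
    using \<sigma> H_subset T by (intro tangent_toI[of 1 \<sigma>]) (auto simp: \<sigma>_def)
next
  have yU: "y \<in> U" using assms H_subset by auto
  assume "differential A p y u \<in> tangent_to X A T (p y)"
  then obtain \<sigma> \<delta> \<sigma>' where \<sigma>: "\<delta> > 0" "smooth_in {-\<delta><..<\<delta>} \<sigma>" "\<sigma> ` {-\<delta><..<\<delta>} \<subseteq> U" "\<sigma> 0 = y"
    "\<And>s. s \<in> {-\<delta><..<\<delta>} \<Longrightarrow> p (\<sigma> s) \<in> T" "(\<sigma> has_vector_derivative \<sigma>') (at 0)"
    "differential A p y u = differential A p y \<sigma>'"
    using tangent_to_lift[OF _ yU] by metis
  have u: "u = \<sigma>'" using differential_inj[OF yU \<sigma>(7)] .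
  have "\<sigma> s \<in> H" if "s \<in> {-\<delta><..<\<delta>}" for s
    by (rule lift_stays_in_H[OF _ smooth_in_continuous[OF \<sigma>(2)] \<sigma>(3,5), of 0])
       (use \<sigma>(1,4) assms that in auto)
  then have c: "\<sigma> s $ 3 = z0" if "s \<in> {-\<delta><..<\<delta>}" for s using that H_iff by blast
  have "((\<lambda>s. \<sigma> s $ 3) has_vector_derivative \<sigma>' $ 3) (at 0)"
    using bounded_linear.has_vector_derivative[OF bounded_linear_vec_nth \<sigma>(6)] .
  moreover have "((\<lambda>s. \<sigma> s $ 3) has_vector_derivative 0) (at 0)"
    by (rule has_vector_derivative_transform_within_open[of "\<lambda>_. z0" _ _ "{-\<delta><..<\<delta>}"])
       (use c \<sigma>(1) in auto)
  ultimately show "u $ 3 = 0" using u vector_derivative_unique_at by blast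
qed

text \<open>A vertical geodesic that leaves \<open>H\<close> and meets another lift \<open>g H\<close> orthogonally does so at the
  top of a sphere tangent to the boundary plane: \<open>g H\<close> is the level set \<open>z = z0 (a + b \<bullet> x + c |x|\<^sup>2)\<close>,
  orthogonality makes the gradient of the right-hand side vertical, \<open>c = 0\<close> would be a rescaling,
  and disjointness of \<open>H\<close> and \<open>g H\<close> puts the sphere below \<open>H\<close>.  The third part says that a family
  of points over \<open>T\<close> cannot leave the sphere; \<open>g\<close> transports this property from \<open>H\<close>.\<close>
proposition end_sphere:
  assumes y0: "y0 \<in> H" and e: "e \<in> U" "p e \<in> T" "e $ 1 = y0 $ 1" "e $ 2 = y0 $ 2" "e $ 3 \<noteq> z0"
    and perp: "\<And>u. differential A p e u \<in> tangent_to X A T (p e) \<Longrightarrow> u $ 3 = 0"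
  defines "Q \<equiv> y0 - z0 *\<^sub>R axis 3 1"
  shows "e $ 3 < z0"
    and "\<And>x. x \<in> U \<Longrightarrow> (x - Q) \<bullet> (x - Q) = e $ 3 * x $ 3 \<Longrightarrow> p x \<in> T"
    and "\<And>S (f :: 'd::topological_space \<Rightarrow> real^3) s0 s. connected S \<Longrightarrow> continuous_on S f \<Longrightarrow>
      f ` S \<subseteq> U \<Longrightarrow> (\<And>s. s \<in> S \<Longrightarrow> p (f s) \<in> T) \<Longrightarrow> s0 \<in> S \<Longrightarrow>
      (f s0 - Q) \<bullet> (f s0 - Q) = e $ 3 * f s0 $ 3 \<Longrightarrow> s \<in> S \<Longrightarrow>
      (f s - Q) \<bullet> (f s - Q) = e $ 3 * f s $ 3"
proof -
  obtain y where y: "y \<in> H" "p y = p e" using e(2) T by auto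
  have yU: "y \<in> U" using y H_subset by auto
  obtain g g' where g: "deck g g'" "g y = e" using deck_exists[OF yU e(1) y(2)] by metis
  note g' = deck_inverse[OF g(1)]
  obtain a b c where abc: "b $ 3 = 0" "b \<bullet> b = 4 * a * c"
    "\<And>x. x \<in> U \<Longrightarrow> x $ 3 = g' x $ 3 * (a + b \<bullet> x + c * (x \<bullet> x))"
    using deck_height[OF g'] by metis
  define F where "F x = a + b \<bullet> x + c * (x \<bullet> x)" for x
  let ?J = "fd g y"
  have dg: "(g has_derivative ?J) (at y)" using smooth_on_has_derivative[OF deck_smooth[OF g(1)] yU] .
  interpret J: linear ?J using dg has_derivative_linear by blast
  have horizontal: "?J w $ 3 = 0" if "w $ 3 = 0" for w
  proof -
    have "differential A p e (?J w) \<in> tangent_to X A T (p e)"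
      using deck_differential[OF g(1) yU, of w] g(2) y tangent_H[OF y(1), of w] that by simp
    then show ?thesis using perp by blast
  qed
  define r where "r = (e $ 3 / y $ 3)\<^sup>2"
  have r: "r > 0" using upper_half_space_pos[OF yU] upper_half_space_pos[OF e(1)] by (simp add: r_def)
  have conf: "?J u \<bullet> ?J v = r * (u \<bullet> v)" for u v
  proof -
    define k where "k = h (p e) (differential A p y u) (differential A p y v)"
    have "k = (?J u \<bullet> ?J v) / (e $ 3)\<^sup>2"
      using p_isometry[OF e(1), of "?J u" "?J v"] g(2) deck_differential[OF g(1) yU]
      by (simp only: k_def)
    moreover have "k = (u \<bullet> v) / (y $ 3)\<^sup>2"
      using p_isometry[OF yU, of u v] y(2) by (simp only: k_def)
    ultimately show ?thesis
      using upper_half_space_pos[OF yU] upper_half_space_pos[OF e(1)]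
      by (simp add: r_def power_divide field_simps)
  qed
  \<comment> \<open>As \<open>dg\<close> is conformal and preserves the horizontal plane, it also preserves the vertical line.\<close>
  have "inj ?J"
    unfolding linear_injective_0[OF J.linear_axioms]
    using conf r by (metis inner_eq_zero_iff inner_zero_left mult_eq_0_iff less_irrefl)
  then have surj: "\<exists>u. ?J u = w" for w
    using linear_injective_imp_surjective[OF J.linear_axioms] by (metis surjD)
  have vertical: "?J (axis 3 1) $ 1 = 0 \<and> ?J (axis 3 1) $ 2 = 0"
  proof -
    obtain n where n: "?J n = axis 3 1" using surj by blast
    have "n $ i = 0" if "i \<noteq> 3" for i
    proof -
      have "(axis i 1 :: real^3) $ 3 = 0" using that by (simp add: axis_def)
      then have "?J n \<bullet> ?J (axis i 1) = 0" using horizontal n by (simp add: inner_axis')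
      then have "n \<bullet> axis i 1 = 0" using conf[of n "axis i 1"] r by simp
      then show ?thesis by (simp add: inner_axis)
    qed
    then have "n = n $ 3 *\<^sub>R axis 3 1" by (simp add: vec_eq_iff axis_def)
    then have "axis 3 1 = n $ 3 *\<^sub>R ?J (axis 3 1)" using n J.scale by metis
    then have "n $ 3 * ?J (axis 3 1) $ i = axis 3 1 $ i" for i
      by (metis vector_scaleR_component real_scaleR_def)
    from this[of 1] this[of 2] this[of 3] show ?thesis by (auto simp: axis_def)
  qed
  have Fg: "F (g x) = g x $ 3 / x $ 3" if "x \<in> U" for x
    using abc(3)[OF deck_in[OF g(1) that]] deck_inv_apply[OF g(1) that] upper_half_space_pos[OF that]
    by (simp add: F_def field_simps)
  \<comment> \<open>\<open>m\<close> is the gradient of \<open>F\<close> at \<open>e\<close>; by \<open>Fg\<close> it is orthogonal to the tangent plane of \<open>g H\<close>.\<close>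
  define m where "m = b + (2 * c) *\<^sub>R e"
  have grad: "m \<bullet> ?J w = 0" if "w $ 3 = 0" for w
  proof -
    have dF: "(F has_derivative (\<lambda>u. m \<bullet> u)) (at (g y))"
      unfolding F_def m_def g(2)
      by (auto intro!: derivative_eq_intros simp: inner_add_left inner_commute algebra_simps)
    have 1: "((\<lambda>x. F (g x)) has_derivative (\<lambda>w. m \<bullet> ?J w)) (at y)"
      by (rule has_derivative_compose[OF dg dF])
    have 2: "((\<lambda>x. g x $ 3 / x $ 3) has_derivative
        (\<lambda>w. (?J w $ 3 * y $ 3 - g y $ 3 * w $ 3) / (y $ 3 * y $ 3))) (at y)"
      using bounded_linear.has_derivative[OF bounded_linear_vec_nth dg]
        bounded_linear.has_derivative[OF bounded_linear_vec_nth has_derivative_ident]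
        upper_half_space_pos[OF yU]
      by (intro has_derivative_divide') auto
    have 3: "((\<lambda>x. F (g x)) has_derivative
        (\<lambda>w. (?J w $ 3 * y $ 3 - g y $ 3 * w $ 3) / (y $ 3 * y $ 3))) (at y)"
      by (rule has_derivative_transform_within_open[OF 2 open_upper_half_space yU]) (simp add: Fg)
    show ?thesis
      using fun_cong[OF has_derivative_unique[OF 1 3], of w] horizontal[OF that] that by simp
  qed
  have "m $ i = 0" if "i = 1 \<or> i = 2" for i
  proof -
    obtain u where u: "?J u = axis i 1" using surj by blast
    have "?J u = ?J (u - u $ 3 *\<^sub>R axis 3 1) + u $ 3 *\<^sub>R ?J (axis 3 1)"
      by (simp add: J.diff J.scale)
    then have "m \<bullet> axis i 1 = u $ 3 * (m \<bullet> ?J (axis 3 1))"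
      using grad[of "u - u $ 3 *\<^sub>R axis 3 1"] u by (simp add: inner_add_right axis_def)
    moreover have "u $ 3 = 0"
    proof -
      have "?J u \<bullet> ?J (axis 3 1) = 0" using u vertical that by (auto simp: inner_axis')
      then show ?thesis using conf[of u "axis 3 1"] r by (simp add: inner_axis)
    qed
    ultimately show ?thesis by (simp add: inner_axis)
  qed
  then have m0: "b $ 1 = - (2 * c * e $ 1)" "b $ 2 = - (2 * c * e $ 2)"
    by (auto simp: m_def eq_neg_iff_add_eq_0)
  have level: "x $ 3 = z0 * F x \<longleftrightarrow> g' x \<in> H" if "x \<in> U" for x
    using abc(3)[OF that] upper_half_space_pos[OF that] by (auto simp: F_def H_iff)
  have "g' e = y" using deck_inv_apply[OF g(1) yU] g(2) by simp
  then have eF: "e $ 3 = z0 * F e" using level[OF e(1)] y(1) by simp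
  have epos: "e $ 3 > 0" using upper_half_space_pos[OF e(1)] .
  have c0: "c \<noteq> 0"
  proof
    assume "c = 0"
    then have "b = 0" using abc(2) by simp
    then have "x $ 3 = a * g' x $ 3" if "x \<in> U" for x using abc(3)[OF that] \<open>c = 0\<close> by simp
    then have "a = 1" using no_scaling_deck[OF g'] by blast
    then show False using eF e(5) \<open>b = 0\<close> \<open>c = 0\<close> by (simp add: F_def)
  qed
  have FQ: "F x = c * ((x - Q) \<bullet> (x - Q))" for x
  proof -
    have Q: "Q $ 1 = e $ 1" "Q $ 2 = e $ 2" "Q $ 3 = 0" using e y0 by (auto simp: Q_def axis_def H_iff)
    have "4 * c * a = 4 * c * (c * ((e $ 1)\<^sup>2 + (e $ 2)\<^sup>2))"
      using abc(1,2) m0 by (simp add: inner_real3 power2_eq_square algebra_simps)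
    then have "a = c * ((e $ 1)\<^sup>2 + (e $ 2)\<^sup>2)" using c0 by (simp only: mult_cancel_left) simp
    then show ?thesis
      using abc(1) m0 Q by (simp add: F_def inner_real3 power2_eq_square algebra_simps)
  qed
  have Fe: "F e = c * (e $ 3)\<^sup>2"
    using e y0 by (simp add: FQ inner_real3 Q_def axis_def H_iff power2_eq_square)
  have d: "e $ 3 * (z0 * c) = 1" using eF Fe epos by (simp add: power2_eq_square ac_simps)
  have sphere: "(x - Q) \<bullet> (x - Q) = e $ 3 * x $ 3 \<longleftrightarrow> g' x \<in> H" if "x \<in> U" for x
  proof -
    have "(x - Q) \<bullet> (x - Q) = e $ 3 * x $ 3 \<longleftrightarrow> (z0 * c) * ((x - Q) \<bullet> (x - Q)) = (z0 * c) * (e $ 3 * x $ 3)"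
      using z0 c0 by simp
    also have "(z0 * c) * (e $ 3 * x $ 3) = x $ 3" using d by (metis mult.assoc mult.commute mult_1)
    finally show ?thesis using level[OF that] FQ by (auto simp: mult.assoc)
  qed
  show "e $ 3 < z0"
  proof (rule ccontr)
    assume "\<not> e $ 3 < z0"
    \<comment> \<open>If the sphere is at least as high as \<open>H\<close>, this is one of their common points.\<close>
    define x where "x = Q + sqrt (z0 * (e $ 3 - z0)) *\<^sub>R axis 1 1 + z0 *\<^sub>R axis 3 1"
    have x3: "x $ 3 = z0" using y0 by (simp add: x_def Q_def H_iff axis_def)
    then have xH: "x \<in> H" "x \<in> U" using z0 by (auto simp: H_iff upper_half_space_def)
    have "(x - Q) \<bullet> (x - Q) = e $ 3 * x $ 3"
    proof -
      define w where "w = sqrt (z0 * (e $ 3 - z0))"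
      have w: "w * w = z0 * (e $ 3 - z0)"
        using \<open>\<not> e $ 3 < z0\<close> z0 by (simp add: w_def)
      have "x - Q = w *\<^sub>R axis 1 1 + z0 *\<^sub>R axis 3 1" by (simp add: x_def w_def)
      then have "(x - Q) \<bullet> (x - Q) = w * w + z0 * z0" by (simp add: inner_real3 axis_def)
      then show ?thesis using w x3 by (simp add: algebra_simps)
    qed
    then have "g' x \<in> H" using sphere xH by blast
    then have "x \<in> g ` H" using deck_inv_apply[OF g' xH(2)] by (metis imageI)
    have "deck_transformation p g" "deck_transformation p (\<lambda>x. x)"
      using deck_transformation[OF g(1)] by (auto simp: deck_transformation_def intro: homeomorphism_ident)
    then have "g ` H = H \<or> disjnt (g ` H) H"
      using disjoint_lifts unfolding pairwise_def by (metis (mono_tags, lifting) image_ident mem_Collect_eq)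
    then have "g ` H = H" using \<open>x \<in> g ` H\<close> xH(1) by (auto simp: disjnt_def)
    then show False using e(5) g(2) y(1) H_iff by blast
  qed
  show "p x \<in> T" if "x \<in> U" "(x - Q) \<bullet> (x - Q) = e $ 3 * x $ 3" for x
    using sphere[OF that(1)] that(2) deck_p[OF g' that(1)] T by (metis imageI)
  fix S s0 s and f :: "'d \<Rightarrow> real^3"
  assume f: "connected S" "continuous_on S f" "f ` S \<subseteq> U" "\<And>s. s \<in> S \<Longrightarrow> p (f s) \<in> T" "s0 \<in> S"
    "(f s0 - Q) \<bullet> (f s0 - Q) = e $ 3 * f s0 $ 3" "s \<in> S"
  have s0: "g' (f s0) \<in> H" using sphere f(3,5,6) by blast
  have cg': "continuous_on U g'" using g(1) unfolding deck_def homeomorphism_def by blast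
  have "g' (f s) \<in> H"
  proof (rule lift_stays_in_H[OF f(1), of "\<lambda>s. g' (f s)" s0])
    show "continuous_on S (\<lambda>s. g' (f s))" using continuous_on_compose2[OF cg' f(2)] f(3) by auto
  qed (use f s0 deck_in[OF g'] deck_p[OF g'] in auto)
  then show "(f s - Q) \<bullet> (f s - Q) = e $ 3 * f s $ 3" using sphere f by blast
qed

end

section \<open>Geodesics in the universal cover\<close>

lemma fd_expand:
  fixes F :: "'e::euclidean_space \<Rightarrow> 'f::real_normed_vector"
  assumes "F differentiable (at x)"
  shows "fd F x u = (\<Sum>b\<in>Basis. (u \<bullet> b) *\<^sub>R fd F x b)"
proof -
  interpret linear "fd F x" using fd_linear[OF assms] .
  have "fd F x u = fd F x (\<Sum>b\<in>Basis. (u \<bullet> b) *\<^sub>R b)" by (simp add: euclidean_representation)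
  then show ?thesis by (simp only: sum scale)
qed

text \<open>The base point and the vector of the derivative \<open>dF(f s) (u s)\<close> both depend on \<open>s\<close>; expanding \<open>u\<close> in
  a basis separates the two dependences.\<close>
lemma fd_moving_has_derivative:
  fixes F :: "'e::euclidean_space \<Rightarrow> 'f::real_normed_vector"
    and f u :: "'d::real_normed_vector \<Rightarrow> 'e"
  assumes S: "open S" "smooth_on S F" "f s \<in> S"
    and f: "(f has_derivative f') (at s within I)" and u: "(u has_derivative u') (at s within I)"
    and fS: "f ` I \<subseteq> S" and s: "s \<in> I"
  shows "((\<lambda>s. fd F (f s) (u s)) has_derivative
    (\<lambda>v. fd F (f s) (u' v) + fd (\<lambda>y. fd F y (u s)) (f s) (f' v))) (at s within I)"
proof -
  have diff: "F differentiable (at y)" if "y \<in> S" for y using S(2) that smooth_on_iff by blast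
  have 2: "((\<lambda>y. fd F y b) has_derivative fd (\<lambda>y. fd F y b) (f s)) (at (f s))" for b
    by (rule smooth_on_has_derivative[OF smooth_on_fd[OF S(2)] S(3)])
  have 1: "((\<lambda>s. \<Sum>b\<in>Basis. (u s \<bullet> b) *\<^sub>R fd F (f s) b) has_derivative
      (\<lambda>v. \<Sum>b\<in>Basis. (u s \<bullet> b) *\<^sub>R fd (\<lambda>y. fd F y b) (f s) (f' v) + (u' v \<bullet> b) *\<^sub>R fd F (f s) b))
      (at s within I)"
    by (intro has_derivative_sum has_derivative_scaleR has_derivative_inner_left u
        has_derivative_compose[OF f 2])
  have 3: "fd (\<lambda>y. fd F y w) (f s) v = (\<Sum>b\<in>Basis. (w \<bullet> b) *\<^sub>R fd (\<lambda>y. fd F y b) (f s) v)" for w v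
  proof -
    have "((\<lambda>y. \<Sum>b\<in>Basis. (w \<bullet> b) *\<^sub>R fd F y b) has_derivative
        (\<lambda>v. \<Sum>b\<in>Basis. (w \<bullet> b) *\<^sub>R fd (\<lambda>y. fd F y b) (f s) v)) (at (f s))"
      by (intro has_derivative_sum has_derivative_scaleR_right 2)
    then have "((\<lambda>y. fd F y w) has_derivative
        (\<lambda>v. \<Sum>b\<in>Basis. (w \<bullet> b) *\<^sub>R fd (\<lambda>y. fd F y b) (f s) v)) (at (f s))"
      by (rule has_derivative_transform_within_open[OF _ S(1,3)]) (rule fd_expand[OF diff, symmetric])
    then show ?thesis by (simp add: fd_eqI)
  qed
  have 4: "((\<lambda>s. fd F (f s) (u s)) has_derivative
      (\<lambda>v. \<Sum>b\<in>Basis. (u s \<bullet> b) *\<^sub>R fd (\<lambda>y. fd F y b) (f s) (f' v) + (u' v \<bullet> b) *\<^sub>R fd F (f s) b))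
      (at s within I)"
    by (rule has_derivative_transform[OF s _ 1]) (use fS in \<open>auto intro: fd_expand[OF diff]\<close>)
  then show ?thesis
    by (rule has_derivative_eq_rhs)
       (simp add: 3[of "u s"] fd_expand[OF diff[OF S(3)], of "u' _"] sum.distrib fun_eq_iff)
qed

lemma smooth_in_Icc_derivative:
  fixes f :: "real \<Rightarrow> 'f::euclidean_space"
  assumes "smooth_in {0..1} f"
  obtains f' where "smooth_in {0..1} f'"
    "\<And>t. t \<in> {0..1} \<Longrightarrow> (f has_vector_derivative f' t) (at t within {0..1})"
proof -
  have th: "thick {0..1::real}" by (rule thick_Icc) simp
  have "(f has_vector_derivative dw {0..1} f t 1) (at t within {0..1})" if "t \<in> {0..1}" for t
  proof -
    have d: "(f has_derivative dw {0..1} f t) (at t within {0..1})"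
      by (rule smooth_in_has_derivative[OF th assms that])
    have "dw {0..1} f t = (\<lambda>r. r *\<^sub>R dw {0..1} f t 1)"
    proof
      show "dw {0..1} f t r = r *\<^sub>R dw {0..1} f t 1" for r
        using linear_scale[OF has_derivative_linear[OF d], of r 1] by simp
    qed
    then show ?thesis unfolding has_vector_derivative_def by (rule has_derivative_eq_rhs[OF d])
  qed
  then show thesis using that smooth_in_dw[OF th assms, of 1] by blast
qed

lemma Icc_not_bot: "t \<in> {0..1::real} \<Longrightarrow> at t within {0..1} \<noteq> bot"
  using thick_Icc[of 0 1] islimpt_Icc[of 0 1 t] by (simp add: trivial_limit_within)

lemma constant_of_zero_derivative:
  fixes f :: "real \<Rightarrow> real"
  assumes "\<And>t. t \<in> {0..1} \<Longrightarrow> (f has_real_derivative 0) (at t within {0..1})" "t \<in> {0..1}"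
  shows "f t = f 0"
proof -
  have "\<exists>c. \<forall>t\<in>{0..1}. f t = c"
    by (rule has_field_derivative_zero_constant) (use assms in auto)
  then show ?thesis using assms(2) by fastforce
qed

lemma exponential_decay:
  fixes z :: "real \<Rightarrow> real"
  assumes "\<And>t. t \<in> {0..1} \<Longrightarrow> (z has_real_derivative - L * z t) (at t within {0..1})" "t \<in> {0..1}"
  shows "z t = z 0 * exp (- L * t)"
proof -
  have "z t * exp (L * t) = z 0 * exp (L * 0)"
    by (rule constant_of_zero_derivative[OF _ assms(2)])
       (auto intro!: derivative_eq_intros assms(1))
  then show ?thesis by (simp add: exp_minus field_simps)
qed

lemma has_real_derivative_nth:
  "(f has_vector_derivative f') (at t within S) \<Longrightarrow>
    ((\<lambda>t. f t $ i) has_real_derivative f' $ i) (at t within S)"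
  using bounded_linear.has_vector_derivative[OF bounded_linear_vec_nth]
  by (simp add: has_real_derivative_iff_has_vector_derivative)

text \<open>The equation says that \<open>f\<close> is a geodesic of the hyperbolic metric; it is solved by means of
  the first integrals \<open>f'\<^sub>1/z\<^sup>2\<close>, \<open>f'\<^sub>2/z\<^sup>2\<close> and \<open>z'/z\<close>.\<close>
lemma vertical_geodesic:
  fixes f :: "real \<Rightarrow> real^3"
  assumes f: "f ` {0..1} \<subseteq> upper_half_space"
    and f1: "\<And>t. t \<in> {0..1} \<Longrightarrow> (f has_vector_derivative f1 t) (at t within {0..1})"
    and f2: "\<And>t. t \<in> {0..1} \<Longrightarrow> (f1 has_vector_derivative f2 t) (at t within {0..1})"
    and eq: "\<And>t w. t \<in> {0..1} \<Longrightarrow>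
      f t $ 3 * (f2 t \<bullet> w) - 2 * (f1 t \<bullet> w) * f1 t $ 3 + (f1 t \<bullet> f1 t) * w $ 3 = 0"
    and init: "f1 0 $ 1 = 0" "f1 0 $ 2 = 0"
  obtains L where "\<And>t. t \<in> {0..1} \<Longrightarrow> f t = f 0 + (f 0 $ 3 * (exp (- L * t) - 1)) *\<^sub>R axis 3 1"
proof -
  have pos: "f t $ 3 > 0" if "t \<in> {0..1}" for t using f that by (intro upper_half_space_pos) blast
  note d1 = has_real_derivative_nth[OF f1] and d2 = has_real_derivative_nth[OF f2]
  have horiz: "f1 t $ i = 0 \<and> f t $ i = f 0 $ i" if i: "i = 1 \<or> i = 2" and t: "t \<in> {0..1}" for i t
  proof -
    have "f1 t $ i / (f t $ 3)\<^sup>2 = f1 0 $ i / (f 0 $ 3)\<^sup>2" if "t \<in> {0..1}" for t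
    proof (rule constant_of_zero_derivative[OF _ that])
      fix t :: real assume t: "t \<in> {0..1}"
      have "f t $ 3 * f2 t $ i = 2 * f1 t $ i * f1 t $ 3"
      proof -
        have "(axis i 1 :: real^3) $ 3 = 0" using i by (auto simp: axis_def)
        then show ?thesis using eq[OF t, of "axis i 1"] by (simp add: inner_axis)
      qed
      then show "((\<lambda>t. f1 t $ i / (f t $ 3)\<^sup>2) has_real_derivative 0) (at t within {0..1})"
        using pos[OF t]
        by (auto intro!: derivative_eq_intros d1[OF t] d2[OF t] simp: power2_eq_square algebra_simps)
    qed
    then have z: "f1 t $ i = 0" if "t \<in> {0..1}" for t using pos[OF that] i init that by fastforce
    have "f t $ i = f 0 $ i"
      by (rule constant_of_zero_derivative[OF _ t]) (use d1[of _ i] z in auto)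
    then show ?thesis using z[OF t] by simp
  qed
  define L where "L = - (f1 0 $ 3 / f 0 $ 3)"
  have ratio: "f1 t $ 3 / f t $ 3 = f1 0 $ 3 / f 0 $ 3" if "t \<in> {0..1}" for t
  proof (rule constant_of_zero_derivative[OF _ that])
    fix t :: real assume t: "t \<in> {0..1}"
    have "f t $ 3 * f2 t $ 3 = f1 t $ 3 * f1 t $ 3"
      using eq[OF t, of "axis 3 1"] horiz[of 1, OF _ t] horiz[of 2, OF _ t]
      by (simp add: inner_axis inner_real3[of "f1 t"])
    moreover have "((\<lambda>t. f1 t $ 3 / f t $ 3) has_real_derivative
        (f2 t $ 3 * f t $ 3 - f1 t $ 3 * f1 t $ 3) / (f t $ 3 * f t $ 3)) (at t within {0..1})"
      by (rule DERIV_divide[OF d2[OF t] d1[OF t]]) (use pos[OF t] in simp)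
    ultimately show "((\<lambda>t. f1 t $ 3 / f t $ 3) has_real_derivative 0) (at t within {0..1})"
      by (simp add: mult.commute)
  qed
  have f13: "f1 t $ 3 = - L * f t $ 3" if "t \<in> {0..1}" for t
  proof -
    have "f1 t $ 3 = (f1 t $ 3 / f t $ 3) * f t $ 3" using pos[OF that] by simp
    then show ?thesis unfolding ratio[OF that] by (simp add: L_def)
  qed
  have f3: "f t $ 3 = f 0 $ 3 * exp (- L * t)" if "t \<in> {0..1}" for t
  proof (rule exponential_decay[OF _ that])
    show "((\<lambda>t. f t $ 3) has_real_derivative - L * f s $ 3) (at s within {0..1})" if "s \<in> {0..1}" for s
      using d1[OF that, of 3] f13[OF that] by simp
  qed
  have "f t = f 0 + (f 0 $ 3 * (exp (- L * t) - 1)) *\<^sub>R axis 3 1" if "t \<in> {0..1}" for t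
    using horiz[of 1, OF _ that] horiz[of 2, OF _ that]
    unfolding vec_eq_iff forall_3 by (simp add: axis_def f3[OF that] algebra_simps)
  then show thesis using that by blast
qed

context hyperbolic_covering
begin

definition DG :: "'a chart \<Rightarrow> real^3 \<Rightarrow> real^3 \<Rightarrow> real^3 \<Rightarrow> real^3 \<Rightarrow> real" where
  "DG \<kappa> y a u v = fd (\<lambda>y. G \<kappa> y u v) y a"

lemma G_has_derivative:
  "\<kappa> \<in> A \<Longrightarrow> y \<in> cod_chart \<kappa> \<Longrightarrow> ((\<lambda>y. G \<kappa> y u v) has_derivative (\<lambda>a. DG \<kappa> y a u v)) (at y)"
  unfolding DG_def using smooth_on_has_derivative[OF G_smooth] by simp

lemma DG_linear1: "\<kappa> \<in> A \<Longrightarrow> y \<in> cod_chart \<kappa> \<Longrightarrow> linear (\<lambda>a. DG \<kappa> y a u v)"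
  using G_has_derivative has_derivative_linear by blast

lemma DG_linear3:
  assumes "\<kappa> \<in> A" "y \<in> cod_chart \<kappa>"
  shows "linear (DG \<kappa> y a u)"
proof -
  note d = G_has_derivative[OF assms] and op = chart_props(2)[OF assms(1)]
  have lin: "linear (G \<kappa> x u)" if "x \<in> cod_chart \<kappa>" for x
    using G_bilinear[OF assms(1) that] by (simp add: bilinear_def)
  show ?thesis
  proof (rule linearI)
    fix v w
    have "((\<lambda>y. G \<kappa> y u (v + w)) has_derivative (\<lambda>a. DG \<kappa> y a u v + DG \<kappa> y a u w)) (at y)"
      by (rule has_derivative_transform_within_open[OF has_derivative_add[OF d d] op assms(2)])
         (simp add: linear_add[OF lin])
    from has_derivative_unique[OF d this]
    show "DG \<kappa> y a u (v + w) = DG \<kappa> y a u v + DG \<kappa> y a u w" by metis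
  next
    fix v and r :: real
    have "((\<lambda>y. G \<kappa> y u (r *\<^sub>R v)) has_derivative (\<lambda>a. r *\<^sub>R DG \<kappa> y a u v)) (at y)"
      by (rule has_derivative_transform_within_open[OF has_derivative_scaleR_right[OF d] op assms(2)])
         (simp add: linear_scale[OF lin])
    from has_derivative_unique[OF d this]
    show "DG \<kappa> y a u (r *\<^sub>R v) = r *\<^sub>R DG \<kappa> y a u v" by metis
  qed
qed

lemma DG_sym:
  assumes "\<kappa> \<in> A" "y \<in> cod_chart \<kappa>"
  shows "DG \<kappa> y a u v = DG \<kappa> y a v u"
proof -
  have "((\<lambda>y. G \<kappa> y u v) has_derivative (\<lambda>a. DG \<kappa> y a v u)) (at y)"
    by (rule has_derivative_transform_within_open[OF G_has_derivative[OF assms]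
          chart_props(2)[OF assms(1)] assms(2)]) (simp add: G_sym[OF assms(1)])
  from has_derivative_unique[OF G_has_derivative[OF assms] this] show ?thesis by metis
qed

lemma G_moving_has_derivative:
  assumes \<kappa>: "\<kappa> \<in> A" and y: "x0 \<in> S" "open S" "\<And>x. x \<in> S \<Longrightarrow> F x \<in> cod_chart \<kappa>"
    and F: "(F has_derivative F') (at x0)" and u: "(u has_derivative u') (at x0)"
    and v: "(v has_derivative v') (at x0)"
  shows "((\<lambda>x. G \<kappa> (F x) (u x) (v x)) has_derivative
    (\<lambda>a. DG \<kappa> (F x0) (F' a) (u x0) (v x0) + G \<kappa> (F x0) (u' a) (v x0) + G \<kappa> (F x0) (u x0) (v' a)))
    (at x0)"
proof -
  have c: "F x0 \<in> cod_chart \<kappa>" using y by blast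
  have nth: "((\<lambda>x. w x $ i) has_derivative (\<lambda>a. w' a $ i)) (at x0)"
    if "(w has_derivative w') (at x0)" for w w' :: "_ \<Rightarrow> real^3" and i
    by (rule bounded_linear.has_derivative[OF bounded_linear_vec_nth that])
  have dG: "((\<lambda>x. G \<kappa> (F x) e e') has_derivative (\<lambda>a. DG \<kappa> (F x0) (F' a) e e')) (at x0)" for e e'
    by (rule has_derivative_compose[OF F G_has_derivative[OF \<kappa> c]])
  have exp: "G \<kappa> y w w' = (\<Sum>i\<in>UNIV. \<Sum>j\<in>UNIV. w $ i * w' $ j * G \<kappa> y (axis i 1) (axis j 1))"
    if "y \<in> cod_chart \<kappa>" for y w w'
    using G_expand_left[OF \<kappa> that, of w w'] G_expand_right[OF \<kappa> that, of _ w']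
    by (simp add: sum_3 algebra_simps)
  have DGexp: "DG \<kappa> (F x0) a w w' = (\<Sum>i\<in>UNIV. \<Sum>j\<in>UNIV. w $ i * w' $ j * DG \<kappa> (F x0) a (axis i 1) (axis j 1))"
    for a w w'
  proof -
    have r: "DG \<kappa> (F x0) a w w' = (\<Sum>j\<in>UNIV. w' $ j * DG \<kappa> (F x0) a w (axis j 1))"
      using linear_real3[OF DG_linear3[OF \<kappa> c], of a w w'] by (simp add: sum_3)
    have l: "DG \<kappa> (F x0) a w e = (\<Sum>i\<in>UNIV. w $ i * DG \<kappa> (F x0) a (axis i 1) e)" for e
      using linear_real3[OF DG_linear3[OF \<kappa> c], of a e w] DG_sym[OF \<kappa> c, of a _ e]
      by (simp only: sum_3 real_scaleR_def)
    show ?thesis unfolding r unfolding l by (simp add: sum_3 algebra_simps)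
  qed
  have "((\<lambda>x. \<Sum>i\<in>UNIV. \<Sum>j\<in>UNIV. u x $ i * v x $ j * G \<kappa> (F x) (axis i 1) (axis j 1)) has_derivative
      (\<lambda>a. \<Sum>i\<in>UNIV. \<Sum>j\<in>UNIV. u x0 $ i * v x0 $ j * DG \<kappa> (F x0) (F' a) (axis i 1) (axis j 1) +
        (u x0 $ i * v' a $ j + u' a $ i * v x0 $ j) * G \<kappa> (F x0) (axis i 1) (axis j 1))) (at x0)"
    by (intro has_derivative_sum has_derivative_mult nth u v dG)
  then have "((\<lambda>x. G \<kappa> (F x) (u x) (v x)) has_derivative
      (\<lambda>a. \<Sum>i\<in>UNIV. \<Sum>j\<in>UNIV. u x0 $ i * v x0 $ j * DG \<kappa> (F x0) (F' a) (axis i 1) (axis j 1) +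
        (u x0 $ i * v' a $ j + u' a $ i * v x0 $ j) * G \<kappa> (F x0) (axis i 1) (axis j 1))) (at x0)"
    by (rule has_derivative_transform_within_open[OF _ y(2,1)]) (simp add: exp[OF y(3)])
  then show ?thesis
    by (rule has_derivative_eq_rhs)
       (simp add: fun_eq_iff DGexp[of _ "u x0" "v x0"] exp[OF c, of "u' _" "v x0"]
         exp[OF c, of "u x0" "v' _"] sum.distrib algebra_simps)
qed

text \<open>This is the derivative of the isometry condition \<open>h(dp(u), dp(v)) = (u \<bullet> v)/z\<^sup>2\<close> in the
  direction \<open>a\<close>.\<close>
lemma G_P_derivative:
  assumes \<kappa>: "\<kappa> \<in> A" "x \<in> Dom \<kappa>"
  shows "DG \<kappa> (P \<kappa> x) (fd (P \<kappa>) x a) (fd (P \<kappa>) x u) (fd (P \<kappa>) x v) +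
      G \<kappa> (P \<kappa> x) (fd (\<lambda>y. fd (P \<kappa>) y u) x a) (fd (P \<kappa>) x v) +
      G \<kappa> (P \<kappa> x) (fd (P \<kappa>) x u) (fd (\<lambda>y. fd (P \<kappa>) y v) x a) = - 2 * (u \<bullet> v) * a $ 3 / (x $ 3)^3"
proof -
  note op = open_Dom[OF \<kappa>(1)]
  have 1: "((\<lambda>x. G \<kappa> (P \<kappa> x) (fd (P \<kappa>) x u) (fd (P \<kappa>) x v)) has_derivative
    (\<lambda>a. DG \<kappa> (P \<kappa> x) (fd (P \<kappa>) x a) (fd (P \<kappa>) x u) (fd (P \<kappa>) x v) +
      G \<kappa> (P \<kappa> x) (fd (\<lambda>y. fd (P \<kappa>) y u) x a) (fd (P \<kappa>) x v) +
      G \<kappa> (P \<kappa> x) (fd (P \<kappa>) x u) (fd (\<lambda>y. fd (P \<kappa>) y v) x a))) (at x)"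
    by (rule G_moving_has_derivative[OF \<kappa>(1,2) op P_in_cod P_has_derivative[OF \<kappa>]
          smooth_on_has_derivative[OF smooth_on_fd[OF smooth_P[OF \<kappa>(1)]] \<kappa>(2)]
          smooth_on_has_derivative[OF smooth_on_fd[OF smooth_P[OF \<kappa>(1)]] \<kappa>(2)]])
  have pos: "x $ 3 > 0" using upper_half_space_pos[OF DomD[OF \<kappa>(2)]] .
  have dz: "((\<lambda>x. x $ 3) has_derivative (\<lambda>a. a $ 3)) (at x)"
    by (rule bounded_linear.has_derivative[OF bounded_linear_vec_nth has_derivative_ident])
  have "((\<lambda>x. (u \<bullet> v) / (x $ 3)\<^sup>2) has_derivative (\<lambda>a. - 2 * (u \<bullet> v) * a $ 3 / (x $ 3)^3)) (at x)"
    using pos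
    by (auto intro!: derivative_eq_intros dz simp: power2_eq_square power3_eq_cube field_simps)
  then have "((\<lambda>x. G \<kappa> (P \<kappa> x) (fd (P \<kappa>) x u) (fd (P \<kappa>) x v)) has_derivative
      (\<lambda>a. - 2 * (u \<bullet> v) * a $ 3 / (x $ 3)^3)) (at x)"
    by (rule has_derivative_transform_within_open[OF _ op \<kappa>(2)]) (simp add: G_P[OF \<kappa>(1)])
  from has_derivative_unique[OF 1 this] show ?thesis by metis
qed

text \<open>Multiplication with the Gram matrix cancels its inverse in the Christoffel symbols and leaves
  derivatives of the metric.\<close>
lemma geodesic_equation_lowered:
  assumes \<kappa>: "\<kappa> \<in> A" "y \<in> cod_chart \<kappa>"
    and eq: "\<And>k. a $ k + (\<Sum>i\<in>UNIV. \<Sum>j\<in>UNIV. christoffel A h \<kappa> k i j y * v $ i * v $ j) = 0"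
  shows "G \<kappa> y a w + DG \<kappa> y v v w - 1/2 * DG \<kappa> y w v v = 0"
proof -
  let ?g = "gram A h \<kappa> y"
  have gnth: "gram A h \<kappa> z $ i $ j = G \<kappa> z (axis i 1) (axis j 1)" for z i j by (simp add: gram_def)
  have gv: "(?g *v u) $ i = G \<kappa> y (axis i 1) u" for u i
    using G_expand_right[OF \<kappa>, of "axis i 1" u]
    by (simp add: matrix_vector_mult_def sum_3 gnth mult.commute)
  have "u = 0" if "?g *v u = 0" for u
  proof (rule ccontr)
    assume "u \<noteq> 0"
    then have "G \<kappa> y u u > 0" using metric \<kappa> unfolding riemannian_metric_def by blast
    moreover have "G \<kappa> y u u = u \<bullet> (?g *v u)"
      using G_expand_left[OF \<kappa>, of u u] by (simp add: inner_real3 gv)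
    ultimately show False using that by simp
  qed
  then have "\<exists>B. B ** ?g = mat 1" by (simp add: matrix_left_invertible_ker)
  then have "invertible ?g" by (simp add: invertible_left_inverse)
  then have inv: "?g ** matrix_inv ?g = mat 1"
    unfolding invertible_def matrix_inv_def by (rule someI2_ex) blast
  define S where "S i j = (\<chi> l. DG \<kappa> y (axis i 1) (axis j 1) (axis l 1) +
    DG \<kappa> y (axis j 1) (axis i 1) (axis l 1) - DG \<kappa> y (axis l 1) (axis i 1) (axis j 1))" for i j
  have chr: "(\<chi> k. christoffel A h \<kappa> k i j y) = (1/2) *\<^sub>R (matrix_inv ?g *v S i j)" for i j
    by (simp add: vec_eq_iff christoffel_def partial_def gnth matrix_vector_mult_def S_def DG_def)
  have gchr: "?g *v (\<chi> k. christoffel A h \<kappa> k i j y) = (1/2) *\<^sub>R S i j" for i j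
    unfolding chr by (simp add: matrix_vector_mult_scaleR matrix_vector_mul_assoc inv)
  have "a + (\<Sum>i\<in>UNIV. \<Sum>j\<in>UNIV. (v $ i * v $ j) *\<^sub>R (\<chi> k. christoffel A h \<kappa> k i j y)) = 0"
    using eq by (simp add: vec_eq_iff ac_simps)
  then have "?g *v (a + (\<Sum>i\<in>UNIV. \<Sum>j\<in>UNIV. (v $ i * v $ j) *\<^sub>R (\<chi> k. christoffel A h \<kappa> k i j y))) = 0"
    by simp
  then have E: "?g *v a + (\<Sum>i\<in>UNIV. \<Sum>j\<in>UNIV. (v $ i * v $ j) *\<^sub>R (1/2) *\<^sub>R S i j) = 0"
    by (simp add: matrix_vector_right_distrib matrix_vector_mult_scaleR gchr sum_3)
  have l2: "DG \<kappa> y b v e = (\<Sum>j\<in>UNIV. v $ j * DG \<kappa> y b (axis j 1) e)" for b e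
    using linear_real3[OF DG_linear3[OF \<kappa>], of b e v] DG_sym[OF \<kappa>, of b _ e] by (simp add: sum_3)
  have l1: "DG \<kappa> y v b e = (\<Sum>i\<in>UNIV. v $ i * DG \<kappa> y (axis i 1) b e)" for b e
    using linear_real3[OF DG_linear1[OF \<kappa>], of v b e] by (simp add: sum_3)
  have l3: "DG \<kappa> y b e v = (\<Sum>i\<in>UNIV. v $ i * DG \<kappa> y b e (axis i 1))" for b e
    using linear_real3[OF DG_linear3[OF \<kappa>], of b e v] by (simp add: sum_3)
  have comp: "G \<kappa> y a (axis l 1) + DG \<kappa> y v v (axis l 1) - 1/2 * DG \<kappa> y (axis l 1) v v = 0" for l
  proof -
    have "(?g *v a) $ l + (\<Sum>i\<in>UNIV. \<Sum>j\<in>UNIV. (v $ i * v $ j) *\<^sub>R (1/2) *\<^sub>R S i j) $ l = 0"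
      using arg_cong[OF E, of "\<lambda>u. u $ l"] by simp
    moreover have "(\<Sum>i\<in>UNIV. \<Sum>j\<in>UNIV. (v $ i * v $ j) *\<^sub>R (1/2) *\<^sub>R S i j) $ l =
        DG \<kappa> y v v (axis l 1) - 1/2 * DG \<kappa> y (axis l 1) v v"
      unfolding l1 l2[of _ "axis l 1"] l2[of "axis l 1" v] l3[of "axis l 1" "axis _ 1"]
      by (simp add: S_def sum_3 algebra_simps)
    ultimately show ?thesis by (simp add: gv G_sym[OF \<kappa>, of a])
  qed
  have "linear (\<lambda>w. G \<kappa> y a w + DG \<kappa> y v v w - 1/2 * DG \<kappa> y w v v)"
    using G_bilinear[OF \<kappa>] DG_linear3[OF \<kappa>, of v v] DG_linear1[OF \<kappa>, of v v]
    by (auto simp: bilinear_def linear_iff algebra_simps)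
  from linear_real3[OF this, of w] show ?thesis by (simp only: comp) simp
qed

text \<open>A lift of a geodesic is a geodesic.  The geodesic equation with lowered index is paired with
  \<open>dp(w)\<close>, and the derivatives of the metric are eliminated by \<open>G_P_derivative\<close>.  All second
  derivatives of \<open>p\<close> cancel.\<close>
lemma geodesic_lift:
  assumes c: "geodesic X A h c"
    and f: "f ` {0..1} \<subseteq> U" "\<And>t. t \<in> {0..1} \<Longrightarrow> p (f t) = c t"
    and f1: "\<And>t. t \<in> {0..1} \<Longrightarrow> (f has_vector_derivative f1 t) (at t within {0..1})"
    and f2: "\<And>t. t \<in> {0..1} \<Longrightarrow> (f1 has_vector_derivative f2 t) (at t within {0..1})"
    and t: "t \<in> {0..1}"
  shows "f t $ 3 * (f2 t \<bullet> w) - 2 * (f1 t \<bullet> w) * f1 t $ 3 + (f1 t \<bullet> f1 t) * w $ 3 = 0"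
proof -
  have fU: "f t \<in> U" using f(1) t by blast
  obtain \<kappa> where \<kappa>: "\<kappa> \<in> A" "f t \<in> Dom \<kappa>" using Dom_exists[OF fU] by blast
  let ?I = "{0..1::real}" and ?J = "fd (P \<kappa>) (f t)" and ?y = "P \<kappa> (f t)"
  let ?K = "\<lambda>u. fd (\<lambda>y. fd (P \<kappa>) y u) (f t)"
  have yc: "?y \<in> cod_chart \<kappa>" using P_in_cod[OF \<kappa>(2)] .
  have ct: "\<kappa> \<in> charts_at A (c t)" using charts_at_DomI[OF \<kappa>] f(2)[OF t] by simp
  have cf: "continuous_on ?I f"
    using f1 by (intro continuous_on_vector_derivative) auto
  obtain d where d: "d > 0" "\<And>s. s \<in> ?I \<Longrightarrow> dist s t < d \<Longrightarrow> f s \<in> Dom \<kappa>"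
  proof -
    have "openin (top_of_set ?I) (?I \<inter> f -` Dom \<kappa>)"
      by (rule continuous_openin_preimage_gen[OF cf open_Dom[OF \<kappa>(1)]])
    moreover have "t \<in> ?I \<inter> f -` Dom \<kappa>" using t \<kappa> by blast
    ultimately obtain e where "e > 0" "ball t e \<inter> ?I \<subseteq> ?I \<inter> f -` Dom \<kappa>"
      unfolding openin_contains_ball by blast
    then show thesis using that[of e] by (auto simp: dist_commute subset_iff)
  qed
  define x' where "x' \<tau> = vector_derivative (coord \<kappa> \<circ> c) (at \<tau> within ?I)" for \<tau>
  have x'_eq: "x' s = fd (P \<kappa>) (f s) (f1 s)" if s: "s \<in> ?I" "f s \<in> Dom \<kappa>" for s
  proof -
    have "((\<lambda>s. P \<kappa> (f s)) has_vector_derivative fd (P \<kappa>) (f s) (f1 s)) (at s within ?I)"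
      using has_derivative_compose[OF f1[OF s(1), unfolded has_vector_derivative_def]
          P_has_derivative[OF \<kappa>(1) s(2)]] linear_scale[OF P_linear[OF \<kappa>(1) s(2)]]
      by (simp add: has_vector_derivative_def)
    then have "((coord \<kappa> \<circ> c) has_vector_derivative fd (P \<kappa>) (f s) (f1 s)) (at s within ?I)"
      by (rule has_vector_derivative_transform[OF s(1), rotated]) (simp add: f(2) P_def)
    then show ?thesis unfolding x'_def using vector_derivative_within[OF Icc_not_bot[OF s(1)]] by blast
  qed
  define Id where "Id = ?I \<inter> ball t d"
  have "((\<lambda>s. fd (P \<kappa>) (f s) (f1 s)) has_derivative
      (\<lambda>r. ?J (r *\<^sub>R f2 t) + ?K (f1 t) (r *\<^sub>R f1 t))) (at t within Id)"
    by (rule fd_moving_has_derivative[where f=f, OF open_Dom[OF \<kappa>(1)] smooth_P[OF \<kappa>(1)] \<kappa>(2)])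
       (use f1[OF t] f2[OF t] d t in \<open>auto simp: has_vector_derivative_def Id_def dist_commute
         intro: has_derivative_subset\<close>)
  then have "((\<lambda>s. fd (P \<kappa>) (f s) (f1 s)) has_vector_derivative ?J (f2 t) + ?K (f1 t) (f1 t))
      (at t within Id)"
    using linear_scale[OF P_linear[OF \<kappa>]]
      linear_scale[OF has_derivative_linear[OF smooth_on_has_derivative[OF smooth_on_fd[OF smooth_P[OF \<kappa>(1)]] \<kappa>(2)]]]
    by (simp add: has_vector_derivative_def scaleR_add_right)
  then have "(x' has_vector_derivative ?J (f2 t) + ?K (f1 t) (f1 t)) (at t within Id)"
    by (rule has_vector_derivative_transform[rotated 2])
       (use t d x'_eq in \<open>auto simp: Id_def dist_commute\<close>)
  moreover have "at t within Id = at t within ?I"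
    by (rule at_within_nhd[of _ "ball t d"]) (use d in \<open>auto simp: Id_def\<close>)
  ultimately have x'': "vector_derivative x' (at t within ?I) = ?J (f2 t) + ?K (f1 t) (f1 t)"
    using vector_derivative_within[OF Icc_not_bot[OF t]] by simp
  have "\<And>k. (?J (f2 t) + ?K (f1 t) (f1 t)) $ k +
      (\<Sum>i\<in>UNIV. \<Sum>j\<in>UNIV. christoffel A h \<kappa> k i j ?y * ?J (f1 t) $ i * ?J (f1 t) $ j) = 0"
    using c t ct x'' x'_eq[OF t \<kappa>(2)] f(2)[OF t] unfolding geodesic_def Let_def x'_def[abs_def] P_def
    by fastforce
  from geodesic_equation_lowered[OF \<kappa>(1) yc this, of "?J w"]
  have E: "G \<kappa> ?y (?J (f2 t)) (?J w) + G \<kappa> ?y (?K (f1 t) (f1 t)) (?J w) +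
      DG \<kappa> ?y (?J (f1 t)) (?J (f1 t)) (?J w) - 1/2 * DG \<kappa> ?y (?J w) (?J (f1 t)) (?J (f1 t)) = 0"
    using G_bilinear[OF \<kappa>(1) yc] by (simp add: bilinear_ladd)
  have sym: "?K u v = ?K v u" for u v
    by (rule fd_commute[OF open_Dom[OF \<kappa>(1)] smooth_P[OF \<kappa>(1)] \<kappa>(2)])
  have pos: "f t $ 3 > 0" using upper_half_space_pos[OF fU] .
  have "(f2 t \<bullet> w) / (f t $ 3)\<^sup>2 - 2 * (f1 t \<bullet> w) * f1 t $ 3 / (f t $ 3)^3 +
      (f1 t \<bullet> f1 t) * w $ 3 / (f t $ 3)^3 = 0"
    using E G_P_derivative[OF \<kappa>, of "f1 t" "f1 t" w] G_P_derivative[OF \<kappa>, of w "f1 t" "f1 t"]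
      G_P[OF \<kappa>, of "f2 t" w] sym[of w "f1 t"] G_sym[OF \<kappa>(1) yc, of "?K (f1 t) w"]
    by (simp add: algebra_simps)
  moreover have "(f t $ 3 * (f2 t \<bullet> w) - 2 * (f1 t \<bullet> w) * f1 t $ 3 + (f1 t \<bullet> f1 t) * w $ 3) / (f t $ 3)^3 =
      (f2 t \<bullet> w) / (f t $ 3)\<^sup>2 - 2 * (f1 t \<bullet> w) * f1 t $ 3 / (f t $ 3)^3 +
      (f1 t \<bullet> f1 t) * w $ 3 / (f t $ 3)^3"
    using pos by (simp add: add_divide_distrib diff_divide_distrib power2_eq_square power3_eq_cube)
  ultimately show ?thesis using pos by simp
qed

end

section \<open>The second variation of the energy in the half space\<close>

definition slab :: "real \<Rightarrow> (real \<times> real \<times> real) set" where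
  "slab \<delta> = {-\<delta><..<\<delta>} \<times> {-\<delta><..<\<delta>} \<times> {0..1}"

lemma thick_slab: "thick (slab \<delta>)"
  unfolding slab_def by (intro thick_Times thick_open thick_Icc) auto

lemma convex_slab: "convex (slab \<delta>)"
  unfolding slab_def by (intro convex_Times) auto

abbreviation "ds \<delta> f x \<equiv> dw (slab \<delta>) f x (1, 0, 0)"
abbreviation "dr \<delta> f x \<equiv> dw (slab \<delta>) f x (0, 1, 0)"
abbreviation "dt \<delta> f x \<equiv> dw (slab \<delta>) f x (0, 0, 1)"

lemma dw_cong:
  assumes "\<And>x. x \<in> S \<Longrightarrow> f x = g x" "x \<in> S"
  shows "dw S f x = dw S g x"
proof -
  have "(f has_derivative D) (at x within S) \<longleftrightarrow> (g has_derivative D) (at x within S)" for D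
    using has_derivative_transform[OF assms(2)] assms(1) by metis
  then show ?thesis unfolding frechet_derivative_def by simp
qed

lemma partial_derivative:
  fixes f :: "'e::euclidean_space \<Rightarrow> 'f::real_normed_vector" and k :: "real \<Rightarrow> 'e"
  assumes "thick S" "smooth_in S f" "k ` J \<subseteq> S" "\<tau> \<in> J"
    and "(k has_vector_derivative v) (at \<tau> within J)"
  shows "((\<lambda>\<tau>. f (k \<tau>)) has_vector_derivative dw S f (k \<tau>) v) (at \<tau> within J)"
proof -
  have d: "(f has_derivative dw S f (k \<tau>)) (at (k \<tau>) within S)"
    using smooth_in_has_derivative[OF assms(1,2)] assms(3,4) by blast
  then have "(f has_derivative dw S f (k \<tau>)) (at (k \<tau>) within k ` J)"
    using assms(3) has_derivative_subset by blast
  from has_derivative_in_compose[OF assms(5)[unfolded has_vector_derivative_def] this]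
  show ?thesis
    using linear_scale[OF has_derivative_linear[OF d]] by (simp add: has_vector_derivative_def)
qed

lemma slab_partials:
  assumes f: "smooth_in (slab \<delta>) f" and x: "(s, r, t) \<in> slab \<delta>"
  shows "((\<lambda>s. f (s, r, t)) has_vector_derivative ds \<delta> f (s, r, t)) (at s)"
    and "((\<lambda>r. f (s, r, t)) has_vector_derivative dr \<delta> f (s, r, t)) (at r)"
    and "((\<lambda>t. f (s, r, t)) has_vector_derivative dt \<delta> f (s, r, t)) (at t within {0..1})"
proof -
  have pd: "((\<lambda>\<tau>. f (k \<tau>)) has_vector_derivative dw (slab \<delta>) f (k \<tau>) v) (at \<tau> within J)"
    if "k ` J \<subseteq> slab \<delta>" "\<tau> \<in> J" "(k has_vector_derivative v) (at \<tau> within J)" for k J \<tau> v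
    by (rule partial_derivative[OF thick_slab f that])
  have k: "((\<lambda>s. (s, r, t)) has_vector_derivative (1, 0, 0)) (at s within J)"
    "((\<lambda>r. (s, r, t)) has_vector_derivative (0, 1, 0)) (at r within J)"
    "((\<lambda>t. (s, r, t)) has_vector_derivative (0, 0, 1)) (at t within J)" for J
    unfolding has_vector_derivative_def
    by (auto intro!: derivative_eq_intros simp: zero_prod_def[symmetric])
  have "((\<lambda>s. f (s, r, t)) has_vector_derivative ds \<delta> f (s, r, t)) (at s within {-\<delta><..<\<delta>})"
    by (rule pd[of "\<lambda>s. (s, r, t)", OF _ _ k(1)]) (use x in \<open>auto simp: slab_def\<close>)
  then show "((\<lambda>s. f (s, r, t)) has_vector_derivative ds \<delta> f (s, r, t)) (at s)"
    using x at_within_open[of s "{-\<delta><..<\<delta>}"] by (simp add: slab_def)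
  have "((\<lambda>r. f (s, r, t)) has_vector_derivative dr \<delta> f (s, r, t)) (at r within {-\<delta><..<\<delta>})"
    by (rule pd[of "\<lambda>r. (s, r, t)", OF _ _ k(2)]) (use x in \<open>auto simp: slab_def\<close>)
  then show "((\<lambda>r. f (s, r, t)) has_vector_derivative dr \<delta> f (s, r, t)) (at r)"
    using x at_within_open[of r "{-\<delta><..<\<delta>}"] by (simp add: slab_def)
  show "((\<lambda>t. f (s, r, t)) has_vector_derivative dt \<delta> f (s, r, t)) (at t within {0..1})"
    by (rule pd[of "\<lambda>t. (s, r, t)", OF _ _ k(3)]) (use x in \<open>auto simp: slab_def\<close>)
qed

text \<open>Both differentiations are performed under the integral sign.\<close>
lemma second_derivative_integral:
  fixes l :: "real \<times> real \<times> real \<Rightarrow> real"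
  assumes l: "smooth_in (slab \<delta>) l" and \<delta>: "\<delta> > 0"
  shows "((\<lambda>s. deriv (\<lambda>r. integral {0..1} (\<lambda>t. l (s, r, t))) 0) has_real_derivative
    integral {0..1} (\<lambda>t. ds \<delta> (dr \<delta> l) (0, 0, t))) (at 0)"
proof -
  let ?I = "{-\<delta><..<\<delta>}"
  note lr = smooth_in_dw[OF thick_slab l, of "(0, 1, 0)"]
  note lrs = smooth_in_dw[OF thick_slab lr, of "(1, 0, 0)"]
  have cont: "continuous_on ({0..1}) (\<lambda>t. f (s, r, t))" if "smooth_in (slab \<delta>) f" "s \<in> ?I" "r \<in> ?I"
    for f :: "real \<times> real \<times> real \<Rightarrow> real" and s r
    by (rule continuous_on_compose2[OF smooth_in_continuous[OF that(1)]])
       (use that in \<open>auto simp: slab_def intro!: continuous_intros\<close>)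
  have 1: "deriv (\<lambda>r. integral {0..1} (\<lambda>t. l (s, r, t))) 0 = integral {0..1} (\<lambda>t. dr \<delta> l (s, 0, t))"
    if s: "s \<in> ?I" for s
  proof -
    have "((\<lambda>r. integral (cbox 0 1) (\<lambda>t. l (s, r, t))) has_field_derivative
        integral (cbox 0 1) (\<lambda>t. dr \<delta> l (s, 0, t))) (at 0 within ?I)"
    proof (rule leibniz_rule_field_derivative[where f="\<lambda>r t. l (s, r, t)" and fx="\<lambda>r t. dr \<delta> l (s, r, t)"])
      show "((\<lambda>r. l (s, r, t)) has_field_derivative dr \<delta> l (s, r, t)) (at r within ?I)"
        if "r \<in> ?I" "t \<in> cbox 0 1" for r t
        using slab_partials(2)[OF l, of s r t] s that has_vector_derivative_at_within
        unfolding slab_def has_real_derivative_iff_has_vector_derivative by auto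
      show "(\<lambda>t. l (s, r, t)) integrable_on cbox 0 1" if "r \<in> ?I" for r
        using integrable_continuous_interval[OF cont[OF l s that]] by simp
      show "continuous_on (?I \<times> cbox 0 1) (\<lambda>(r, t). dr \<delta> l (s, r, t))"
        unfolding case_prod_unfold
        by (rule continuous_on_compose2[OF smooth_in_continuous[OF lr]])
           (use s in \<open>auto simp: slab_def intro!: continuous_intros\<close>)
    qed (use \<delta> in auto)
    then have "((\<lambda>r. integral {0..1} (\<lambda>t. l (s, r, t))) has_field_derivative
        integral {0..1} (\<lambda>t. dr \<delta> l (s, 0, t))) (at 0)"
      using at_within_open[of 0 ?I] \<delta> by simp
    then show ?thesis by (rule DERIV_imp_deriv)
  qed
  have "((\<lambda>s. integral (cbox 0 1) (\<lambda>t. dr \<delta> l (s, 0, t))) has_field_derivative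
      integral (cbox 0 1) (\<lambda>t. ds \<delta> (dr \<delta> l) (0, 0, t))) (at 0 within ?I)"
  proof (rule leibniz_rule_field_derivative[where f="\<lambda>s t. dr \<delta> l (s, 0, t)"
        and fx="\<lambda>s t. ds \<delta> (dr \<delta> l) (s, 0, t)"])
    show "((\<lambda>s. dr \<delta> l (s, 0, t)) has_field_derivative ds \<delta> (dr \<delta> l) (s, 0, t)) (at s within ?I)"
      if "s \<in> ?I" "t \<in> cbox 0 1" for s t
      using slab_partials(1)[OF lr, of s 0 t] \<delta> that has_vector_derivative_at_within
      unfolding slab_def has_real_derivative_iff_has_vector_derivative by auto
    show "(\<lambda>t. dr \<delta> l (s, 0, t)) integrable_on cbox 0 1" if "s \<in> ?I" for s
      using integrable_continuous_interval[OF cont[OF lr that, of 0]] \<delta> by simp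
    show "continuous_on (?I \<times> cbox 0 1) (\<lambda>(s, t). ds \<delta> (dr \<delta> l) (s, 0, t))"
      unfolding case_prod_unfold
      by (rule continuous_on_compose2[OF smooth_in_continuous[OF lrs]])
         (use \<delta> in \<open>auto simp: slab_def intro!: continuous_intros\<close>)
  qed (use \<delta> in auto)
  then have "((\<lambda>s. integral {0..1} (\<lambda>t. dr \<delta> l (s, 0, t))) has_field_derivative
      integral {0..1} (\<lambda>t. ds \<delta> (dr \<delta> l) (0, 0, t))) (at 0)"
    using at_within_open[of 0 ?I] \<delta> by simp
  then show ?thesis
    by (rule has_field_derivative_transform_within_open[of _ _ _ ?I]) (use 1 \<delta> in auto)
qed

lemma quotient_derivative:
  fixes N M w z :: "real \<Rightarrow> real"
  assumes N: "(N has_real_derivative N') (at s)" and M: "(M has_real_derivative M') (at s)"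
    and w: "(w has_real_derivative w') (at s)" and z: "(z has_real_derivative z') (at s)" "z s > 0"
  shows "((\<lambda>s. N s / (z s)\<^sup>2 - M s * w s / (z s)^3) has_real_derivative
    N' / (z s)\<^sup>2 - 2 * N s * z' / (z s)^3 - (M' * w s + M s * w') / (z s)^3 + 3 * M s * w s * z' / (z s)^4)
    (at s)"
  by (rule DERIV_cong[OF DERIV_diff[OF DERIV_divide[OF N DERIV_power[OF z(1), of 2]]
          DERIV_divide[OF DERIV_mult[OF M w] DERIV_power[OF z(1), of 3]]]])
     (use z(2) in \<open>simp_all add: divide_simps\<close>, simp add: algebra_simps eval_nat_numeral)

lemma boundary_term_derivative:
  fixes y v z :: "real \<Rightarrow> real"
  assumes y: "(y has_real_derivative y') (at t within S)" and v: "(v has_real_derivative v') (at t within S)"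
    and z: "(z has_real_derivative - L * z t) (at t within S)" "z t > 0"
  shows "((\<lambda>t. - L * y t / z t + L * (v t)\<^sup>2 / (z t)\<^sup>2) has_real_derivative
    - L * y' / z t - L\<^sup>2 * y t / z t + 2 * L * v t * v' / (z t)\<^sup>2 + 2 * L\<^sup>2 * (v t)\<^sup>2 / (z t)\<^sup>2)
    (at t within S)"
  by (rule DERIV_cong[OF DERIV_add[OF DERIV_divide[OF DERIV_cmult[OF y, of "- L"] z(1)]
          DERIV_divide[OF DERIV_cmult[OF DERIV_power[OF v, of 2], of L] DERIV_power[OF z(1), of 2]]]])
     (use z(2) in \<open>simp_all add: divide_simps\<close>, simp add: algebra_simps eval_nat_numeral)

text \<open>The geodesic \<open>c\<close> runs from the horosphere \<open>z = z0\<close> down to the top \<open>Q + d e\<^sub>3\<close> of the horosphere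
  \<open>|x - Q|\<^sup>2 = d z\<close>, a Euclidean sphere of diameter \<open>d\<close>.\<close>
locale vertical_segment =
  fixes y0 :: "real^3" and z0 L d :: real and Q :: "real^3" and c :: "real \<Rightarrow> real^3"
  assumes seg_z0: "z0 > 0" "y0 $ 3 = z0" and seg_L: "L > 0"
    and seg_d: "d = z0 * exp (- L)" and seg_Q: "Q = y0 - z0 *\<^sub>R axis 3 1"
    and seg_c: "c = (\<lambda>t. y0 + (z0 * (exp (- L * t) - 1)) *\<^sub>R axis 3 1)"
begin

lemma d_pos: "d > 0" using seg_d seg_z0 by simp

lemma c_nth: "c t $ 1 = y0 $ 1" "c t $ 2 = y0 $ 2" "c t $ 3 = z0 * exp (- L * t)"
  using seg_z0 by (simp_all add: seg_c axis_def algebra_simps)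

lemma c_0: "c 0 = y0" by (simp add: seg_c)

lemma c_1: "c 1 = Q + d *\<^sub>R axis 3 1" by (simp add: seg_c seg_d seg_Q algebra_simps)

lemma Q_3: "Q $ 3 = 0" using seg_z0 by (simp add: seg_Q axis_def)

lemma c_in: "c t \<in> upper_half_space" using seg_z0 by (simp add: upper_half_space_def c_nth)

lemma c_3_ge: "t \<le> 1 \<Longrightarrow> c t $ 3 \<ge> d" using seg_z0 seg_L by (simp add: c_nth seg_d)

lemma c_smooth: "smooth_on UNIV c"
  unfolding seg_c diff_conv_add_uminus
  by (intro smooth_on_add smooth_on_scaleR smooth_on_mult smooth_on_exp smooth_on_const smooth_on_ident)
     auto

lemma c_derivative: "(c has_vector_derivative (- L * (z0 * exp (- L * t))) *\<^sub>R axis 3 1) (at t within S)"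
  unfolding seg_c by (auto intro!: derivative_eq_intros simp: has_vector_derivative_def algebra_simps)

text \<open>Both parameters move \<open>c\<close> in the direction of the same field \<open>V\<close>: the diagonal values of a definite
  form decide its index and its nullity.\<close>
definition lifted_variation :: "real \<Rightarrow> (real \<Rightarrow> real^3) \<Rightarrow> (real \<times> real \<times> real \<Rightarrow> real^3) \<Rightarrow> bool" where
  "lifted_variation \<delta> V \<Phi> \<longleftrightarrow> \<delta> > 0 \<and> smooth_in (slab \<delta>) \<Phi> \<and> \<Phi> ` slab \<delta> \<subseteq> upper_half_space \<and>
    (\<forall>t\<in>{0..1}. \<Phi> (0, 0, t) = c t \<and> ds \<delta> \<Phi> (0, 0, t) = V t \<and> dr \<delta> \<Phi> (0, 0, t) = V t) \<and>
    (\<forall>s\<in>{-\<delta><..<\<delta>}. \<forall>r\<in>{-\<delta><..<\<delta>}. \<Phi> (s, r, 0) $ 3 = z0 \<and>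
      (\<Phi> (s, r, 1) - Q) \<bullet> (\<Phi> (s, r, 1) - Q) = d * \<Phi> (s, r, 1) $ 3)"

definition lagrangian :: "real \<Rightarrow> (real \<times> real \<times> real \<Rightarrow> real^3) \<Rightarrow> real \<times> real \<times> real \<Rightarrow> real" where
  "lagrangian \<delta> \<Phi> x = 1/2 * ((dt \<delta> \<Phi> x \<bullet> dt \<delta> \<Phi> x) / (\<Phi> x $ 3)\<^sup>2)"

text \<open>The form of the second derivative after completion of the square in \<open>V\<^sub>3'\<close> and \<open>V\<^sub>3\<close>.\<close>
definition integrand :: "(real \<Rightarrow> real^3) \<Rightarrow> (real \<Rightarrow> real^3) \<Rightarrow> real \<Rightarrow> real" where
  "integrand V V' t = ((V' t $ 1)\<^sup>2 + (V' t $ 2)\<^sup>2 + (V' t $ 3 + L * V t $ 3)\<^sup>2) / (c t $ 3)\<^sup>2"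

definition quadratic_form :: "(real \<Rightarrow> real^3) \<Rightarrow> (real \<Rightarrow> real^3) \<Rightarrow> real" where
  "quadratic_form V V' = integral {0..1} (integrand V V') + 2 * L * (V 1 \<bullet> V 1) / d\<^sup>2"

text \<open>Pointwise, the second derivative of the Lagrangian is the integrand of the quadratic form plus
  the derivative of \<open>B = - L Y\<^sub>3/z + L V\<^sub>3\<^sup>2/z\<^sup>2\<close>, where \<open>Y = \<partial>\<^sub>s\<partial>\<^sub>r\<Phi>\<close>.  Differentiating the equations of
  the two horospheres twice gives \<open>B 0 = 0\<close> and \<open>B 1 = 2 L |V 1|\<^sup>2/d\<^sup>2\<close>.\<close>
proposition second_variation_lifted:
  assumes lv: "lifted_variation \<delta> V \<Phi>"
    and V': "\<And>t. t \<in> {0..1} \<Longrightarrow> (V has_vector_derivative V' t) (at t within {0..1})"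
  shows "((\<lambda>s. deriv (\<lambda>r. integral {0..1} (\<lambda>t. lagrangian \<delta> \<Phi> (s, r, t))) 0) has_real_derivative
    quadratic_form V V') (at 0)"
proof -
  have \<delta>: "\<delta> > 0" and sm: "smooth_in (slab \<delta>) \<Phi>" and in_U: "\<And>x. x \<in> slab \<delta> \<Longrightarrow> \<Phi> x $ 3 > 0"
    and \<Phi>0: "\<And>t. t \<in> {0..1} \<Longrightarrow> \<Phi> (0, 0, t) = c t"
    and Vs: "\<And>t. t \<in> {0..1} \<Longrightarrow> ds \<delta> \<Phi> (0, 0, t) = V t"
    and Vr: "\<And>t. t \<in> {0..1} \<Longrightarrow> dr \<delta> \<Phi> (0, 0, t) = V t"
    and b0: "\<And>s r. s \<in> {-\<delta><..<\<delta>} \<Longrightarrow> r \<in> {-\<delta><..<\<delta>} \<Longrightarrow> \<Phi> (s, r, 0) $ 3 = z0"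
    and b1: "\<And>s r. s \<in> {-\<delta><..<\<delta>} \<Longrightarrow> r \<in> {-\<delta><..<\<delta>} \<Longrightarrow>
      (\<Phi> (s, r, 1) - Q) \<bullet> (\<Phi> (s, r, 1) - Q) = d * \<Phi> (s, r, 1) $ 3"
    using lv upper_half_space_pos unfolding lifted_variation_def by blast+
  note sd = smooth_in_dw[OF thick_slab]
  define \<Phi>t where "\<Phi>t = dt \<delta> \<Phi>"
  define \<Phi>r where "\<Phi>r = dr \<delta> \<Phi>"
  define \<Phi>tr where "\<Phi>tr = dr \<delta> \<Phi>t"
  define Y where "Y t = ds \<delta> \<Phi>r (0, 0, t)" for t
  have sms: "smooth_in (slab \<delta>) \<Phi>t" "smooth_in (slab \<delta>) \<Phi>r" "smooth_in (slab \<delta>) \<Phi>tr"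
    unfolding \<Phi>t_def \<Phi>r_def \<Phi>tr_def by (intro sd sm)+
  have sl: "smooth_in (slab \<delta>) (lagrangian \<delta> \<Phi>)"
    unfolding smooth_in_def lagrangian_def
  proof
    fix x assume x: "x \<in> slab \<delta>"
    have 1: "smooth_at (slab \<delta>) x \<Phi>" "smooth_at (slab \<delta>) x \<Phi>t" using sm sms x by (auto simp: smooth_in_def)
    have 2: "smooth_at (slab \<delta>) x (\<lambda>x. \<Phi> x $ 3 * \<Phi> x $ 3)"
      by (intro smooth_at_mult smooth_at_vec_nth 1 x)
    have "smooth_at (slab \<delta>) x (\<lambda>x. 1/2 * ((\<Phi>t x \<bullet> \<Phi>t x) * inverse (\<Phi> x $ 3 * \<Phi> x $ 3)))"
      by (intro smooth_at_mult smooth_at_const smooth_at_inner smooth_at_inverse 1 2 x)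
         (use in_U[OF x] in auto)
    then show "smooth_at (slab \<delta>) x (\<lambda>x. 1/2 * ((dt \<delta> \<Phi> x \<bullet> dt \<delta> \<Phi> x) / (\<Phi> x $ 3)\<^sup>2))"
      by (rule smooth_at_cong[OF _ open_UNIV UNIV_I])
         (simp only: \<Phi>t_def power2_eq_square divide_inverse)
  qed
  have nth: "((\<lambda>x. f x $ i) has_real_derivative D $ i) F" if "(f has_vector_derivative D) F"
    for f :: "real \<Rightarrow> real^3" and D F i
    using bounded_linear.has_vector_derivative[OF bounded_linear_vec_nth that]
    by (simp add: has_real_derivative_iff_has_vector_derivative)
  have inner: "((\<lambda>x. f x \<bullet> g x) has_real_derivative f a \<bullet> g' + f' \<bullet> g a) (at a within S)"
    if "(f has_vector_derivative f') (at a within S)" "(g has_vector_derivative g') (at a within S)"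
    for f g :: "real \<Rightarrow> real^3" and f' g' a S
    unfolding has_field_derivative_def
    by (rule has_derivative_eq_rhs[OF has_derivative_inner[OF that[unfolded has_vector_derivative_def]]])
       (simp add: fun_eq_iff algebra_simps)
  have lag: "lagrangian \<delta> \<Phi> x = 1/2 * ((\<Phi>t x \<bullet> \<Phi>t x) / (\<Phi> x $ 3)\<^sup>2)" for x
    by (simp only: lagrangian_def \<Phi>t_def)
  have lr: "dr \<delta> (lagrangian \<delta> \<Phi>) x = (\<Phi>t x \<bullet> \<Phi>tr x) / (\<Phi> x $ 3)\<^sup>2 -
      (\<Phi>t x \<bullet> \<Phi>t x) * \<Phi>r x $ 3 / (\<Phi> x $ 3)^3" if x: "x \<in> slab \<delta>" for x
  proof -
    obtain s r t where x': "x = (s, r, t)" by (metis prod_cases3)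
    note xs = x[unfolded x']
    have z: "\<Phi> (s, r, t) $ 3 > 0" using in_U xs by blast
    note d1 = inner[OF slab_partials(2)[OF sms(1) xs] slab_partials(2)[OF sms(1) xs]]
    note d2 = nth[OF slab_partials(2)[OF sm xs], of 3]
    have "((\<lambda>r. lagrangian \<delta> \<Phi> (s, r, t)) has_real_derivative
        (\<Phi>t x \<bullet> \<Phi>tr x) / (\<Phi> x $ 3)\<^sup>2 - (\<Phi>t x \<bullet> \<Phi>t x) * \<Phi>r x $ 3 / (\<Phi> x $ 3)^3) (at r)"
      unfolding lag x'
      using z by (auto intro!: derivative_eq_intros d1 d2
          simp: \<Phi>tr_def \<Phi>r_def inner_commute power2_eq_square power3_eq_cube field_simps)
    moreover have "((\<lambda>r. lagrangian \<delta> \<Phi> (s, r, t)) has_real_derivative dr \<delta> (lagrangian \<delta> \<Phi>) x) (at r)"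
      using slab_partials(2)[OF sl xs] by (simp add: has_real_derivative_iff_has_vector_derivative x')
    ultimately show ?thesis by (rule DERIV_unique[symmetric])
  qed
  have in_slab: "(s, r, t) \<in> slab \<delta>" if "s \<in> {-\<delta><..<\<delta>}" "r \<in> {-\<delta><..<\<delta>}" "t \<in> {0..1}" for s r t
    using that by (simp add: slab_def)
  define B where "B t = - L * Y t $ 3 / c t $ 3 + L * (V t $ 3)\<^sup>2 / (c t $ 3)\<^sup>2" for t
  have tr: "\<Phi>tr x = dt \<delta> \<Phi>r x" if "x \<in> slab \<delta>" for x
    unfolding \<Phi>tr_def \<Phi>t_def \<Phi>r_def by (rule dw_commute[OF thick_slab sm that])
  have main: "ds \<delta> (dr \<delta> (lagrangian \<delta> \<Phi>)) (0, 0, t) = integrand V V' t + B' t \<and>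
      (B has_real_derivative B' t) (at t within {0..1})"
    if t: "t \<in> {0..1}" and B': "B' = (\<lambda>t. ds \<delta> (dr \<delta> (lagrangian \<delta> \<Phi>)) (0, 0, t) - integrand V V' t)"
    for t B'
  proof -
    have x0: "(0, 0, t) \<in> slab \<delta>" using in_slab \<delta> t by simp
    let ?z = "c t $ 3"
    have z: "?z > 0" "\<Phi> (0, 0, t) $ 3 > 0" using in_U[OF x0] \<Phi>0[OF t] by auto
    define Y' where "Y' = dt \<delta> (ds \<delta> \<Phi>r) (0, 0, t)"
    have Y: "(Y has_vector_derivative Y') (at t within {0..1})"
      unfolding Y_def Y'_def by (rule slab_partials(3)[OF sd[OF sms(2)] x0])
    have c': "\<Phi>t (0, 0, t) = (- L * ?z) *\<^sub>R axis 3 1"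
    proof -
      have "((\<lambda>t. \<Phi> (0, 0, t)) has_vector_derivative \<Phi>t (0, 0, t)) (at t within {0..1})"
        unfolding \<Phi>t_def by (rule slab_partials(3)[OF sm x0])
      then have "(c has_vector_derivative \<Phi>t (0, 0, t)) (at t within {0..1})"
        by (rule has_vector_derivative_transform[OF t, rotated]) (simp add: \<Phi>0)
      from vector_derivative_unique_within[OF Icc_not_bot[OF t] this c_derivative]
      show ?thesis by (simp add: c_nth)
    qed
    have ts: "ds \<delta> \<Phi>t (0, 0, t) = V' t"
    proof -
      have "((\<lambda>t. ds \<delta> \<Phi> (0, 0, t)) has_vector_derivative dt \<delta> (ds \<delta> \<Phi>) (0, 0, t)) (at t within {0..1})"
        by (rule slab_partials(3)[OF sd[OF sm] x0])
      then have "(V has_vector_derivative dt \<delta> (ds \<delta> \<Phi>) (0, 0, t)) (at t within {0..1})"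
        by (rule has_vector_derivative_transform[OF t, rotated]) (simp add: Vs)
      from vector_derivative_unique_within[OF Icc_not_bot[OF t] this V'[OF t]]
      show ?thesis unfolding \<Phi>t_def dw_commute[OF thick_slab sm x0, of "(0,0,1)"] .
    qed
    have tr0: "\<Phi>tr (0, 0, t) = V' t"
    proof -
      have "((\<lambda>t. dr \<delta> \<Phi> (0, 0, t)) has_vector_derivative dt \<delta> (dr \<delta> \<Phi>) (0, 0, t)) (at t within {0..1})"
        by (rule slab_partials(3)[OF sd[OF sm] x0])
      then have "(V has_vector_derivative dt \<delta> (dr \<delta> \<Phi>) (0, 0, t)) (at t within {0..1})"
        by (rule has_vector_derivative_transform[OF t, rotated]) (simp add: Vr)
      from vector_derivative_unique_within[OF Icc_not_bot[OF t] this V'[OF t]]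
      show ?thesis using tr[OF x0] by (simp add: \<Phi>r_def)
    qed
    have trs: "ds \<delta> \<Phi>tr (0, 0, t) = Y'"
    proof -
      have "dw (slab \<delta>) \<Phi>tr (0, 0, t) = dw (slab \<delta>) (dt \<delta> \<Phi>r) (0, 0, t)"
        by (rule dw_cong[OF tr x0])
      then show ?thesis unfolding Y'_def using dw_commute[OF thick_slab sms(2) x0] by metis
    qed
    note dt1 = slab_partials(1)[OF sms(1) x0, unfolded ts]
    note dtr1 = slab_partials(1)[OF sms(3) x0, unfolded trs]
    note dz = nth[OF slab_partials(1)[OF sm x0, unfolded Vs[OF t]], of 3]
    note dr1 = nth[OF slab_partials(1)[OF sms(2) x0, folded Y_def], of 3]
    let ?D = "(V' t \<bullet> V' t + (- L * ?z) * Y' $ 3) / ?z\<^sup>2 - 4 * ((- L * ?z) * V' t $ 3) * V t $ 3 / ?z^3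
        - (L * ?z)\<^sup>2 * Y t $ 3 / ?z^3 + 3 * (L * ?z)\<^sup>2 * (V t $ 3)\<^sup>2 / ?z^4"
    have "((\<lambda>s. (\<Phi>t (s, 0, t) \<bullet> \<Phi>tr (s, 0, t)) / (\<Phi> (s, 0, t) $ 3)\<^sup>2 -
        (\<Phi>t (s, 0, t) \<bullet> \<Phi>t (s, 0, t)) * \<Phi>r (s, 0, t) $ 3 / (\<Phi> (s, 0, t) $ 3)^3)
        has_real_derivative ?D) (at 0)"
    proof (rule DERIV_cong[OF quotient_derivative[OF inner[OF dt1 dtr1] inner[OF dt1 dt1] dr1 dz z(2)]])
      have e: "\<Phi>r (0, 0, t) = V t" using Vr[OF t] by (simp add: \<Phi>r_def)
      show "(\<Phi>t (0, 0, t) \<bullet> Y' + V' t \<bullet> \<Phi>tr (0, 0, t)) / (\<Phi> (0, 0, t) $ 3)\<^sup>2 -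
          2 * (\<Phi>t (0, 0, t) \<bullet> \<Phi>tr (0, 0, t)) * V t $ 3 / (\<Phi> (0, 0, t) $ 3)^3 -
          ((\<Phi>t (0, 0, t) \<bullet> V' t + V' t \<bullet> \<Phi>t (0, 0, t)) * \<Phi>r (0, 0, t) $ 3 +
            \<Phi>t (0, 0, t) \<bullet> \<Phi>t (0, 0, t) * Y t $ 3) / (\<Phi> (0, 0, t) $ 3)^3 +
          3 * (\<Phi>t (0, 0, t) \<bullet> \<Phi>t (0, 0, t)) * \<Phi>r (0, 0, t) $ 3 * V t $ 3 / (\<Phi> (0, 0, t) $ 3)^4 = ?D"
        unfolding e c' tr0 \<Phi>0[OF t] using z(1)
        by (simp add: inner_axis inner_axis' divide_simps) (simp add: algebra_simps eval_nat_numeral)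
    qed
    then have "((\<lambda>s. dr \<delta> (lagrangian \<delta> \<Phi>) (s, 0, t)) has_real_derivative ?D) (at 0)"
      by (rule has_field_derivative_transform_within_open[of _ _ _ "{-\<delta><..<\<delta>}"])
         (use lr in_slab \<delta> t in auto)
    moreover have "((\<lambda>s. dr \<delta> (lagrangian \<delta> \<Phi>) (s, 0, t)) has_real_derivative
        ds \<delta> (dr \<delta> (lagrangian \<delta> \<Phi>)) (0, 0, t)) (at 0)"
      using slab_partials(1)[OF sd[OF sl] x0] by (simp add: has_real_derivative_iff_has_vector_derivative)
    ultimately have lrs: "ds \<delta> (dr \<delta> (lagrangian \<delta> \<Phi>)) (0, 0, t) = ?D" by (rule DERIV_unique[symmetric])
    have dc: "((\<lambda>t. c t $ 3) has_real_derivative - L * ?z) (at t within {0..1})"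
      using nth[OF c_derivative, of 3 t "{0..1}"] by (simp add: c_nth axis_def)
    have "(B has_real_derivative - L * Y' $ 3 / ?z - L\<^sup>2 * Y t $ 3 / ?z +
        2 * L * V t $ 3 * V' t $ 3 / ?z\<^sup>2 + 2 * L\<^sup>2 * (V t $ 3)\<^sup>2 / ?z\<^sup>2) (at t within {0..1})"
      unfolding B_def[abs_def] by (rule boundary_term_derivative[OF nth[OF Y] nth[OF V'[OF t]] dc z(1)])
    moreover have "- L * Y' $ 3 / ?z - L\<^sup>2 * Y t $ 3 / ?z + 2 * L * V t $ 3 * V' t $ 3 / ?z\<^sup>2 +
        2 * L\<^sup>2 * (V t $ 3)\<^sup>2 / ?z\<^sup>2 = ?D - integrand V V' t"
      unfolding integrand_def inner_real3 using z
      by (simp add: divide_simps) (simp add: algebra_simps eval_nat_numeral)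
    ultimately show ?thesis by (simp add: B' lrs)
  qed
  define B' where "B' = (\<lambda>t. ds \<delta> (dr \<delta> (lagrangian \<delta> \<Phi>)) (0, 0, t) - integrand V V' t)"
  have "(B has_vector_derivative B' t) (at t within {0..1})" if "t \<in> {0..1}" for t
    using main[OF that B'_def] by (simp add: has_real_derivative_iff_has_vector_derivative)
  then have iB: "(B' has_integral (B 1 - B 0)) {0..1}"
    by (intro fundamental_theorem_of_calculus) auto
  have "continuous_on {0..1} (\<lambda>t. ds \<delta> (dr \<delta> (lagrangian \<delta> \<Phi>)) (0, 0, t))"
    by (rule continuous_on_compose2[OF smooth_in_continuous[OF sd[OF sd[OF sl]]]])
       (use \<delta> in \<open>auto simp: slab_def intro!: continuous_intros\<close>)
  then have il: "((\<lambda>t. ds \<delta> (dr \<delta> (lagrangian \<delta> \<Phi>)) (0, 0, t)) has_integral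
      integral {0..1} (\<lambda>t. ds \<delta> (dr \<delta> (lagrangian \<delta> \<Phi>)) (0, 0, t))) {0..1}"
    using integrable_continuous_interval integrable_integral by blast
  have "(integrand V V' has_integral
      integral {0..1} (\<lambda>t. ds \<delta> (dr \<delta> (lagrangian \<delta> \<Phi>)) (0, 0, t)) - (B 1 - B 0)) {0..1}"
    using has_integral_diff[OF il iB] by (simp add: B'_def)
  from integral_unique[OF this]
  have int: "integral {0..1} (\<lambda>t. ds \<delta> (dr \<delta> (lagrangian \<delta> \<Phi>)) (0, 0, t)) =
      integral {0..1} (integrand V V') + (B 1 - B 0)"
    by linarith
  have I: "0 \<in> {-\<delta><..<\<delta>}" "open {-\<delta><..<\<delta>}" using \<delta> by auto
  have t01: "(0::real) \<in> {0..1}" "(1::real) \<in> {0..1}" by auto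
  have V0: "V 0 $ 3 = 0"
  proof -
    have "((\<lambda>s. \<Phi> (s, 0, 0) $ 3) has_real_derivative V 0 $ 3) (at 0)"
      using nth[OF slab_partials(1)[OF sm in_slab[OF I(1) I(1) t01(1)]], of 3] Vs[of 0] by simp
    moreover have "((\<lambda>s. \<Phi> (s, 0, 0) $ 3) has_real_derivative 0) (at 0)"
      by (rule has_field_derivative_transform_within_open[OF DERIV_const[of z0] I(2,1)]) (use b0 I in auto)
    ultimately show ?thesis by (rule DERIV_unique)
  qed
  have \<Phi>r0: "\<Phi>r (s, 0, 0) $ 3 = 0" if s: "s \<in> {-\<delta><..<\<delta>}" for s
  proof -
    have "((\<lambda>r. \<Phi> (s, r, 0) $ 3) has_real_derivative \<Phi>r (s, 0, 0) $ 3) (at 0)"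
      unfolding \<Phi>r_def using nth[OF slab_partials(2)[OF sm in_slab[OF s I(1) t01(1)]], of 3] by simp
    moreover have "((\<lambda>r. \<Phi> (s, r, 0) $ 3) has_real_derivative 0) (at 0)"
      by (rule has_field_derivative_transform_within_open[OF DERIV_const[of z0] I(2,1)]) (use b0 s in auto)
    ultimately show ?thesis by (rule DERIV_unique)
  qed
  have Y0: "Y 0 $ 3 = 0"
  proof -
    have "((\<lambda>s. \<Phi>r (s, 0, 0) $ 3) has_real_derivative Y 0 $ 3) (at 0)"
      unfolding Y_def using nth[OF slab_partials(1)[OF sms(2) in_slab[OF I(1) I(1) t01(1)]], of 3] by simp
    moreover have "((\<lambda>s. \<Phi>r (s, 0, 0) $ 3) has_real_derivative 0) (at 0)"
      by (rule has_field_derivative_transform_within_open[OF DERIV_const[of 0] I(2,1)]) (use \<Phi>r0 in auto)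
    ultimately show ?thesis by (rule DERIV_unique)
  qed
  have sub: "((\<lambda>x. f x - Q) has_vector_derivative f') (at a)" if "(f has_vector_derivative f') (at a)"
    for f f' and a :: real
    using has_vector_derivative_diff[OF that has_vector_derivative_const[of Q]] by simp
  have \<Phi>r1: "2 * ((\<Phi> (s, 0, 1) - Q) \<bullet> \<Phi>r (s, 0, 1)) = d * \<Phi>r (s, 0, 1) $ 3"
    if s: "s \<in> {-\<delta><..<\<delta>}" for s
  proof -
    note dr1 = slab_partials(2)[OF sm in_slab[OF s I(1) t01(2)]]
    have "((\<lambda>r. d * \<Phi> (s, r, 1) $ 3) has_real_derivative d * \<Phi>r (s, 0, 1) $ 3) (at 0)"
      unfolding \<Phi>r_def using nth[OF dr1, of 3] by (auto intro!: derivative_eq_intros)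
    then have "((\<lambda>r. (\<Phi> (s, r, 1) - Q) \<bullet> (\<Phi> (s, r, 1) - Q)) has_real_derivative d * \<Phi>r (s, 0, 1) $ 3) (at 0)"
      by (rule has_field_derivative_transform_within_open[OF _ I(2,1)]) (use b1 s in auto)
    moreover have "((\<lambda>r. (\<Phi> (s, r, 1) - Q) \<bullet> (\<Phi> (s, r, 1) - Q)) has_real_derivative
        2 * ((\<Phi> (s, 0, 1) - Q) \<bullet> \<Phi>r (s, 0, 1))) (at 0)"
      unfolding \<Phi>r_def using inner[OF sub[OF dr1] sub[OF dr1]] by (simp add: inner_commute)
    ultimately show ?thesis by (rule DERIV_unique[symmetric])
  qed
  have e1: "\<Phi> (0, 0, 1) - Q = d *\<^sub>R axis 3 1" using \<Phi>0[of 1] c_1 by simp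
  have V1: "V 1 $ 3 = 0"
    using \<Phi>r1[OF I(1)] Vr[of 1] d_pos by (simp add: e1 \<Phi>r_def inner_axis')
  have Y1: "Y 1 $ 3 = - 2 * (V 1 \<bullet> V 1) / d"
  proof -
    note ds1 = slab_partials(1)[OF sm in_slab[OF I(1) I(1) t01(2)]]
    note ds2 = slab_partials(1)[OF sms(2) in_slab[OF I(1) I(1) t01(2)]]
    have "((\<lambda>s. d * \<Phi>r (s, 0, 1) $ 3) has_real_derivative d * Y 1 $ 3) (at 0)"
      unfolding Y_def using nth[OF ds2, of 3] by (auto intro!: derivative_eq_intros)
    then have "((\<lambda>s. 2 * ((\<Phi> (s, 0, 1) - Q) \<bullet> \<Phi>r (s, 0, 1))) has_real_derivative d * Y 1 $ 3) (at 0)"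
      by (rule has_field_derivative_transform_within_open[OF _ I(2,1)]) (use \<Phi>r1 in auto)
    moreover have "((\<lambda>s. 2 * ((\<Phi> (s, 0, 1) - Q) \<bullet> \<Phi>r (s, 0, 1))) has_real_derivative
        2 * ((d *\<^sub>R axis 3 1) \<bullet> Y 1 + V 1 \<bullet> V 1)) (at 0)"
      using DERIV_cmult[OF inner[OF sub[OF ds1] ds2], of 2] Vs[of 1] Vr[of 1]
      by (simp add: e1 Y_def \<Phi>r_def)
    ultimately have "d * Y 1 $ 3 = 2 * ((d *\<^sub>R axis 3 1) \<bullet> Y 1 + V 1 \<bullet> V 1)" by (rule DERIV_unique)
    then show ?thesis using d_pos by (simp add: inner_axis' field_simps)
  qed
  have "c 1 $ 3 = d" by (simp add: c_nth seg_d)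
  then have "B 1 - B 0 = 2 * L * (V 1 \<bullet> V 1) / d\<^sup>2"
    using d_pos by (simp add: B_def V0 V1 Y0 Y1 power2_eq_square)
  then have "integral {0..1} (\<lambda>t. ds \<delta> (dr \<delta> (lagrangian \<delta> \<Phi>)) (0, 0, t)) = quadratic_form V V'"
    by (simp add: int quadratic_form_def)
  then show ?thesis using second_derivative_integral[OF sl \<delta>] by simp
qed

text \<open>If the form vanishes, then so do \<open>V 1\<close> and the squares in the integrand.  The horizontal components
  are then constant, hence zero, and the vertical one is a multiple of its initial value \<open>0\<close>.\<close>
lemma quadratic_form_pos:
  assumes V: "\<And>t. t \<in> {0..1} \<Longrightarrow> (V has_vector_derivative V' t) (at t within {0..1})"
    and V'c: "continuous_on {0..1} V'" and t: "t \<in> {0..1}" "V t \<noteq> 0"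
    and V0: "V 0 $ 3 = 0"
  shows "quadratic_form V V' > 0"
proof (rule ccontr)
  assume n: "\<not> quadratic_form V V' > 0"
  have pos: "c s $ 3 > 0" for s using c_in upper_half_space_pos by blast
  have Vc: "continuous_on {0..1} V" using V by (intro continuous_on_vector_derivative) auto
  have nn: "integrand V V' s \<ge> 0" for s by (simp add: integrand_def)
  have cc: "continuous_on {0..1} c" using smooth_on_continuous[OF c_smooth] continuous_on_subset by blast
  have ic: "continuous_on {0..1} (integrand V V')"
    unfolding integrand_def[abs_def] using Vc V'c cc pos
    by (auto intro!: continuous_intros simp: less_imp_neq[THEN not_sym])
  have "integral {0..1} (integrand V V') \<ge> 0"
    using integrable_continuous_interval[OF ic] nn by (simp add: integral_nonneg)
  moreover have "2 * L * (V 1 \<bullet> V 1) / d\<^sup>2 \<ge> 0" using seg_L by simp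
  ultimately have "integral {0..1} (integrand V V') = 0" "2 * L * (V 1 \<bullet> V 1) / d\<^sup>2 = 0"
    using n unfolding quadratic_form_def by linarith+
  then have V1: "V 1 = 0" and i0: "integrand V V' s = 0" if "s \<in> {0..1}" for s
    using seg_L d_pos integral_eq_0_iff[OF ic, of] nn that by auto
  have z: "V' s $ 1 = 0" "V' s $ 2 = 0" "V' s $ 3 = - L * V s $ 3" if "s \<in> {0..1}" for s
  proof -
    have "(V' s $ 1)\<^sup>2 + (V' s $ 2)\<^sup>2 + (V' s $ 3 + L * V s $ 3)\<^sup>2 = 0"
      using i0[OF that] pos[of s] by (simp add: integrand_def)
    then have "V' s $ 1 = 0 \<and> V' s $ 2 = 0 \<and> V' s $ 3 + L * V s $ 3 = 0"
      by (simp add: add_nonneg_eq_0_iff)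
    then show "V' s $ 1 = 0" "V' s $ 2 = 0" "V' s $ 3 = - L * V s $ 3"
      by (auto simp: eq_neg_iff_add_eq_0)
  qed
  have h: "V s $ i = 0" if "s \<in> {0..1}" "i = 1 \<or> i = 2" for s i
  proof -
    have "V s $ i = V 0 $ i" if "s \<in> {0..1}" for s
      by (rule constant_of_zero_derivative[OF _ that])
         (use has_real_derivative_nth[OF V, of _ i] z \<open>i = 1 \<or> i = 2\<close> in auto)
    from this[OF that(1)] this[of 1] show ?thesis using V1[of 1] by simp
  qed
  have "V t $ 3 = V 0 $ 3 * exp (- L * t)"
    by (rule exponential_decay[OF _ t(1)]) (use has_real_derivative_nth[OF V, of _ 3] z in auto)
  then have "V t = 0" using h[OF t(1)] V0 by (simp add: vec_eq_iff forall_3)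
  then show False using t by simp
qed

end

section \<open>Morse index and nullity\<close>

lemma smooth_on_fd_pair:
  fixes f :: "'e::euclidean_space \<Rightarrow> 'f::real_normed_vector"
  assumes "open S" "smooth_on S f"
  shows "smooth_on (S \<times> UNIV) (\<lambda>z. fd f (fst z) (snd z))"
proof -
  have op: "open (S \<times> (UNIV :: 'e set))" using assms(1) by (simp add: open_Times)
  have 1: "smooth_on (S \<times> UNIV) (fst :: 'e \<times> 'e \<Rightarrow> 'e)" "smooth_on (S \<times> UNIV) (snd :: 'e \<times> 'e \<Rightarrow> 'e)"
    using smooth_on_fst[OF op smooth_on_ident] smooth_on_snd[OF op smooth_on_ident] by simp_all
  have 2: "smooth_on (S \<times> UNIV) (\<lambda>z :: 'e \<times> 'e. fd f (fst z) b)" for b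
    by (rule smooth_on_compose[OF smooth_on_fd[OF assms(2)] 1(1) op assms(1)]) auto
  have "smooth_on (S \<times> UNIV) (\<lambda>z :: 'e \<times> 'e. \<Sum>b\<in>Basis. (snd z \<bullet> b) *\<^sub>R fd f (fst z) b)"
    by (rule smooth_on_sum[OF op]) (intro smooth_on_scaleR smooth_on_inner op 1 2 smooth_on_const)
  then show ?thesis
  proof (rule smooth_on_cong[OF op, rotated])
    fix z :: "'e \<times> 'e" assume "z \<in> S \<times> UNIV"
    then have "f differentiable (at (fst z))" using assms(2) smooth_on_iff by (metis mem_Times_iff)
    then show "(\<Sum>b\<in>Basis. (snd z \<bullet> b) *\<^sub>R fd f (fst z) b) = fd f (fst z) (snd z)"
      by (rule fd_expand[symmetric])
  qed
qed

context vertical_segment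
begin

text \<open>The straight variation \<open>c + u V\<close> is corrected at \<open>t = 1\<close> so that its end is the point
  \<open>Q + d (W + e\<^sub>3)/(1 + |W|\<^sup>2)\<close> of the sphere, with \<open>W = u V(1)/d\<close>, which is the image of a point of the plane \<open>z = d\<close> under an
  inversion.  The correction is of second order in \<open>u\<close>.\<close>
lemma lifted_variation_exists:
  assumes V: "smooth_in {0..1} V" and V0: "V 0 $ 3 = 0" and V1: "V 1 $ 3 = 0"
  shows "\<exists>\<delta> \<Phi>. lifted_variation \<delta> V \<Phi>"
proof -
  define m where "m = (V 1 \<bullet> V 1) / d\<^sup>2"
  have m: "m \<ge> 0" by (simp add: m_def)
  define k where "k u = u\<^sup>2 * m * inverse (1 + u\<^sup>2 * m)" for u
  define w where "w u = (u / d) *\<^sub>R V 1 + axis 3 1" for u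
  define \<phi> where "\<phi> u t = c t + (u *\<^sub>R V t + (- (t * (d * k u))) *\<^sub>R w u)" for u t
  define \<Phi> where "\<Phi> x = \<phi> (fst x + fst (snd x)) (snd (snd x))" for x :: "real \<times> real \<times> real"
  have "compact ((\<lambda>t. \<bar>V t $ 3\<bar>) ` {0..1})"
    by (intro compact_continuous_image continuous_intros smooth_in_continuous[OF V]) simp
  then obtain B where "\<forall>y\<in>(\<lambda>t. \<bar>V t $ 3\<bar>) ` {0..1}. norm y \<le> B"
    using compact_imp_bounded bounded_iff by blast
  then have B: "\<bar>V t $ 3\<bar> \<le> B" if "t \<in> {0..1}" for t using that by force
  have B0: "B \<ge> 0" using B[of 0] by simp
  \<comment> \<open>For \<open>|u| < 2 \<delta>\<close> the heights change by less than the minimal height \<open>d\<close> of \<open>c\<close>.\<close>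
  define \<delta> where "\<delta> = min (1/2) (d / (2 * (B + d * m + 1)))"
  have den: "B + d * m + 1 > 0" using B0 d_pos m by (simp add: add_nonneg_pos)
  have \<delta>: "\<delta> > 0" using den d_pos by (simp add: \<delta>_def)
  have k_le: "0 \<le> k u" "k u \<le> \<bar>u\<bar> * m" if "\<bar>u\<bar> \<le> 1" for u
  proof -
    have "u\<^sup>2 * m \<ge> 0" using m by simp
    then show "0 \<le> k u" by (simp add: k_def)
    have "inverse (1 + u\<^sup>2 * m) \<le> 1" using \<open>u\<^sup>2 * m \<ge> 0\<close> by (simp add: inverse_le_1_iff)
    then have 1: "k u \<le> u\<^sup>2 * m * 1" unfolding k_def using \<open>u\<^sup>2 * m \<ge> 0\<close> by (intro mult_left_mono)
    have "u\<^sup>2 \<le> \<bar>u\<bar>" using that by (metis abs_ge_zero mult_left_le power2_abs power2_eq_square)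
    then have "u\<^sup>2 * m \<le> \<bar>u\<bar> * m" using m by (intro mult_right_mono)
    with 1 show "k u \<le> \<bar>u\<bar> * m" by linarith
  qed
  have w3: "w u $ 3 = 1" for u using V1 by (simp add: w_def axis_def)
  have in_U: "\<phi> u t \<in> upper_half_space" if u: "\<bar>u\<bar> < 2 * \<delta>" and t: "t \<in> {0..1}" for u t
  proof -
    have u1: "\<bar>u\<bar> \<le> 1" using u by (simp add: \<delta>_def)
    have "2 * \<delta> \<le> 2 * (d / (2 * (B + d * m + 1)))" unfolding \<delta>_def by simp
    also have "\<dots> = d / (B + d * m + 1)" using den by (simp only: mult.commute[of 2] mult_divide_mult_cancel_right times_divide_eq_left)
    finally have "\<bar>u\<bar> < d / (B + d * m + 1)" using u by simp
    then have ub: "\<bar>u\<bar> * (B + d * m + 1) < d" using den by (simp add: pos_less_divide_eq)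
    have "\<bar>u * V t $ 3\<bar> \<le> \<bar>u\<bar> * B" using B[OF t] by (simp add: abs_mult mult_left_mono)
    moreover have "t * (d * k u) \<le> 1 * (d * (\<bar>u\<bar> * m))"
      using t k_le[OF u1] d_pos by (intro mult_mono) auto
    moreover have "d \<le> c t $ 3" using c_3_ge t by simp
    moreover have "\<phi> u t $ 3 = c t $ 3 + u * V t $ 3 - t * (d * k u)" by (simp add: \<phi>_def w3)
    moreover have "\<bar>u\<bar> * (B + d * m + 1) = \<bar>u\<bar> * B + d * (\<bar>u\<bar> * m) + \<bar>u\<bar>" by (simp add: algebra_simps)
    ultimately have "\<phi> u t $ 3 > 0" using ub by linarith
    then show ?thesis by (simp add: upper_half_space_def)
  qed
  have smooth: "smooth_in (slab \<delta>) \<Phi>"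
    unfolding smooth_in_def
  proof
    fix x assume x: "x \<in> slab \<delta>"
    note S = smooth_on_imp_smooth_at[OF _ open_UNIV UNIV_I]
    have u: "smooth_at (slab \<delta>) x (\<lambda>x. fst x + fst (snd x))"
      by (rule S) (intro smooth_on_add smooth_on_fst smooth_on_snd smooth_on_ident open_UNIV)
    have \<tau>: "smooth_at (slab \<delta>) x (\<lambda>x. snd (snd x))"
      by (rule S) (intro smooth_on_snd smooth_on_ident open_UNIV)
    have c\<tau>: "smooth_at (slab \<delta>) x (\<lambda>x. c (snd (snd x)))"
      by (rule smooth_at_compose_on[OF c_smooth open_UNIV \<tau> x UNIV_I])
    have V\<tau>: "smooth_at (slab \<delta>) x (\<lambda>x. V (snd (snd x)))"
      by (rule smooth_at_compose[OF _ \<tau> x, of "{0..1}"])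
         (use V x in \<open>auto simp: smooth_in_def slab_def\<close>)
    have "smooth_on UNIV (\<lambda>u. u\<^sup>2 * m * inverse (1 + u\<^sup>2 * m))"
    proof (intro smooth_on_mult smooth_on_inverse smooth_on_add smooth_on_power smooth_on_ident
        smooth_on_const open_UNIV)
      show "1 + u\<^sup>2 * m \<noteq> 0" for u using m by (metis add_nonneg_eq_0_iff mult_nonneg_nonneg
            zero_le_one zero_le_power2 zero_neq_one)
    qed
    then have ku: "smooth_at (slab \<delta>) x (\<lambda>x. k (fst x + fst (snd x)))"
      unfolding k_def[abs_def] using smooth_at_compose_on[OF _ open_UNIV u x UNIV_I] by blast
    have "smooth_on UNIV w" unfolding w_def[abs_def] divide_inverse
      by (intro smooth_on_add smooth_on_scaleR smooth_on_mult smooth_on_ident smooth_on_const open_UNIV)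
    then have wu: "smooth_at (slab \<delta>) x (\<lambda>x. w (fst x + fst (snd x)))"
      using smooth_at_compose_on[OF _ open_UNIV u x UNIV_I] by blast
    have "smooth_at (slab \<delta>) x (\<lambda>x. c (snd (snd x)) + ((fst x + fst (snd x)) *\<^sub>R V (snd (snd x)) +
        ((-1) * (snd (snd x) * (d * k (fst x + fst (snd x))))) *\<^sub>R w (fst x + fst (snd x))))"
      by (intro smooth_at_add smooth_at_scaleR smooth_at_mult smooth_at_const x u \<tau> c\<tau> V\<tau> ku wu)
    then show "smooth_at (slab \<delta>) x \<Phi>"
      by (rule smooth_at_cong[OF _ open_UNIV UNIV_I]) (simp add: \<Phi>_def \<phi>_def)
  qed
  have d\<phi>: "((\<lambda>u. \<phi> u t) has_vector_derivative V t) (at 0)" for t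
  proof -
    have "(k has_real_derivative 0) (at 0)"
      unfolding k_def[abs_def] by (auto intro!: derivative_eq_intros)
    then have 1: "((\<lambda>u. - (t * (d * k u))) has_real_derivative 0) (at 0)"
      by (auto intro!: derivative_eq_intros)
    have 2: "(w has_vector_derivative (1 / d) *\<^sub>R V 1) (at 0)"
      unfolding w_def[abs_def] has_vector_derivative_def
      by (auto intro!: derivative_eq_intros simp: d_pos less_imp_neq[OF d_pos, THEN not_sym])
    have 3: "((\<lambda>u. u *\<^sub>R V t) has_vector_derivative V t) (at 0)"
      unfolding has_vector_derivative_def by (auto intro!: derivative_eq_intros)
    have "((\<lambda>u. \<phi> u t) has_vector_derivative 0 + (V t +
        ((- (t * (d * k 0))) *\<^sub>R ((1 / d) *\<^sub>R V 1) + 0 *\<^sub>R w 0))) (at 0)"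
      unfolding \<phi>_def
      by (intro has_vector_derivative_add has_vector_derivative_const 3 has_vector_derivative_scaleR 1 2)
    then show ?thesis by (simp add: k_def)
  qed
  have in_slab: "(0, 0, t) \<in> slab \<delta>" if "t \<in> {0..1}" for t using \<delta> that by (simp add: slab_def)
  have "lifted_variation \<delta> V \<Phi>"
    unfolding lifted_variation_def
  proof (intro conjI ballI \<delta> smooth)
    show "\<Phi> ` slab \<delta> \<subseteq> upper_half_space"
      unfolding \<Phi>_def by (rule image_subsetI, rule in_U) (auto simp: slab_def)
    fix t :: real assume t: "t \<in> {0..1}"
    show "\<Phi> (0, 0, t) = c t" by (simp add: \<Phi>_def \<phi>_def k_def)
    show "ds \<delta> \<Phi> (0, 0, t) = V t"
      using vector_derivative_unique_at[OF slab_partials(1)[OF smooth in_slab[OF t]]] d\<phi>[of t]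
      by (simp add: \<Phi>_def)
    show "dr \<delta> \<Phi> (0, 0, t) = V t"
      using vector_derivative_unique_at[OF slab_partials(2)[OF smooth in_slab[OF t]]] d\<phi>[of t]
      by (simp add: \<Phi>_def)
  next
    fix s r assume "s \<in> {-\<delta><..<\<delta>}" "r \<in> {-\<delta><..<\<delta>}"
    show "\<Phi> (s, r, 0) $ 3 = z0" using V0 seg_z0 by (simp add: \<Phi>_def \<phi>_def c_0)
    define u where "u = s + r"
    define n where "n = u\<^sup>2 * m"
    have n: "n \<ge> 0" using m by (simp add: n_def)
    have dw: "d *\<^sub>R w u = u *\<^sub>R V 1 + d *\<^sub>R axis 3 1"
      using d_pos by (simp add: w_def scaleR_add_right)
    have "\<Phi> (s, r, 1) - Q = d *\<^sub>R w u - (d * k u) *\<^sub>R w u"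
      unfolding dw by (simp add: \<Phi>_def \<phi>_def c_1 u_def)
    also have "\<dots> = (d * (1 - k u)) *\<^sub>R w u" by (simp add: algebra_simps)
    also have "1 - k u = inverse (1 + n)"
    proof -
      have "k u = n * inverse (1 + n)" by (simp only: k_def n_def)
      then show ?thesis using n by (simp add: field_simps)
    qed
    finally have e: "\<Phi> (s, r, 1) - Q = (d * inverse (1 + n)) *\<^sub>R w u" .
    have "w u \<bullet> w u = 1 + n"
      using V1 by (simp add: w_def inner_add_left inner_add_right inner_axis inner_axis' n_def m_def
          power_divide power2_eq_square)
    then have "(\<Phi> (s, r, 1) - Q) \<bullet> (\<Phi> (s, r, 1) - Q) = (d * inverse (1 + n))\<^sup>2 * (1 + n)"
      unfolding e by (simp add: power2_eq_square)
    also have "\<dots> = d * (d * inverse (1 + n))" using n by (simp add: power2_eq_square)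
    also have "d * inverse (1 + n) = (\<Phi> (s, r, 1) - Q) $ 3" unfolding e by (simp add: w3)
    finally show "(\<Phi> (s, r, 1) - Q) \<bullet> (\<Phi> (s, r, 1) - Q) = d * \<Phi> (s, r, 1) $ 3" by (simp add: Q_3)
  qed
  then show ?thesis by blast
qed

end

locale orthogonal_chord = horotorus X A h p T z0 + vertical_segment y0 z0 L d Q c
  for X :: "'a::t2_space set" and A h p T z0 y0 L d Q c +
  assumes end_in_T: "p (c 1) \<in> T"
    and orthogonal: "\<And>u. differential A p (c 1) u \<in> tangent_to X A T (p (c 1)) \<Longrightarrow> u $ 3 = 0"
begin

lemma y0_in_H: "y0 \<in> H" using seg_z0 by (simp add: H_iff)

lemma c1_3: "c 1 $ 3 = d" by (simp add: c_nth seg_d)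

lemma d_neq: "c 1 $ 3 \<noteq> z0" using seg_L seg_z0 by (simp add: c_nth)

lemma c1_on_sphere: "(c 1 - Q) \<bullet> (c 1 - Q) = d * c 1 $ 3"
  by (simp add: c1_3) (simp add: c_1 inner_axis')

lemma sphere_in_T:
  assumes "x \<in> U" "(x - Q) \<bullet> (x - Q) = d * x $ 3"
  shows "p x \<in> T"
  by (rule end_sphere(2)[OF y0_in_H c_in end_in_T c_nth(1,2) d_neq orthogonal assms(1)])
     (use assms in \<open>simp_all add: c1_3 seg_Q\<close>)

lemma lift_stays_in_sphere:
  fixes f :: "'d::topological_space \<Rightarrow> real^3"
  assumes "connected S" "continuous_on S f" "f ` S \<subseteq> U" "\<And>s. s \<in> S \<Longrightarrow> p (f s) \<in> T"
    "s0 \<in> S" "(f s0 - Q) \<bullet> (f s0 - Q) = d * f s0 $ 3" "s \<in> S"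
  shows "(f s - Q) \<bullet> (f s - Q) = d * f s $ 3"
  using end_sphere(3)[OF y0_in_H c_in end_in_T c_nth(1,2) d_neq orthogonal assms(1-5)
      assms(6)[unfolded seg_Q c1_3[symmetric]] assms(7)]
  by (simp add: c1_3 seg_Q)

lemma lift_energy:
  assumes lv: "smooth_in (slab \<delta>) \<Phi>" "\<Phi> ` slab \<delta> \<subseteq> U"
    and F: "\<And>s r t. (s, r, t) \<in> slab \<delta> \<Longrightarrow> F s r t = p (\<Phi> (s, r, t))"
    and sr: "s \<in> {-\<delta><..<\<delta>}" "r \<in> {-\<delta><..<\<delta>}"
  shows "energy A h (F s r) = integral {0..1} (\<lambda>t. lagrangian \<delta> \<Phi> (s, r, t))"
proof -
  have "h (F s r t) (velocity A (F s r) {0..1} t) (velocity A (F s r) {0..1} t) =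
      (dt \<delta> \<Phi> (s, r, t) \<bullet> dt \<delta> \<Phi> (s, r, t)) / (\<Phi> (s, r, t) $ 3)\<^sup>2" if t: "t \<in> {0..1}" for t
  proof -
    have in_slab: "(s, r, t) \<in> slab \<delta>" if "t \<in> {0..1}" for t using sr that by (simp add: slab_def)
    have "velocity A (F s r) {0..1} t = differential A p (\<Phi> (s, r, t)) (dt \<delta> \<Phi> (s, r, t))"
      by (rule velocity_projection[OF slab_partials(3)[OF lv(1) in_slab[OF t]] _ t _ Icc_not_bot[OF t]])
         (use lv(2) in_slab F in auto)
    moreover have "\<Phi> (s, r, t) \<in> U" using lv(2) in_slab[OF t] by auto
    ultimately show ?thesis using p_isometry F[OF in_slab[OF t]] by simp
  qed
  then have "integral {0..1} (\<lambda>t. h (F s r t) (velocity A (F s r) {0..1} t) (velocity A (F s r) {0..1} t)) =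
      integral {0..1} (\<lambda>t. (dt \<delta> \<Phi> (s, r, t) \<bullet> dt \<delta> \<Phi> (s, r, t)) / (\<Phi> (s, r, t) $ 3)\<^sup>2)"
    by (rule integral_cong)
  then show ?thesis by (simp only: energy_def lagrangian_def integral_mult_right)
qed

lemma energy_second_derivative:
  assumes lv: "lifted_variation \<delta> V \<Phi>"
    and V': "\<And>t. t \<in> {0..1} \<Longrightarrow> (V has_vector_derivative V' t) (at t within {0..1})"
    and F: "\<And>s r t. (s, r, t) \<in> slab \<delta> \<Longrightarrow> F s r t = p (\<Phi> (s, r, t))"
  shows "((\<lambda>s. deriv (\<lambda>r. energy A h (F s r)) 0) has_real_derivative quadratic_form V V') (at 0)"
proof -
  have \<delta>: "\<delta> > 0" "smooth_in (slab \<delta>) \<Phi>" "\<Phi> ` slab \<delta> \<subseteq> U"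
    using lv by (auto simp: lifted_variation_def)
  have "deriv (\<lambda>r. integral {0..1} (\<lambda>t. lagrangian \<delta> \<Phi> (s, r, t))) 0 = deriv (\<lambda>r. energy A h (F s r)) 0"
    if s: "s \<in> {-\<delta><..<\<delta>}" for s
  proof (rule deriv_cong_ev[OF _ refl])
    have "\<forall>\<^sub>F r in nhds 0. r \<in> {-\<delta><..<\<delta>}"
      using \<delta>(1) by (intro eventually_nhds_in_open) auto
    then show "\<forall>\<^sub>F r in nhds 0. integral {0..1} (\<lambda>t. lagrangian \<delta> \<Phi> (s, r, t)) = energy A h (F s r)"
      by eventually_elim (simp add: lift_energy[OF \<delta>(2,3) F s])
  qed
  then show ?thesis
    using \<delta>(1)
    by (intro has_field_derivative_transform_within_open[OF second_variation_lifted[OF lv V'],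
          of "{-\<delta><..<\<delta>}"]) auto
qed

text \<open>The lifted field is smooth because \<open>dp\<close> has smooth local inverses.  At its ends it is horizontal:
  there \<open>T\<close> lifts to \<open>H\<close> and to a surface with a horizontal tangent plane at \<open>c 1\<close>.\<close>
lemma field_lift:
  assumes cN: "\<And>t. t \<in> {0..1} \<Longrightarrow> cN t = p (c t)" and W: "W \<in> path_tangent X A T cN"
  obtains V where "smooth_in {0..1} V" "\<And>t. t \<in> {0..1} \<Longrightarrow> W t = differential A p (c t) (V t)"
    "V 0 $ 3 = 0" "V 1 $ 3 = 0"
proof -
  have "\<exists>u. W t = differential A p (c t) u" if "t \<in> {0..1}" for t
  proof (rule differential_surj[OF c_in])
    have "W t \<in> tangent_space A (cN t)" using W that unfolding path_tangent_def by blast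
    then show "W t \<in> tangent_space A (p (c t))" by (simp add: cN[OF that])
  qed
  then obtain V where V: "\<And>t. t \<in> {0..1} \<Longrightarrow> W t = differential A p (c t) (V t)" by metis
  have "smooth_in {0..1} V"
    unfolding smooth_in_def
  proof
    fix t0 :: real assume t0: "t0 \<in> {0..1}"
    obtain \<kappa> where \<kappa>: "\<kappa> \<in> A" "c t0 \<in> Dom \<kappa>" using Dom_exists[OF c_in] by blast
    obtain N M \<psi> where loc: "open N" "open M" "c t0 \<in> N" "N \<subseteq> Dom \<kappa>"
        "homeomorphism N M (P \<kappa>) \<psi>" "smooth_on M \<psi>"
      using local_inverse[OF \<kappa>] by metis
    have "smooth_at {0..1} t0 (\<lambda>\<tau>. W \<tau> \<kappa>)"
      using W t0 cN[OF t0] charts_at_DomI[OF \<kappa>] by (simp add: path_tangent_def)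
    moreover have "smooth_at {0..1} t0 (\<lambda>t. P \<kappa> (c t))"
      by (rule smooth_at_compose_on[OF smooth_P[OF \<kappa>(1)] open_Dom[OF \<kappa>(1)]
            smooth_on_imp_smooth_at[OF c_smooth open_UNIV UNIV_I] t0 \<kappa>(2)])
    ultimately have "smooth_at {0..1} t0 (\<lambda>t. (P \<kappa> (c t), W t \<kappa>))" by (intro smooth_at_Pair)
    moreover have "P \<kappa> (c t0) \<in> M" using homeomorphism_image1[OF loc(5)] loc(3) by blast
    ultimately have "smooth_at {0..1} t0 (\<lambda>t. fd \<psi> (fst (P \<kappa> (c t), W t \<kappa>)) (snd (P \<kappa> (c t), W t \<kappa>)))"
      using open_Times[OF loc(2) open_UNIV]
      by (intro smooth_at_compose_on[OF smooth_on_fd_pair[OF loc(2,6)] _ _ t0]) auto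
    then show "smooth_at {0..1} t0 V"
    proof (rule smooth_at_cong)
      show "open (c -` N)" using open_vimage[OF loc(1) smooth_on_continuous[OF c_smooth]] .
      show "t0 \<in> c -` N" using loc(3) by simp
      fix t assume t: "t \<in> {0..1} \<inter> c -` N"
      then have ct: "c t \<in> Dom \<kappa>" "P \<kappa> (c t) \<in> M" using loc homeomorphism_image1[OF loc(5)] by blast+
      have "W t \<kappa> = fd (P \<kappa>) (c t) (V t)"
        using V[of t] t differential_apply[OF charts_at_DomI[OF \<kappa>(1) ct(1)]] by simp
      moreover have "fd \<psi> (P \<kappa> (c t)) (fd (P \<kappa>) (c t) u) = u" for u
      proof -
        have "((\<lambda>x. \<psi> (P \<kappa> x)) has_derivative (\<lambda>u. fd \<psi> (P \<kappa> (c t)) (fd (P \<kappa>) (c t) u))) (at (c t))"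
          by (rule has_derivative_compose[OF P_has_derivative[OF \<kappa>(1) ct(1)]
                smooth_on_has_derivative[OF loc(6) ct(2)]])
        then have "((\<lambda>x. x) has_derivative (\<lambda>u. fd \<psi> (P \<kappa> (c t)) (fd (P \<kappa>) (c t) u))) (at (c t))"
          by (rule has_derivative_transform_within_open[OF _ loc(1)])
             (use t homeomorphism_apply1[OF loc(5)] in auto)
        from has_derivative_unique[OF this has_derivative_ident] show ?thesis by metis
      qed
      ultimately show "fd \<psi> (fst (P \<kappa> (c t), W t \<kappa>)) (snd (P \<kappa> (c t), W t \<kappa>)) = V t" by simp
    qed
  qed
  moreover have "V 0 $ 3 = 0"
    using W V[of 0] cN[of 0] tangent_H[OF y0_in_H, of "V 0"] by (simp add: path_tangent_def c_0)
  moreover have "V 1 $ 3 = 0"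
    using W V[of 1] cN[of 1] orthogonal[of "V 1"] by (simp add: path_tangent_def)
  ultimately show thesis using that V by blast
qed

lemma velocity_slab:
  assumes \<Phi>: "smooth_in (slab \<delta>) \<Phi>" "\<Phi> ` slab \<delta> \<subseteq> U" and \<delta>: "\<delta> > 0" and t: "t \<in> {0..1}"
    and F: "\<And>s r t. (s, r, t) \<in> slab \<delta> \<Longrightarrow> F s r t = p (\<Phi> (s, r, t))"
  shows "velocity A (\<lambda>s. F s 0 t) UNIV 0 = differential A p (\<Phi> (0, 0, t)) (ds \<delta> \<Phi> (0, 0, t))"
    and "velocity A (\<lambda>r. F 0 r t) UNIV 0 = differential A p (\<Phi> (0, 0, t)) (dr \<delta> \<Phi> (0, 0, t))"
proof -
  let ?I = "{-\<delta><..<\<delta>}"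
  have I: "open ?I" "0 \<in> ?I" using \<delta> by auto
  have nb: "at 0 within ?I \<noteq> bot" using at_within_open[OF I(2,1)] by simp
  have in_slab: "(s, 0, t) \<in> slab \<delta>" "(0, s, t) \<in> slab \<delta>" if "s \<in> ?I" for s
    using that t \<delta> by (auto simp: slab_def)
  have "velocity A (\<lambda>s. F s 0 t) ?I 0 = differential A p (\<Phi> (0, 0, t)) (ds \<delta> \<Phi> (0, 0, t))"
    by (rule velocity_projection[OF has_vector_derivative_at_within[OF slab_partials(1)[OF \<Phi>(1)
              in_slab(1)[OF I(2)]]] _ I(2) _ nb]) (use \<Phi>(2) in_slab F in auto)
  then show "velocity A (\<lambda>s. F s 0 t) UNIV 0 = differential A p (\<Phi> (0, 0, t)) (ds \<delta> \<Phi> (0, 0, t))"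
    using velocity_open_interval[OF I] by simp
  have "velocity A (\<lambda>r. F 0 r t) ?I 0 = differential A p (\<Phi> (0, 0, t)) (dr \<delta> \<Phi> (0, 0, t))"
    by (rule velocity_projection[OF has_vector_derivative_at_within[OF slab_partials(2)[OF \<Phi>(1)
              in_slab(2)[OF I(2)]]] _ I(2) _ nb]) (use \<Phi>(2) in_slab F in auto)
  then show "velocity A (\<lambda>r. F 0 r t) UNIV 0 = differential A p (\<Phi> (0, 0, t)) (dr \<delta> \<Phi> (0, 0, t))"
    using velocity_open_interval[OF I] by simp
qed

text \<open>The family is lifted from \<open>y0\<close> on.  For each end, the parameter domain is connected, so the lifted
  endpoints remain on the lift of \<open>T\<close> that contains the end of \<open>c\<close>.\<close>
lemma variation_lift:
  assumes cN: "\<And>t. t \<in> {0..1} \<Longrightarrow> cN t = p (c t)" and F: "variation X A T cN F"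
    and W: "\<And>t. t \<in> {0..1} \<Longrightarrow> W t = differential A p (c t) (V t)"
    and v: "\<And>t. t \<in> {0..1} \<Longrightarrow> velocity A (\<lambda>s. F s 0 t) UNIV 0 = W t"
      "\<And>t. t \<in> {0..1} \<Longrightarrow> velocity A (\<lambda>r. F 0 r t) UNIV 0 = W t"
  obtains \<delta> \<Phi> where "lifted_variation \<delta> V \<Phi>" "\<And>s r t. (s, r, t) \<in> slab \<delta> \<Longrightarrow> F s r t = p (\<Phi> (s, r, t))"
proof -
  obtain \<delta> where \<delta>: "\<delta> > 0" "smooth_map X A (slab \<delta>) (\<lambda>(s, r, t). F s r t)"
    and FT: "\<And>s r. s \<in> {-\<delta><..<\<delta>} \<Longrightarrow> r \<in> {-\<delta><..<\<delta>} \<Longrightarrow> F s r 0 \<in> T \<and> F s r 1 \<in> T"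
    and F0: "\<And>t. t \<in> {0..1} \<Longrightarrow> F 0 0 t = cN t"
    using F unfolding variation_def slab_def by blast
  have in_slab: "(s, r, t) \<in> slab \<delta>" if "s \<in> {-\<delta><..<\<delta>}" "r \<in> {-\<delta><..<\<delta>}" "t \<in> {0..1}" for s r t
    using that by (simp add: slab_def)
  have I: "0 \<in> {-\<delta><..<\<delta>}" using \<delta> by auto
  have s0: "(0, 0, 0) \<in> slab \<delta>" using in_slab[OF I I] by simp
  have e: "p y0 = (\<lambda>(s, r, t). F s r t) (0, 0, 0)" using F0[of 0] cN[of 0] by (simp add: c_0)
  obtain \<Phi> where \<Phi>: "smooth_in (slab \<delta>) \<Phi>" "\<Phi> ` slab \<delta> \<subseteq> U" "\<Phi> (0, 0, 0) = y0"
    and p\<Phi>: "\<And>x. x \<in> slab \<delta> \<Longrightarrow> p (\<Phi> x) = (\<lambda>(s, r, t). F s r t) x"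
    using lift_exists[OF \<delta>(2) convex_slab s0 _ e] y0_in_H H_subset by (metis subsetD)
  have F\<Phi>: "F s r t = p (\<Phi> (s, r, t))" if "(s, r, t) \<in> slab \<delta>" for s r t using p\<Phi>[OF that] by simp
  note cont = smooth_in_continuous[OF \<Phi>(1)]
  have base: "\<Phi> (0, 0, t) = c t" if t: "t \<in> {0..1}" for t
  proof (rule covering_space_lift_unique[OF covering, where a="0::real" and f="\<lambda>t. p (c t)" and T="{0..1}"])
    show "\<Phi> (0, 0, 0) = c 0" using \<Phi>(3) by (simp add: c_0)
    show cc: "continuous_on {0..1} c" using smooth_on_continuous[OF c_smooth] continuous_on_subset by blast
    show "continuous_on {0..1} (\<lambda>t. p (c t))"
      by (rule continuous_on_compose2[OF p_continuous cc]) (use c_in in auto)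
    show "continuous_on {0..1} (\<lambda>t. \<Phi> (0, 0, t))"
      by (rule continuous_on_compose2[OF cont]) (use in_slab[OF I I] in \<open>auto intro!: continuous_intros\<close>)
    show "p (c t) = p (\<Phi> (0, 0, t))" if "t \<in> {0..1}" for t
      using F\<Phi>[OF in_slab[OF I I that]] F0[OF that] cN[OF that] by simp
  qed (use t c_in p_in \<Phi>(2) in_slab[OF I I] in auto)
  have vel: "ds \<delta> \<Phi> (0, 0, t) = V t" "dr \<delta> \<Phi> (0, 0, t) = V t" if t: "t \<in> {0..1}" for t
    using velocity_slab[OF \<Phi>(1,2) \<delta>(1) t F\<Phi>] v[OF t] W[OF t] base[OF t] differential_inj[OF c_in]
    by metis+
  have con: "connected ({-\<delta><..<\<delta>} \<times> {-\<delta><..<\<delta>})" by (intro connected_Times) auto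
  have cs: "continuous_on ({-\<delta><..<\<delta>} \<times> {-\<delta><..<\<delta>}) (\<lambda>x. \<Phi> (fst x, snd x, t))" if "t \<in> {0..1}" for t
    by (rule continuous_on_compose2[OF cont]) (use in_slab that in \<open>auto intro!: continuous_intros\<close>)
  have im: "(\<lambda>x. \<Phi> (fst x, snd x, t)) ` ({-\<delta><..<\<delta>} \<times> {-\<delta><..<\<delta>}) \<subseteq> U" if "t \<in> {0..1}" for t
    using \<Phi>(2) in_slab that by auto
  have "lifted_variation \<delta> V \<Phi>"
    unfolding lifted_variation_def
  proof (intro conjI ballI \<delta>(1) \<Phi>(1,2) base vel)
    fix s r assume sr: "s \<in> {-\<delta><..<\<delta>}" "r \<in> {-\<delta><..<\<delta>}"
    have "\<Phi> (fst (s, r), snd (s, r), 0) \<in> H"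
      by (rule lift_stays_in_H[OF con cs im, of 0 "(0, 0)"])
         (use FT F\<Phi>[OF in_slab] I \<Phi>(3) y0_in_H sr in auto)
    then show "\<Phi> (s, r, 0) $ 3 = z0" by (simp add: H_iff)
    have "(\<Phi> (fst (s, r), snd (s, r), 1) - Q) \<bullet> (\<Phi> (fst (s, r), snd (s, r), 1) - Q) =
        d * \<Phi> (fst (s, r), snd (s, r), 1) $ 3"
      by (rule lift_stays_in_sphere[OF con cs im, of 1 "(0, 0)"])
         (use FT F\<Phi>[OF in_slab] I base[of 1] c1_on_sphere sr in auto)
    then show "(\<Phi> (s, r, 1) - Q) \<bullet> (\<Phi> (s, r, 1) - Q) = d * \<Phi> (s, r, 1) $ 3" by simp
  qed
  then show thesis using that F\<Phi> by blast
qed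

lemma variation_exists:
  assumes cN: "\<And>t. t \<in> {0..1} \<Longrightarrow> cN t = p (c t)" and lv: "lifted_variation \<delta> V \<Phi>"
    and W: "\<And>t. t \<in> {0..1} \<Longrightarrow> W t = differential A p (c t) (V t)"
  defines "F \<equiv> \<lambda>s r t. p (\<Phi> (s, r, t))"
  shows "variation X A T cN F"
    and "\<And>t. t \<in> {0..1} \<Longrightarrow> velocity A (\<lambda>s. F s 0 t) UNIV 0 = W t \<and> velocity A (\<lambda>r. F 0 r t) UNIV 0 = W t"
proof -
  have \<Phi>: "\<delta> > 0" "smooth_in (slab \<delta>) \<Phi>" "\<Phi> ` slab \<delta> \<subseteq> U"
    using lv by (auto simp: lifted_variation_def)
  have "smooth_map X A (slab \<delta>) (\<lambda>(s, r, t). F s r t)"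
    using projection_smooth[OF \<Phi>(2,3)] by (rule smooth_map_cong) (auto simp: F_def)
  moreover have "F s r 0 \<in> T \<and> F s r 1 \<in> T" if "s \<in> {-\<delta><..<\<delta>}" "r \<in> {-\<delta><..<\<delta>}" for s r
  proof -
    have "(s, r, 0) \<in> slab \<delta>" "(s, r, 1) \<in> slab \<delta>" using that by (auto simp: slab_def)
    then have "\<Phi> (s, r, 0) \<in> H" "\<Phi> (s, r, 1) \<in> U"
      "(\<Phi> (s, r, 1) - Q) \<bullet> (\<Phi> (s, r, 1) - Q) = d * \<Phi> (s, r, 1) $ 3"
      using lv that \<Phi>(3) by (auto simp: lifted_variation_def H_iff)
    then show ?thesis using sphere_in_T T by (auto simp: F_def)
  qed
  moreover have "F 0 0 t = cN t" if "t \<in> {0..1}" for t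
    using lv cN[OF that] that by (simp add: F_def lifted_variation_def)
  ultimately show "variation X A T cN F"
    unfolding variation_def slab_def using \<Phi>(1) by blast
  fix t :: real assume t: "t \<in> {0..1}"
  have F: "F s r t = p (\<Phi> (s, r, t))" for s r t by (simp add: F_def)
  show "velocity A (\<lambda>s. F s 0 t) UNIV 0 = W t \<and> velocity A (\<lambda>r. F 0 r t) UNIV 0 = W t"
    using velocity_slab[OF \<Phi>(2,3,1) t F] lv t W[OF t] by (simp add: lifted_variation_def)
qed

text \<open>Since variations with the field \<open>W\<close> exist and all of them lift, the quadratic form is the unique
  value of the second derivative of the energy.\<close>
proposition second_variation_pos:
  assumes cN: "\<And>t. t \<in> {0..1} \<Longrightarrow> cN t = p (c t)" and W: "W \<in> path_tangent X A T cN" "W \<noteq> 0"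
  shows "second_variation X A h T cN W W > 0"
proof -
  obtain V where V: "smooth_in {0..1} V" "\<And>t. t \<in> {0..1} \<Longrightarrow> W t = differential A p (c t) (V t)"
    "V 0 $ 3 = 0" "V 1 $ 3 = 0"
    using field_lift[OF cN W(1)] by metis
  obtain V' where V': "smooth_in {0..1} V'"
    "\<And>t. t \<in> {0..1} \<Longrightarrow> (V has_vector_derivative V' t) (at t within {0..1})"
    using smooth_in_Icc_derivative[OF V(1)] by metis
  have "second_variation X A h T cN W W = quadratic_form V V'"
    unfolding second_variation_def
  proof (rule the_equality)
    obtain \<delta> \<Phi> where lv: "lifted_variation \<delta> V \<Phi>" using lifted_variation_exists[OF V(1,3,4)] by blast
    show "\<exists>F. variation X A T cN F \<and> (\<forall>t\<in>{0..1}. velocity A (\<lambda>s. F s 0 t) UNIV 0 = W t \<and>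
        velocity A (\<lambda>r. F 0 r t) UNIV 0 = W t) \<and>
        ((\<lambda>s. deriv (\<lambda>r. energy A h (F s r)) 0) has_real_derivative quadratic_form V V') (at 0)"
      using variation_exists[of cN \<delta> V \<Phi> W, OF cN lv V(2)]
        energy_second_derivative[of \<delta> V \<Phi> V' "\<lambda>s r t. p (\<Phi> (s, r, t))", OF lv V'(2) refl]
      by blast
  next
    fix a assume "\<exists>F. variation X A T cN F \<and> (\<forall>t\<in>{0..1}. velocity A (\<lambda>s. F s 0 t) UNIV 0 = W t \<and>
        velocity A (\<lambda>r. F 0 r t) UNIV 0 = W t) \<and>
        ((\<lambda>s. deriv (\<lambda>r. energy A h (F s r)) 0) has_real_derivative a) (at 0)"
    then obtain F where F: "variation X A T cN F"
      "\<And>t. t \<in> {0..1} \<Longrightarrow> velocity A (\<lambda>s. F s 0 t) UNIV 0 = W t"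
      "\<And>t. t \<in> {0..1} \<Longrightarrow> velocity A (\<lambda>r. F 0 r t) UNIV 0 = W t"
      "((\<lambda>s. deriv (\<lambda>r. energy A h (F s r)) 0) has_real_derivative a) (at 0)" by blast
    obtain \<delta> \<Phi> where "lifted_variation \<delta> V \<Phi>"
      "\<And>s r t. (s, r, t) \<in> slab \<delta> \<Longrightarrow> F s r t = p (\<Phi> (s, r, t))"
      using variation_lift[OF cN F(1) V(2) F(2,3)] by metis
    from energy_second_derivative[OF this(1) V'(2) this(2)] F(4)
    show "a = quadratic_form V V'" using DERIV_unique by blast
  qed
  moreover obtain t where t: "t \<in> {0..1}" "V t \<noteq> 0"
  proof -
    obtain t where "W t \<noteq> 0" using W(2) by (auto simp: fun_eq_iff zero_fun_def)
    then have t: "t \<in> {0..1}" using W(1) by (auto simp: path_tangent_def)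
    have "differential A p (c t) 0 \<kappa> = 0" for \<kappa>
      using linear_0[OF differential_linear[OF c_in]] .
    then have "V t \<noteq> 0" using \<open>W t \<noteq> 0\<close> V(2)[OF t] by (auto simp: fun_eq_iff)
    then show thesis using that t by blast
  qed
  ultimately show ?thesis
    using quadratic_form_pos[OF V'(2) smooth_in_continuous[OF V'(1)] t V(3)] by simp
qed

lemma field_dim_zero: "W \<subseteq> {0} \<Longrightarrow> field_dim W = 0"
proof -
  assume W: "W \<subseteq> {0}"
  have "enat (card B) \<le> 0" if "B \<subseteq> W" "path_fields.independent B" for B
  proof -
    have "0 \<notin> B" using that(2) path_fields.dependent_zero by blast
    then have "B = {}" using that(1) W by blast
    then show ?thesis by (simp add: zero_enat_def)
  qed
  then have "field_dim W \<le> 0" unfolding field_dim_def by (intro SUP_least) auto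
  then show ?thesis by simp
qed

corollary morse_index_zero:
  assumes "\<And>t. t \<in> {0..1} \<Longrightarrow> cN t = p (c t)"
  shows "morse_index X A h T cN = 0"
proof -
  have sub: "W \<subseteq> {0}" if W: "W \<subseteq> path_tangent X A T cN" "\<forall>V\<in>W - {0}. second_variation X A h T cN V V < 0" for W
  proof
    fix V assume "V \<in> W"
    show "V \<in> {0}"
    proof (rule ccontr)
      assume "V \<notin> {0}"
      then have "V \<noteq> 0" by simp
      have "second_variation X A h T cN V V < 0" using W(2) \<open>V \<in> W\<close> \<open>V \<notin> {0}\<close> by blast
      moreover have "second_variation X A h T cN V V > 0"
        by (rule second_variation_pos[OF assms]) (use W(1) \<open>V \<in> W\<close> \<open>V \<noteq> 0\<close> in auto)
      ultimately show False by linarith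
    qed
  qed
  have "morse_index X A h T cN \<le> 0"
    unfolding morse_index_def
  proof (rule SUP_least)
    fix W assume "W \<in> {W. path_fields.subspace W \<and> W \<subseteq> path_tangent X A T cN \<and>
      (\<forall>V\<in>W - {0}. second_variation X A h T cN V V < 0)}"
    then have "W \<subseteq> {0}" by (intro sub) simp_all
    from field_dim_zero[OF this] show "field_dim W \<le> 0" by simp
  qed
  then show ?thesis by simp
qed

corollary nullity_zero:
  assumes "\<And>t. t \<in> {0..1} \<Longrightarrow> cN t = p (c t)"
  shows "nullity X A h T cN = 0"
  unfolding nullity_def
proof (rule field_dim_zero, rule subsetI, rule ccontr)
  fix V assume V: "V \<in> {V \<in> path_tangent X A T cN. \<forall>W\<in>path_tangent X A T cN.
      second_variation X A h T cN V W = 0}" "V \<notin> {0}"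
  have "second_variation X A h T cN V V > 0"
    by (rule second_variation_pos[OF assms]) (use V in auto)
  then show False using V(1) by simp
qed

end

section \<open>The cotangent bundle and the Hamiltonian flow\<close>

context hyperbolic_covering
begin

text \<open>The covering of the cotangent bundles induced by \<open>p\<close>.  The metric of the half space identifies
  a covector \<open>\<xi>\<close> with the vector \<open>z\<^sup>2 \<xi>\<close>, which is mapped by \<open>dp\<close> and turned into a covector by \<open>h\<close>.
  In this way no inverse of \<open>dp\<close> is involved.\<close>
definition colift :: "(real^3) \<times> (real^3) \<Rightarrow> 'a cotangent" where
  "colift z = (p (fst z), \<lambda>v. if v \<in> tangent_space A (p (fst z))
     then (fst z $ 3)\<^sup>2 * h (p (fst z)) (differential A p (fst z) (snd z)) v else 0)"

text \<open>The map \<open>colift\<close> in canonical coordinates.\<close>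
definition C :: "'a chart \<Rightarrow> (real^3) \<times> (real^3) \<Rightarrow> (real^3) \<times> (real^3)" where
  "C \<kappa> z = (P \<kappa> (fst z), \<chi> i. (fst z $ 3)\<^sup>2 * G \<kappa> (P \<kappa> (fst z)) (fd (P \<kappa>) (fst z) (snd z)) (axis i 1))"

lemma fst_colift [simp]: "fst (colift z) = p (fst z)" by (simp add: colift_def)

lemma colift_differential:
  assumes "fst z \<in> U"
  shows "snd (colift z) (differential A p (fst z) u) = snd z \<bullet> u"
  using p_isometry[OF assms, of "snd z" u] differential_in_tangent_space[OF assms, of u]
    upper_half_space_pos[OF assms]
  by (simp add: colift_def)

lemma tangent_of_in_tangent_space:
  assumes "x \<in> U" "\<kappa> \<in> charts_at A (p x)"
  shows "tangent_of A \<kappa> (p x) u \<in> tangent_space A (p x)"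
  using P_surj[of \<kappa> x u] charts_at_DomD[OF assms(2,1)] differential_in_tangent_space[OF assms(1)]
    differential_tangent_of[OF assms] by metis

lemma colift_tangent_of:
  assumes \<kappa>: "\<kappa> \<in> A" "fst z \<in> Dom \<kappa>"
  shows "snd (colift z) (tangent_of A \<kappa> (p (fst z)) u) =
    (fst z $ 3)\<^sup>2 * G \<kappa> (P \<kappa> (fst z)) (fd (P \<kappa>) (fst z) (snd z)) u"
proof -
  note x = DomD[OF \<kappa>(2)] and c = charts_at_DomI[OF \<kappa>]
  show ?thesis
    using tangent_of_in_tangent_space[OF x c, of u] h_tangent_of[OF c, of "fd (P \<kappa>) (fst z) (snd z)" u]
      differential_tangent_of[OF x c, of "snd z"]
    by (simp add: colift_def P_def)
qed

lemma canonical_colift: "\<kappa> \<in> A \<Longrightarrow> fst z \<in> Dom \<kappa> \<Longrightarrow> canonical A \<kappa> (colift z) = C \<kappa> z"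
  by (simp add: canonical_def C_def colift_tangent_of P_def)

lemma colift_in_cotangent_bundle:
  assumes "fst z \<in> U"
  shows "colift z \<in> cotangent_bundle X A"
proof -
  have "linear (\<lambda>u. snd (colift z) (tangent_of A \<kappa> (p (fst z)) u))" if "\<kappa> \<in> charts_at A (p (fst z))" for \<kappa>
  proof -
    have \<kappa>: "\<kappa> \<in> A" "fst z \<in> Dom \<kappa>" using charts_at_DomD[OF that assms] by auto
    have "linear (G \<kappa> (P \<kappa> (fst z)) (fd (P \<kappa>) (fst z) (snd z)))"
      using G_bilinear[OF \<kappa>(1) P_in_cod[OF \<kappa>(2)]] by (simp add: bilinear_def)
    then show ?thesis unfolding colift_tangent_of[OF \<kappa>]
      by (auto simp: linear_iff algebra_simps)
  qed
  moreover have "snd (colift z) v = 0" if "v \<notin> tangent_space A (p (fst z))" for v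
    using that by (simp add: colift_def)
  ultimately show ?thesis
    unfolding cotangent_bundle_def using p_in[OF assms]
    by (intro CollectI case_prodI2) (auto simp: prod_eq_iff[of "colift z"])
qed

lemma colift_surj:
  assumes "\<xi> \<in> cotangent_bundle X A" "x \<in> U" "fst \<xi> = p x"
  shows "\<xi> = colift (x, \<chi> i. snd \<xi> (differential A p x (axis i 1)))"
proof -
  let ?z = "(x, \<chi> i. snd \<xi> (differential A p x (axis i 1)))"
  have \<xi>: "\<And>v. v \<notin> tangent_space A (p x) \<Longrightarrow> snd \<xi> v = 0"
    "\<And>\<kappa>. \<kappa> \<in> charts_at A (p x) \<Longrightarrow> linear (\<lambda>u. snd \<xi> (tangent_of A \<kappa> (p x) u))"
    using assms(1,3) by (auto simp: cotangent_bundle_def)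
  obtain \<kappa> where \<kappa>: "\<kappa> \<in> A" "x \<in> Dom \<kappa>" using Dom_exists[OF assms(2)] by blast
  note c = charts_at_DomI[OF \<kappa>]
  have "linear (\<lambda>u. snd \<xi> (differential A p x u))"
    using linear_compose[OF P_linear[OF \<kappa>] \<xi>(2)[OF c]] differential_tangent_of[OF assms(2) c]
    by (simp add: o_def)
  then have lin: "snd \<xi> (differential A p x u) = (\<chi> i. snd \<xi> (differential A p x (axis i 1))) \<bullet> u" for u
    by (rule linear_functional_real3)
  have cd: "snd (colift ?z) (differential A p x u) =
      (\<chi> i. snd \<xi> (differential A p x (axis i 1))) \<bullet> u" for u
    using colift_differential[of ?z u] assms(2) by (simp only: fst_conv snd_conv)
  have "snd \<xi> (differential A p x u) = snd (colift ?z) (differential A p x u)" for u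
    by (rule trans[OF lin cd[symmetric]])
  then have eq: "snd \<xi> v = snd (colift ?z) v" for v
  proof (cases "v \<in> tangent_space A (p x)")
    case True
    then show ?thesis using differential_surj[OF assms(2) True]
        \<open>\<And>u. snd \<xi> (differential A p x u) = snd (colift ?z) (differential A p x u)\<close> by metis
  next
    case False
    then show ?thesis using \<xi>(1) by (simp add: colift_def)
  qed
  show ?thesis
  proof (rule prod_eqI)
    show "snd \<xi> = snd (colift ?z)" by (rule ext, rule eq)
  qed (simp add: assms(3))
qed

lemma C_pairing:
  assumes \<kappa>: "\<kappa> \<in> A" "fst z \<in> Dom \<kappa>"
  shows "snd (C \<kappa> z) \<bullet> fd (P \<kappa>) (fst z) u = snd z \<bullet> u"
proof -
  let ?y = "P \<kappa> (fst z)" and ?v = "fd (P \<kappa>) (fst z) u" and ?w = "fd (P \<kappa>) (fst z) (snd z)"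
  have "snd (C \<kappa> z) \<bullet> ?v = (fst z $ 3)\<^sup>2 * G \<kappa> ?y ?w ?v"
    unfolding G_expand_right[OF \<kappa>(1) P_in_cod[OF \<kappa>(2)], of ?w ?v]
    by (simp add: C_def inner_real3 algebra_simps)
  also have "\<dots> = snd z \<bullet> u"
    using G_P[OF \<kappa>, of "snd z" u] upper_half_space_pos[OF DomD[OF \<kappa>(2)]] by simp
  finally show ?thesis .
qed

lemma open_cotangent_Dom: "\<kappa> \<in> A \<Longrightarrow> open (Dom \<kappa> \<times> (UNIV :: (real^3) set))"
  by (intro open_Times open_Dom open_UNIV)

lemma C_smooth:
  assumes \<kappa>: "\<kappa> \<in> A"
  shows "smooth_on (Dom \<kappa> \<times> UNIV) (C \<kappa>)"
proof -
  let ?D = "Dom \<kappa> \<times> (UNIV :: (real^3) set)"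
  note op = open_cotangent_Dom[OF \<kappa>]
  have f: "smooth_on ?D fst" using smooth_on_fst[OF op smooth_on_ident] by simp
  have Pf: "smooth_on ?D (\<lambda>z. P \<kappa> (fst z))"
    by (rule smooth_on_compose[OF smooth_P[OF \<kappa>] f op open_Dom[OF \<kappa>]]) auto
  have w: "smooth_on ?D (\<lambda>z. fd (P \<kappa>) (fst z) (snd z) $ j)" for j
    by (rule smooth_on_vec_nth[OF op smooth_on_fd_pair[OF open_Dom[OF \<kappa>] smooth_P[OF \<kappa>]]])
  have g: "smooth_on ?D (\<lambda>z. G \<kappa> (P \<kappa> (fst z)) a b)" for a b
    by (rule smooth_on_compose[OF G_smooth[OF \<kappa>] Pf op chart_props(2)[OF \<kappa>]])
       (use P_in_cod[of _ \<kappa>] in auto)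
  have "smooth_on ?D (\<lambda>z. \<chi> i. (fst z $ 3)\<^sup>2 * G \<kappa> (P \<kappa> (fst z)) (fd (P \<kappa>) (fst z) (snd z)) (axis i 1))"
  proof (rule smooth_on_vec[OF op])
    fix i
    have "smooth_on ?D (\<lambda>z. (fst z $ 3)\<^sup>2 *
        (fd (P \<kappa>) (fst z) (snd z) $ 1 * G \<kappa> (P \<kappa> (fst z)) (axis 1 1) (axis i 1) +
         fd (P \<kappa>) (fst z) (snd z) $ 2 * G \<kappa> (P \<kappa> (fst z)) (axis 2 1) (axis i 1) +
         fd (P \<kappa>) (fst z) (snd z) $ 3 * G \<kappa> (P \<kappa> (fst z)) (axis 3 1) (axis i 1)))"
      by (intro smooth_on_mult smooth_on_add smooth_on_power[OF op smooth_on_vec_nth[OF op f]] op w g)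
    then show "smooth_on ?D (\<lambda>z. (\<chi> i. (fst z $ 3)\<^sup>2 *
        G \<kappa> (P \<kappa> (fst z)) (fd (P \<kappa>) (fst z) (snd z)) (axis i 1)) $ i)"
      by (rule smooth_on_cong[OF op, rotated])
         (simp add: G_expand_left[OF \<kappa> P_in_cod, of _ "fd (P \<kappa>) _ _"] mem_Times_iff)
  qed
  then show ?thesis unfolding C_def[abs_def] using Pf by (intro smooth_on_Pair op)
qed

lemma C_local_inverse:
  assumes \<kappa>: "\<kappa> \<in> A" "x \<in> Dom \<kappa>"
  obtains W V \<Theta> where "open W" "open V" "x \<in> W" "W \<subseteq> Dom \<kappa>"
    "smooth_on (V \<times> UNIV) \<Theta>" "\<And>z. fst z \<in> W \<Longrightarrow> C \<kappa> z \<in> V \<times> UNIV \<and> \<Theta> (C \<kappa> z) = z"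
    "\<And>y. y \<in> V \<times> UNIV \<Longrightarrow> fst (\<Theta> y) \<in> W \<and> C \<kappa> (\<Theta> y) = y"
proof -
  obtain W V \<psi> where loc: "open W" "open V" "x \<in> W" "W \<subseteq> Dom \<kappa>"
      "homeomorphism W V (P \<kappa>) \<psi>" "smooth_on V \<psi>"
    using local_inverse[OF \<kappa>] by metis
  define \<Theta> where "\<Theta> y = (\<psi> (fst y), \<chi> i. snd y \<bullet> fd (P \<kappa>) (\<psi> (fst y)) (axis i 1))"
    for y :: "(real^3) \<times> (real^3)"
  have op: "open (V \<times> (UNIV :: (real^3) set))" using loc(2) by (simp add: open_Times)
  have \<psi>W: "\<psi> y \<in> W" "P \<kappa> (\<psi> y) = y" if "y \<in> V" for y
    using homeomorphism_image2[OF loc(5)] homeomorphism_apply2[OF loc(5)] that by auto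
  have fs: "smooth_on (V \<times> UNIV) (fst :: (real^3) \<times> (real^3) \<Rightarrow> _)"
    "smooth_on (V \<times> UNIV) (snd :: (real^3) \<times> (real^3) \<Rightarrow> _)"
    using smooth_on_fst[OF op smooth_on_ident] smooth_on_snd[OF op smooth_on_ident] by simp_all
  have s1: "smooth_on (V \<times> UNIV) (\<lambda>y :: (real^3) \<times> (real^3). \<psi> (fst y))"
    by (rule smooth_on_compose[OF loc(6) fs(1) op loc(2)]) auto
  have s2: "smooth_on (V \<times> UNIV) (\<lambda>y :: (real^3) \<times> (real^3). fd (P \<kappa>) (\<psi> (fst y)) e)" for e
    by (rule smooth_on_compose[OF smooth_on_fd[OF smooth_P[OF \<kappa>(1)]] s1 op open_Dom[OF \<kappa>(1)]])
       (use \<psi>W loc(4) in auto)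
  have sm: "smooth_on (V \<times> UNIV) \<Theta>" unfolding \<Theta>_def[abs_def]
    by (intro smooth_on_Pair op s1 smooth_on_vec) (simp, intro smooth_on_inner op fs s2)
  have 1: "C \<kappa> z \<in> V \<times> UNIV \<and> \<Theta> (C \<kappa> z) = z" if "fst z \<in> W" for z
  proof -
    have fC: "fst (C \<kappa> z) = P \<kappa> (fst z)" by (simp add: C_def)
    have e: "\<psi> (P \<kappa> (fst z)) = fst z" "P \<kappa> (fst z) \<in> V"
      using homeomorphism_apply1[OF loc(5) that] homeomorphism_image1[OF loc(5)] that by auto
    have s: "snd (C \<kappa> z) \<bullet> fd (P \<kappa>) (fst z) (axis i 1) = snd z $ i" for i
      using C_pairing[OF \<kappa>(1), of z "axis i 1"] that loc(4) by (auto simp: inner_axis)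
    have "\<Theta> (C \<kappa> z) = (fst z, \<chi> i. snd z $ i)"
      unfolding \<Theta>_def fC e s ..
    then show ?thesis using e(2) fC by (simp add: mem_Times_iff)
  qed
  have 2: "fst (\<Theta> y) \<in> W \<and> C \<kappa> (\<Theta> y) = y" if "y \<in> V \<times> UNIV" for y
  proof -
    have y: "fst y \<in> V" using that by (simp add: mem_Times_iff)
    have D: "fst (\<Theta> y) \<in> Dom \<kappa>" using \<psi>W[OF y] loc(4) by (auto simp: \<Theta>_def)
    have "(snd (C \<kappa> (\<Theta> y)) - snd y) \<bullet> fd (P \<kappa>) (fst (\<Theta> y)) u = 0" for u
    proof -
      have "snd y \<bullet> fd (P \<kappa>) (fst (\<Theta> y)) u = snd (\<Theta> y) \<bullet> u"
        using linear_functional_real3[OF linear_compose[OF P_linear[OF \<kappa>(1) D],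
              of "\<lambda>w. snd y \<bullet> w", unfolded o_def], of u]
        by (simp add: \<Theta>_def linear_iff inner_add_right)
      then show ?thesis using C_pairing[OF \<kappa>(1) D, of u] by (simp add: inner_diff_left)
    qed
    then have "(snd (C \<kappa> (\<Theta> y)) - snd y) \<bullet> w = 0" for w using P_surj[OF \<kappa>(1) D, of w] by metis
    then have "snd (C \<kappa> (\<Theta> y)) = snd y" by (metis inner_eq_zero_iff right_minus_eq)
    moreover have "fst (C \<kappa> (\<Theta> y)) = fst y" using \<psi>W[OF y] by (simp add: C_def \<Theta>_def)
    ultimately show ?thesis using \<psi>W[OF y] by (simp add: prod_eq_iff \<Theta>_def)
  qed
  show thesis by (rule that[OF loc(1-4) sm 1 2])
qed

lemma C_has_derivative: "\<kappa> \<in> A \<Longrightarrow> fst z \<in> Dom \<kappa> \<Longrightarrow> (C \<kappa> has_derivative fd (C \<kappa>) z) (at z)"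
  using smooth_on_has_derivative[OF C_smooth] by (simp add: mem_Times_iff)

lemma C_derivative_surj:
  assumes \<kappa>: "\<kappa> \<in> A" "fst z \<in> Dom \<kappa>"
  shows "\<exists>b. fd (C \<kappa>) z b = Y"
proof -
  obtain W V \<Theta> where loc: "open V" "fst z \<in> W" "smooth_on (V \<times> UNIV) \<Theta>"
    "\<And>z. fst z \<in> W \<Longrightarrow> C \<kappa> z \<in> V \<times> UNIV \<and> \<Theta> (C \<kappa> z) = z"
    "\<And>y. y \<in> V \<times> UNIV \<Longrightarrow> fst (\<Theta> y) \<in> W \<and> C \<kappa> (\<Theta> y) = y"
    using C_local_inverse[OF \<kappa>] by metis
  have op: "open (V \<times> (UNIV :: (real^3) set))" using loc(1) by (simp add: open_Times)
  have y: "C \<kappa> z \<in> V \<times> UNIV" "\<Theta> (C \<kappa> z) = z" using loc(4)[OF loc(2)] by auto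
  have d: "(C \<kappa> has_derivative fd (C \<kappa>) z) (at (\<Theta> (C \<kappa> z)))"
    using C_has_derivative[OF \<kappa>] y(2) by simp
  have "((\<lambda>y. C \<kappa> (\<Theta> y)) has_derivative (\<lambda>Y. fd (C \<kappa>) z (fd \<Theta> (C \<kappa> z) Y))) (at (C \<kappa> z))"
    by (rule has_derivative_compose[OF smooth_on_has_derivative[OF loc(3) y(1)] d])
  then have "((\<lambda>y. y) has_derivative (\<lambda>Y. fd (C \<kappa>) z (fd \<Theta> (C \<kappa> z) Y))) (at (C \<kappa> z))"
    by (rule has_derivative_transform_within_open[OF _ op y(1)]) (use loc(5) in auto)
  from has_derivative_unique[OF this has_derivative_ident] show ?thesis by metis
qed

text \<open>The derivative of \<open>C_pairing\<close> expresses the momentum part of \<open>dC\<close> by \<open>dP\<close> and the second derivative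
  of \<open>P\<close>; the latter is symmetric and cancels.\<close>
lemma symplectic_C:
  assumes \<kappa>: "\<kappa> \<in> A" "fst z \<in> Dom \<kappa>"
  shows "symplectic_form (fd (C \<kappa>) z a) (fd (C \<kappa>) z b) = symplectic_form a b"
proof -
  let ?J = "fd (P \<kappa>) (fst z)" and ?K = "\<lambda>u. fd (\<lambda>y. fd (P \<kappa>) y u) (fst z)"
  note dC = C_has_derivative[OF \<kappa>]
  have f: "fst (fd (C \<kappa>) z a) = ?J (fst a)" for a
  proof -
    have 1: "((\<lambda>z. fst (C \<kappa> z)) has_derivative (\<lambda>a. fst (fd (C \<kappa>) z a))) (at z)"
      by (rule bounded_linear.has_derivative[OF bounded_linear_fst dC])
    have "((\<lambda>z. P \<kappa> (fst z)) has_derivative (\<lambda>a. ?J (fst a))) (at z)"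
      by (rule has_derivative_compose[OF bounded_linear_imp_has_derivative[OF bounded_linear_fst]
            P_has_derivative[OF \<kappa>]])
    then have 2: "((\<lambda>z. fst (C \<kappa> z)) has_derivative (\<lambda>a. ?J (fst a))) (at z)" by (simp add: C_def)
    show ?thesis using has_derivative_unique[OF 1 2] by metis
  qed
  have s: "snd (fd (C \<kappa>) z a) \<bullet> ?J u = snd a \<bullet> u - snd (C \<kappa> z) \<bullet> ?K u (fst a)" for a u
  proof -
    have d1: "((\<lambda>z. snd (C \<kappa> z)) has_derivative (\<lambda>a. snd (fd (C \<kappa>) z a))) (at z)"
      by (rule bounded_linear.has_derivative[OF bounded_linear_snd dC])
    have d2: "((\<lambda>z. fd (P \<kappa>) (fst z) u) has_derivative (\<lambda>a. ?K u (fst a))) (at z)"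
      by (rule has_derivative_compose[OF bounded_linear_imp_has_derivative[OF bounded_linear_fst]
            smooth_on_has_derivative[OF smooth_on_fd[OF smooth_P[OF \<kappa>(1)]] \<kappa>(2)]])
    have 1: "((\<lambda>z. snd (C \<kappa> z) \<bullet> fd (P \<kappa>) (fst z) u) has_derivative
        (\<lambda>a. snd (C \<kappa> z) \<bullet> ?K u (fst a) + snd (fd (C \<kappa>) z a) \<bullet> ?J u)) (at z)"
      by (rule has_derivative_inner[OF d1 d2])
    have "((\<lambda>z. snd z \<bullet> u) has_derivative (\<lambda>a. snd a \<bullet> u)) (at z)"
      by (rule bounded_linear_imp_has_derivative)
         (intro bounded_linear_compose[OF bounded_linear_inner_left bounded_linear_snd])
    then have 2: "((\<lambda>z. snd (C \<kappa> z) \<bullet> fd (P \<kappa>) (fst z) u) has_derivative (\<lambda>a. snd a \<bullet> u)) (at z)"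
      by (rule has_derivative_transform_within_open[OF _ open_cotangent_Dom[OF \<kappa>(1)]])
         (use \<kappa> C_pairing[OF \<kappa>(1)] in \<open>auto simp: mem_Times_iff\<close>)
    show ?thesis using fun_cong[OF has_derivative_unique[OF 1 2], of a] by simp
  qed
  have "?K (fst a) (fst b) = ?K (fst b) (fst a)"
    by (rule fd_commute[OF open_Dom[OF \<kappa>(1)] smooth_P[OF \<kappa>(1)] \<kappa>(2)])
  then show ?thesis
    using s[of b "fst a"] s[of a "fst b"] by (simp add: symplectic_form_def f inner_commute)
qed

lemma hamiltonian_colift:
  assumes "fst z \<in> U"
  shows "hamiltonian A h (colift z) = 1/2 * ((fst z $ 3)\<^sup>2 * (snd z \<bullet> snd z))"
proof -
  let ?x = "fst z" and ?D = "differential A p (fst z)"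
  let ?v = "?D ((?x $ 3)\<^sup>2 *\<^sub>R snd z)"
  have pos: "?x $ 3 > 0" using upper_half_space_pos[OF assms] .
  have "sharp A h (colift z) = ?v"
    unfolding sharp_def
  proof (rule the_equality)
    have "h (p ?x) ?v w = snd (colift z) w" if w: "w \<in> tangent_space A (p ?x)" for w
    proof -
      obtain u where u: "w = ?D u" using differential_surj[OF assms w] by blast
      show ?thesis unfolding u using p_isometry[OF assms] colift_differential[OF assms, of u] pos by simp
    qed
    then show "?v \<in> tangent_space A (fst (colift z)) \<and>
        (\<forall>w\<in>tangent_space A (fst (colift z)). h (fst (colift z)) ?v w = snd (colift z) w)"
      using differential_in_tangent_space[OF assms] by simp
  next
    fix v assume v: "v \<in> tangent_space A (fst (colift z)) \<and>
        (\<forall>w\<in>tangent_space A (fst (colift z)). h (fst (colift z)) v w = snd (colift z) w)"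
    then obtain u where u: "v = ?D u" using differential_surj[OF assms, of v] by auto
    have "h (p ?x) (?D u) (?D w) = snd z \<bullet> w" for w
      using v u colift_differential[OF assms, of w] differential_in_tangent_space[OF assms, of w] by simp
    then have "u \<bullet> w = ((?x $ 3)\<^sup>2 *\<^sub>R snd z) \<bullet> w" for w
      using p_isometry[OF assms, of u w] pos by (simp add: field_simps)
    then have "u = (?x $ 3)\<^sup>2 *\<^sub>R snd z" using vector_eq_rdot by blast
    then show "v = ?v" using u by simp
  qed
  then show ?thesis
    unfolding hamiltonian_def using p_isometry[OF assms] pos by (simp add: power2_eq_square)
qed

lemma inv_canonical_C:
  assumes \<kappa>: "\<kappa> \<in> A" "fst z \<in> Dom \<kappa>"
  shows "inv_canonical A \<kappa> (C \<kappa> z) = colift z"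
proof -
  note x = DomD[OF \<kappa>(2)]
  have q: "inv_coord \<kappa> (fst (C \<kappa> z)) = p (fst z)" using inv_coord_P[OF \<kappa>] by (simp add: C_def)
  have "snd (inv_canonical A \<kappa> (C \<kappa> z)) v = snd (colift z) v" for v
  proof (cases "v \<in> tangent_space A (p (fst z))")
    case True
    then obtain u where u: "v = differential A p (fst z) u" using differential_surj[OF x] by blast
    have "v \<kappa> = fd (P \<kappa>) (fst z) u" using u differential_apply[OF charts_at_DomI[OF \<kappa>]] by simp
    then show ?thesis
      using True C_pairing[OF \<kappa>, of u] colift_differential[OF x, of u] u
      by (simp add: inv_canonical_def q)
  next
    case False
    then show ?thesis by (simp add: inv_canonical_def q colift_def)
  qed
  then show ?thesis by (simp add: prod_eq_iff fun_eq_iff) (simp add: inv_canonical_def q)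
qed

text \<open>In the half space the Hamiltonian is \<open>z\<^sup>2 |\<xi>|\<^sup>2/2\<close>.  The local inverse of \<open>C \<kappa>\<close> shows that the
  Hamiltonian is differentiable in canonical coordinates, and then the chain rule applies.\<close>
lemma hamiltonian_derivative:
  assumes \<kappa>: "\<kappa> \<in> A" "fst z \<in> Dom \<kappa>"
  shows "fd (hamiltonian A h \<circ> inv_canonical A \<kappa>) (C \<kappa> z) (fd (C \<kappa>) z b) =
    fst z $ 3 * fst b $ 3 * (snd z \<bullet> snd z) + (fst z $ 3)\<^sup>2 * (snd z \<bullet> snd b)"
proof -
  define H0 where "H0 z = 1/2 * ((fst z $ 3)\<^sup>2 * (snd z \<bullet> snd z))" for z :: "(real^3) \<times> (real^3)"
  define Hk where "Hk = hamiltonian A h \<circ> inv_canonical A \<kappa>"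
  have HC: "Hk (C \<kappa> z) = H0 z" if "fst z \<in> Dom \<kappa>" for z
    using inv_canonical_C[OF \<kappa>(1) that] hamiltonian_colift[OF DomD[OF that]] by (simp add: Hk_def H0_def)
  have dz: "((\<lambda>z. fst z $ 3) has_derivative (\<lambda>b. fst b $ 3)) (at z)" for z :: "(real^3) \<times> (real^3)"
    by (rule bounded_linear_imp_has_derivative)
       (intro bounded_linear_compose[OF bounded_linear_vec_nth bounded_linear_fst])
  have dH0: "(H0 has_derivative (\<lambda>b. fst z $ 3 * fst b $ 3 * (snd z \<bullet> snd z) +
      (fst z $ 3)\<^sup>2 * (snd z \<bullet> snd b))) (at z)" for z
    unfolding H0_def[abs_def]
    by (auto intro!: derivative_eq_intros dz simp: fun_eq_iff inner_commute power2_eq_square algebra_simps)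
  obtain W V \<Theta> where loc: "open V" "fst z \<in> W" "W \<subseteq> Dom \<kappa>" "smooth_on (V \<times> UNIV) \<Theta>"
    "\<And>z. fst z \<in> W \<Longrightarrow> C \<kappa> z \<in> V \<times> UNIV \<and> \<Theta> (C \<kappa> z) = z"
    "\<And>y. y \<in> V \<times> UNIV \<Longrightarrow> fst (\<Theta> y) \<in> W \<and> C \<kappa> (\<Theta> y) = y"
    using C_local_inverse[OF \<kappa>] by metis
  have op: "open (V \<times> (UNIV :: (real^3) set))" using loc(1) by (simp add: open_Times)
  have y: "C \<kappa> z \<in> V \<times> UNIV" "\<Theta> (C \<kappa> z) = z" using loc(5)[OF loc(2)] by auto
  have "((\<lambda>y. H0 (\<Theta> y)) has_derivative (\<lambda>Y. fst (\<Theta> (C \<kappa> z)) $ 3 * fst (fd \<Theta> (C \<kappa> z) Y) $ 3 *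
      (snd (\<Theta> (C \<kappa> z)) \<bullet> snd (\<Theta> (C \<kappa> z))) + (fst (\<Theta> (C \<kappa> z)) $ 3)\<^sup>2 *
      (snd (\<Theta> (C \<kappa> z)) \<bullet> snd (fd \<Theta> (C \<kappa> z) Y)))) (at (C \<kappa> z))"
    by (rule has_derivative_compose[OF smooth_on_has_derivative[OF loc(4) y(1)] dH0])
  moreover have "H0 (\<Theta> y) = Hk y" if "y \<in> V \<times> UNIV" for y
    using HC[of "\<Theta> y"] loc(6)[OF that] loc(3) by auto
  ultimately have "\<exists>D. (Hk has_derivative D) (at (C \<kappa> z))"
    using has_derivative_transform_within_open[OF _ op y(1)] by blast
  then have "(Hk has_derivative fd Hk (C \<kappa> z)) (at (C \<kappa> z))"
    using differentiableI frechet_derivative_works by blast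
  from has_derivative_compose[OF C_has_derivative[OF \<kappa>] this]
  have "(H0 has_derivative (\<lambda>b. fd Hk (C \<kappa> z) (fd (C \<kappa>) z b))) (at z)"
    by (rule has_derivative_transform_within_open[OF _ open_cotangent_Dom[OF \<kappa>(1)]])
       (use HC \<kappa> in \<open>auto simp: mem_Times_iff\<close>)
  from fun_cong[OF has_derivative_unique[OF this dH0], of b] show ?thesis by (simp add: Hk_def)
qed

lemma colift_smooth:
  fixes \<Gamma> :: "'d::euclidean_space \<Rightarrow> (real^3) \<times> (real^3)"
  assumes \<Gamma>: "smooth_in S \<Gamma>" "\<And>s. s \<in> S \<Longrightarrow> fst (\<Gamma> s) \<in> U"
  shows "smooth_cotangent_map X A S (\<lambda>s. colift (\<Gamma> s))"
  unfolding smooth_cotangent_map_def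
proof (intro conjI ballI)
  show "(\<lambda>s. colift (\<Gamma> s)) ` S \<subseteq> cotangent_bundle X A"
    using colift_in_cotangent_bundle \<Gamma>(2) by blast
  have cf: "continuous_on S (\<lambda>s. fst (\<Gamma> s))"
    using smooth_in_continuous[OF \<Gamma>(1)] by (intro continuous_intros)
  have "continuous_on S (\<lambda>s. p (fst (\<Gamma> s)))"
    by (rule continuous_on_compose2[OF p_continuous cf]) (use \<Gamma>(2) in auto)
  then show "continuous_on S (fst \<circ> (\<lambda>s. colift (\<Gamma> s)))" by (simp add: o_def)
  fix s \<kappa> assume s: "s \<in> S" "\<kappa> \<in> charts_at A (fst (colift (\<Gamma> s)))"
  then have \<kappa>: "\<kappa> \<in> A" "fst (\<Gamma> s) \<in> Dom \<kappa>" using charts_at_DomD \<Gamma>(2) by auto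
  obtain N where N: "open N" "S \<inter> (\<lambda>s. fst (\<Gamma> s)) -` Dom \<kappa> = S \<inter> N"
    using continuous_openin_preimage_gen[OF cf open_Dom[OF \<kappa>(1)]] unfolding openin_open by metis
  have "smooth_at S s \<Gamma>" using \<Gamma>(1) s(1) by (simp add: smooth_in_def)
  then have "smooth_at S s (\<lambda>s. C \<kappa> (\<Gamma> s))"
    using smooth_at_compose_on[where f=\<Gamma>, OF C_smooth[OF \<kappa>(1)] open_cotangent_Dom[OF \<kappa>(1)] _ s(1)] \<kappa>(2)
    by (simp add: mem_Times_iff)
  then show "smooth_at S s (canonical A \<kappa> \<circ> (\<lambda>s. colift (\<Gamma> s)))"
  proof (rule smooth_at_cong[OF _ N(1)])
    show "s \<in> N" using N \<kappa>(2) s(1) by blast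
    fix r assume "r \<in> S \<inter> N"
    then have "fst (\<Gamma> r) \<in> Dom \<kappa>" using N(2) by blast
    then show "C \<kappa> (\<Gamma> r) = (canonical A \<kappa> \<circ> (\<lambda>s. colift (\<Gamma> s))) r"
      using canonical_colift[OF \<kappa>(1)] by simp
  qed
qed

lemma canonical_colift_derivative:
  assumes \<Gamma>: "(\<Gamma> has_vector_derivative \<Gamma>') (at t within S)" "fst (\<Gamma> t) \<in> Dom \<kappa>" "t \<in> S" and \<kappa>: "\<kappa> \<in> A"
    and c: "continuous_on S \<Gamma>" and t: "at t within S \<noteq> bot"
    and \<gamma>: "\<And>s. s \<in> S \<Longrightarrow> \<gamma> s = colift (\<Gamma> s)"
  shows "vector_derivative (canonical A \<kappa> \<circ> \<gamma>) (at t within S) = fd (C \<kappa>) (\<Gamma> t) \<Gamma>'"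
proof -
  have d: "((\<lambda>s. C \<kappa> (\<Gamma> s)) has_vector_derivative fd (C \<kappa>) (\<Gamma> t) \<Gamma>') (at t within S)"
    using has_derivative_compose[OF \<Gamma>(1)[unfolded has_vector_derivative_def] C_has_derivative[OF \<kappa> \<Gamma>(2)]]
      linear_scale[OF has_derivative_linear[OF C_has_derivative[OF \<kappa> \<Gamma>(2)]]]
    by (simp add: has_vector_derivative_def)
  have "\<exists>e>0. \<forall>s\<in>S. dist s t < e \<longrightarrow> fst (\<Gamma> s) \<in> Dom \<kappa>"
  proof -
    have "openin (top_of_set S) (S \<inter> (\<lambda>s. fst (\<Gamma> s)) -` Dom \<kappa>)"
      using c by (intro continuous_openin_preimage_gen open_Dom \<kappa> continuous_intros)
    then obtain e where "e > 0" "ball t e \<inter> S \<subseteq> S \<inter> (\<lambda>s. fst (\<Gamma> s)) -` Dom \<kappa>"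
      unfolding openin_contains_ball using \<Gamma>(2,3) by blast
    then show ?thesis by (intro exI[of _ e]) (auto simp: dist_commute subset_iff)
  qed
  then obtain e where e: "e > 0" "\<And>s. s \<in> S \<Longrightarrow> dist s t < e \<Longrightarrow> fst (\<Gamma> s) \<in> Dom \<kappa>" by blast
  have eq: "C \<kappa> (\<Gamma> s) = (canonical A \<kappa> \<circ> \<gamma>) s" if "s \<in> S" "dist s t < e" for s
    using canonical_colift[OF \<kappa> e(2)[OF that]] \<gamma>[OF that(1)] by simp
  have "((canonical A \<kappa> \<circ> \<gamma>) has_vector_derivative fd (C \<kappa>) (\<Gamma> t) \<Gamma>') (at t within S)"
    using has_derivative_transform_within[OF d[unfolded has_vector_derivative_def] e(1) \<Gamma>(3) eq]
    by (simp only: has_vector_derivative_def)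
  then show ?thesis using vector_derivative_within[OF t] by blast
qed

text \<open>Since \<open>C \<kappa>\<close> is symplectic with surjective derivative, a path solves Hamilton's equation if and
  only if its lift does.\<close>
proposition hamiltonian_equation_lift:
  assumes \<Gamma>: "smooth_in {0..1} \<Gamma>" "\<And>t. t \<in> {0..1} \<Longrightarrow> fst (\<Gamma> t) \<in> U"
    and \<Gamma>': "\<And>t. t \<in> {0..1} \<Longrightarrow> (\<Gamma> has_vector_derivative \<Gamma>' t) (at t within {0..1})"
    and \<gamma>: "\<And>t. t \<in> {0..1} \<Longrightarrow> \<gamma> t = colift (\<Gamma> t)"
  shows "(\<forall>t\<in>{0..1}. \<forall>\<kappa>\<in>charts_at A (fst (\<gamma> t)). \<forall>Y.
      symplectic_form (vector_derivative (canonical A \<kappa> \<circ> \<gamma>) (at t within {0..1})) Y =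
      fd (hamiltonian A h \<circ> inv_canonical A \<kappa>) (canonical A \<kappa> (\<gamma> t)) Y) \<longleftrightarrow>
    (\<forall>t\<in>{0..1}. fst (\<Gamma>' t) = (fst (\<Gamma> t) $ 3)\<^sup>2 *\<^sub>R snd (\<Gamma> t) \<and>
      snd (\<Gamma>' t) = (- (fst (\<Gamma> t) $ 3 * (snd (\<Gamma> t) \<bullet> snd (\<Gamma> t)))) *\<^sub>R axis 3 1)"
proof -
  have "(\<forall>Y. symplectic_form (vector_derivative (canonical A \<kappa> \<circ> \<gamma>) (at t within {0..1})) Y =
      fd (hamiltonian A h \<circ> inv_canonical A \<kappa>) (canonical A \<kappa> (\<gamma> t)) Y) \<longleftrightarrow>
    (fst (\<Gamma>' t) = (fst (\<Gamma> t) $ 3)\<^sup>2 *\<^sub>R snd (\<Gamma> t) \<and>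
      snd (\<Gamma>' t) = (- (fst (\<Gamma> t) $ 3 * (snd (\<Gamma> t) \<bullet> snd (\<Gamma> t)))) *\<^sub>R axis 3 1)" (is "?l \<longleftrightarrow> ?r")
    if t: "t \<in> {0..1}" and c: "\<kappa> \<in> charts_at A (fst (\<gamma> t))" for t \<kappa>
  proof -
    have \<kappa>: "\<kappa> \<in> A" "fst (\<Gamma> t) \<in> Dom \<kappa>" using charts_at_DomD[OF _ \<Gamma>(2)[OF t]] c \<gamma>[OF t] by auto
    have vd: "vector_derivative (canonical A \<kappa> \<circ> \<gamma>) (at t within {0..1}) = fd (C \<kappa>) (\<Gamma> t) (\<Gamma>' t)"
      by (rule canonical_colift_derivative[OF \<Gamma>'[OF t] \<kappa>(2) t \<kappa>(1) smooth_in_continuous[OF \<Gamma>(1)]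
            Icc_not_bot[OF t] \<gamma>])
    have "?l \<longleftrightarrow> (\<forall>Y. symplectic_form (fd (C \<kappa>) (\<Gamma> t) (\<Gamma>' t)) Y =
        fd (hamiltonian A h \<circ> inv_canonical A \<kappa>) (C \<kappa> (\<Gamma> t)) Y)"
      by (simp add: vd \<gamma>[OF t] canonical_colift[OF \<kappa>])
    also have "\<dots> \<longleftrightarrow> (\<forall>b. symplectic_form (fd (C \<kappa>) (\<Gamma> t) (\<Gamma>' t)) (fd (C \<kappa>) (\<Gamma> t) b) =
        fd (hamiltonian A h \<circ> inv_canonical A \<kappa>) (C \<kappa> (\<Gamma> t)) (fd (C \<kappa>) (\<Gamma> t) b))"
      using C_derivative_surj[OF \<kappa>] by metis
    also have "\<dots> \<longleftrightarrow> (\<forall>b. fst (\<Gamma>' t) \<bullet> snd b - fst b \<bullet> snd (\<Gamma>' t) =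
        fst (\<Gamma> t) $ 3 * fst b $ 3 * (snd (\<Gamma> t) \<bullet> snd (\<Gamma> t)) + (fst (\<Gamma> t) $ 3)\<^sup>2 * (snd (\<Gamma> t) \<bullet> snd b))"
      unfolding hamiltonian_derivative[OF \<kappa>] symplectic_C[OF \<kappa>] by (simp add: symplectic_form_def)
    also have "\<dots> \<longleftrightarrow> ?r"
    proof
      assume *: "\<forall>b. fst (\<Gamma>' t) \<bullet> snd b - fst b \<bullet> snd (\<Gamma>' t) =
        fst (\<Gamma> t) $ 3 * fst b $ 3 * (snd (\<Gamma> t) \<bullet> snd (\<Gamma> t)) + (fst (\<Gamma> t) $ 3)\<^sup>2 * (snd (\<Gamma> t) \<bullet> snd b)"
      have "fst (\<Gamma>' t) \<bullet> u = ((fst (\<Gamma> t) $ 3)\<^sup>2 *\<^sub>R snd (\<Gamma> t)) \<bullet> u" for u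
        using *[rule_format, of "(0, u)"] by simp
      moreover have "u \<bullet> snd (\<Gamma>' t) = u \<bullet> ((- (fst (\<Gamma> t) $ 3 * (snd (\<Gamma> t) \<bullet> snd (\<Gamma> t)))) *\<^sub>R axis 3 1)" for u
      proof -
        have "- (u \<bullet> snd (\<Gamma>' t)) = fst (\<Gamma> t) $ 3 * u $ 3 * (snd (\<Gamma> t) \<bullet> snd (\<Gamma> t))"
          using *[rule_format, of "(u, 0)"] by simp
        then have "u \<bullet> snd (\<Gamma>' t) = - (fst (\<Gamma> t) $ 3 * u $ 3 * (snd (\<Gamma> t) \<bullet> snd (\<Gamma> t)))"
          by linarith
        then show ?thesis by (simp add: inner_axis ac_simps)
      qed
      ultimately show ?r using vector_eq_rdot vector_eq_ldot by blast
    qed (auto simp: inner_axis)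
    finally show ?thesis .
  qed
  moreover have "\<exists>\<kappa>. \<kappa> \<in> charts_at A (fst (\<gamma> t))" if "t \<in> {0..1}" for t
    using chart_exists[OF p_in[OF \<Gamma>(2)[OF that]]] \<gamma>[OF that] by simp
  ultimately show ?thesis by meson
qed

lemma cotangent_lift:
  fixes \<gamma> :: "real \<Rightarrow> 'a cotangent"
  assumes \<gamma>: "smooth_cotangent_map X A {0..1} \<gamma>" and x0: "x0 \<in> U" "p x0 = fst (\<gamma> 0)"
  obtains \<Gamma> where "smooth_in {0..1} \<Gamma>" "\<And>t. t \<in> {0..1} \<Longrightarrow> fst (\<Gamma> t) \<in> U"
    "fst (\<Gamma> 0) = x0" "\<And>t. t \<in> {0..1} \<Longrightarrow> \<gamma> t = colift (\<Gamma> t)"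
proof -
  have \<gamma>T: "\<gamma> t \<in> cotangent_bundle X A" if "t \<in> {0..1}" for t
    using \<gamma> that by (auto simp: smooth_cotangent_map_def)
  have sm: "smooth_at {0..1} t (canonical A \<kappa> \<circ> \<gamma>)" if "t \<in> {0..1}" "\<kappa> \<in> charts_at A (fst (\<gamma> t))" for t \<kappa>
    using \<gamma> that by (simp add: smooth_cotangent_map_def)
  have "smooth_map X A {0..1} (fst \<circ> \<gamma>)"
    unfolding smooth_map_def
  proof (intro conjI ballI)
    show "(fst \<circ> \<gamma>) ` {0..1} \<subseteq> X" using \<gamma>T by (force simp: cotangent_bundle_def)
    show "continuous_on {0..1} (fst \<circ> \<gamma>)" using \<gamma> by (simp add: smooth_cotangent_map_def)
    fix t \<kappa> assume "t \<in> {0..1::real}" "\<kappa> \<in> charts_at A ((fst \<circ> \<gamma>) t)"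
    then have "smooth_at {0..1} t (\<lambda>t. fst ((canonical A \<kappa> \<circ> \<gamma>) t))" by (intro smooth_at_fst sm) auto
    then show "smooth_at {0..1} t (coord \<kappa> \<circ> (fst \<circ> \<gamma>))" by (simp add: o_def canonical_def)
  qed
  then obtain f where f: "smooth_in {0..1} f" "f ` {0..1} \<subseteq> U" "f 0 = x0"
    "\<And>t. t \<in> {0..1} \<Longrightarrow> p (f t) = (fst \<circ> \<gamma>) t"
    using lift_exists[of "{0..1}" "fst \<circ> \<gamma>" 0 x0] x0 by auto
  define \<Gamma> where "\<Gamma> t = (f t, \<chi> i. snd (\<gamma> t) (differential A p (f t) (axis i 1)))" for t
  have fU: "fst (\<Gamma> t) \<in> U" if "t \<in> {0..1}" for t using f(2) that by (auto simp: \<Gamma>_def)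
  have \<gamma>\<Gamma>: "\<gamma> t = colift (\<Gamma> t)" if "t \<in> {0..1}" for t
    unfolding \<Gamma>_def
  proof (rule colift_surj[OF \<gamma>T[OF that]])
    show "f t \<in> U" using f(2) that by blast
    show "fst (\<gamma> t) = p (f t)" using f(4)[OF that] by simp
  qed
  have "smooth_in {0..1} \<Gamma>"
    unfolding smooth_in_def
  proof
    fix t :: real assume t: "t \<in> {0..1}"
    obtain \<kappa> where \<kappa>: "\<kappa> \<in> A" "fst (\<Gamma> t) \<in> Dom \<kappa>" using Dom_exists[OF fU[OF t]] by blast
    obtain W V \<Theta> where loc: "open W" "open V" "fst (\<Gamma> t) \<in> W" "W \<subseteq> Dom \<kappa>" "smooth_on (V \<times> UNIV) \<Theta>"
      "\<And>z. fst z \<in> W \<Longrightarrow> C \<kappa> z \<in> V \<times> UNIV \<and> \<Theta> (C \<kappa> z) = z"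
      using C_local_inverse[OF \<kappa>] by metis
    have op: "open (V \<times> (UNIV :: (real^3) set))" using loc(2) by (simp add: open_Times)
    obtain N where N: "open N" "{0..1} \<inter> f -` W = {0..1} \<inter> N"
      using continuous_openin_preimage_gen[OF smooth_in_continuous[OF f(1)] loc(1)]
      unfolding openin_open by metis
    have near: "(canonical A \<kappa> \<circ> \<gamma>) s = C \<kappa> (\<Gamma> s)" if "s \<in> {0..1}" "fst (\<Gamma> s) \<in> W" for s
    proof -
      have "fst (\<Gamma> s) \<in> Dom \<kappa>" using loc(4) that(2) by blast
      then show ?thesis using canonical_colift[OF \<kappa>(1), of "\<Gamma> s"] \<gamma>\<Gamma>[OF that(1)] by simp
    qed
    have "smooth_at {0..1} t (canonical A \<kappa> \<circ> \<gamma>)"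
      using sm[OF t] charts_at_DomI[OF \<kappa>] \<gamma>\<Gamma>[OF t] by simp
    moreover have "(canonical A \<kappa> \<circ> \<gamma>) t \<in> V \<times> UNIV" using near[OF t loc(3)] loc(6)[OF loc(3)] by simp
    ultimately have "smooth_at {0..1} t (\<lambda>s. \<Theta> ((canonical A \<kappa> \<circ> \<gamma>) s))"
      by (rule smooth_at_compose_on[OF loc(5) op _ t])
    then show "smooth_at {0..1} t \<Gamma>"
    proof (rule smooth_at_cong[OF _ N(1)])
      have f\<Gamma>: "fst (\<Gamma> s) = f s" for s by (simp add: \<Gamma>_def)
      show "t \<in> N" using N(2) t loc(3) unfolding f\<Gamma> by blast
      fix s assume "s \<in> {0..1} \<inter> N"
      then have "s \<in> {0..1}" "fst (\<Gamma> s) \<in> W" using N(2) unfolding f\<Gamma> by blast+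
      then show "\<Theta> ((canonical A \<kappa> \<circ> \<gamma>) s) = \<Gamma> s" using near[of s] loc(6)[of "\<Gamma> s"] by metis
    qed
  qed
  moreover have "fst (\<Gamma> 0) = x0" using f(3) by (simp add: \<Gamma>_def)
  ultimately show thesis using that fU \<gamma>\<Gamma> by blast
qed

lemma cotangent_tangent_toI:
  assumes \<Gamma>: "smooth_on UNIV \<Gamma>" "\<And>s. fst (\<Gamma> s) \<in> U" "(\<Gamma> has_vector_derivative \<Gamma>') (at 0)"
    and K: "\<And>s. colift (\<Gamma> s) \<in> K" and \<kappa>: "\<kappa> \<in> A" "fst (\<Gamma> 0) \<in> Dom \<kappa>"
  shows "fd (C \<kappa>) (\<Gamma> 0) \<Gamma>' \<in> cotangent_tangent_to X A \<kappa> K (colift (\<Gamma> 0))"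
  unfolding cotangent_tangent_to_def
proof (intro CollectI exI[of _ "\<lambda>s. colift (\<Gamma> s)"] exI[of _ "1::real"] conjI)
  have "smooth_in {-1<..<1} \<Gamma>"
    using smooth_on_subset[OF \<Gamma>(1) subset_UNIV] smooth_in_open open_greaterThanLessThan by blast
  then show "smooth_cotangent_map X A {-1<..<1} (\<lambda>s. colift (\<Gamma> s))" using colift_smooth \<Gamma>(2) by blast
  show "vector_derivative (canonical A \<kappa> \<circ> (\<lambda>s. colift (\<Gamma> s))) (at 0) = fd (C \<kappa>) (\<Gamma> 0) \<Gamma>'"
    by (rule canonical_colift_derivative[OF \<Gamma>(3) \<kappa>(2) UNIV_I \<kappa>(1) smooth_on_continuous[OF \<Gamma>(1)]]) auto
qed (use K in auto)

lemma colift_conormal_iff: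
  assumes "fst z \<in> U"
  shows "colift z \<in> conormal X A T \<longleftrightarrow> p (fst z) \<in> T \<and>
    (\<forall>u. differential A p (fst z) u \<in> tangent_to X A T (p (fst z)) \<longrightarrow> snd z \<bullet> u = 0)"
proof -
  have "(\<forall>v\<in>tangent_to X A T (p (fst z)). snd (colift z) v = 0) \<longleftrightarrow>
      (\<forall>u. differential A p (fst z) u \<in> tangent_to X A T (p (fst z)) \<longrightarrow> snd z \<bullet> u = 0)"
  proof (intro iffI ballI allI impI)
    fix u assume "\<forall>v\<in>tangent_to X A T (p (fst z)). snd (colift z) v = 0"
      "differential A p (fst z) u \<in> tangent_to X A T (p (fst z))"
    then show "snd z \<bullet> u = 0" using colift_differential[OF assms, of u] by force
  next
    fix v assume *: "\<forall>u. differential A p (fst z) u \<in> tangent_to X A T (p (fst z)) \<longrightarrow> snd z \<bullet> u = 0"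
      "v \<in> tangent_to X A T (p (fst z))"
    obtain u where u: "v = differential A p (fst z) u" using tangent_to_lift[OF *(2) assms] by metis
    then have "snd z \<bullet> u = 0" using * by blast
    then show "snd (colift z) v = 0" unfolding u colift_differential[OF assms] .
  qed
  then show ?thesis
    unfolding conormal_def using colift_in_cotangent_bundle[OF assms] by simp
qed

end

section \<open>Cords and chords are vertical\<close>

context horotorus
begin

definition vertical :: "real^3 \<Rightarrow> real \<Rightarrow> real \<Rightarrow> real^3" where
  "vertical y L t = y + (z0 * (exp (- L * t) - 1)) *\<^sub>R axis 3 1"

lemma vertical_nth:
  assumes "y \<in> H"
  shows "vertical y L t $ 1 = y $ 1" "vertical y L t $ 2 = y $ 2" "vertical y L t $ 3 = z0 * exp (- L * t)"
  using assms by (simp_all add: vertical_def axis_def H_iff algebra_simps)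

lemma vertical_in_U: "y \<in> H \<Longrightarrow> vertical y L t \<in> U"
  using z0 by (simp add: upper_half_space_def vertical_nth)

lemma vertical_0: "vertical y L 0 = y" by (simp add: vertical_def)

lemma vertical_derivative:
  "((\<lambda>t. vertical y L t) has_vector_derivative (- (L * z0 * exp (- L * t))) *\<^sub>R axis 3 1) (at t within S)"
  unfolding vertical_def by (auto intro!: derivative_eq_intros simp: has_vector_derivative_def algebra_simps)

text \<open>Since the lift of \<open>T\<close> at the end is a sphere below \<open>H\<close>, the vertical geodesic points down.\<close>
lemma orthogonal_chordI:
  assumes y: "y \<in> H" and L: "L \<noteq> 0" and e: "p (vertical y L 1) \<in> T"
    and orth: "\<And>u. differential A p (vertical y L 1) u \<in> tangent_to X A T (p (vertical y L 1)) \<Longrightarrow> u $ 3 = 0"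
  shows "orthogonal_chord X A h p T z0 y L (z0 * exp (- L)) (y - z0 *\<^sub>R axis 3 1) (vertical y L)"
proof -
  have "vertical y L 1 $ 3 < z0"
    by (rule end_sphere(1)[OF y vertical_in_U[OF y] e vertical_nth(1,2)[OF y] _ orth])
       (use L z0 in \<open>simp_all add: vertical_nth[OF y]\<close>)
  then have "L > 0" using z0 by (simp add: vertical_nth[OF y])
  then show ?thesis
    using y e orth z0
    by unfold_locales (simp_all add: H_iff vertical_def[abs_def])
qed

text \<open>Perpendicularity to \<open>T\<close> at the start means that the lift from a point of \<open>H\<close> starts vertically.\<close>
lemma cord_vertical:
  assumes c: "c \<in> Cord X A h T" and nc: "nonconstant_path c"
  obtains y L where "orthogonal_chord X A h p T z0 y L (z0 * exp (- L)) (y - z0 *\<^sub>R axis 3 1) (vertical y L)"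
    "\<And>t. t \<in> {0..1} \<Longrightarrow> c t = p (vertical y L t)"
proof -
  have geo: "geodesic X A h c" and cT: "c 0 \<in> T" "c 1 \<in> T"
    and perp: "\<And>i v. i = 0 \<or> i = 1 \<Longrightarrow> v \<in> tangent_to X A T (c i) \<Longrightarrow> h (c i) (velocity A c {0..1} i) v = 0"
    using c by (auto simp: Cord_def)
  obtain y where y: "y \<in> H" "p y = c 0" using cT(1) T by auto
  have yU: "y \<in> U" using y(1) H_subset by auto
  have sm: "smooth_map X A {0..1} c" using geo by (simp add: geodesic_def)
  obtain f where f: "smooth_in {0..1} f" "f ` {0..1} \<subseteq> U" "f 0 = y"
      "\<And>t. t \<in> {0..1} \<Longrightarrow> p (f t) = c t"
    using lift_exists[OF sm convex_real_interval(5) _ yU y(2)] by auto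
  obtain f1 where f1: "smooth_in {0..1} f1"
    "\<And>t. t \<in> {0..1} \<Longrightarrow> (f has_vector_derivative f1 t) (at t within {0..1})"
    using smooth_in_Icc_derivative[OF f(1)] by metis
  obtain f2 where f2: "\<And>t. t \<in> {0..1} \<Longrightarrow> (f1 has_vector_derivative f2 t) (at t within {0..1})"
    using smooth_in_Icc_derivative[OF f1(1)] by metis
  have vel: "velocity A c {0..1} t = differential A p (f t) (f1 t)" if t: "t \<in> {0..1}" for t
    by (rule velocity_projection[OF f1(2)[OF t] f(2) t _ Icc_not_bot[OF t]]) (simp add: f(4))
  have orth: "f1 i \<bullet> u = 0" if i: "i = 0 \<or> i = 1"
    and u: "differential A p (f i) u \<in> tangent_to X A T (p (f i))" for i u
  proof -
    have i1: "i \<in> {0..1}" using i by auto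
    have fi: "f i \<in> U" using f(2) i1 by auto
    have "(f1 i \<bullet> u) / (f i $ 3)\<^sup>2 = 0"
      using perp[OF i, of "differential A p (f i) u"] u vel[OF i1] f(4)[OF i1]
        p_isometry[OF fi, of "f1 i" u] by simp
    then show ?thesis using upper_half_space_pos[OF fi] by simp
  qed
  have init: "f1 0 $ i = 0" if "i = 1 \<or> i = 2" for i
  proof -
    have "(axis i 1 :: real^3) $ 3 = 0" using that by (auto simp: axis_def)
    then have "f1 0 \<bullet> axis i 1 = 0"
      using orth[of 0 "axis i 1"] tangent_H[OF y(1), of "axis i 1"] f(3) by simp
    then show ?thesis by (simp add: inner_axis)
  qed
  have y3: "y $ 3 = z0" using y(1) H_iff by blast
  have eq: "f t $ 3 * (f2 t \<bullet> w) - 2 * (f1 t \<bullet> w) * f1 t $ 3 + (f1 t \<bullet> f1 t) * w $ 3 = 0"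
    if "t \<in> {0..1}" for t w
    by (rule geodesic_lift[OF geo f(2,4) f1(2) f2 that])
  obtain L where "\<forall>t\<in>{0..1}. f t = f 0 + (f 0 $ 3 * (exp (- L * t) - 1)) *\<^sub>R axis 3 1"
    by (rule vertical_geodesic[OF f(2) f1(2) f2 eq init[OF disjI1[OF refl]] init[OF disjI2[OF refl]]])
       blast+
  then have fv: "f t = vertical y L t" if "t \<in> {0..1}" for t using that f(3) y3 by (simp add: vertical_def)
  have cv: "c t = p (vertical y L t)" if "t \<in> {0..1}" for t using f(4)[OF that] fv[OF that] by simp
  have "L \<noteq> 0"
  proof
    assume "L = 0"
    then have "c t = c 0" if "t \<in> {0..1}" for t using cv[OF that] cv[of 0] by (simp add: vertical_def)
    then show False using nc unfolding nonconstant_path_def by blast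
  qed
  moreover have "u $ 3 = 0"
    if u: "differential A p (vertical y L 1) u \<in> tangent_to X A T (p (vertical y L 1))" for u
  proof -
    have t1: "(1::real) \<in> {0..1}" by simp
    have "(f has_vector_derivative (- (L * z0 * exp (- L * 1))) *\<^sub>R axis 3 1) (at 1 within {0..1})"
      by (rule has_vector_derivative_transform[OF t1 fv vertical_derivative])
    from vector_derivative_unique_within[OF Icc_not_bot[OF t1] f1(2)[OF t1] this]
    show ?thesis using orth[of 1 u] u fv[OF t1] \<open>L \<noteq> 0\<close> z0 by (simp add: inner_axis')
  qed
  ultimately have "orthogonal_chord X A h p T z0 y L (z0 * exp (- L)) (y - z0 *\<^sub>R axis 3 1) (vertical y L)"
    using cT(2) cv[of 1] by (intro orthogonal_chordI[OF y(1)]) auto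
  then show thesis using that cv by blast
qed

lemma vertical_covector_conormal:
  assumes "y \<in> H"
  shows "colift (y, r *\<^sub>R axis 3 1) \<in> conormal X A T"
proof -
  have "y \<in> U" using assms H_subset by auto
  then show ?thesis
    using colift_conormal_iff[of "(y, r *\<^sub>R axis 3 1)" T] tangent_H[OF assms] T assms
    by (auto simp: inner_axis')
qed

text \<open>The first integrals \<open>\<xi>\<^sub>1\<close>, \<open>\<xi>\<^sub>2\<close> and \<open>z \<xi>\<^sub>3\<close> determine the solution; the conormal condition at the
  start makes \<open>\<xi>\<^sub>1\<close> and \<open>\<xi>\<^sub>2\<close> vanish.  At the end the covector is a nonzero multiple of the vertical one, so
  the conormal condition there says that \<open>T\<close> is met orthogonally.\<close>
lemma hamiltonian_chord_vertical:
  assumes \<gamma>: "hamiltonian_chord X A h T \<gamma>" and nc: "nonconstant_path \<gamma>"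
  obtains y L where "orthogonal_chord X A h p T z0 y L (z0 * exp (- L)) (y - z0 *\<^sub>R axis 3 1) (vertical y L)"
    "\<And>t. t \<in> {0..1} \<Longrightarrow> \<gamma> t = colift (vertical y L t, (- (L / (z0 * exp (- L * t)))) *\<^sub>R axis 3 1)"
proof -
  have tr: "hamiltonian_trajectory X A h \<gamma>" and con: "\<gamma> 0 \<in> conormal X A T" "\<gamma> 1 \<in> conormal X A T"
    using \<gamma> by (auto simp: hamiltonian_chord_def)
  have sm: "smooth_cotangent_map X A {0..1} \<gamma>" using tr by (simp add: hamiltonian_trajectory_def)
  have "fst (\<gamma> 0) \<in> T" using con(1) by (simp add: conormal_def)
  then obtain y where y: "y \<in> H" "p y = fst (\<gamma> 0)" using T by auto
  have yU: "y \<in> U" using y(1) H_subset by auto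
  obtain \<Gamma> where \<Gamma>: "smooth_in {0..1} \<Gamma>" "\<And>t. t \<in> {0..1} \<Longrightarrow> fst (\<Gamma> t) \<in> U"
    "fst (\<Gamma> 0) = y" "\<And>t. t \<in> {0..1} \<Longrightarrow> \<gamma> t = colift (\<Gamma> t)"
    using cotangent_lift[OF sm yU y(2)] by metis
  obtain \<Gamma>' where \<Gamma>': "\<And>t. t \<in> {0..1} \<Longrightarrow> (\<Gamma> has_vector_derivative \<Gamma>' t) (at t within {0..1})"
    using smooth_in_Icc_derivative[OF \<Gamma>(1)] by metis
  have ham: "fst (\<Gamma>' t) = (fst (\<Gamma> t) $ 3)\<^sup>2 *\<^sub>R snd (\<Gamma> t)"
    "snd (\<Gamma>' t) = (- (fst (\<Gamma> t) $ 3 * (snd (\<Gamma> t) \<bullet> snd (\<Gamma> t)))) *\<^sub>R axis 3 1" if "t \<in> {0..1}" for t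
    using hamiltonian_equation_lift[OF \<Gamma>(1,2) \<Gamma>' \<Gamma>(4)] tr that
    unfolding hamiltonian_trajectory_def by blast+
  define x where "x i t = fst (\<Gamma> t) $ i" for i t
  define \<xi> where "\<xi> i t = snd (\<Gamma> t) $ i" for i t
  have pos: "x 3 t > 0" if "t \<in> {0..1}" for t
    using upper_half_space_pos[OF \<Gamma>(2)[OF that]] by (simp add: x_def)
  have dx: "(x i has_real_derivative (x 3 t)\<^sup>2 * \<xi> i t) (at t within {0..1})" if "t \<in> {0..1}" for t i
    using has_real_derivative_nth[OF bounded_linear.has_vector_derivative[OF bounded_linear_fst \<Gamma>'[OF that]], of i]
      ham(1)[OF that] by (simp add: x_def[abs_def] \<xi>_def)
  have d\<xi>: "(\<xi> i has_real_derivative - (x 3 t * (snd (\<Gamma> t) \<bullet> snd (\<Gamma> t)) * (axis 3 1 :: real^3) $ i))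
      (at t within {0..1})" if "t \<in> {0..1}" for t i
    using has_real_derivative_nth[OF bounded_linear.has_vector_derivative[OF bounded_linear_snd \<Gamma>'[OF that]], of i]
      ham(2)[OF that] by (simp add: x_def \<xi>_def[abs_def])
  have t0: "(0::real) \<in> {0..1}" and t1: "(1::real) \<in> {0..1}" by auto
  have hor: "\<xi> i t = 0 \<and> x i t = y $ i" if i: "i = 1 \<or> i = 2" and t: "t \<in> {0..1}" for i t
  proof -
    have e: "(axis 3 1 :: real^3) $ i = 0" "(axis i 1 :: real^3) $ 3 = 0" using i by (auto simp: axis_def)
    have "snd (\<Gamma> 0) \<bullet> axis i 1 = 0"
      using con(1) \<Gamma>(3) \<Gamma>(4)[OF t0] colift_conormal_iff[OF \<Gamma>(2)[OF t0], of T] tangent_H[OF y(1)] e(2) by auto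
    then have "\<xi> i 0 = 0" by (simp add: \<xi>_def inner_axis)
    moreover have "\<xi> i s = \<xi> i 0" if "s \<in> {0..1}" for s
      by (rule constant_of_zero_derivative[OF _ that]) (use d\<xi>[of _ i] e in auto)
    ultimately have z: "\<xi> i s = 0" if "s \<in> {0..1}" for s using that by metis
    have "x i t = x i 0"
      by (rule constant_of_zero_derivative[OF _ t]) (use dx[of _ i] z in auto)
    then show ?thesis using z[OF t] \<Gamma>(3) by (simp add: x_def)
  qed
  have sq: "snd (\<Gamma> t) \<bullet> snd (\<Gamma> t) = \<xi> 3 t * \<xi> 3 t" if "t \<in> {0..1}" for t
    using hor[OF _ that, of 1] hor[OF _ that, of 2] by (simp add: inner_real3 \<xi>_def)
  define L where "L = - (x 3 0 * \<xi> 3 0)"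
  have xL: "x 3 t * \<xi> 3 t = - L" if t: "t \<in> {0..1}" for t
  proof -
    have "x 3 t * \<xi> 3 t = x 3 0 * \<xi> 3 0"
    proof (rule constant_of_zero_derivative[OF _ t])
      fix s :: real assume s: "s \<in> {0..1}"
      show "((\<lambda>t. x 3 t * \<xi> 3 t) has_real_derivative 0) (at s within {0..1})"
        by (rule DERIV_cong[OF DERIV_mult[OF dx[OF s] d\<xi>[OF s]]])
           (simp add: sq[OF s] power2_eq_square algebra_simps)
    qed
    then show ?thesis by (simp add: L_def)
  qed
  have x3: "x 3 t = z0 * exp (- L * t)" if t: "t \<in> {0..1}" for t
  proof -
    have "x 3 t = x 3 0 * exp (- L * t)"
    proof (rule exponential_decay[OF _ t])
      fix s :: real assume s: "s \<in> {0..1}"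
      have "(x 3 s)\<^sup>2 * \<xi> 3 s = x 3 s * (x 3 s * \<xi> 3 s)" by (simp add: power2_eq_square)
      then have "(x 3 s)\<^sup>2 * \<xi> 3 s = - L * x 3 s" by (simp add: xL[OF s])
      then show "(x 3 has_real_derivative - L * x 3 s) (at s within {0..1})" using dx[OF s, of 3] by simp
    qed
    then show ?thesis using \<Gamma>(3) y(1) by (simp add: x_def H_iff)
  qed
  have \<Gamma>v: "\<Gamma> t = (vertical y L t, (- (L / (z0 * exp (- L * t)))) *\<^sub>R axis 3 1)" if t: "t \<in> {0..1}" for t
  proof (rule prod_eqI)
    show "fst (\<Gamma> t) = fst (vertical y L t, (- (L / (z0 * exp (- L * t)))) *\<^sub>R (axis 3 1 :: real^3))"
      using hor[OF _ t, of 1] hor[OF _ t, of 2] x3[OF t] vertical_nth[OF y(1), of L t]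
      by (simp add: vec_eq_iff forall_3 x_def)
    have "\<xi> 3 t = x 3 t * \<xi> 3 t / x 3 t" using pos[OF t] by simp
    also have "\<dots> = - (L / (z0 * exp (- L * t)))" using xL[OF t] x3[OF t] by simp
    finally show "snd (\<Gamma> t) = snd (vertical y L t, (- (L / (z0 * exp (- L * t)))) *\<^sub>R (axis 3 1 :: real^3))"
      using hor[OF _ t, of 1] hor[OF _ t, of 2] by (simp add: vec_eq_iff forall_3 \<xi>_def axis_def)
  qed
  have "L \<noteq> 0"
  proof
    assume "L = 0"
    then have "\<gamma> t = \<gamma> 0" if "t \<in> {0..1}" for t
      unfolding \<Gamma>(4)[OF that] \<Gamma>(4)[OF t0] \<Gamma>v[OF that] \<Gamma>v[OF t0] by (simp add: vertical_def \<open>L = 0\<close>)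
    then show False using nc unfolding nonconstant_path_def by blast
  qed
  moreover have "p (vertical y L 1) \<in> T \<and> (\<forall>u. differential A p (vertical y L 1) u \<in>
      tangent_to X A T (p (vertical y L 1)) \<longrightarrow> snd (\<Gamma> 1) \<bullet> u = 0)"
    using con(2) \<Gamma>(4)[OF t1] colift_conormal_iff[OF \<Gamma>(2)[OF t1], of T] \<Gamma>v[OF t1] by simp
  moreover have "u $ 3 = 0" if "snd (\<Gamma> 1) \<bullet> u = 0" for u
    using that \<open>L \<noteq> 0\<close> z0 \<Gamma>v[OF t1] by (simp add: inner_axis')
  ultimately have "orthogonal_chord X A h p T z0 y L (z0 * exp (- L)) (y - z0 *\<^sub>R axis 3 1) (vertical y L)"
    by (intro orthogonal_chordI[OF y(1)]) auto
  then show thesis using that \<Gamma>(4) \<Gamma>v by simp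
qed

text \<open>The explicit trajectory that starts with the conormal covector \<open>- (l/z0) e\<^sub>3\<close> at \<open>y\<close>.\<close>
lemma time_one_vertical:
  assumes y: "y \<in> H"
  shows "colift (vertical y l 1, (- (l / z0 * exp l)) *\<^sub>R axis 3 1) \<in> time_one_image X A h (conormal X A T)"
proof -
  define \<Gamma> where "\<Gamma> t = (vertical y l t, (- (l / z0 * exp (l * t))) *\<^sub>R (axis 3 1 :: real^3))" for t
  define \<Gamma>' where "\<Gamma>' t = ((- (l * z0 * exp (- l * t))) *\<^sub>R (axis 3 1 :: real^3),
    (- (l * l / z0 * exp (l * t))) *\<^sub>R (axis 3 1 :: real^3))" for t
  have U: "fst (\<Gamma> t) \<in> U" for t using vertical_in_U[OF y] by (simp add: \<Gamma>_def)
  have "smooth_on UNIV \<Gamma>"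
    unfolding \<Gamma>_def[abs_def] vertical_def[abs_def] diff_conv_add_uminus
    by (intro smooth_on_Pair smooth_on_add smooth_on_scaleR smooth_on_mult smooth_on_exp smooth_on_minus
        smooth_on_const smooth_on_ident open_UNIV)
  then have sm: "smooth_in {0..1} \<Gamma>"
    unfolding smooth_in_def using smooth_on_imp_smooth_at[OF _ open_UNIV UNIV_I] by blast
  have d: "(\<Gamma> has_vector_derivative \<Gamma>' t) (at t within {0..1})" for t
  proof -
    have "((\<lambda>t. (- (l / z0 * exp (l * t))) *\<^sub>R (axis 3 1 :: real^3)) has_vector_derivative
        (- (l * l / z0 * exp (l * t))) *\<^sub>R axis 3 1) (at t within {0..1})"
      using z0 by (auto intro!: derivative_eq_intros simp: has_vector_derivative_def algebra_simps)
    then show ?thesis unfolding \<Gamma>_def[abs_def] \<Gamma>'_def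
      by (intro has_vector_derivative_Pair vertical_derivative)
  qed
  define \<gamma> where "\<gamma> t = colift (\<Gamma> t)" for t
  have "\<forall>t\<in>{0..1}. fst (\<Gamma>' t) = (fst (\<Gamma> t) $ 3)\<^sup>2 *\<^sub>R snd (\<Gamma> t) \<and>
      snd (\<Gamma>' t) = (- (fst (\<Gamma> t) $ 3 * (snd (\<Gamma> t) \<bullet> snd (\<Gamma> t)))) *\<^sub>R axis 3 1"
  proof
    fix t :: real
    define E where "E = exp (l * t)"
    have E: "exp (- l * t) = 1 / E" "E > 0" by (simp_all add: E_def exp_minus field_simps)
    show "fst (\<Gamma>' t) = (fst (\<Gamma> t) $ 3)\<^sup>2 *\<^sub>R snd (\<Gamma> t) \<and>
      snd (\<Gamma>' t) = (- (fst (\<Gamma> t) $ 3 * (snd (\<Gamma> t) \<bullet> snd (\<Gamma> t)))) *\<^sub>R axis 3 1"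
      using z0 E(2) unfolding \<Gamma>_def \<Gamma>'_def fst_conv snd_conv vertical_nth(3)[OF y] E_def[symmetric] E(1)
      by (simp add: inner_axis' power2_eq_square field_simps)
  qed
  then have "hamiltonian_trajectory X A h \<gamma>"
    unfolding hamiltonian_trajectory_def
    using hamiltonian_equation_lift[OF sm U d, of \<gamma>] colift_smooth[OF sm U] \<gamma>_def[abs_def] by simp
  moreover have "\<gamma> 0 \<in> conormal X A T"
    using vertical_covector_conormal[OF y, of "- (l / z0)"] by (simp add: \<gamma>_def \<Gamma>_def vertical_0)
  moreover have "\<gamma> 1 = colift (vertical y l 1, (- (l / z0 * exp l)) *\<^sub>R axis 3 1)"
    by (simp add: \<gamma>_def \<Gamma>_def)
  ultimately show ?thesis unfolding time_one_image_def by (intro CollectI exI[of _ \<gamma>]) auto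
qed

end

section \<open>Nondegeneracy\<close>

context orthogonal_chord
begin

lemma c_vertical: "c = vertical y0 L"
  unfolding seg_c vertical_def[abs_def] ..

text \<open>The vector \<open>2 (x - Q) - d e\<^sub>3\<close> is the Euclidean gradient of \<open>|x - Q|\<^sup>2 - d z\<close>, which vanishes on
  the sphere.\<close>
lemma sphere_conormal:
  assumes x: "x \<in> U" "(x - Q) \<bullet> (x - Q) = d * x $ 3"
  shows "colift (x, \<mu> *\<^sub>R (2 *\<^sub>R (x - Q) - d *\<^sub>R axis 3 1)) \<in> conormal X A T"
proof -
  have "2 * ((x - Q) \<bullet> u) = d * u $ 3" if u: "differential A p x u \<in> tangent_to X A T (p x)" for u
  proof -
    obtain \<sigma> \<delta> \<sigma>' where \<sigma>: "\<delta> > 0" "smooth_in {-\<delta><..<\<delta>} \<sigma>" "\<sigma> ` {-\<delta><..<\<delta>} \<subseteq> U" "\<sigma> 0 = x"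
      "\<And>s. s \<in> {-\<delta><..<\<delta>} \<Longrightarrow> p (\<sigma> s) \<in> T" "(\<sigma> has_vector_derivative \<sigma>') (at 0)"
      "differential A p x u = differential A p x \<sigma>'"
      using tangent_to_lift[OF u x(1)] by metis
    have u: "u = \<sigma>'" using differential_inj[OF x(1) \<sigma>(7)] .
    have eq: "d * \<sigma> s $ 3 = (\<sigma> s - Q) \<bullet> (\<sigma> s - Q)" if "s \<in> {-\<delta><..<\<delta>}" for s
      by (rule lift_stays_in_sphere[OF _ smooth_in_continuous[OF \<sigma>(2)] \<sigma>(3,5), of 0, symmetric])
         (use \<sigma>(1,4) x(2) that in auto)
    have d: "(\<sigma> has_derivative (\<lambda>h. h *\<^sub>R u)) (at 0)" using \<sigma>(6) u by (simp add: has_vector_derivative_def)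
    have "((\<lambda>s. (\<sigma> s - Q) \<bullet> (\<sigma> s - Q)) has_derivative (\<lambda>h. h * (2 * ((x - Q) \<bullet> u)))) (at 0)"
      using \<sigma>(4) by (auto intro!: derivative_eq_intros d simp: inner_commute algebra_simps)
    moreover have "((\<lambda>s. d * \<sigma> s $ 3) has_derivative (\<lambda>h. h * (d * u $ 3))) (at 0)"
      by (rule has_derivative_eq_rhs[OF has_derivative_mult_right[OF
              bounded_linear.has_derivative[OF bounded_linear_vec_nth d]]]) (simp add: fun_eq_iff)
    then have "((\<lambda>s. (\<sigma> s - Q) \<bullet> (\<sigma> s - Q)) has_derivative (\<lambda>h. h * (d * u $ 3))) (at 0)"
      by (rule has_derivative_transform_within_open[of _ _ _ _ "{-\<delta><..<\<delta>}"]) (use eq \<sigma>(1) in auto)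
    ultimately have "(\<lambda>h. h * (2 * ((x - Q) \<bullet> u))) = (\<lambda>h. h * (d * u $ 3))"
      by (rule has_derivative_unique)
    from fun_cong[OF this, of 1] show ?thesis by simp
  qed
  then show ?thesis
    using colift_conormal_iff[of "(x, \<mu> *\<^sub>R (2 *\<^sub>R (x - Q) - d *\<^sub>R axis 3 1))" T] x sphere_in_T[OF x]
    by (simp add: inner_diff_left inner_axis')
qed

text \<open>Curves in the time-one image move the starting point in \<open>H\<close> and the speed, which gives the
  tangent vectors \<open>(a - d k e\<^sub>3, - k (1 + L)/d e\<^sub>3)\<close> with \<open>a\<close> horizontal.  Curves in the conormal bundle
  move the point on the sphere and rescale the covector, which gives \<open>(w, 2 \<mu> w + \<nu> d e\<^sub>3)\<close> with \<open>w\<close>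
  horizontal and \<open>\<mu> = - L/d\<^sup>2\<close>.  Horizontal momenta occur only in the second family, and are all
  reached because \<open>L \<noteq> 0\<close>.\<close>
proposition transversal:
  "transversal_at X A (time_one_image X A h (conormal X A T)) (conormal X A T)
    (colift (c 1, (- (L / d)) *\<^sub>R axis 3 1))"
  unfolding transversal_at_def
proof (intro ballI set_eqI iffI UNIV_I)
  fix \<kappa> and Y :: "(real^3) \<times> (real^3)"
  let ?z = "(c 1, (- (L / d)) *\<^sub>R axis 3 1) :: (real^3) \<times> (real^3)"
  let ?L1 = "time_one_image X A h (conormal X A T)" and ?L2 = "conormal X A T"
  assume "\<kappa> \<in> charts_at A (fst (colift ?z))"
  then have \<kappa>: "\<kappa> \<in> A" "fst ?z \<in> Dom \<kappa>" using charts_at_DomD[OF _ c_in] by auto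
  obtain b where b: "fd (C \<kappa>) ?z b = Y" using C_derivative_surj[OF \<kappa>] by blast
  define \<mu> where "\<mu> = - L / d\<^sup>2"
  have \<mu>: "\<mu> \<noteq> 0" using seg_L d_pos by (simp add: \<mu>_def)
  have L: "L \<noteq> 0" using seg_L by simp
  \<comment> \<open>The values of \<open>w\<close>, \<open>a\<close>, \<open>k\<close> and \<open>\<nu>\<close> solve \<open>(a - d k e\<^sub>3, - k (1 + L)/d e\<^sub>3) + (w, 2 \<mu> w + \<nu> d e\<^sub>3) = b\<close>.\<close>
  define w where "w = (1 / (2 * \<mu>)) *\<^sub>R (snd b - snd b $ 3 *\<^sub>R axis 3 1)"
  define a where "a = fst b - fst b $ 3 *\<^sub>R axis 3 1 - w"
  define k where "k = - fst b $ 3 / d"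
  define \<nu> where "\<nu> = (snd b $ 3 + k * (1 + L) / d) / d"
  have w3: "w $ 3 = 0" and a3: "a $ 3 = 0" by (simp_all add: w_def a_def axis_def)
  define \<Gamma>1 where "\<Gamma>1 s = (vertical (y0 + s *\<^sub>R a) (L + s * k) 1,
    (- ((L + s * k) / z0 * exp (L + s * k))) *\<^sub>R (axis 3 1 :: real^3))" for s
  have y_in_H: "y0 + s *\<^sub>R a \<in> H" for s using seg_z0 a3 by (simp add: H_iff)
  have z0_neq: "z0 \<noteq> 0" using z0 by simp
  have \<Gamma>10: "\<Gamma>1 0 = ?z"
    using z0_neq by (simp add: \<Gamma>1_def c_vertical seg_d exp_minus field_simps)
  have s1: "smooth_on UNIV \<Gamma>1"
    unfolding \<Gamma>1_def[abs_def] vertical_def diff_conv_add_uminus divide_inverse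
    by (intro smooth_on_Pair smooth_on_add smooth_on_scaleR smooth_on_mult smooth_on_exp smooth_on_minus
        smooth_on_const smooth_on_ident open_UNIV)
  have d1: "(\<Gamma>1 has_vector_derivative (a - (d * k) *\<^sub>R axis 3 1, (- (k * (1 + L) / d)) *\<^sub>R axis 3 1)) (at 0)"
  proof -
    have "((\<lambda>s. vertical (y0 + s *\<^sub>R a) (L + s * k) 1) has_vector_derivative a - (d * k) *\<^sub>R axis 3 1) (at 0)"
      unfolding vertical_def has_vector_derivative_def
      by (auto intro!: derivative_eq_intros simp: seg_d algebra_simps)
    moreover have "((\<lambda>s. (- ((L + s * k) / z0 * exp (L + s * k))) *\<^sub>R (axis 3 1 :: real^3)) has_vector_derivative
        (- (k * (1 + L) / d)) *\<^sub>R axis 3 1) (at 0)"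
      unfolding has_vector_derivative_def using z0_neq
      by (auto intro!: derivative_eq_intros simp: seg_d exp_minus field_simps)
    ultimately show ?thesis unfolding \<Gamma>1_def[abs_def] by (rule has_vector_derivative_Pair)
  qed
  have "fd (C \<kappa>) (\<Gamma>1 0) (a - (d * k) *\<^sub>R axis 3 1, (- (k * (1 + L) / d)) *\<^sub>R axis 3 1)
      \<in> cotangent_tangent_to X A \<kappa> ?L1 (colift (\<Gamma>1 0))"
  proof (rule cotangent_tangent_toI[OF s1 _ d1 _ \<kappa>(1)])
    show "fst (\<Gamma>1 s) \<in> U" for s using vertical_in_U[OF y_in_H] by (simp add: \<Gamma>1_def)
    show "colift (\<Gamma>1 s) \<in> ?L1" for s unfolding \<Gamma>1_def by (rule time_one_vertical[OF y_in_H])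
    show "fst (\<Gamma>1 0) \<in> Dom \<kappa>" using \<kappa>(2) by (simp add: \<Gamma>10)
  qed
  then have v: "fd (C \<kappa>) ?z (a - (d * k) *\<^sub>R axis 3 1, (- (k * (1 + L) / d)) *\<^sub>R axis 3 1)
      \<in> cotangent_tangent_to X A \<kappa> ?L1 (colift ?z)" unfolding \<Gamma>10 .
  define n where "n = (w \<bullet> w) / d\<^sup>2"
  have n: "1 + s\<^sup>2 * n > 0" for s
  proof -
    have "s\<^sup>2 * n \<ge> 0" by (simp add: n_def)
    then show ?thesis by linarith
  qed
  \<comment> \<open>A curve on the sphere through its top with velocity \<open>w\<close>.\<close>
  define x where "x s = Q + (d * inverse (1 + s\<^sup>2 * n)) *\<^sub>R ((s / d) *\<^sub>R w + axis 3 1)" for s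
  define \<Gamma>2 where "\<Gamma>2 s = (x s, (\<mu> + s * \<nu>) *\<^sub>R (2 *\<^sub>R (x s - Q) - d *\<^sub>R (axis 3 1 :: real^3)))" for s
  have x3: "x s $ 3 = d * inverse (1 + s\<^sup>2 * n)" for s by (simp add: x_def Q_3 w3)
  have xU: "x s \<in> U" for s using n[of s] d_pos by (simp add: upper_half_space_def x3)
  have xQ: "(x s - Q) \<bullet> (x s - Q) = d * x s $ 3" for s
  proof -
    have "((s / d) *\<^sub>R w + axis 3 1) \<bullet> ((s / d) *\<^sub>R w + axis 3 1) = 1 + s\<^sup>2 * n"
      using w3 by (simp add: inner_add_left inner_add_right inner_axis inner_axis' n_def power2_eq_square)
    then have "(x s - Q) \<bullet> (x s - Q) = (d * inverse (1 + s\<^sup>2 * n))\<^sup>2 * (1 + s\<^sup>2 * n)"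
      by (simp add: x_def power2_eq_square)
    also have "\<dots> = d * (d * inverse (1 + s\<^sup>2 * n))" using n[of s] by (simp add: power2_eq_square)
    finally show ?thesis by (simp add: x3)
  qed
  have x0: "x 0 = c 1" by (simp add: x_def c_1)
  have n0: "2 *\<^sub>R (x 0 - Q) - d *\<^sub>R axis 3 1 = d *\<^sub>R axis 3 1"
    unfolding x0 c_1 by (simp add: vec_eq_iff)
  have \<Gamma>20: "\<Gamma>2 0 = ?z"
  proof -
    have "\<mu> * d = - (L / d)" using d_pos by (simp add: \<mu>_def power2_eq_square)
    then show ?thesis by (simp add: \<Gamma>2_def n0) (simp add: x0)
  qed
  have sx: "smooth_on UNIV x"
    unfolding x_def[abs_def] divide_inverse
    by (intro smooth_on_add smooth_on_scaleR smooth_on_mult smooth_on_inverse smooth_on_power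
        smooth_on_const smooth_on_ident open_UNIV) (use n in \<open>simp add: less_imp_neq[THEN not_sym]\<close>)
  have s2: "smooth_on UNIV \<Gamma>2"
    unfolding \<Gamma>2_def[abs_def]
    by (intro smooth_on_Pair smooth_on_add smooth_on_diff smooth_on_scaleR smooth_on_mult sx
        smooth_on_const smooth_on_ident open_UNIV)
  have dx: "(x has_vector_derivative w) (at 0)"
  proof -
    have "((\<lambda>s. d * inverse (1 + s\<^sup>2 * n)) has_real_derivative 0) (at 0)"
      by (auto intro!: derivative_eq_intros)
    moreover have "((\<lambda>s. (s / d) *\<^sub>R w + axis 3 1) has_vector_derivative (1 / d) *\<^sub>R w) (at 0)"
      unfolding has_vector_derivative_def using d_pos by (auto intro!: derivative_eq_intros)
    ultimately have "((\<lambda>s. (d * inverse (1 + s\<^sup>2 * n)) *\<^sub>R ((s / d) *\<^sub>R w + axis 3 1)) has_vector_derivative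
        (d * inverse (1 + 0\<^sup>2 * n)) *\<^sub>R ((1 / d) *\<^sub>R w) + 0 *\<^sub>R ((0 / d) *\<^sub>R w + axis 3 1)) (at 0)"
      by (intro has_vector_derivative_scaleR)
    then have "((\<lambda>s. Q + (d * inverse (1 + s\<^sup>2 * n)) *\<^sub>R ((s / d) *\<^sub>R w + axis 3 1)) has_vector_derivative
        0 + w) (at 0)"
      using d_pos by (intro has_vector_derivative_add has_vector_derivative_const) simp
    then show ?thesis unfolding x_def[abs_def] by simp
  qed
  have d2: "(\<Gamma>2 has_vector_derivative (w, (2 * \<mu>) *\<^sub>R w + (\<nu> * d) *\<^sub>R axis 3 1)) (at 0)"
  proof -
    have 1: "((\<lambda>s. \<mu> + s * \<nu>) has_real_derivative \<nu>) (at 0)" by (auto intro!: derivative_eq_intros)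
    have 2: "((\<lambda>s. 2 *\<^sub>R (x s - Q) - d *\<^sub>R (axis 3 1 :: real^3)) has_vector_derivative 2 *\<^sub>R w) (at 0)"
      using dx unfolding has_vector_derivative_def by (auto intro!: derivative_eq_intros simp: algebra_simps)
    have "((\<lambda>s. (\<mu> + s * \<nu>) *\<^sub>R (2 *\<^sub>R (x s - Q) - d *\<^sub>R (axis 3 1 :: real^3))) has_vector_derivative
        (\<mu> + 0 * \<nu>) *\<^sub>R (2 *\<^sub>R w) + \<nu> *\<^sub>R (2 *\<^sub>R (x 0 - Q) - d *\<^sub>R axis 3 1)) (at 0)"
      by (rule has_vector_derivative_scaleR[OF 1 2])
    then have "((\<lambda>s. (\<mu> + s * \<nu>) *\<^sub>R (2 *\<^sub>R (x s - Q) - d *\<^sub>R (axis 3 1 :: real^3))) has_vector_derivative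
        (2 * \<mu>) *\<^sub>R w + (\<nu> * d) *\<^sub>R axis 3 1) (at 0)"
      unfolding n0 by (simp add: mult.commute)
    then show ?thesis unfolding \<Gamma>2_def[abs_def] by (intro has_vector_derivative_Pair dx)
  qed
  have "fd (C \<kappa>) (\<Gamma>2 0) (w, (2 * \<mu>) *\<^sub>R w + (\<nu> * d) *\<^sub>R axis 3 1)
      \<in> cotangent_tangent_to X A \<kappa> ?L2 (colift (\<Gamma>2 0))"
  proof (rule cotangent_tangent_toI[OF s2 _ d2 _ \<kappa>(1)])
    show "fst (\<Gamma>2 s) \<in> U" for s using xU by (simp add: \<Gamma>2_def)
    show "colift (\<Gamma>2 s) \<in> ?L2" for s unfolding \<Gamma>2_def by (rule sphere_conormal[OF xU xQ])
    show "fst (\<Gamma>2 0) \<in> Dom \<kappa>" using \<kappa>(2) by (simp add: \<Gamma>20)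
  qed
  then have w: "fd (C \<kappa>) ?z (w, (2 * \<mu>) *\<^sub>R w + (\<nu> * d) *\<^sub>R axis 3 1)
      \<in> cotangent_tangent_to X A \<kappa> ?L2 (colift ?z)" unfolding \<Gamma>20 .
  have "(a - (d * k) *\<^sub>R axis 3 1, (- (k * (1 + L) / d)) *\<^sub>R axis 3 1) +
      (w, (2 * \<mu>) *\<^sub>R w + (\<nu> * d) *\<^sub>R axis 3 1) = b"
  proof (rule prod_eqI)
    show "fst ((a - (d * k) *\<^sub>R axis 3 1, (- (k * (1 + L) / d)) *\<^sub>R axis 3 1) +
        (w, (2 * \<mu>) *\<^sub>R w + (\<nu> * d) *\<^sub>R axis 3 1)) = fst b"
      using d_pos by (simp add: a_def k_def)
    have "(2 * \<mu>) *\<^sub>R w = snd b - snd b $ 3 *\<^sub>R axis 3 1" using \<mu> by (simp add: w_def)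
    moreover have "\<nu> * d = snd b $ 3 + k * (1 + L) / d" using d_pos by (simp add: \<nu>_def)
    ultimately show "snd ((a - (d * k) *\<^sub>R axis 3 1, (- (k * (1 + L) / d)) *\<^sub>R axis 3 1) +
        (w, (2 * \<mu>) *\<^sub>R w + (\<nu> * d) *\<^sub>R axis 3 1)) = snd b"
      by (simp add: algebra_simps)
  qed
  then have "Y = fd (C \<kappa>) ?z (a - (d * k) *\<^sub>R axis 3 1, (- (k * (1 + L) / d)) *\<^sub>R axis 3 1) +
      fd (C \<kappa>) ?z (w, (2 * \<mu>) *\<^sub>R w + (\<nu> * d) *\<^sub>R axis 3 1)"
    using b linear_add[OF has_derivative_linear[OF C_has_derivative[OF \<kappa>]]] by metis
  then show "Y \<in> {v + w | v w. v \<in> cotangent_tangent_to X A \<kappa> ?L1 (colift ?z) \<and>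
      w \<in> cotangent_tangent_to X A \<kappa> ?L2 (colift ?z)}"
    using v w by blast
qed

end

context horotorus
begin

theorem cord_index_nullity:
  assumes "c \<in> Cord X A h T" "nonconstant_path c"
  shows "morse_index X A h T c = 0 \<and> nullity X A h T c = 0"
proof -
  obtain y L where yL: "orthogonal_chord X A h p T z0 y L (z0 * exp (- L)) (y - z0 *\<^sub>R axis 3 1) (vertical y L)"
    "\<And>t. t \<in> {0..1} \<Longrightarrow> c t = p (vertical y L t)"
    using cord_vertical[OF assms] by metis
  from orthogonal_chord.morse_index_zero[OF yL(1), of c] orthogonal_chord.nullity_zero[OF yL(1), of c] yL(2)
  show ?thesis by blast
qed

theorem chord_rigid_nondegenerate:
  assumes "hamiltonian_chord X A h T \<gamma>" "nonconstant_path \<gamma>"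
  shows "rigid X A h T \<gamma> \<and> nondegenerate X A h T \<gamma>"
proof -
  obtain y L where yL: "orthogonal_chord X A h p T z0 y L (z0 * exp (- L)) (y - z0 *\<^sub>R axis 3 1) (vertical y L)"
    "\<And>t. t \<in> {0..1} \<Longrightarrow> \<gamma> t = colift (vertical y L t, (- (L / (z0 * exp (- L * t)))) *\<^sub>R axis 3 1)"
    using hamiltonian_chord_vertical[OF assms] by metis
  have "(fst \<circ> \<gamma>) t = p (vertical y L t)" if "t \<in> {0..1}" for t using yL(2)[OF that] by simp
  from orthogonal_chord.morse_index_zero[OF yL(1), of "fst \<circ> \<gamma>", OF this]
  have "rigid X A h T \<gamma>" by (simp add: rigid_def)
  moreover have "nondegenerate X A h T \<gamma>"
    unfolding nondegenerate_def using orthogonal_chord.transversal[OF yL(1)] yL(2)[of 1] by simp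
  ultimately show ?thesis by simp
qed

end

section \<open>The complement of the knot\<close>

text \<open>By periodicity \<open>K\<close> is the image of \<open>[0, 2 \<pi>]\<close>.\<close>
lemma smooth_knot_compact:
  fixes M :: "'a::topological_space set"
  assumes "smooth_knot M A K"
  shows "compact K"
proof -
  obtain k where k: "smooth_map M A UNIV k" "\<And>\<theta>. k (\<theta> + 2 * pi) = k \<theta>" "K = range k"
    using assms unfolding smooth_knot_def by blast
  interpret k: periodic_fun_simple k "2 * pi" by unfold_locales (rule k(2))
  have "range k = k ` {0..2 * pi}"
  proof
    show "range k \<subseteq> k ` {0..2 * pi}"
    proof (rule image_subsetI)
      fix \<theta> :: real
      define n where "n = \<lfloor>\<theta> / (2 * pi)\<rfloor>"
      define r where "r = \<theta> - of_int n * (2 * pi)"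
      have "of_int n \<le> \<theta> / (2 * pi)" "\<theta> / (2 * pi) < of_int n + 1" by (auto simp: n_def)
      then have "r \<in> {0..2 * pi}" by (auto simp: r_def field_simps)
      moreover have "k \<theta> = k r" using k.plus_of_int[of r n] by (simp add: r_def)
      ultimately show "k \<theta> \<in> k ` {0..2 * pi}" by blast
    qed
  qed auto
  moreover have "continuous_on {0..2 * pi} k"
    using k(1) continuous_on_subset[of UNIV k] by (auto simp: smooth_map_def)
  ultimately show ?thesis using k(3) compact_continuous_image[of "{0..2 * pi}" k] by simp
qed

lemma smooth_atlas_complement:
  fixes M :: "'a::topological_space set"
  assumes A: "smooth_atlas M A" and K: "closed K"
  shows "smooth_atlas (M - K) (complement_atlas A K)"
proof -
  define r where "r \<kappa> = (dom_chart \<kappa> - K, coord \<kappa>)" for \<kappa> :: "'a chart"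
  have r: "dom_chart (r \<kappa>) = dom_chart \<kappa> - K" "coord (r \<kappa>) = coord \<kappa>" for \<kappa> by (simp_all add: r_def)
  have CA: "complement_atlas A K = r ` A" by (simp add: complement_atlas_def r_def[abs_def])
  have un: "(\<Union>\<kappa>\<in>A. dom_chart \<kappa>) = M"
    and ch: "\<And>\<kappa>. \<kappa> \<in> A \<Longrightarrow> openin (top_of_set M) (dom_chart \<kappa>) \<and> open (cod_chart \<kappa>) \<and>
      homeomorphism (dom_chart \<kappa>) (cod_chart \<kappa>) (coord \<kappa>) (inv_coord \<kappa>)"
    and tr: "\<And>\<kappa> \<kappa>'. \<kappa> \<in> A \<Longrightarrow> \<kappa>' \<in> A \<Longrightarrow>
      smooth_on (coord \<kappa> ` (dom_chart \<kappa> \<inter> dom_chart \<kappa>')) (transition \<kappa> \<kappa>')"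
    using A unfolding smooth_atlas_def by auto
  have inj: "inj_on (coord \<kappa>) (dom_chart \<kappa>)" if "\<kappa> \<in> A" for \<kappa>
  proof (rule inj_on_inverseI)
    fix q assume "q \<in> dom_chart \<kappa>"
    then show "inv_coord \<kappa> (coord \<kappa> q) = q" using ch[OF that] by (blast intro: homeomorphism_apply1)
  qed
  have inv: "inv_coord (r \<kappa>) y = inv_coord \<kappa> y" if "\<kappa> \<in> A" and y: "y \<in> cod_chart (r \<kappa>)" for \<kappa> y
  proof -
    obtain q where q: "q \<in> dom_chart \<kappa> - K" "y = coord \<kappa> q" using y r by auto
    have "inv_coord (r \<kappa>) y = q"
      unfolding inv_coord_def r q(2) using inj[OF \<open>\<kappa> \<in> A\<close>] q(1)
      by (intro inv_into_f_f) (auto intro: inj_on_subset)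
    moreover have "inv_coord \<kappa> y = q"
      unfolding inv_coord_def q(2) using inj[OF \<open>\<kappa> \<in> A\<close>] q(1) by (intro inv_into_f_f) auto
    ultimately show ?thesis by simp
  qed
  have open_image: "open (coord \<kappa> ` (dom_chart \<kappa> \<inter> V))" if "\<kappa> \<in> A" "openin (top_of_set M) V" for \<kappa> V
  proof -
    have "openin (top_of_set (dom_chart \<kappa>)) (dom_chart \<kappa> \<inter> V)"
      using that(2) ch[OF that(1)] unfolding openin_open by blast
    then have "openin (top_of_set (cod_chart \<kappa>)) (coord \<kappa> ` (dom_chart \<kappa> \<inter> V))"
      using homeomorphism_imp_open_map ch[OF that(1)] by metis
    then show ?thesis using ch[OF that(1)] openin_open_trans by blast
  qed
  have openK: "openin (top_of_set M) (M - K)"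
    using K openin_open_Int[of "- K" M] by (simp add: Diff_eq open_Compl)
  have sub: "dom_chart \<kappa> \<subseteq> M" if "\<kappa> \<in> A" for \<kappa> using un that by blast
  show ?thesis
    unfolding smooth_atlas_def CA
  proof (intro conjI ballI)
    show "(\<Union>\<kappa>\<in>r ` A. dom_chart \<kappa>) = M - K" using un by (auto simp: r)
    fix \<kappa>r assume "\<kappa>r \<in> r ` A"
    then obtain \<kappa> where \<kappa>: "\<kappa> \<in> A" "\<kappa>r = r \<kappa>" by blast
    show "openin (top_of_set (M - K)) (dom_chart \<kappa>r)"
      using ch[OF \<kappa>(1)] unfolding openin_open \<kappa>(2) r by blast
    have eq: "dom_chart \<kappa> - K = dom_chart \<kappa> \<inter> (M - K)" using sub[OF \<kappa>(1)] by blast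
    show "open (cod_chart \<kappa>r)" unfolding \<kappa>(2) r eq by (rule open_image[OF \<kappa>(1) openK])
    have "homeomorphism (dom_chart \<kappa> - K) (coord \<kappa> ` (dom_chart \<kappa> - K)) (coord \<kappa>) (inv_coord \<kappa>)"
      by (rule homeomorphism_of_subsets[OF conjunct2[OF conjunct2[OF ch[OF \<kappa>(1)]]]]) auto
    then show "homeomorphism (dom_chart \<kappa>r) (cod_chart \<kappa>r) (coord \<kappa>r) (inv_coord \<kappa>r)"
      unfolding \<kappa>(2) r
      by (rule homeomorphism_cong[OF _ refl refl]) (use inv[OF \<kappa>(1)] in \<open>simp_all add: r\<close>)
  next
    fix \<kappa>r \<kappa>r' assume "\<kappa>r \<in> r ` A" "\<kappa>r' \<in> r ` A"
    then obtain \<kappa> \<kappa>' where \<kappa>: "\<kappa> \<in> A" "\<kappa>r = r \<kappa>" "\<kappa>' \<in> A" "\<kappa>r' = r \<kappa>'" by blast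
    let ?S = "coord \<kappa> ` ((dom_chart \<kappa> - K) \<inter> (dom_chart \<kappa>' - K))"
    have "openin (top_of_set M) ((M - K) \<inter> dom_chart \<kappa>')" using openK ch[OF \<kappa>(3)] by (simp add: openin_Int)
    moreover have "(dom_chart \<kappa> - K) \<inter> (dom_chart \<kappa>' - K) = dom_chart \<kappa> \<inter> ((M - K) \<inter> dom_chart \<kappa>')"
      using sub[OF \<kappa>(3)] by auto
    ultimately have "open ?S" using open_image[OF \<kappa>(1)] by metis
    moreover have "smooth_on ?S (transition \<kappa> \<kappa>')"      by (rule smooth_on_subset[OF tr[OF \<kappa>(1,3)] image_mono]) auto
    moreover have "transition \<kappa> \<kappa>' y = transition \<kappa>r \<kappa>r' y" if "y \<in> ?S" for y
      using inv[OF \<kappa>(1), of y] that unfolding transition_def \<kappa>(2,4) r by auto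
    ultimately show "smooth_on (coord \<kappa>r ` (dom_chart \<kappa>r \<inter> dom_chart \<kappa>r')) (transition \<kappa>r \<kappa>r')"
      unfolding \<kappa>(2,4) r using smooth_on_cong by blast
  qed
qed

theorem theorem1p1:
  fixes M K N T :: "'a::{t2_space, second_countable_topology} set"
    and A A\<^sub>N :: "'a chart set" and h :: "'a metric"
  assumes "closed_manifold M A" and "orientable_manifold M A"
    and "smooth_knot M A K"
    and "N = M - K" and "A\<^sub>N = complement_atlas A K"
    and "complete_hyperbolic_metric N A\<^sub>N h"
    and "horo_torus N A\<^sub>N h T"
  shows "(\<forall>c\<in>Cord N A\<^sub>N h T. nonconstant_path c \<longrightarrow>
            morse_index N A\<^sub>N h T c = 0 \<and> nullity N A\<^sub>N h T c = 0) \<and>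
         (\<forall>\<gamma>. hamiltonian_chord N A\<^sub>N h T \<gamma> \<and> nonconstant_path \<gamma> \<longrightarrow>
            rigid N A\<^sub>N h T \<gamma> \<and> nondegenerate N A\<^sub>N h T \<gamma>)"
proof -
  have "closed K" using smooth_knot_compact[OF assms(3)] compact_imp_closed by blast
  then have atlas: "smooth_atlas N A\<^sub>N"
    using smooth_atlas_complement assms(1,4,5) unfolding closed_manifold_def by blast
  obtain p z0 where T: "hyperbolic_universal_cover N A\<^sub>N h p" "z0 > 0"
    "\<And>C. compact C \<Longrightarrow> C \<subseteq> N \<Longrightarrow> \<exists>a>0. p ` {x. x $ 3 > a} \<inter> C = {}"
    "pairwise disjnt {g ` horosphere z0 | g. deck_transformation p g}"
    "T = p ` horosphere z0" "T homeomorphic (sphere (0::complex) 1 \<times> sphere (0::complex) 1)"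
    using assms(7) unfolding horo_torus_def by blast
  interpret horotorus N A\<^sub>N h p T z0
    by unfold_locales
       (use atlas assms(6) T in \<open>simp_all add: complete_hyperbolic_metric_def\<close>)
  show ?thesis using cord_index_nullity chord_rigid_nondegenerate by blast
qed

end
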